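(* Let $\boldsymbol\beta\in\mathbb{G}_m^2$ be non-torsion, and let $\boldsymbol F:\mathbb{N}_0\to\mathbb{G}_m^2$ be a function for which there exist $\delta\in[0,1/9)$ and $\theta\ge0$ such that $$\forall\,n\in\mathbb{N}_0:\quad d\big(\boldsymbol F(n),\boldsymbol\beta^n\big)\le\theta+n\,\delta\,h(\boldsymbol\beta).$$ Then, for all real $$X>\frac{\log\left(\frac{6-3\delta}{1-9\delta}+\frac12\right)}{\log\left(\frac{3-2\delta}{2(1+\delta)}\right)},$$ it holds that $$\#\big(\boldsymbol F(\mathbb{N}_{\ge\nu})\cap\Pi\big)\le\lceil X\rceil\quad\text{with}\quad\nu=\frac1{h(\boldsymbol\beta)}\cdot\min_{t\in I_{\delta,X}}\max\big\{f_{\theta,\delta}(t);\,g_{\theta,\delta,X}(t)\big\}.$$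
   Context: $\mathbb{G}_m^2$ denotes the group $(\overline{\mathbb{Q}}^* )^2$ with coordinatewise multiplication; an element is non-torsion if it is not of finite order in this group. $h:\overline{\mathbb{Q}}^*\to\mathbb{R}_{\ge0}$ is the absolute logarithmic Weil height, and for $\boldsymbol x=(x_1,x_2)\in\mathbb{G}_m^2$ one sets $h(\boldsymbol x):=\max\{h(x_1),h(x_2)\}$. For $\boldsymbol x,\boldsymbol y\in\mathbb{G}_m^2$, $d(\boldsymbol x,\boldsymbol y):=h(\boldsymbol x\boldsymbol y^{-1})$. $\Pi:=\{\boldsymbol x\in(\overline{\mathbb{Q}}^* )^2:x_1+x_2=1\}$. $\mathbb{N}_0$ is the set of non-negative integers and $\mathbb{N}_{\ge\nu}$ the set of integers $n\in\mathbb{N}_0$ with $n\ge\nu$ ($\nu$ real). For $\delta\in[0,1/9)$, $\theta\ge0$ and $X$ satisfying the displayed lower bound, $I_{\delta,X}$ is the non-empty open interval $$I_{\delta,X}:=\left(\frac{6-3\delta}{1-9\delta},\ \left(\frac{3-2\delta}{2(1+\delta)}\right)^X-\frac12\right),$$ and for $t\in I_{\delta,X}$ $$f_{\theta,\delta}(t):=\frac{(t-5)\log(6\sqrt3)+6\log6+(5t-1)\theta}{(1-9\delta)t-(6-3\delta)},$$ $$g_{\theta,\delta,X}(t):=\frac{\log2+4\theta}{(3-2\delta)-2(1+\delta)(t+1/2)^{1/X}}.$$ *)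

theory Defs
  imports
    "HOL-Analysis.Infinite_Sum"
    "HOL-Algebra.Algebra"
    "HOL-Algebra.Algebraic_Closure_Type"
begin

type_synonym qbar = "rat alg_closure"

abbreviation Qbar :: "qbar ring" where
  "Qbar \<equiv> ring_of_type_algebra"

section \<open>The absolute logarithmic Weil height\<close>

text \<open>
  Number fields are subfields \<open>K\<close> of \<open>Qbar\<close> of finite degree over \<open>\<rat>\<close>.  The places of \<open>K\<close> are
  represented by the embeddings \<open>K \<rightarrow> \<complex>\<close> (so that each real place occurs once and each complex
  place twice, i.e. with its local degree) and by the nonzero prime ideals of the ring of
  integers of \<open>K\<close>.
\<close>

definition nf_degree :: "qbar set \<Rightarrow> nat" where
  "nf_degree K = ring.dim Qbar \<rat> K"

definition nf_integers :: "qbar set \<Rightarrow> qbar ring" where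
  "nf_integers K = Qbar\<lparr>carrier := {x \<in> K. algebraic_int x}\<rparr>"

text \<open>
  Elements of \<^const>\<open>ring_hom\<close> are constrained on the carrier only, so they are made unique by
  intersecting with \<^const>\<open>extensional\<close>.
\<close>

definition nf_embeddings :: "qbar set \<Rightarrow> (qbar \<Rightarrow> complex) set" where
  "nf_embeddings K =
     ring_hom (Qbar\<lparr>carrier := K\<rparr>) (ring_of_type_algebra :: complex ring) \<inter> extensional K"

definition nf_primes :: "qbar set \<Rightarrow> qbar set set" where
  "nf_primes K = {P. primeideal P (nf_integers K) \<and> P \<noteq> {0}}"

definition ideal_norm :: "qbar set \<Rightarrow> qbar set \<Rightarrow> nat" where
  "ideal_norm K P = card (carrier (nf_integers K Quot P))"

text \<open>For a nonzero integer \<open>a\<close>: the exponent of \<open>P\<close> in the factorisation of the ideal \<open>(a)\<close>.\<close>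

definition prime_ord_int :: "qbar set \<Rightarrow> qbar set \<Rightarrow> qbar \<Rightarrow> nat" where
  "prime_ord_int K P a = (GREATEST n. a \<in> P [^]\<^bsub>ideals_set (nf_integers K)\<^esub> n)"

text \<open>For nonzero \<open>x \<in> K\<close>; the value does not depend on how \<open>x\<close> is written as a fraction \<open>a / b\<close>.\<close>

definition prime_ord :: "qbar set \<Rightarrow> qbar set \<Rightarrow> qbar \<Rightarrow> int" where
  "prime_ord K P x = (THE k. \<exists>a \<in> carrier (nf_integers K) - {0}. \<exists>b \<in> carrier (nf_integers K) - {0}.
      x = a / b \<and> k = int (prime_ord_int K P a) - int (prime_ord_int K P b))"

text \<open>
  The \<open>P\<close>-adic absolute value \<open>N(P)\<close> to the power \<open>-ord P x\<close>.  This is the absolute value extending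
  the standard \<open>p\<close>-adic one on \<open>\<rat>\<close>, raised to the local degree.
\<close>

definition prime_abs :: "qbar set \<Rightarrow> qbar set \<Rightarrow> qbar \<Rightarrow> real" where
  "prime_abs K P x = (if x = 0 then 0 else real (ideal_norm K P) powi (- prime_ord K P x))"

definition weil_height_on :: "qbar set \<Rightarrow> qbar \<Rightarrow> real" where
  "weil_height_on K x =
     ((\<Sum>\<sigma>\<in>nf_embeddings K. ln (max 1 (cmod (\<sigma> x)))) +
      (\<Sum>\<^sub>\<infinity>P\<in>nf_primes K. ln (max 1 (prime_abs K P x)))) / real (nf_degree K)"

text \<open>
  \<^const>\<open>weil_height_on\<close> has the same value for every number field containing \<open>x\<close>; the
  smallest one, \<open>\<rat>(x)\<close>, is used here.
\<close>

definition weil_height :: "qbar \<Rightarrow> real" where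
  "weil_height x = weil_height_on (generate_field Qbar {x}) x"

section \<open>The group and the line\<close>

definition Gm2 :: "(qbar \<times> qbar) monoid" where
  "Gm2 = Multiplicative_Group.mult_of Qbar \<times>\<times> Multiplicative_Group.mult_of Qbar"

definition height2 :: "qbar \<times> qbar \<Rightarrow> real" where
  "height2 x = max (weil_height (fst x)) (weil_height (snd x))"

definition dist2 :: "qbar \<times> qbar \<Rightarrow> qbar \<times> qbar \<Rightarrow> real" where
  "dist2 x y = height2 (x \<otimes>\<^bsub>Gm2\<^esub> inv\<^bsub>Gm2\<^esub> y)"

definition unit_line :: "(qbar \<times> qbar) set" where
  "unit_line = {x \<in> carrier Gm2. fst x + snd x = 1}"

lemma mult_of_Qbar_group: "Group.group (Multiplicative_Group.mult_of Qbar)"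
  by (rule field.field_mult_group) (rule field_from_type_algebra)

lemma Gm2_group: "Group.group Gm2"
  unfolding Gm2_def by (intro DirProd_group mult_of_Qbar_group)

lemma carrier_Gm2: "carrier Gm2 = {(x, y). x \<noteq> 0 \<and> y \<noteq> 0}"
  by (auto simp: Gm2_def ring_of_type_algebra_def)

lemma one_Gm2: "\<one>\<^bsub>Gm2\<^esub> = (1, 1)"
  by (simp add: Gm2_def ring_of_type_algebra_def)

lemma mult_Gm2: "x \<otimes>\<^bsub>Gm2\<^esub> y = (fst x * fst y, snd x * snd y)"
  by (simp add: Gm2_def mult_DirProd' ring_of_type_algebra_def)

lemma pow_Gm2: "x [^]\<^bsub>Gm2\<^esub> (n :: nat) = (fst x ^ n, snd x ^ n)"
  by (induction n) (simp_all add: one_Gm2 mult_Gm2 Groups.mult.commute)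

lemma inv_Gm2:
  assumes "x \<in> carrier Gm2"
  shows "inv\<^bsub>Gm2\<^esub> x = (inverse (fst x), inverse (snd x))"
  using assms by (intro group.inv_equality[OF Gm2_group])
    (auto simp: carrier_Gm2 one_Gm2 mult_Gm2)

section \<open>The interval and the auxiliary functions\<close>

text \<open>The parameter called \<open>X\<close> in the literature is written \<open>x\<close>, since HOL-Algebra reserves the token \<open>X\<close>.\<close>

definition I_int :: "real \<Rightarrow> real \<Rightarrow> real set" where
  "I_int \<delta> x =
     {(6 - 3 * \<delta>) / (1 - 9 * \<delta>) <..< ((3 - 2 * \<delta>) / (2 * (1 + \<delta>))) powr x - 1 / 2}"

definition f_fun :: "real \<Rightarrow> real \<Rightarrow> real \<Rightarrow> real" where
  "f_fun \<theta> \<delta> t =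
     ((t - 5) * ln (6 * sqrt 3) + 6 * ln 6 + (5 * t - 1) * \<theta>) / ((1 - 9 * \<delta>) * t - (6 - 3 * \<delta>))"

definition g_fun :: "real \<Rightarrow> real \<Rightarrow> real \<Rightarrow> real \<Rightarrow> real" where
  "g_fun \<theta> \<delta> x t =
     (ln 2 + 4 * \<theta>) / ((3 - 2 * \<delta>) - 2 * (1 + \<delta>) * (t + 1 / 2) powr (1 / x))"

end

theory Submission
  imports Defs "Jordan_Normal_Form.Char_Poly"
begin

text \<open>
  Write \<open>F(n) = a \<beta>\<^sup>n\<close> with \<open>h(a)\<close> small.  Given two points \<open>F(n)\<close>, \<open>F(m)\<close> of the line, the two
  coordinates of \<open>\<beta>\<^sup>M\<^sup>n\<close> solve two linear equations: one says that \<open>F(m)\<close> lies on the line, and the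
  other comes from the point \<open>x = F(n)\<close>, either directly (\<open>M = 1\<close>) or through a Pade relation
  \<open>x\<^sub>1\<^sup>M A(x\<^sub>1) + x\<^sub>2\<^sup>M B(x\<^sub>1) = C(x\<^sub>1)\<close> with \<open>M = 2N\<close> and \<open>A\<close>, \<open>B\<close>, \<open>C\<close> of degree at most \<open>N\<close>.  If the
  determinant does not vanish, Cramer's rule bounds \<open>h(\<beta>\<^sup>M\<^sup>n) = M n h(\<beta>)\<close> from above.  For \<open>M = 1\<close>
  this gives a gap \<open>m \<ge> (t + 1/2)\<^sup>1\<^sup>/\<^sup>X n\<close>; with the choice \<open>N \<approx> m / (2 n)\<close> it gives \<open>m < (t + 1/2) n\<close>,
  where one of two neighbouring Pade relations has nonzero determinant.  A chain of \<open>\<lceil>X\<rceil> + 1\<close>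
  points would contradict this.

  The height is handled through its expression as the logarithmic Mahler measure of the primitive
  integer polynomial \<open>p\<close> of \<open>x\<close>, divided by the degree.  The contribution of the primes is the
  leading coefficient of \<open>p\<close>, since both describe the growth in \<open>k\<close> of the index of the ring of
  integers \<open>O\<close> in the lattice \<open>O + x O + \<dots> + x\<^sup>k O\<close>.
\<close>

section \<open>Subgroups of finite index\<close>

text \<open>The height is defined over \<open>Q(x)\<close>, a field that varies with
  \<open>x\<close>, while Cramer's rule needs one field for all the numbers involved. The Mahler
  measure refers to \<open>x\<close> alone and settles independence of the field. Applied to
  \<open>x\<close> and \<open>1/x\<close>, whose integer polynomials are reversals of each other up
  to sign, it also gives the product formula, which removes the determinant, a common denominator,
  from the height of a Cramer quotient. Unique factorisation of ideals is not presupposed. Its place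
  is taken by counting: nonzero ideals have finite index, indices multiply along towers, and bounded
  errors disappear in the growth rate. With \<open>H = n h(\<beta>)\<close>, the function
  \<open>g\<close> is the threshold for \<open>H\<close> from which the case \<open>M = 1\<close>
  forces the gap, and \<open>f\<close> the threshold from which the Pade inequality fails once
  \<open>m >= (t + 1/2) n\<close>. Their denominators vanish at the two ends of the interval, that
  of \<open>f\<close> at the left and that of \<open>g\<close> at the right. The constant
  \<open>6 sqrt 3\<close> is the exponential growth rate in \<open>N\<close> of the bound for the
  Pade polynomials.\<close>

definition subgrp :: "'a::ab_group_add set \<Rightarrow> bool" where
  "subgrp A \<longleftrightarrow> 0 \<in> A \<and> (\<forall>a\<in>A. \<forall>b\<in>A. a - b \<in> A)"

lemma subgrp_0: "subgrp A \<Longrightarrow> 0 \<in> A"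
  and subgrp_diff: "subgrp A \<Longrightarrow> a \<in> A \<Longrightarrow> b \<in> A \<Longrightarrow> a - b \<in> A"
  by (auto simp: subgrp_def)

lemma subgrp_uminus: "subgrp A \<Longrightarrow> a \<in> A \<Longrightarrow> - a \<in> A"
  using subgrp_diff[of A 0 a] subgrp_0 by auto

lemma subgrp_add: "subgrp A \<Longrightarrow> a \<in> A \<Longrightarrow> b \<in> A \<Longrightarrow> a + b \<in> A"
  using subgrp_diff[of A a "- b"] subgrp_uminus by auto

lemma subgrp_sum: "subgrp A \<Longrightarrow> (\<And>i. i \<in> I \<Longrightarrow> f i \<in> A) \<Longrightarrow> sum f I \<in> A"
  by (induction I rule: infinite_finite_induct) (auto intro: subgrp_0 subgrp_add)

lemma subgrp_of_int_mult:
  fixes a :: "'a::ring_1"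
  assumes "subgrp A" "a \<in> A"
  shows "of_int c * a \<in> A"
proof -
  have nat: "of_nat n * a \<in> A" for n
    by (induction n) (use assms in \<open>auto intro: subgrp_0 subgrp_add simp: algebra_simps\<close>)
  show ?thesis
  proof (cases "c \<ge> 0")
    case True
    then show ?thesis using nat[of "nat c"] by simp
  next
    case False
    then show ?thesis using subgrp_uminus[OF assms(1) nat[of "nat (-c)"]] by simp
  qed
qed

lemma subgrp_image_mult:
  fixes x :: "'a::ring"
  shows "subgrp A \<Longrightarrow> subgrp ((*) x ` A)"
  unfolding subgrp_def by (auto simp: image_iff right_diff_distrib[symmetric])
     (metis mult_zero_right)

definition coset :: "'a::ab_group_add set \<Rightarrow> 'a \<Rightarrow> 'a set" where
  "coset B a = (\<lambda>b. b + a) ` B"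

text \<open>An infinite set has \<open>card\<close> 0, so for subgroups \<open>idx A B > 0\<close>
  is the way to express finiteness of the index, and products of indices remain correct in the
  infinite case.\<close>

definition idx :: "'a::ab_group_add set \<Rightarrow> 'a set \<Rightarrow> nat" where
  "idx A B = card (coset B ` A)"

lemma coset_eq_iff: "subgrp B \<Longrightarrow> coset B a = coset B a' \<longleftrightarrow> a - a' \<in> B"
proof
  assume B: "subgrp B" and "coset B a = coset B a'"
  then have "0 + a \<in> coset B a'"
    using subgrp_0[OF B] unfolding coset_def by blast
  then show "a - a' \<in> B"
    by (auto simp: coset_def)
next
  assume B: "subgrp B" and *: "a - a' \<in> B"
  have "b + a \<in> coset B a'" "b + a' \<in> coset B a" if "b \<in> B" for b
    unfolding coset_def
    by (rule image_eqI[of _ _ "b + (a - a')"] image_eqI[of _ _ "b - (a - a')"];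
        use that B * in \<open>simp add: subgrp_add subgrp_diff\<close>)+
  then show "coset B a = coset B a'"
    unfolding coset_def by blast
qed

lemma card_image_cong_inj:
  assumes "\<And>a a'. a \<in> A \<Longrightarrow> a' \<in> A \<Longrightarrow> f a = f a' \<longleftrightarrow> g a = g a'"
  shows "card (f ` A) = card (g ` A)"
proof -
  have "bij_betw (\<lambda>y. g (inv_into A f y)) (f ` A) (g ` A)"
    unfolding bij_betw_def
  proof
    show "inj_on (\<lambda>y. g (inv_into A f y)) (f ` A)"
      by (rule inj_onI) (metis assms f_inv_into_f inv_into_into)
    have "g a \<in> (\<lambda>y. g (inv_into A f y)) ` f ` A" if "a \<in> A" for a
      by (rule image_eqI[of _ _ "f a"]) (use that assms in \<open>metis f_inv_into_f inv_into_into imageI\<close>)+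
    then show "(\<lambda>y. g (inv_into A f y)) ` f ` A = g ` A"
      by (auto intro: inv_into_into)
  qed
  then show ?thesis
    by (rule bij_betw_same_card)
qed

text \<open>The first isomorphism theorem as a count: \<phi> is additive on \<open>A\<close>, maps
  it onto \<open>C\<close> modulo \<open>D\<close>, and pulls \<open>D\<close> back to
  \<open>B\<close>. All conditions are relative to \<open>A\<close>, so multiplication maps between
  lattices can be inserted directly.\<close>

lemma idx_iso:
  assumes A: "subgrp A" and B: "subgrp B" and D: "subgrp D"
    and diff: "\<And>a a'. a \<in> A \<Longrightarrow> a' \<in> A \<Longrightarrow> \<phi> (a - a') = \<phi> a - \<phi> a'"
    and C: "\<And>a. a \<in> A \<Longrightarrow> \<phi> a \<in> C"
    and surj: "\<And>c. c \<in> C \<Longrightarrow> \<exists>a\<in>A. c - \<phi> a \<in> D"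
    and ker: "\<And>a. a \<in> A \<Longrightarrow> \<phi> a \<in> D \<longleftrightarrow> a \<in> B"
  shows "idx C D = idx A B"
proof -
  have "coset D ` C = (coset D \<circ> \<phi>) ` A"
  proof (intro equalityI subsetI)
    fix z assume "z \<in> coset D ` C"
    then obtain c where c: "c \<in> C" "z = coset D c" by blast
    then obtain a where "a \<in> A" "c - \<phi> a \<in> D" using surj by blast
    then show "z \<in> (coset D \<circ> \<phi>) ` A" using c by (auto simp: coset_eq_iff[OF D] intro!: image_eqI[of _ _ a])
  qed (use C in auto)
  moreover have "(coset D \<circ> \<phi>) a = (coset D \<circ> \<phi>) a' \<longleftrightarrow> coset B a = coset B a'"
    if "a \<in> A" "a' \<in> A" for a a'
    using diff[OF that] ker[of "a - a'"] subgrp_diff[OF A that] by (simp add: coset_eq_iff B D)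
  ultimately show ?thesis
    unfolding idx_def using card_image_cong_inj[of A "coset D \<circ> \<phi>" "coset B"] by presburger
qed

lemma idx_mult:
  fixes x :: "'a::field"
  assumes "subgrp A" "subgrp B" "x \<noteq> 0"
  shows "idx ((*) x ` A) ((*) x ` B) = idx A B"
proof (rule idx_iso[where \<phi> = "(*) x"])
  show "\<exists>a\<in>A. c - x * a \<in> (*) x ` B" if "c \<in> (*) x ` A" for c
    using that subgrp_0[OF assms(2)] by force
qed (use assms in \<open>auto simp: subgrp_image_mult right_diff_distrib\<close>)

lemma idx_tower:
  assumes A: "subgrp A" and B: "subgrp B" and C: "subgrp C" and BA: "B \<subseteq> A" and CB: "C \<subseteq> B"
  shows "idx A C = idx A B * idx B C"
proof -
  \<comment> \<open>The representative depends only on the coset of \<open>B\<close>. Subtracting it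
    turns a class of \<open>A\<close> modulo \<open>C\<close> into a pair: a coset of
    \<open>B\<close> in \<open>A\<close> and a coset of \<open>C\<close> in
    \<open>B\<close>.\<close>
  define r where "r a = (SOME x. x \<in> A \<and> coset B x = coset B a)" for a
  have r: "r a \<in> A" "coset B (r a) = coset B a" if "a \<in> A" for a
    using someI[of "\<lambda>x. x \<in> A \<and> coset B x = coset B a" a] that by (auto simp: r_def)
  define p where "p a = (coset B a, coset C (a - r a))" for a
  have rcong: "r a = r a'" if "coset B a = coset B a'" for a a'
    using that by (simp add: r_def)
  have "p a = p a' \<longleftrightarrow> coset C a = coset C a'" if "a \<in> A" "a' \<in> A" for a a'
    using rcong[of a a'] CB by (auto simp: p_def coset_eq_iff B C)
  then have "card (coset C ` A) = card (p ` A)"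
    by (intro card_image_cong_inj) auto
  also have "p ` A = coset B ` A \<times> coset C ` B"
  proof (intro equalityI subsetI)
    fix z assume "z \<in> p ` A"
    then obtain a where a: "a \<in> A" "z = p a" by blast
    have "a - r a \<in> B"
      using r(2)[OF a(1)] B by (metis coset_eq_iff)
    then show "z \<in> coset B ` A \<times> coset C ` B"
      using a by (auto simp: p_def)
  next
    fix z assume "z \<in> coset B ` A \<times> coset C ` B"
    then obtain a b where z: "a \<in> A" "b \<in> B" "z = (coset B a, coset C b)" by blast
    have *: "coset B (r a + b) = coset B a"
      using r(2)[OF z(1)] subgrp_add[OF B z(2), of "r a - a"] by (simp add: coset_eq_iff B algebra_simps)
    then have "z = p (r a + b)"
      using rcong[OF *] z(3) by (simp add: p_def)
    moreover have "r a + b \<in> A"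
      using r(1) z BA by (auto intro: subgrp_add[OF A])
    ultimately show "z \<in> p ` A" by blast
  qed
  finally show ?thesis
    by (simp add: idx_def card_cartesian_product)
qed

lemma idx_self:
  assumes "subgrp A"
  shows "idx A A = 1"
proof -
  have "coset A ` A = {coset A 0}"
    using assms coset_eq_iff[OF assms, of _ 0] subgrp_0[OF assms] by (auto simp: image_iff)
  then show ?thesis by (simp add: idx_def)
qed

lemma idx_pos_mono:
  assumes "subgrp A" "subgrp B" "subgrp C" "B \<subseteq> A" "C \<subseteq> B" "idx A C > 0"
  shows "idx A B > 0" "idx B C > 0"
  using assms idx_tower[of A B C] by auto

lemma idx_eq_1_iff:
  assumes "subgrp A" "subgrp B" "B \<subseteq> A"
  shows "idx A B = 1 \<longleftrightarrow> A = B"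
proof
  assume "idx A B = 1"
  then obtain Z where Z: "coset B ` A = {Z}"
    unfolding idx_def by (meson card_1_singletonE)
  then have "coset B a = coset B 0" if "a \<in> A" for a
    using that subgrp_0[OF assms(1)] Z by blast
  then show "A = B"
    using assms by (auto simp: coset_eq_iff)
qed (use assms idx_self in auto)

lemma idx_int_multiples:
  assumes "a > 0"
  shows "idx UNIV {c::int. a dvd c} = nat a"
proof -
  have s: "subgrp {c::int. a dvd c}" by (auto simp: subgrp_def)
  have "idx UNIV {c::int. a dvd c} = card (range (\<lambda>c. c mod a))"
    unfolding idx_def
    by (rule card_image_cong_inj) (auto simp: coset_eq_iff[OF s] mod_eq_dvd_iff)
  also have "range (\<lambda>c. c mod a) = {0..<a}"
    using assms by (auto simp: image_iff) (metis mod_pos_pos_trivial)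
  finally show ?thesis by simp
qed

section \<open>Extensions by one generator, and the index of the multiples of a lattice\<close>

definition adjoin :: "'a::comm_ring_1 set \<Rightarrow> 'a \<Rightarrow> 'a set" where
  "adjoin G v = {g + of_int c * v | g c. g \<in> G}"

text \<open>The quotient is cyclic, generated by the class of \<open>v\<close>, and
  \<open>iff\<close> says that this class has order \<open>a\<close>.\<close>

lemma idx_adjoin:
  assumes G: "subgrp G" and a: "a > 0" and iff: "\<And>c. of_int c * v \<in> G \<longleftrightarrow> a dvd c"
  shows "idx (adjoin G v) G = nat a"
proof -
  have "idx (adjoin G v) G = idx UNIV {c::int. a dvd c}"
  proof (rule idx_iso[where \<phi> = "\<lambda>c. of_int c * v"])
    show "of_int c * v \<in> adjoin G v" for c
      using subgrp_0[OF G] by (force simp: adjoin_def)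
    show "\<exists>c\<in>UNIV. y - of_int c * v \<in> G" if "y \<in> adjoin G v" for y
    proof -
      obtain g c where "y = g + of_int c * v" "g \<in> G" using \<open>y \<in> adjoin G v\<close> by (auto simp: adjoin_def)
      then show ?thesis by (intro bexI[of _ c]) auto
    qed
  qed (use G iff in \<open>auto simp: subgrp_def left_diff_distrib\<close>)
  then show ?thesis
    using idx_int_multiples[OF a] by simp
qed

text \<open>With \<open>N' = D N\<close> between \<open>D E M\<close> and \<open>M\<close>, the
  index of \<open>m N'\<close> in \<open>M\<close> is \<open>[M:N'] [N':m N']\<close> and also
  \<open>[M:m M] [m M:m N']\<close>. As \<open>[m M:m N'] = [M:N']\<close> is positive, it cancels.
  The invariant is the rank in disguise: a lattice without a known basis can be compared with one
  that has a basis.\<close>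

lemma idx_commensurable:
  fixes M N :: "'a::field_char_0 set"
  assumes M: "subgrp M" and N: "subgrp N" and D: "D > 0" "(*) (of_nat D) ` N \<subseteq> M"
    and E: "E > 0" "(*) (of_nat E) ` M \<subseteq> N"
    and fin: "\<And>m. m > 0 \<Longrightarrow> idx M ((*) (of_nat m) ` M) > 0" and m: "m > 0"
  shows "idx N ((*) (of_nat m) ` N) = idx M ((*) (of_nat m) ` M)" "idx M ((*) (of_nat D) ` N) > 0"
proof -
  define N' where "N' = (*) (of_nat D :: 'a) ` N"
  have N': "subgrp N'" "N' \<subseteq> M"
    using D(2) N by (auto simp: N'_def subgrp_image_mult)
  have mult: "(*) (of_nat m) ` A \<subseteq> A" if "subgrp A" for A :: "'a set"
    using subgrp_of_int_mult[OF that, of _ "int m"] by auto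
  have DE: "(*) (of_nat (D * E)) ` M \<subseteq> N'"
  proof
    fix y assume "y \<in> (*) (of_nat (D * E)) ` M"
    then obtain z where "z \<in> M" "y = of_nat D * (of_nat E * z)" by (auto simp: mult.assoc)
    then show "y \<in> N'" using E(2) unfolding N'_def by blast
  qed
  show pos: "idx M ((*) (of_nat D) ` N) > 0"
    using idx_pos_mono[OF M N'(1) subgrp_image_mult[OF M] N'(2) DE] fin[of "D * E"] D E
    by (simp add: N'_def)
  have "idx N ((*) (of_nat m) ` N) = idx N' ((*) (of_nat D) ` (*) (of_nat m) ` N)"
    unfolding N'_def by (rule idx_mult[symmetric]) (use N D in \<open>auto simp: subgrp_image_mult\<close>)
  also have "(*) (of_nat D) ` (*) (of_nat m) ` N = (*) (of_nat m) ` N'"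
    by (auto simp: N'_def image_image mult_ac)
  finally have 1: "idx N ((*) (of_nat m) ` N) = idx N' ((*) (of_nat m) ` N')" .
  have "idx M N' * idx N' ((*) (of_nat m) ` N') = idx M ((*) (of_nat m) ` N')"
    by (rule idx_tower[symmetric]) (use M N' mult[of N'] in \<open>auto simp: subgrp_image_mult\<close>)
  also have "\<dots> = idx M ((*) (of_nat m) ` M) * idx ((*) (of_nat m) ` M) ((*) (of_nat m) ` N')"
    by (rule idx_tower) (use M N' mult[of M] in \<open>auto simp: subgrp_image_mult\<close>)
  also have "idx ((*) (of_nat m) ` M) ((*) (of_nat m) ` N') = idx M N'"
    by (rule idx_mult) (use M N' m in auto)
  finally show "idx N ((*) (of_nat m) ` N) = idx M ((*) (of_nat m) ` M)"
    using 1 pos by (simp add: N'_def)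
qed

definition zspan :: "('i \<Rightarrow> 'a::comm_ring_1) \<Rightarrow> 'i set \<Rightarrow> 'a set" where
  "zspan e I = {\<Sum>i\<in>I. of_int (c i) * e i | c. True}"

lemma zspanI: "y = (\<Sum>i\<in>I. of_int (c i) * e i) \<Longrightarrow> y \<in> zspan e I"
  and zspanE: "y \<in> zspan e I \<Longrightarrow> (\<And>c. y = (\<Sum>i\<in>I. of_int (c i) * e i) \<Longrightarrow> thesis) \<Longrightarrow> thesis"
  by (auto simp: zspan_def)

lemma subgrp_zspan: "subgrp (zspan e I)"
  unfolding subgrp_def zspan_def
proof (safe, goal_cases)
  case 1
  then show ?case by (auto intro!: exI[of _ "\<lambda>_. 0"])
next
  case (2 _ _ c c')
  then show ?case
    by (intro exI[of _ "\<lambda>i. c i - c' i"]) (auto simp: algebra_simps sum_subtractf)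
qed

lemma zspan_mem:
  assumes "finite I" "i \<in> I"
  shows "e i \<in> zspan e I"
proof -
  have "(\<Sum>j\<in>I. of_int (if j = i then 1 else 0) * e j) = (\<Sum>j\<in>I. if j = i then e j else 0)"
    by (intro sum.cong) auto
  also have "\<dots> = e i" using assms by simp
  finally show ?thesis unfolding zspan_def by (intro CollectI exI conjI) (erule sym, simp)
qed

lemma idx_zspan_mult:
  fixes e :: "'i \<Rightarrow> 'a::field_char_0"
  assumes fin: "finite I" and ind: "\<And>c. (\<Sum>i\<in>I. of_int (c i) * e i) = 0 \<Longrightarrow> \<forall>i\<in>I. c i = 0" and m: "m > 0"
  shows "idx (zspan e I) ((*) (of_nat m) ` zspan e I) = m ^ card I"
proof -
  \<comment> \<open>A flag from \<open>m M\<close> to \<open>M\<close>: coefficients outside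
    \<open>J\<close> are divisible by \<open>m\<close>, and each new element of \<open>J\<close>
    releases one coefficient, which multiplies the index by \<open>m\<close>.\<close>
  define G where "G J = {\<Sum>i\<in>I. of_int (c i) * e i | c. \<forall>i\<in>I - J. int m dvd c i}" for J
  have GI: "G I = zspan e I" by (auto simp: G_def zspan_def)
  have G0: "G {} = (*) (of_nat m) ` zspan e I"
  proof (intro equalityI subsetI)
    fix y assume "y \<in> G {}"
    then obtain c where c: "y = (\<Sum>i\<in>I. of_int (c i) * e i)" "\<forall>i\<in>I. int m dvd c i" by (auto simp: G_def)
    have *: "of_int (c i) = of_nat m * (of_int (c i div int m) :: 'a)" if "i \<in> I" for i
    proof -
      have "c i = int m * (c i div int m)" using c(2) that by simp
      then have "of_int (c i) = (of_int (int m * (c i div int m)) :: 'a)" by presburger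
      then show ?thesis by simp
    qed
    have "y = of_nat m * (\<Sum>i\<in>I. of_int (c i div int m) * e i)"
      unfolding sum_distrib_left c(1) by (intro sum.cong refl) (simp add: * mult.assoc)
    then show "y \<in> (*) (of_nat m) ` zspan e I"
      unfolding zspan_def by (intro image_eqI[of _ _ "\<Sum>i\<in>I. of_int (c i div int m) * e i"]) auto
  next
    fix y assume "y \<in> (*) (of_nat m) ` zspan e I"
    then obtain c where "y = of_nat m * (\<Sum>i\<in>I. of_int (c i) * e i)" by (auto simp: zspan_def)
    then show "y \<in> G {}"
      by (auto simp: G_def sum_distrib_left mult.assoc intro!: exI[of _ "\<lambda>i. int m * c i"])
  qed
  have sG: "subgrp (G J)" for J
    unfolding subgrp_def G_def
  proof (safe, goal_cases)
    case 1
    then show ?case by (auto intro!: exI[of _ "\<lambda>_. 0"])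
  next
    case (2 _ _ c c')
    then show ?case
      by (intro exI[of _ "\<lambda>i. c i - c' i"]) (auto simp: algebra_simps sum_subtractf)
  qed
  have "J \<subseteq> I \<Longrightarrow> idx (G J) (G {}) = m ^ card J" if "finite J" for J
    using that
  proof (induction J rule: finite_induct)
    case (insert j J)
    have "G (insert j J) = adjoin (G J) (e j)"
    proof (intro equalityI subsetI)
      fix y assume "y \<in> G (insert j J)"
      then obtain c where c: "y = (\<Sum>i\<in>I. of_int (c i) * e i)" "\<forall>i\<in>I - insert j J. int m dvd c i"
        by (auto simp: G_def)
      have "y = (\<Sum>i\<in>I. of_int ((c(j:=0)) i) * e i) + of_int (c j) * e j"
        unfolding c(1) using insert.prems fin by (simp add: sum.remove[of I j])
      moreover have "(\<Sum>i\<in>I. of_int ((c(j:=0)) i) * e i) \<in> G J"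
        unfolding G_def using c(2) by (auto intro!: exI[of _ "c(j:=0)"])
      ultimately show "y \<in> adjoin (G J) (e j)" unfolding adjoin_def by blast
    next
      fix y assume "y \<in> adjoin (G J) (e j)"
      then obtain c k where c: "y = (\<Sum>i\<in>I. of_int (c i) * e i) + of_int k * e j" "\<forall>i\<in>I - J. int m dvd c i"
        by (auto simp: G_def adjoin_def)
      have "y = (\<Sum>i\<in>I. of_int ((c(j:=c j + k)) i) * e i)"
        unfolding c(1) using insert.prems fin by (simp add: sum.remove[of I j] algebra_simps)
      then show "y \<in> G (insert j J)"
        unfolding G_def using c(2) by (intro CollectI exI[of _ "c(j:=c j + k)"]) simp
    qed
    moreover have "of_int k * e j \<in> G J \<longleftrightarrow> int m dvd k" for k
    proof
      assume "of_int k * e j \<in> G J"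
      then obtain c where c: "of_int k * e j = (\<Sum>i\<in>I. of_int (c i) * e i)" "\<forall>i\<in>I - J. int m dvd c i"
        by (auto simp: G_def)
      have "(\<Sum>i\<in>I. of_int ((c(j:=c j - k)) i) * e i) = (\<Sum>i\<in>I. of_int (c i) * e i) - of_int k * e j"
        using insert.prems fin by (simp add: sum.remove[of I j] algebra_simps)
      then have "(\<Sum>i\<in>I. of_int ((c(j:=c j - k)) i) * e i) = 0" using c(1) by simp
      from ind[OF this] have "c j = k" using insert.prems by auto
      then show "int m dvd k" using c(2) insert by auto
    next
      assume "int m dvd k"
      moreover have "of_int k * e j = (\<Sum>i\<in>I. of_int (((\<lambda>_. 0)(j:=k)) i) * e i)"
        using insert.prems fin by (simp add: sum.remove[of I j])
      ultimately show "of_int k * e j \<in> G J"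
        unfolding G_def by (auto intro!: exI[of _ "(\<lambda>_. 0)(j:=k)"])
    qed
    ultimately have "idx (G (insert j J)) (G J) = m"
      using idx_adjoin[OF sG, of "int m"] m by simp
    moreover have "idx (G (insert j J)) (G {}) = idx (G (insert j J)) (G J) * idx (G J) (G {})"
      by (rule idx_tower[OF sG sG sG]) (force simp: G_def)+
    ultimately show ?case using insert by simp
  qed (simp add: idx_self sG)
  from this[OF fin] show ?thesis by (simp add: GI G0)
qed

section \<open>Minimal polynomials over the rationals\<close>

text \<open>Polymorphic in the target field: one rational polynomial is evaluated both at an
  algebraic number in \<open>qbar\<close> and at its conjugates in \<open>complex\<close>, so that
  no embedding of all of \<open>qbar\<close> into \<open>complex\<close> has to be chosen.\<close>

abbreviation ev :: "rat poly \<Rightarrow> 'a::field_char_0 \<Rightarrow> 'a" where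
  "ev p x \<equiv> poly (map_poly of_rat p) x"

lemma map_poly_of_rat_hom: "map_poly_inj_idom_hom (of_rat :: rat \<Rightarrow> 'a::field_char_0)" ..

lemma ev_add: "ev (p + q) x = ev p x + ev q x"
  and ev_diff: "ev (p - q) x = ev p x - ev q x"
  and ev_uminus: "ev (- p) x = - ev p x"
  and ev_mult: "ev (p * q) x = ev p x * ev q x"
  and ev_smult: "ev (smult a p) x = of_rat a * ev p x"
  and ev_1: "ev 1 x = 1"
  and ev_power: "ev (p ^ n) x = ev p x ^ n"
proof -
  interpret h: map_poly_inj_idom_hom "of_rat :: rat \<Rightarrow> 'a" by (rule map_poly_of_rat_hom)
  show "ev (p + q) x = ev p x + ev q x" "ev (p - q) x = ev p x - ev q x" "ev (- p) x = - ev p x"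
    "ev (p * q) x = ev p x * ev q x" "ev 1 x = 1" "ev (p ^ n) x = ev p x ^ n"
    "ev (smult a p) x = of_rat a * ev p x"
    by (simp_all add: hom_distribs of_rat_hom.map_poly_hom_smult)
qed

lemma ev_sum: "ev (sum f I) x = (\<Sum>i\<in>I. ev (f i) x)"
  by (induction I rule: infinite_finite_induct) (simp_all add: ev_add)

lemma ev_pCons: "ev (pCons a p) x = of_rat a + x * ev p x"
  by (simp add: of_rat_hom.map_poly_pCons_hom)

lemma ev_const: "ev [:a:] x = of_rat a"
  by (simp add: ev_pCons)

lemma ev_pcompose: "ev (pcompose p q) x = ev p (ev q x)"
  by (induction p) (simp_all add: pcompose_pCons ev_add ev_mult ev_const ev_pCons)

lemma ev_altdef: "ev p x = (\<Sum>i\<le>degree p. of_rat (Polynomial.coeff p i) * x ^ i)"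
  by (simp add: poly_altdef)

lemma poly_of_int_poly_mult: "poly (of_int_poly (p * q)) x = poly (of_int_poly p) x * poly (of_int_poly q) x"
  and poly_of_int_poly_diff: "poly (of_int_poly (p - q)) x = poly (of_int_poly p) x - poly (of_int_poly q) x"
  and poly_of_int_poly_smult: "poly (of_int_poly (smult a p)) x = of_int a * poly (of_int_poly p) x"
  and poly_of_int_poly_monom: "poly (of_int_poly (Polynomial.monom a n)) x = of_int a * x ^ n"
  for x :: "'a::field_char_0"
proof -
  interpret h: map_poly_inj_idom_hom "of_int :: int \<Rightarrow> 'a" ..
  show "poly (of_int_poly (p * q)) x = poly (of_int_poly p) x * poly (of_int_poly q) x"
    "poly (of_int_poly (p - q)) x = poly (of_int_poly p) x - poly (of_int_poly q) x"
    by (simp_all add: hom_distribs)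
  show "poly (of_int_poly (smult a p)) x = of_int a * poly (of_int_poly p) x"
    by (simp add: of_int_hom.map_poly_hom_smult)
  show "poly (of_int_poly (Polynomial.monom a n)) x = of_int a * x ^ n"
    by (simp add: map_poly_monom poly_monom)
qed

lemma poly_of_int_poly_eq_ev: "poly (of_int_poly g) x = ev (of_int_poly g) x"
  by (simp add: map_poly_map_poly o_def)

lemma clear_denominators:
  fixes c :: "rat poly"
  obtains D :: int and g :: "int poly" where "D > 0" "smult (of_int D) c = of_int_poly g"
proof -
  have "\<exists>D g. D > 0 \<and> smult (of_int D) c = (of_int_poly g :: rat poly)"
  proof (induction c)
    case (pCons a q)
    then obtain D g where D: "D > 0" "smult (of_int D) q = (of_int_poly g :: rat poly)" by blast
    obtain n d where nd: "quotient_of a = (n, d)" by fastforce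
    have d: "d > 0" "a = of_int n / of_int d"
      using nd quotient_of_denom_pos quotient_of_div by auto
    have "smult (of_int (d * D)) (pCons a q) = of_int_poly (pCons (n * D) (smult d g))"
      using d by (simp add: of_int_hom.map_poly_hom_smult of_int_hom.map_poly_pCons_hom flip: D(2))
    then show ?case using d(1) D(1) by (metis mult_pos_pos)
  qed (rule exI[of _ 1], rule exI[of _ 0], simp)
  then show ?thesis using that by blast
qed

lemma to_ac_eq_of_rat: "to_ac r = of_rat r"
proof -
  obtain n d where "r = of_int n / of_int d" "d \<noteq> 0"
    by (metis of_int_eq_0_iff quotient_of_div quotient_of_denom_pos less_irrefl surj_pair)
  then show ?thesis by (simp add: of_rat_divide)
qed

text \<open>Specified through divisibility instead of least degree, the form in which it is applied;
  being monic makes it unique.\<close>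

definition mp :: "qbar \<Rightarrow> rat poly" where
  "mp x = (SOME p. monic p \<and> (\<forall>c. ev c x = 0 \<longleftrightarrow> p dvd c))"

lemma mp: "monic (mp x)" "ev c x = 0 \<longleftrightarrow> mp x dvd c"
proof -
  obtain p0 :: "rat poly" where "p0 \<noteq> 0" "ev p0 x = 0"
    using alg_closure_algebraic[of x] by (metis map_poly_cong to_ac_eq_of_rat)
  then obtain p where p: "p \<noteq> 0" "ev p x = 0" "\<And>q. q \<noteq> 0 \<Longrightarrow> ev q x = 0 \<Longrightarrow> degree p \<le> degree q"
    using ex_has_least_nat[of "\<lambda>p. p \<noteq> 0 \<and> ev p x = 0" p0 degree] by blast
  define m where "m = smult (inverse (lead_coeff p)) p"
  have m: "monic m" "degree m = degree p" "ev m x = 0"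
    using p(1,2) by (auto simp: m_def ev_smult)
  have "ev c x = 0 \<longleftrightarrow> m dvd c" for c
  proof
    assume c: "ev c x = 0"
    have "ev (c mod m) x = ev (c - m * (c div m)) x"
      by (simp add: minus_mult_div_eq_mod)
    also have "\<dots> = 0" by (simp add: ev_diff ev_mult c m)
    finally have "c mod m = 0"
      using p(3)[of "c mod m"] m(1,2) degree_mod_less[of m c] p(1) by force
    then show "m dvd c" by (simp add: mod_eq_0_iff_dvd)
  qed (auto elim!: dvdE simp: ev_mult m)
  then have ex: "\<exists>p. monic p \<and> (\<forall>c. ev c x = 0 \<longleftrightarrow> p dvd c)" using m(1) by blast
  have "monic (mp x) \<and> (\<forall>c. ev c x = 0 \<longleftrightarrow> mp x dvd c)"
    unfolding mp_def by (rule someI_ex[OF ex])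
  then show "monic (mp x)" "ev c x = 0 \<longleftrightarrow> mp x dvd c" by blast+
qed

lemma ev_mp [simp]: "ev (mp x) x = 0"
  by (simp add: mp)

lemma mp_nonzero [simp]: "mp x \<noteq> 0"
  using mp(1)[of x] by auto

lemma degree_mp_pos: "degree (mp x) > 0"
proof (rule ccontr)
  assume "\<not> degree (mp x) > 0"
  then have "mp x = 1"
    using mp(1)[of x] by (metis gr0I monic_degree_0)
  then show False using ev_mp[of x] by (simp add: ev_1)
qed

lemma mp_irreducible: "Factorial_Ring.irreducible (mp x)"
proof (rule Factorial_Ring.irreducibleI)
  show "\<not> is_unit (mp x)"
    using degree_mp_pos[of x] by (auto simp: is_unit_iff_degree)
  fix a b assume ab: "mp x = a * b"
  then have nz: "a \<noteq> 0" "b \<noteq> 0" using mp_nonzero by (metis mult_zero_left mult_zero_right)+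
  have "ev a x * ev b x = 0" using ev_mp[of x] unfolding ab ev_mult .
  then have "mp x dvd a \<or> mp x dvd b" by (auto simp: mp(2))
  then have "degree (mp x) \<le> degree a \<or> degree (mp x) \<le> degree b"
    using nz dvd_imp_degree_le by blast
  then have "degree a = 0 \<or> degree b = 0" using ab nz by (auto simp: degree_mult_eq)
  then show "is_unit a \<or> is_unit b" using nz by (auto simp: is_unit_iff_degree)
qed simp

lemma ev_conjugate: "ev (mp x) z = 0 \<Longrightarrow> ev c x = 0 \<Longrightarrow> ev c z = 0"
  by (auto simp: mp(2) ev_mult elim!: dvdE)

text \<open>Irreducibility makes \<open>mp x\<close> coprime to every nonzero polynomial of smaller
  degree. Simple roots, inverses in \<open>Q(x)\<close> and the minimality of \<open>mp x\<close> at
  each of its complex roots all follow from this one identity.\<close>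

lemma mp_bezout:
  assumes "c \<noteq> 0" "degree c < degree (mp x)"
  obtains u v where "u * mp x + v * c = 1"
proof -
  have "\<not> mp x dvd c" using assms dvd_imp_degree_le[of "mp x" c] by auto
  moreover have "prime_elem (mp x)"
    by (rule irreducible_imp_prime_elem_gcd[OF mp_irreducible])
  ultimately have "coprime (mp x) c"
    by (rule prime_elem_imp_coprime[rotated])
  then have "gcd (mp x) c = 1" by simp
  with bezout_coefficients_fst_snd[of "mp x" c] show ?thesis
    by (intro that) (erule trans)
qed

lemma simple_roots_mp:
  fixes z :: "'a::field_char_0"
  assumes "ev (mp x) z = 0"
  shows "ev (pderiv (mp x)) z \<noteq> 0"
proof
  assume *: "ev (pderiv (mp x)) z = 0"
  have "pderiv (mp x) \<noteq> 0" "degree (pderiv (mp x)) < degree (mp x)"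
    using degree_mp_pos[of x] by (auto simp: pderiv_eq_0_iff degree_pderiv)
  then obtain u v where "u * mp x + v * pderiv (mp x) = 1" by (rule mp_bezout)
  then have "ev (u * mp x + v * pderiv (mp x)) z = 1" by (simp add: ev_1)
  then show False using assms * by (simp add: ev_add ev_mult)
qed

lemma rsquarefree_mp: "rsquarefree (map_poly of_rat (mp x) :: 'a::field_char_0 poly)"
  unfolding rsquarefree_roots
  using simple_roots_mp[of x] by (auto simp: of_rat_hom.map_poly_pderiv)

definition conjugates :: "qbar \<Rightarrow> complex set" where
  "conjugates x = {z. ev (mp x) z = 0}"

lemma finite_conjugates: "finite (conjugates x)"
  unfolding conjugates_def by (rule poly_roots_finite) simp

lemma card_conjugates: "card (conjugates x) = degree (mp x)"
  unfolding conjugates_def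
  using rsquarefree_card_degree[of "map_poly of_rat (mp x) :: complex poly"] rsquarefree_mp[of x, where 'a = complex] by simp

lemma mp_complex_factorization:
  "map_poly of_rat (mp x) = (\<Prod>z\<in>conjugates x. [:- z, 1:])"
  using complex_poly_decompose_rsquarefree[OF rsquarefree_mp[of x]] mp(1)[of x]
  by (simp add: conjugates_def)

lemma ev_inverse_exists:
  fixes x :: qbar
  assumes "ev c x \<noteq> 0"
  obtains v where "ev v x * ev c x = 1"
proof -
  define c' where "c' = c mod mp x"
  have "ev c x = ev (c div mp x * mp x + c') x" by (simp add: c'_def)
  then have cc: "ev c x = ev c' x" by (simp only: ev_add ev_mult ev_mp) simp
  then have "c' \<noteq> 0" using assms by auto
  moreover from this have "degree c' < degree (mp x)"
    unfolding c'_def using degree_mod_less[OF mp_nonzero] by blast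
  ultimately obtain u v where "u * mp x + v * c' = 1" by (rule mp_bezout)
  then have "ev (u * mp x + v * c') x = 1" by (simp add: ev_1)
  then show ?thesis using that[of v] cc by (simp add: ev_add ev_mult)
qed

text \<open>Polynomial values suffice because \<open>x\<close> is algebraic:
  \<open>qf_inverse\<close> shows that they form a field, and \<open>generate_field_eq_qf\<close>
  identifies it with the field in the definition of the height.\<close>

definition qf :: "qbar \<Rightarrow> qbar set" where
  "qf x = range (\<lambda>c. ev c x)"

lemma qf_ev [intro]: "ev c x \<in> qf x" by (auto simp: qf_def)

lemma qf_of_rat [intro]: "of_rat r \<in> qf x"
  using qf_ev[of "[:r:]" x] by (simp add: ev_const)

lemma qf_of_int [intro]: "of_int r \<in> qf x"
  using qf_of_rat[of "of_int r" x] by simp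

lemma qf_of_nat [intro]: "of_nat r \<in> qf x"
  using qf_of_rat[of "of_nat r" x] by simp

lemma qf_0 [intro]: "0 \<in> qf x" and qf_1 [intro]: "1 \<in> qf x"
  using qf_of_rat[of 0 x] qf_of_rat[of 1 x] by auto

lemma qf_self [intro]: "x \<in> qf x"
  using qf_ev[of "[:0, 1:]" x] by (simp add: ev_pCons ev_const)

lemma qf_add [intro]: "a \<in> qf x \<Longrightarrow> b \<in> qf x \<Longrightarrow> a + b \<in> qf x"
  and qf_diff [intro]: "a \<in> qf x \<Longrightarrow> b \<in> qf x \<Longrightarrow> a - b \<in> qf x"
  and qf_mult [intro]: "a \<in> qf x \<Longrightarrow> b \<in> qf x \<Longrightarrow> a * b \<in> qf x"
  and qf_uminus [intro]: "a \<in> qf x \<Longrightarrow> - a \<in> qf x"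
  unfolding qf_def by (auto simp flip: ev_add ev_mult ev_diff ev_uminus)

lemma qf_power [intro]: "a \<in> qf x \<Longrightarrow> a ^ n \<in> qf x"
  by (induction n) auto

lemma qf_inverse [intro]: "a \<in> qf x \<Longrightarrow> inverse a \<in> qf x"
proof (cases "a = 0")
  case False
  assume "a \<in> qf x"
  then obtain c where c: "a = ev c x" by (auto simp: qf_def)
  then obtain v where "ev v x * a = 1" using ev_inverse_exists False by metis
  then have "inverse a = ev v x" by (metis inverse_unique mult.commute)
  then show ?thesis by auto
qed auto

lemma qf_divide [intro]: "a \<in> qf x \<Longrightarrow> b \<in> qf x \<Longrightarrow> a / b \<in> qf x"
  by (simp add: divide_inverse qf_mult qf_inverse)

lemma qf_sum [intro]: "(\<And>i. i \<in> I \<Longrightarrow> f i \<in> qf x) \<Longrightarrow> sum f I \<in> qf x"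
  by (induction I rule: infinite_finite_induct) auto

lemma qf_powi [intro]: "a \<in> qf x \<Longrightarrow> a powi n \<in> qf x"
  by (auto simp: power_int_def)

lemma qf_subset: "y \<in> qf x \<Longrightarrow> qf y \<subseteq> qf x"
  unfolding qf_def by (auto simp flip: ev_pcompose)

lemma generate_field_eq_qf: "generate_field Qbar {x} = qf x"
proof (intro equalityI subsetI)
  fix y assume "y \<in> generate_field Qbar {x}"
  then show "y \<in> qf x"
  proof induction
    case (a_inv h)
    have "\<ominus>\<^bsub>Qbar\<^esub> h = - h"
      by (rule abelian_group.minus_equality) 
         (auto simp: ring_of_type_algebra_def intro!: ring.is_abelian_group ring_from_type_algebra[unfolded ring_of_type_algebra_def])
    then show ?case using a_inv by auto
  next
    case (m_inv h)
    have "inv\<^bsub>Qbar\<^esub> h = inverse h"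
      using m_inv cring_from_type_algebra[where ?'a = qbar]
      by (intro comm_monoid.comm_inv_char cring.axioms) (auto simp: ring_of_type_algebra_def cring_def)
    then show ?case using m_inv by auto
  qed (auto simp: ring_of_type_algebra_def)
next
  interpret field Qbar by (rule field_from_type_algebra)
  have sf: "subfield (generate_field Qbar {x}) Qbar"
    by (rule generate_field_is_subfield) (auto simp: ring_of_type_algebra_def)
  note cl = generate_field.eng_add[of _ Qbar "{x}"] generate_field.eng_mult[of _ Qbar "{x}"]
  have 0: "0 \<in> generate_field Qbar {x}"
    using zero_in_generate by (simp add: ring_of_type_algebra_def)
  have 1: "1 \<in> generate_field Qbar {x}"
    using generate_field.one[of Qbar] by (simp add: ring_of_type_algebra_def)
  have add: "a + b \<in> generate_field Qbar {x}" "a * b \<in> generate_field Qbar {x}" 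
    if "a \<in> generate_field Qbar {x}" "b \<in> generate_field Qbar {x}" for a b
    using cl that by (auto simp: ring_of_type_algebra_def)
  have nat: "of_nat n \<in> generate_field Qbar {x}" for n
    by (induction n) (auto intro: 0 1 add)
  have minus: "- a \<in> generate_field Qbar {x}" if "a \<in> generate_field Qbar {x}" for a
  proof -
    have "\<ominus>\<^bsub>Qbar\<^esub> a = - a"
      by (rule minus_equality) (auto simp: ring_of_type_algebra_def)
    then show ?thesis using generate_field.a_inv[OF that] by simp
  qed
  have int: "of_int n \<in> generate_field Qbar {x}" for n
    using nat[of "nat n"] minus[OF nat[of "nat (-n)"]] by (cases "n \<ge> 0") auto
  have inverse: "inverse a \<in> generate_field Qbar {x}" if "a \<in> generate_field Qbar {x}" "a \<noteq> 0" for a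
  proof -
    have "inv\<^bsub>Qbar\<^esub> a = inverse a"
      using that by (intro comm_inv_char) (auto simp: ring_of_type_algebra_def)
    then show ?thesis using generate_field.m_inv[OF that(1)] that(2) by (simp add: ring_of_type_algebra_def)
  qed
  have rat: "of_rat r \<in> generate_field Qbar {x}" for r
  proof -
    obtain n d where "r = of_int n / of_int d" "d \<noteq> 0"
      by (metis quotient_of_div quotient_of_denom_pos less_irrefl surj_pair)
    then show ?thesis using add(2)[OF int[of n] inverse[OF int[of d]]]
      by (simp add: divide_inverse of_rat_mult of_rat_inverse)
  qed
  have "ev c x \<in> generate_field Qbar {x}" for c
  proof (induction c)
    case (pCons a p)
    then show ?case
      using rat[of a] add generate_field.incl[of x "{x}" Qbar] by (auto simp: ev_pCons)
  qed (simp add: 0)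
  then show "y \<in> generate_field Qbar {x}" if "y \<in> qf x" for y
    using that by (auto simp: qf_def)
qed

section \<open>Algebraic integers\<close>

text \<open>The determinant trick: \<tau> acts on the generators through an integer matrix, the
  nonzero vector of generators is an eigenvector for \<tau>, and the characteristic polynomial is
  monic with integer coefficients. The generators may be linearly dependent.\<close>

lemma algebraic_int_if_stable:
  fixes e :: "'i \<Rightarrow> 'a::field_char_0"
  assumes fin: "finite I" and st: "\<And>i. i \<in> I \<Longrightarrow> \<tau> * e i \<in> zspan e I" and nz: "w \<in> I" "e w \<noteq> 0"
  shows "algebraic_int \<tau>"
proof -
  define n where "n = card I"
  obtain h where h: "bij_betw h {0..<n} I"
    using ex_bij_betw_nat_finite[OF fin] unfolding n_def by blast
  have "\<forall>i\<in>I. \<exists>c. \<tau> * e i = (\<Sum>j\<in>I. of_int (c j) * e j)"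
    using st unfolding zspan_def by blast
  then obtain c where c: "\<And>i. i \<in> I \<Longrightarrow> \<tau> * e i = (\<Sum>j\<in>I. of_int (c i j) * e j)"
    by metis
  define M where "M = mat n n (\<lambda>(i, j). c (h i) (h j))"
  define M' :: "'a mat" where "M' = map_mat of_int M"
  define v where "v = vec n (e \<circ> h)"
  have M: "M \<in> carrier_mat n n" "M' \<in> carrier_mat n n" by (auto simp: M_def M'_def)
  have "M' *\<^sub>v v = \<tau> \<cdot>\<^sub>v v"
  proof (rule eq_vecI)
    fix i assume "i < dim_vec (\<tau> \<cdot>\<^sub>v v)"
    then have i: "i < n" "h i \<in> I" using h by (auto simp: v_def bij_betw_def)
    have "(M' *\<^sub>v v) $ i = (\<Sum>j = 0..<n. of_int (c (h i) (h j)) * e (h j))"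
      using i by (simp add: M'_def M_def v_def scalar_prod_def)
    also have "\<dots> = (\<Sum>j\<in>I. of_int (c (h i) j) * e j)"
      by (rule sum.reindex_bij_betw[OF h])
    finally show "(M' *\<^sub>v v) $ i = (\<tau> \<cdot>\<^sub>v v) $ i"
      using i c by (simp add: v_def)
  qed (auto simp: M'_def M_def v_def)
  moreover have "v \<noteq> 0\<^sub>v n"
  proof
    assume "v = 0\<^sub>v n"
    obtain k where "k < n" "h k = w" using h nz(1) by (auto simp: bij_betw_def image_iff)
    then have "v $ k \<noteq> 0" "k < n" using nz by (auto simp: v_def)
    then show False using \<open>v = 0\<^sub>v n\<close> by simp
  qed
  ultimately have "eigenvalue M' \<tau>"
    unfolding eigenvalue_def eigenvector_def using M by (auto simp: v_def intro!: exI[of _ v])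
  then have "poly (char_poly M') \<tau> = 0"
    using eigenvalue_root_char_poly[OF M(2)] by blast
  moreover have "char_poly M' = of_int_poly (char_poly M)"
    unfolding M'_def by (rule of_int_hom.char_poly_hom[OF M(1)])
  moreover have "monic (char_poly M)"
    using degree_monic_char_poly[OF M(1)] by simp
  ultimately show ?thesis
    unfolding algebraic_int_altdef_ipoly by metis
qed

lemma power_in_zspan:
  fixes x :: "'a::field_char_0"
  assumes p: "poly (of_int_poly p) x = 0" "monic p"
  shows "degree p > 0" "x ^ i \<in> zspan (\<lambda>a. x ^ a) {..<degree p}"
proof -
  define m where "m = degree p"
  have m: "m > 0"
  proof (rule ccontr)
    assume "\<not> m > 0"
    then have "p = 1" using p(2) by (metis gr0I m_def monic_degree_0)
    then show False using p(1) by simp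
  qed
  then show "degree p > 0" by (simp add: m_def)
  let ?S = "zspan (\<lambda>a. x ^ a) {..<m}"
  have S: "subgrp ?S" by (rule subgrp_zspan)
  have low: "x ^ i \<in> ?S" if "i < m" for i
    using zspan_mem[of "{..<m}" i "\<lambda>a. x ^ a"] that by simp
  have "0 = (\<Sum>i\<le>m. of_int (Polynomial.coeff p i) * x ^ i)"
    using p(1) by (simp add: poly_altdef m_def)
  also have "\<dots> = x ^ m + (\<Sum>i<m. of_int (Polynomial.coeff p i) * x ^ i)"
    using p(2) by (simp add: m_def lessThan_Suc_atMost[symmetric])
  finally have "x ^ m = - (\<Sum>i<m. of_int (Polynomial.coeff p i) * x ^ i)"
    by (simp add: eq_neg_iff_add_eq_0)
  moreover have "(\<Sum>i<m. of_int (Polynomial.coeff p i) * x ^ i) \<in> ?S"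
    by (rule zspanI) simp
  ultimately have top: "x ^ m \<in> ?S" using subgrp_uminus[OF S] by simp
  have step: "x * y \<in> ?S" if "y \<in> ?S" for y
  proof -
    obtain c where c: "y = (\<Sum>a<m. of_int (c a) * x ^ a)" using \<open>y \<in> ?S\<close> by (rule zspanE)
    have "x ^ Suc a \<in> ?S" if "a < m" for a
      using low[of "Suc a"] top that by (cases "Suc a = m") auto
    then have "(\<Sum>a<m. of_int (c a) * x ^ Suc a) \<in> ?S"
      by (intro subgrp_sum[OF S] subgrp_of_int_mult[OF S]) auto
    then show ?thesis by (simp add: c sum_distrib_left mult_ac)
  qed
  have "x ^ i \<in> ?S" for i
    by (induction i) (use low[of 0] m step in auto)
  then show "x ^ i \<in> zspan (\<lambda>a. x ^ a) {..<degree p}" by (simp add: m_def)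
qed

lemma algebraic_int_power_zspan:
  fixes x :: "'a::field_char_0"
  assumes "algebraic_int x"
  obtains m where "m > 0" "\<And>i. x ^ i \<in> zspan (\<lambda>a. x ^ a) {..<m}"
  using assms power_in_zspan[of _ x] unfolding algebraic_int_altdef_ipoly by metis

text \<open>The finitely many monomials \<open>x^a y^b\<close> span a module stable under
  \<open>x\<close> and \<open>y\<close>, hence under their sum and product.\<close>

lemma algebraic_int_add_mult:
  fixes x y :: "'a::field_char_0"
  assumes "algebraic_int x" "algebraic_int y"
  shows "algebraic_int (x + y)" "algebraic_int (x * y)"
proof -
  obtain m where m: "m > 0" "\<And>i. x ^ i \<in> zspan (\<lambda>a. x ^ a) {..<m}"
    using algebraic_int_power_zspan[OF assms(1)] by blast
  obtain n where n: "n > 0" "\<And>i. y ^ i \<in> zspan (\<lambda>a. y ^ a) {..<n}"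
    using algebraic_int_power_zspan[OF assms(2)] by blast
  define e where "e = (\<lambda>(a, b). x ^ a * y ^ b)"
  define I where "I = {..<m} \<times> {..<n}"
  have S: "subgrp (zspan e I)" by (rule subgrp_zspan)
  have mem: "x ^ i * y ^ j \<in> zspan e I" for i j
  proof -
    obtain c d where "x ^ i = (\<Sum>a<m. of_int (c a) * x ^ a)" "y ^ j = (\<Sum>b<n. of_int (d b) * y ^ b)"
      using m(2)[of i] n(2)[of j] unfolding zspan_def by blast
    then have "x ^ i * y ^ j = (\<Sum>(a, b)\<in>I. of_int (c a * d b) * e (a, b))"
      by (simp add: sum_product I_def sum.cartesian_product e_def mult_ac)
    also have "\<dots> = (\<Sum>k\<in>I. of_int (c (fst k) * d (snd k)) * e k)"
      by (simp add: case_prod_unfold)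
    finally show ?thesis by (rule zspanI)
  qed
  have fin: "finite I" and nz: "(0, 0) \<in> I" "e (0, 0) \<noteq> 0" using m n by (auto simp: I_def e_def)
  show "algebraic_int (x * y)"
  proof (rule algebraic_int_if_stable[where e = e and w = "(0, 0)", OF fin _ nz])
    fix k assume "k \<in> I"
    obtain i j where k: "k = (i, j)" by fastforce
    show "x * y * e k \<in> zspan e I" using mem[of "Suc i" "Suc j"] by (simp add: k e_def mult_ac)
  qed
  show "algebraic_int (x + y)"
  proof (rule algebraic_int_if_stable[where e = e and w = "(0, 0)", OF fin _ nz])
    fix k assume "k \<in> I"
    obtain i j where k: "k = (i, j)" by fastforce
    have "(x + y) * e k = x ^ Suc i * y ^ j + x ^ i * y ^ Suc j"
      by (simp add: k e_def algebra_simps)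
    then show "(x + y) * e k \<in> zspan e I"
      using subgrp_add[OF S mem[of "Suc i" j] mem[of i "Suc j"]] by (simp only:)
  qed
qed

lemma algebraic_int_of_int: "algebraic_int (of_int k)"
  by (rule int_imp_algebraic_int) auto

lemma algebraic_int_diff:
  "algebraic_int x \<Longrightarrow> algebraic_int y \<Longrightarrow> algebraic_int (x - y)" for x y :: "'a::field_char_0"
  using algebraic_int_add_mult(1)[of x "- y"] by simp

lemma algebraic_int_sum:
  "(\<And>i. i \<in> I \<Longrightarrow> algebraic_int (f i)) \<Longrightarrow> algebraic_int (sum f I :: 'a::field_char_0)"
  by (induction I rule: infinite_finite_induct) (auto intro: algebraic_int_add_mult)

section \<open>The primitive integer polynomial of an algebraic number\<close>

lemma of_int_poly_inj:
  assumes "(of_int_poly p :: 'a::field_char_0 poly) = of_int_poly q"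
  shows "p = q"
proof (rule poly_eqI)
  fix n
  have "Polynomial.coeff (of_int_poly p :: 'a poly) n = Polynomial.coeff (of_int_poly q) n"
    by (simp only: assms)
  then show "Polynomial.coeff p n = Polynomial.coeff q n" by simp
qed

lemma smult_left_cancel: "smult a p = smult a q \<Longrightarrow> a \<noteq> 0 \<Longrightarrow> p = q" for a :: "'a::idom"
  by (simp add: poly_eq_iff)

text \<open>Being primitive with positive leading coefficient fixes the integer multiple of the
  minimal polynomial. The leading coefficient is the quantity that will measure the denominators of
  \<open>x\<close> at all primes.\<close>

definition ipol :: "qbar \<Rightarrow> int poly" where
  "ipol x = (SOME f. content f = 1 \<and> lead_coeff f > 0 \<and>
     of_int_poly f = smult (of_int (lead_coeff f)) (mp x))"

lemma ipol: "content (ipol x) = 1" "lead_coeff (ipol x) > 0"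
  "of_int_poly (ipol x) = smult (of_int (lead_coeff (ipol x))) (mp x)"
proof -
  obtain D g where D: "D > 0" "smult (of_int D) (mp x) = of_int_poly g"
    by (rule clear_denominators)
  have lg: "lead_coeff g = D"
  proof -
    have "of_int (lead_coeff g) = lead_coeff (of_int_poly g :: rat poly)" by simp
    also have "\<dots> = of_int D" using D(2)[symmetric] mp(1)[of x] by simp
    finally show ?thesis by simp
  qed
  define f where "f = primitive_part g"
  define k where "k = content g"
  have g: "g = smult k f" by (simp add: f_def k_def content_times_primitive_part)
  have "g \<noteq> 0" using lg D(1) by auto
  then have "content g \<noteq> 0" by simp
  moreover have "content g = \<bar>content g\<bar>" using normalize_content[of g] by (simp del: normalize_content)
  ultimately have c: "content f = 1" "k > 0" using \<open>g \<noteq> 0\<close> by (auto simp: f_def k_def)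
  have lf: "D = k * lead_coeff f" using lg c(2) by (simp add: g)
  then have "lead_coeff f > 0" using D(1) c(2) by (simp add: zero_less_mult_iff)
  moreover have "of_int_poly f = smult (of_int (lead_coeff f)) (mp x)"
  proof -
    have "smult (of_int k) (of_int_poly f) = (of_int_poly g :: rat poly)"
      by (simp add: g of_int_hom.map_poly_hom_smult)
    also have "\<dots> = smult (of_int k) (smult (of_int (lead_coeff f)) (mp x))"
      by (simp add: D(2)[symmetric] lf)
    finally show ?thesis by (rule smult_left_cancel) (use c(2) in simp)
  qed
  ultimately have ex: "\<exists>f. content f = 1 \<and> lead_coeff f > 0 \<and>
      of_int_poly f = smult (of_int (lead_coeff f)) (mp x)" using c(1) by blast
  show "content (ipol x) = 1" "lead_coeff (ipol x) > 0"
    "of_int_poly (ipol x) = smult (of_int (lead_coeff (ipol x))) (mp x)"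
    using someI_ex[OF ex] unfolding ipol_def by blast+
qed

lemma ipol_nonzero [simp]: "ipol x \<noteq> 0"
  using ipol(2)[of x] by auto

lemma poly_ipol: "poly (of_int_poly (ipol x)) z = of_int (lead_coeff (ipol x)) * ev (mp x) z"
proof -
  have "poly (of_int_poly (ipol x)) z = ev (smult (of_int (lead_coeff (ipol x))) (mp x)) z"
    by (simp add: poly_of_int_poly_eq_ev ipol(3)[symmetric])
  then show ?thesis by (simp add: ev_smult)
qed

lemma poly_ipol_self [simp]: "poly (of_int_poly (ipol x)) x = 0"
  by (simp add: poly_ipol)

lemma degree_ipol: "degree (ipol x) = degree (mp x)"
proof -
  have "degree (of_int_poly (ipol x) :: rat poly) = degree (mp x)"
    using ipol(2)[of x] by (simp add: ipol(3) del: of_int_hom.degree_map_poly_hom)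
  then show ?thesis by simp
qed

text \<open>Gauss's lemma. The quotient exists over the rationals; after clearing denominators the
  content of \<open>ipol x * q'\<close> is that of \<open>q'\<close>, so the factor introduced by
  clearing divides \<open>q'\<close> and can be cancelled.\<close>

lemma ipol_dvd:
  assumes "poly (of_int_poly g) x = 0"
  shows "ipol x dvd g"
proof -
  let ?a = "lead_coeff (ipol x)"
  have "mp x dvd of_int_poly g" using assms by (simp add: mp(2)[symmetric] poly_of_int_poly_eq_ev)
  then obtain q where q: "of_int_poly g = mp x * q" by (elim dvdE)
  obtain E q' where E: "E > 0" "smult (of_int E) q = of_int_poly q'"
    by (rule clear_denominators)
  have "(of_int_poly (smult (?a * E) g) :: rat poly) = of_int_poly (ipol x * q')"
    by (simp add: of_int_hom.map_poly_hom_smult q hom_distribs ipol(3) E(2)[symmetric] mult_ac)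
  then have eq: "smult (?a * E) g = ipol x * q'"
    by (rule of_int_poly_inj)
  have "content q' = \<bar>?a * E\<bar> * content g"
    using arg_cong[OF eq, of content] by (simp add: content_mult ipol(1))
  then have "?a * E dvd content q'" by simp
  then have "[:?a * E:] dvd q'" by (simp add: const_poly_dvd_iff_dvd_content)
  then obtain q'' where "q' = smult (?a * E) q''" by (auto elim!: dvdE)
  then have "smult (?a * E) g = smult (?a * E) (ipol x * q'')" using eq by simp
  then have "g = ipol x * q''" by (rule smult_left_cancel) (use E(1) ipol(2)[of x] in auto)
  then show ?thesis by simp
qed

lemma algebraic_int_iff_ipol: "algebraic_int x \<longleftrightarrow> lead_coeff (ipol x) = 1"
proof
  assume "algebraic_int x"
  then obtain p where p: "poly (of_int_poly p) x = 0" "monic p"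
    unfolding algebraic_int_altdef_ipoly by blast
  from ipol_dvd[OF p(1)] obtain q where "p = ipol x * q" by (elim dvdE)
  then have "lead_coeff (ipol x) dvd 1" using p(2) by (metis dvd_triv_left lead_coeff_mult)
  then show "lead_coeff (ipol x) = 1" using ipol(2)[of x] by simp
next
  assume "lead_coeff (ipol x) = 1"
  then show "algebraic_int x" unfolding algebraic_int_altdef_ipoly using poly_ipol_self by blast
qed

lemma multiple_algebraic_int:
  fixes x :: qbar
  obtains m :: int where "m > 0" "algebraic_int (of_int m * x)"
proof -
  let ?f = "ipol x"
  define n where "n = degree ?f"
  define a where "a = lead_coeff ?f"
  have n: "n > 0" using degree_mp_pos[of x] by (simp add: n_def degree_ipol)
  define y where "y = of_int a * x"
  have "0 = (\<Sum>j\<le>n. of_int (Polynomial.coeff ?f j) * x ^ j)"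
    using poly_ipol_self[of x] by (simp add: poly_altdef n_def)
  also have "\<dots> = of_int a * x ^ n + (\<Sum>j<n. of_int (Polynomial.coeff ?f j) * x ^ j)"
    by (simp add: n_def a_def lessThan_Suc_atMost[symmetric])
  finally have eq: "of_int a * x ^ n = - (\<Sum>j<n. of_int (Polynomial.coeff ?f j) * x ^ j)"
    by (simp add: eq_neg_iff_add_eq_0)
  \<comment> \<open>Multiplying the equation of \<open>x\<close> by \<open>a^(n - 1)\<close> makes
    it monic in \<open>y = a x\<close>.\<close>
  have "y * y ^ (n - 1) = y ^ n" using n by (cases n) auto
  also have "\<dots> = of_int a ^ (n - 1) * (of_int a * x ^ n)"
    using n by (cases n) (auto simp: y_def power_mult_distrib mult_ac)
  also have "\<dots> = (\<Sum>j<n. of_int (- Polynomial.coeff ?f j * a ^ (n - 1 - j)) * y ^ j)"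
    unfolding eq by (auto simp: sum_distrib_left sum_negf[symmetric] y_def power_mult_distrib
        mult_ac power_add[symmetric] intro!: sum.cong)
  finally have top: "y * y ^ (n - 1) \<in> zspan (\<lambda>i. y ^ i) {..<n}"
    by (rule zspanI)
  have "algebraic_int y"
  proof (rule algebraic_int_if_stable[where I = "{..<n}" and e = "\<lambda>i. y ^ i" and w = 0])
    fix i assume i: "i \<in> {..<n}"
    show "y * y ^ i \<in> zspan (\<lambda>i. y ^ i) {..<n}"
    proof (cases "i = n - 1")
      case False
      then show ?thesis using zspan_mem[of "{..<n}" "Suc i" "\<lambda>i. y ^ i"] i by simp
    qed (use top in simp)
  qed (use n in auto)
  then show ?thesis using that[of a] ipol(2)[of x] by (simp add: y_def a_def)
qed

section \<open>The ring of integers as a lattice\<close>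

lemma algebraic_int_coeff_mult:
  fixes p q :: "'a::field_char_0 poly"
  assumes "\<And>i. algebraic_int (Polynomial.coeff p i)" "\<And>i. algebraic_int (Polynomial.coeff q i)"
  shows "algebraic_int (Polynomial.coeff (p * q) i)"
  unfolding coeff_mult by (intro algebraic_int_sum algebraic_int_add_mult assms)

lemma algebraic_int_coeff_prod_linear:
  fixes S :: "'a::field_char_0 set"
  assumes "\<And>w. w \<in> S \<Longrightarrow> algebraic_int w"
  shows "algebraic_int (Polynomial.coeff (\<Prod>w\<in>S. [:- w, 1:]) i)"
  using assms
proof (induction S arbitrary: i rule: infinite_finite_induct)
  case (insert w S)
  have "algebraic_int (Polynomial.coeff [:- w, 1:] i)" for i
    using insert.prems[of w] algebraic_int_of_int[of 1, where 'a = 'a]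
    by (auto simp: coeff_pCons split: nat.splits)
  then show ?case using insert by (simp add: algebraic_int_coeff_mult del: mult_pCons_left)
qed (use algebraic_int_of_int[of 1, where 'a = 'a] in \<open>auto simp: coeff_1\<close>)

text \<open>The monic equation of \<open>ev c x\<close> is a rational relation satisfied by
  \<open>x\<close>, and such relations pass to all conjugates.\<close>

lemma algebraic_int_conjugate:
  assumes "algebraic_int (ev c x)" "ev (mp x) z = 0"
  shows "algebraic_int (ev c z)"
proof -
  obtain p where p: "poly (of_int_poly p) (ev c x) = 0" "monic p"
    using assms(1) unfolding algebraic_int_altdef_ipoly by blast
  then have "ev (pcompose (of_int_poly p) c) x = 0" by (simp add: ev_pcompose poly_of_int_poly_eq_ev)
  then have "ev (pcompose (of_int_poly p) c) z = 0" by (rule ev_conjugate[OF assms(2)])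
  then have "poly (of_int_poly p) (ev c z) = 0" by (simp add: ev_pcompose poly_of_int_poly_eq_ev)
  then show ?thesis using p(2) unfolding algebraic_int_altdef_ipoly by blast
qed

lemma ev_mod:
  assumes "ev m z = 0"
  shows "ev (c mod m) z = ev c z"
proof -
  have "ev c z = ev (c div m * m + c mod m) z" by simp
  then show ?thesis using assms by (simp only: ev_add ev_mult) simp
qed

text \<open>Lagrange interpolation at the conjugates of \<open>\<gamma>\<close> shows that \<open>x m'(\<gamma>)\<close> has integral coordinates
  in the power basis, for the minimal polynomial \<open>m\<close> of \<open>\<gamma>\<close>.\<close>

lemma different_times_integer:
  assumes \<gamma>: "algebraic_int \<gamma>" and x: "algebraic_int (ev c \<gamma>)"
  obtains g :: "int poly" where "ev c \<gamma> * ev (pderiv (mp \<gamma>)) \<gamma> = poly (of_int_poly g) \<gamma>"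
proof -
  define m where "m = mp \<gamma>"
  define R where "R = conjugates \<gamma>"
  define g where "g = (c * pderiv m) mod m"
  have R: "finite R" "card R = degree m" using finite_conjugates card_conjugates by (auto simp: R_def m_def)
  have root: "ev m z = 0" if "z \<in> R" for z using that by (auto simp: R_def m_def conjugates_def)
  have evg: "ev g z = ev c z * ev (pderiv m) z" if "z \<in> R" for z
    using ev_mod[OF root[OF that], of "c * pderiv m"] by (simp add: g_def ev_mult)
  have evg': "ev g \<gamma> = ev c \<gamma> * ev (pderiv m) \<gamma>"
    using ev_mod[of m \<gamma> "c * pderiv m"] by (simp add: g_def ev_mult m_def)
  have dg: "degree g < degree m"
    using degree_mod_less'[of m "c * pderiv m"] degree_mp_pos[of \<gamma>] unfolding g_def m_def
    by (cases "c * pderiv (mp \<gamma>) mod mp \<gamma> = 0") auto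
  define P where "P z = (\<Prod>w\<in>R - {z}. [:- w, 1:])" for z :: complex
  have fac: "map_poly of_rat m = [:- z, 1:] * P z" if "z \<in> R" for z
    using mp_complex_factorization[of \<gamma>] that R(1) unfolding P_def m_def R_def
    by (simp add: prod.remove[of "conjugates \<gamma>" z] del: mult_pCons_left)
  have dm: "ev (pderiv m) z = poly (P z) z" if "z \<in> R" for z
    using fac[OF that] by (simp add: of_rat_hom.map_poly_pderiv pderiv_mult pderiv_pCons del: mult_pCons_left)
  have P0: "poly (P z) w = 0" if "w \<in> R" "w \<noteq> z" for z w
    using that R(1) by (auto simp: P_def poly_prod)
  \<comment> \<open>Both sides have degree below the number of conjugates and agree at each of them:
    \<open>P z\<close> vanishes at the other roots and takes at \<open>z\<close> the value of the
    derivative of \<open>m\<close>.\<close>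
  have "map_poly of_rat g = (\<Sum>z\<in>R. smult (ev c z) (P z))"
  proof (rule poly_eqI_degree[of R])
    fix z assume z: "z \<in> R"
    have "poly (\<Sum>w\<in>R. smult (ev c w) (P w)) z = (\<Sum>w\<in>R. if w = z then ev c z * poly (P z) z else 0)"
      unfolding poly_sum by (intro sum.cong) (use P0 z in auto)
    also have "\<dots> = ev g z" using R(1) z dm[OF z] evg[OF z] by simp
    finally show "ev g z = poly (\<Sum>w\<in>R. smult (ev c w) (P w)) z" ..
  next
    show "degree (map_poly of_rat g :: complex poly) < card R" using dg R by simp
    have "degree (P z) < card R" if "z \<in> R" for z
    proof -
      have "degree (P z) = (\<Sum>w\<in>R - {z}. degree [:- w, 1:])"
        unfolding P_def by (rule degree_prod_eq_sum_degree) auto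
      also have "\<dots> = card R - 1" using that R by simp
      moreover have "card R > 0" using that R(1) by (auto simp: card_gt_0_iff)
      ultimately show ?thesis by simp
    qed
    moreover have "card R > 0" using R(2) degree_mp_pos[of \<gamma>] by (simp add: m_def)
    ultimately show "degree (\<Sum>z\<in>R. smult (ev c z) (P z)) < card R"
      by (intro degree_sum_less) (auto intro: le_less_trans[OF degree_smult_le])
  qed
  moreover have "algebraic_int (Polynomial.coeff (\<Sum>z\<in>R. smult (ev c z) (P z)) i)" for i
  proof -
    have "algebraic_int (ev c z)" if "z \<in> R" for z
      by (rule algebraic_int_conjugate[OF x]) (use root that in \<open>simp add: m_def\<close>)
    moreover have "algebraic_int z" if "z \<in> R" for z
      using algebraic_int_conjugate[of "[:0, 1:]" \<gamma> z] \<gamma> root[OF that] by (simp add: ev_pCons ev_const m_def)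
    ultimately show ?thesis
      unfolding coeff_sum coeff_smult P_def
      by (intro algebraic_int_sum algebraic_int_add_mult algebraic_int_coeff_prod_linear) auto
  qed
  \<comment> \<open>The coefficients are rational by construction of \<open>g\<close> and algebraic
    integers by the interpolation formula, hence integers.\<close>
  ultimately have "algebraic_int (of_rat (Polynomial.coeff g i) :: complex)" for i
    by (metis of_rat_hom.coeff_map_poly_hom)
  then have "(of_rat (Polynomial.coeff g i) :: complex) \<in> \<int>" for i
    by (intro rational_algebraic_int_is_int) auto
  then have "\<exists>k. Polynomial.coeff g i = of_int k" for i
    by (metis Ints_cases of_rat_eq_iff of_rat_of_int_eq)
  then obtain k where k: "\<And>i. Polynomial.coeff g i = of_int (k i)" by metis
  have "g = of_int_poly (map_poly floor g)"
    by (rule poly_eqI) (simp add: k coeff_map_poly)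
  then have "poly (of_int_poly (map_poly floor g)) \<gamma> = ev g \<gamma>"
    by (simp add: poly_of_int_poly_eq_ev)
  also have "\<dots> = ev c \<gamma> * ev (pderiv (mp \<gamma>)) \<gamma>"
    using evg' by (simp add: m_def)
  finally show ?thesis using that by metis
qed

definition ints :: "qbar set \<Rightarrow> qbar set" where
  "ints K = {x \<in> K. algebraic_int x}"

lemma power_basis_independent:
  assumes "(\<Sum>i<degree (mp x). of_int (c i) * x ^ i) = 0"
  shows "\<forall>i<degree (mp x). c i = 0"
proof -
  define p :: "rat poly" where "p = (\<Sum>i<degree (mp x). Polynomial.monom (of_int (c i)) i)"
  have "ev p x = 0" using assms by (simp add: p_def ev_sum poly_monom)
  then have "mp x dvd p" by (simp add: mp)
  have co: "Polynomial.coeff p i = (if i < degree (mp x) then of_int (c i) else 0)" for i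
    by (simp add: p_def coeff_sum)
  have "degree p < degree (mp x)"
    by (intro degree_lessI) (use co degree_mp_pos[of x] in auto)
  then have "p = 0" using \<open>mp x dvd p\<close> by (meson dvd_imp_degree_le leD)
  then show ?thesis using co by (metis coeff_0 of_int_eq_0_iff)
qed

text \<open>A number field is presented by an integral generator. No field is lost, since
  \<open>nf_ex\<close> rescales any generator, and the polynomials in \<gamma> then form a lattice
  inside the ring of integers.\<close>

locale nf =
  fixes \<gamma> :: qbar
  assumes int_gen: "algebraic_int \<gamma>"
begin

abbreviation "K \<equiv> qf \<gamma>"
abbreviation "d \<equiv> degree (mp \<gamma>)"
definition "OK = ints K"

lemma OK_K: "a \<in> OK \<Longrightarrow> a \<in> K" by (simp add: OK_def ints_def)

lemma OK_add [intro]: "a \<in> OK \<Longrightarrow> b \<in> OK \<Longrightarrow> a + b \<in> OK"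
  and OK_mult [intro]: "a \<in> OK \<Longrightarrow> b \<in> OK \<Longrightarrow> a * b \<in> OK"
  and OK_diff [intro]: "a \<in> OK \<Longrightarrow> b \<in> OK \<Longrightarrow> a - b \<in> OK"
  and OK_uminus [intro]: "a \<in> OK \<Longrightarrow> - a \<in> OK"
  and OK_of_int [intro]: "of_int n \<in> OK"
  by (auto simp: OK_def ints_def algebraic_int_diff algebraic_int_add_mult algebraic_int_of_int)

lemma OK_0 [intro]: "0 \<in> OK" and OK_1 [intro]: "1 \<in> OK" and OK_of_nat [intro]: "of_nat m \<in> OK"
  using OK_of_int[of 0] OK_of_int[of 1] OK_of_int[of "int m"] by simp_all

lemma OK_gen [intro]: "\<gamma> \<in> OK"
  using int_gen by (auto simp: OK_def ints_def)

lemma OK_power [intro]: "a \<in> OK \<Longrightarrow> a ^ n \<in> OK"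
  by (induction n) auto

lemma OK_sum [intro]: "(\<And>i. i \<in> I \<Longrightarrow> f i \<in> OK) \<Longrightarrow> sum f I \<in> OK"
  by (induction I rule: infinite_finite_induct) auto

lemma OK_prod [intro]: "(\<And>i. i \<in> I \<Longrightarrow> f i \<in> OK) \<Longrightarrow> prod f I \<in> OK"
  by (induction I rule: infinite_finite_induct) auto

lemma OK_poly: "a \<in> OK \<Longrightarrow> poly (of_int_poly g) a \<in> OK"
  unfolding poly_altdef by (auto intro!: OK_sum OK_mult)

lemma subgrp_OK: "subgrp OK"
  by (auto simp: subgrp_def)

lemma poly_in_zspan: "poly (of_int_poly g) \<gamma> \<in> zspan (\<lambda>i. \<gamma> ^ i) {..<d}"
proof -
  have "monic (ipol \<gamma>)" using int_gen by (simp add: algebraic_int_iff_ipol)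
  then have "\<gamma> ^ i \<in> zspan (\<lambda>i. \<gamma> ^ i) {..<d}" for i
    using power_in_zspan(2)[of "ipol \<gamma>" \<gamma>] by (simp add: degree_ipol)
  then show ?thesis
    unfolding poly_altdef
    by (intro subgrp_sum[OF subgrp_zspan]) (simp add: subgrp_of_int_mult[OF subgrp_zspan])
qed

text \<open>For integral \<open>x\<close> the number \<open>x m'(\<gamma>)\<close> lies in
  \<open>Z[\<gamma>]\<close>, with \<open>m\<close> the minimal polynomial of \<gamma>. Multiplying
  by \<open>E / m'(\<gamma>)\<close>, where \<open>E\<close> clears the denominators of the inverse,
  gives one \<open>E\<close> for all integers of the field.\<close>

lemma OK_conductor:
  obtains E :: nat where "E > 0" "(*) (of_nat E) ` OK \<subseteq> zspan (\<lambda>i. \<gamma> ^ i) {..<d}"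
proof -
  obtain v where v: "ev v \<gamma> * ev (pderiv (mp \<gamma>)) \<gamma> = 1"
    using simple_roots_mp[of \<gamma> \<gamma>] ev_inverse_exists by auto
  obtain E v' where E: "E > 0" "smult (of_int E) v = of_int_poly v'" by (rule clear_denominators)
  have v': "poly (of_int_poly v') \<gamma> = of_int E * ev v \<gamma>"
    by (simp add: poly_of_int_poly_eq_ev E(2)[symmetric] ev_smult)
  show ?thesis
  proof (rule that[of "nat E"])
    show "(*) (of_nat (nat E)) ` OK \<subseteq> zspan (\<lambda>i. \<gamma> ^ i) {..<d}"
    proof safe
      fix x assume "x \<in> OK"
      then obtain c where c: "x = ev c \<gamma>" "algebraic_int x" by (auto simp: OK_def ints_def qf_def)
      then obtain g where g: "x * ev (pderiv (mp \<gamma>)) \<gamma> = poly (of_int_poly g) \<gamma>"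
        using different_times_integer[OF int_gen] by metis
      have "poly (of_int_poly (v' * g)) \<gamma> = of_int E * x * (ev v \<gamma> * ev (pderiv (mp \<gamma>)) \<gamma>)"
        unfolding poly_of_int_poly_mult v' g[symmetric] by (simp only: mult_ac)
      then have "of_nat (nat E) * x = poly (of_int_poly (v' * g)) \<gamma>"
        using E(1) unfolding v by simp
      then show "of_nat (nat E) * x \<in> zspan (\<lambda>i. \<gamma> ^ i) {..<d}" using poly_in_zspan by simp
    qed
  qed (use E(1) in simp)
qed

text \<open>The ring of integers is commensurable with \<open>Z[\<gamma>]\<close>, which has an
  explicit basis of \<open>d\<close> elements; this gives the index without an integral basis of the
  ring itself.\<close>

lemma idx_OK:
  assumes m: "m > 0"
  shows "idx OK ((*) (of_nat m) ` OK) = m ^ d"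
proof -
  let ?M = "zspan (\<lambda>i. \<gamma> ^ i) {..<d}"
  obtain E where E: "E > 0" "(*) (of_nat E) ` OK \<subseteq> ?M" by (rule OK_conductor)
  have sub: "(*) (of_nat 1) ` ?M \<subseteq> OK"
    by (auto elim!: zspanE intro!: OK_sum OK_mult)
  have *: "idx ?M ((*) (of_nat m) ` ?M) = m ^ d" if "m > 0" for m
    using idx_zspan_mult[of "{..<d}" "\<lambda>i. \<gamma> ^ i" m] power_basis_independent that by auto
  show ?thesis
    using idx_commensurable(1)[OF subgrp_zspan subgrp_OK E _ sub _ m] * m by simp
qed

end

lemma common_multiple:
  assumes "finite I" "subgrp S" "\<And>i. i \<in> I \<Longrightarrow> \<exists>E>0. of_nat E * z i \<in> S"
  obtains E :: nat where "E > 0" "\<And>i. i \<in> I \<Longrightarrow> of_nat E * z i \<in> (S :: 'a::comm_ring_1 set)"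
proof -
  obtain f where f: "\<And>i. i \<in> I \<Longrightarrow> f i > 0" "\<And>i. i \<in> I \<Longrightarrow> of_nat (f i) * z i \<in> S"
    using assms(3) by metis
  have "of_nat (prod f I) * z i \<in> S" if "i \<in> I" for i
  proof -
    have "of_nat (prod f I) * z i = of_int (int (prod f (I - {i}))) * (of_nat (f i) * z i)"
      using that assms(1) by (simp add: prod.remove[of I i] mult_ac)
    then show ?thesis using subgrp_of_int_mult[OF assms(2) f(2)[OF that]] by presburger
  qed
  then show ?thesis using that[of "prod f I"] f(1) by (simp add: prod_pos)
qed

context nf
begin

text \<open>The constant coefficient of the integer polynomial of \<open>u\<close> is a nonzero
  multiple of \<open>u\<close>; it plays the part of a norm.\<close>

lemma integer_multiple_OK:
  assumes "u \<in> OK" "u \<noteq> 0"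
  obtains N :: nat and u' where "N > 0" "u' \<in> OK" "of_nat N = u * u'"
proof -
  obtain c q where cq: "ipol u = pCons c q" by (cases "ipol u") auto
  have eq: "of_int c + u * poly (of_int_poly q) u = 0"
    using poly_ipol_self[of u] by (simp add: cq of_int_hom.map_poly_pCons_hom)
  have "c \<noteq> 0"
  proof
    assume "c = 0"
    then have "poly (of_int_poly q) u = 0" using eq assms(2) by simp
    then have "ipol u dvd q" by (rule ipol_dvd)
    moreover have "q \<noteq> 0" using cq \<open>c = 0\<close> ipol_nonzero[of u] by auto
    ultimately have "degree (ipol u) \<le> degree q" by (rule dvd_imp_degree_le)
    then show False using cq \<open>q \<noteq> 0\<close> by simp
  qed
  have *: "of_int (- c) = u * poly (of_int_poly q) u" using minus_unique[OF eq] by simp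
  have "of_int \<bar>c\<bar> = u * (of_int (- sgn c) * poly (of_int_poly q) u)"
    using * eq_neg_iff_add_eq_0[THEN iffD2, OF eq] \<open>c \<noteq> 0\<close> by (cases "c > 0") (auto simp: sgn_if)
  then have eq: "of_nat (nat \<bar>c\<bar>) = u * (of_int (- sgn c) * poly (of_int_poly q) u)" by simp
  have mem: "of_int (- sgn c) * poly (of_int_poly q) u \<in> OK"
    by (intro OK_mult OK_of_int OK_poly assms(1))
  show ?thesis by (rule that[OF _ mem eq]) (use \<open>c \<noteq> 0\<close> in simp)
qed

section \<open>Growth of lattices under multiplication by an algebraic number\<close>

text \<open>The degree of the field over \<open>Q(x)\<close>, taken as the degree of \<gamma> over
  \<open>Q(x)\<close>: the first power of \<gamma> that depends linearly on the lower ones.\<close>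

definition rdeg :: "qbar \<Rightarrow> nat" where
  "rdeg x = (LEAST r. \<exists>y. (\<forall>i. y i \<in> qf x) \<and> \<gamma> ^ r = (\<Sum>i<r. \<gamma> ^ i * y i))"

lemma rdeg_relation: "\<exists>y. (\<forall>i. y i \<in> qf x) \<and> \<gamma> ^ rdeg x = (\<Sum>i<rdeg x. \<gamma> ^ i * y i)"
  unfolding rdeg_def
proof (rule LeastI_ex)
  have "0 = (\<Sum>i\<le>d. of_rat (Polynomial.coeff (mp \<gamma>) i) * \<gamma> ^ i)"
    using ev_mp[of \<gamma>] by (simp only: ev_altdef)
  also have "\<dots> = \<gamma> ^ d + (\<Sum>i<d. of_rat (Polynomial.coeff (mp \<gamma>) i) * \<gamma> ^ i)"
    using mp(1)[of \<gamma>] by (simp add: lessThan_Suc_atMost[symmetric])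
  finally have "\<gamma> ^ d = (\<Sum>i<d. \<gamma> ^ i * of_rat (- Polynomial.coeff (mp \<gamma>) i))"
    by (simp add: eq_neg_iff_add_eq_0 sum_negf of_rat_minus mult.commute)
  then show "\<exists>r y. (\<forall>i. y i \<in> qf x) \<and> \<gamma> ^ r = (\<Sum>i<r. \<gamma> ^ i * y i)"
    by (intro exI[of _ d] exI[of _ "\<lambda>i. of_rat (- Polynomial.coeff (mp \<gamma>) i)"]) (auto simp del: of_rat_minus)
qed

text \<open>In a nontrivial relation the highest power of \<gamma> that occurs could be expressed by
  lower ones, against the minimality of \<open>rdeg x\<close>.\<close>

lemma rdeg_direct:
  assumes y: "\<And>i. i < rdeg x \<Longrightarrow> y i \<in> qf x" and eq: "(\<Sum>i<rdeg x. \<gamma> ^ i * y i) = 0" and "i < rdeg x"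
  shows "y i = 0"
proof (rule ccontr)
  assume "y i \<noteq> 0"
  define j where "j = Max {i. i < rdeg x \<and> y i \<noteq> 0}"
  have "j \<in> {i. i < rdeg x \<and> y i \<noteq> 0}"
    unfolding j_def by (rule Max_in) (use \<open>i < rdeg x\<close> \<open>y i \<noteq> 0\<close> in auto)
  then have j: "j < rdeg x" "y j \<noteq> 0" by auto
  have z: "y k = 0" if "k < rdeg x" "j < k" for k
  proof (rule ccontr)
    assume "y k \<noteq> 0"
    then have "k \<le> j" unfolding j_def using that by (intro Max_ge) auto
    then show False using that by simp
  qed
  have "(\<Sum>i<rdeg x. \<gamma> ^ i * y i) = (\<Sum>i<Suc j. \<gamma> ^ i * y i)"
    by (rule sum.mono_neutral_right) (use j z in auto)
  then have "\<gamma> ^ j * y j = - (\<Sum>i<j. \<gamma> ^ i * y i)" using eq by (simp add: eq_neg_iff_add_eq_0 add.commute)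
  then have "\<gamma> ^ j = - (\<Sum>i<j. \<gamma> ^ i * y i) / y j" using j(2) by (simp add: field_simps)
  also have "\<dots> = (\<Sum>i<j. \<gamma> ^ i * (if i < j then - y i / y j else 0))"
    by (simp add: sum_divide_distrib sum_negf)
  finally have "\<gamma> ^ j = (\<Sum>i<j. \<gamma> ^ i * (if i < j then - y i / y j else 0))" .
  moreover have "\<forall>i. (if i < j then - y i / y j else 0) \<in> qf x"
  proof -
    have "y i \<in> qf x" if "i < j" for i using y[of i] that j(1) by simp
    then show ?thesis using y[OF j(1)] by auto
  qed
  ultimately have "\<exists>y. (\<forall>i. y i \<in> qf x) \<and> \<gamma> ^ j = (\<Sum>i<j. \<gamma> ^ i * y i)"
    by (intro exI[of _ "\<lambda>i. if i < j then - y i / y j else 0"] conjI)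
  then have "rdeg x \<le> j" unfolding rdeg_def by (rule Least_le)
  then show False using j by simp
qed

lemma rdeg_span:
  assumes "z \<in> K"
  obtains y where "\<And>i. y i \<in> qf x" "z = (\<Sum>i<rdeg x. \<gamma> ^ i * y i)"
proof -
  let ?r = "rdeg x"
  define V where "V = {\<Sum>i<?r. \<gamma> ^ i * y i | y. \<forall>i. y i \<in> qf x}"
  have Vadd: "a + b \<in> V" if "a \<in> V" "b \<in> V" for a b
  proof -
    obtain y y' where "a = (\<Sum>i<?r. \<gamma> ^ i * y i)" "\<forall>i. y i \<in> qf x"
      "b = (\<Sum>i<?r. \<gamma> ^ i * y' i)" "\<forall>i. y' i \<in> qf x" using \<open>a \<in> V\<close> \<open>b \<in> V\<close> unfolding V_def by blast
    then show ?thesis unfolding V_def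
      by (intro CollectI exI[of _ "\<lambda>i. y i + y' i"]) (auto simp: sum.distrib algebra_simps)
  qed
  have Vsmult: "c * a \<in> V" if "a \<in> V" "c \<in> qf x" for a c
  proof -
    obtain y where "a = (\<Sum>i<?r. \<gamma> ^ i * y i)" "\<forall>i. y i \<in> qf x" using \<open>a \<in> V\<close> unfolding V_def by blast
    then show ?thesis unfolding V_def using that(2)
      by (intro CollectI exI[of _ "\<lambda>i. c * y i"]) (auto simp: sum_distrib_left mult_ac)
  qed
  have Vsum: "sum f I \<in> V" if "\<And>i. i \<in> I \<Longrightarrow> f i \<in> V" "0 \<in> V" for f and I :: "nat set"
    using that by (induction I rule: infinite_finite_induct) (auto intro: Vadd)
  have V0: "0 \<in> V" unfolding V_def by (intro CollectI exI[of _ "\<lambda>_. 0"]) auto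
  have low: "\<gamma> ^ i \<in> V" if "i < ?r" for i
    unfolding V_def using that
    by (intro CollectI exI[of _ "\<lambda>j. if j = i then 1 else 0"]) (auto simp: if_distrib cong: if_cong)
  have top: "\<gamma> ^ ?r \<in> V" using rdeg_relation[of x] unfolding V_def by blast
  have g: "\<gamma> * a \<in> V" if "a \<in> V" for a
  proof -
    obtain y where y: "a = (\<Sum>i<?r. \<gamma> ^ i * y i)" "\<forall>i. y i \<in> qf x" using \<open>a \<in> V\<close> unfolding V_def by blast
    have "\<gamma> * a = (\<Sum>i<?r. y i * \<gamma> ^ Suc i)" by (simp add: y(1) sum_distrib_left mult_ac)
    moreover have "\<gamma> ^ Suc i \<in> V" if "i < ?r" for i
      using low[of "Suc i"] top that by (cases "Suc i = ?r") auto
    ultimately show ?thesis using Vsum[OF _ V0, of "{..<?r}"] Vsmult y(2) by simp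
  qed
  have V1: "1 \<in> V"
    using low[of 0] top by (cases "?r = 0") auto
  have "ev c \<gamma> \<in> V" for c
    by (induction c) (use V0 Vadd[OF Vsmult[OF V1]] g in \<open>auto simp: ev_pCons\<close>)
  then have "z \<in> V" using assms by (auto simp: qf_def)
  then show ?thesis using that unfolding V_def by blast
qed

lemma rdeg_pos: "rdeg x > 0"
proof (rule ccontr)
  assume "\<not> rdeg x > 0"
  then have "rdeg x = 0" by simp
  with rdeg_relation[of x] show False by simp
qed

text \<open>Spanned by \<open>\<gamma>^i x^j\<close> with \<open>j\<close> up to
  \<open>degree (mp x) - 1 + k\<close>, one further power being allowed for \<open>i < J\<close>.
  The parameter \<open>J\<close> breaks the passage from \<open>k\<close> to \<open>k + 1\<close>
  into steps that add one generator each: \<open>J = rdeg x\<close> gives the same lattice as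
  \<open>k + 1\<close> with \<open>J = 0\<close>.\<close>

definition Lam :: "qbar \<Rightarrow> nat \<Rightarrow> nat \<Rightarrow> qbar set" where
  "Lam x k J = {\<Sum>i<rdeg x. \<gamma> ^ i * poly (of_int_poly (g i)) x | g.
     \<forall>i<rdeg x. degree (g i) \<le> degree (mp x) - 1 + k + (if i < J then 1 else 0)}"

lemma LamI: "y = (\<Sum>i<rdeg x. \<gamma> ^ i * poly (of_int_poly (g i)) x) \<Longrightarrow>
   (\<And>i. i < rdeg x \<Longrightarrow> degree (g i) \<le> degree (mp x) - 1 + k + (if i < J then 1 else 0)) \<Longrightarrow> y \<in> Lam x k J"
  unfolding Lam_def by blast

lemma LamE:
  assumes "y \<in> Lam x k J"
  obtains g where "y = (\<Sum>i<rdeg x. \<gamma> ^ i * poly (of_int_poly (g i)) x)"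
   "\<And>i. i < rdeg x \<Longrightarrow> degree (g i) \<le> degree (mp x) - 1 + k + (if i < J then 1 else 0)"
  using assms unfolding Lam_def by blast

lemma subgrp_Lam: "subgrp (Lam x k J)"
  unfolding subgrp_def
proof (intro conjI ballI)
  show "0 \<in> Lam x k J" by (rule LamI[where g = "\<lambda>_. 0"]) auto
  fix a b assume "a \<in> Lam x k J" "b \<in> Lam x k J"
  then obtain g h where gh: "a = (\<Sum>i<rdeg x. \<gamma> ^ i * poly (of_int_poly (g i)) x)"
    "\<And>i. i < rdeg x \<Longrightarrow> degree (g i) \<le> degree (mp x) - 1 + k + (if i < J then 1 else 0)"
    "b = (\<Sum>i<rdeg x. \<gamma> ^ i * poly (of_int_poly (h i)) x)"
    "\<And>i. i < rdeg x \<Longrightarrow> degree (h i) \<le> degree (mp x) - 1 + k + (if i < J then 1 else 0)"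
    by (elim LamE) blast
  show "a - b \<in> Lam x k J"
  proof (rule LamI[where g = "\<lambda>i. g i - h i"])
    show "a - b = (\<Sum>i<rdeg x. \<gamma> ^ i * poly (of_int_poly (g i - h i)) x)"
      by (simp only: gh poly_of_int_poly_diff sum_subtractf right_diff_distrib)
  qed (rule degree_diff_le[OF gh(2,4)])
qed

lemma Lam_mono:
  assumes "k \<le> k'" "J \<le> J'"
  shows "Lam x k J \<subseteq> Lam x k' J'"
proof
  fix y assume "y \<in> Lam x k J"
  then obtain g where g: "y = (\<Sum>i<rdeg x. \<gamma> ^ i * poly (of_int_poly (g i)) x)"
    "\<And>i. i < rdeg x \<Longrightarrow> degree (g i) \<le> degree (mp x) - 1 + k + (if i < J then 1 else 0)" by (elim LamE) blast
  show "y \<in> Lam x k' J'"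
    by (rule LamI[OF g(1)], rule order_trans[OF g(2)]) (use assms in auto)
qed

lemma single_in_Lam:
  assumes "i < rdeg x" "degree g \<le> degree (mp x) - 1 + k + (if i < J then 1 else 0)"
  shows "\<gamma> ^ i * poly (of_int_poly g) x \<in> Lam x k J"
proof (rule LamI[where g = "\<lambda>l. if l = i then g else 0"])
  have "(\<Sum>l<rdeg x. \<gamma> ^ l * poly (of_int_poly (if l = i then g else 0)) x)
     = (\<Sum>l<rdeg x. if l = i then \<gamma> ^ i * poly (of_int_poly g) x else 0)"
    by (intro sum.cong) auto
  then show "\<gamma> ^ i * poly (of_int_poly g) x = (\<Sum>l<rdeg x. \<gamma> ^ l * poly (of_int_poly (if l = i then g else 0)) x)"
    using assms(1) by simp
qed (use assms in auto)

lemma poly_of_int_poly_in_qf: "poly (of_int_poly g) x \<in> qf x"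
  by (simp add: poly_of_int_poly_eq_ev qf_ev)

lemma Lam_Suc:
  assumes J: "J < rdeg x"
  shows "Lam x k (Suc J) = adjoin (Lam x k J) (\<gamma> ^ J * x ^ (degree (mp x) + k))" (is "_ = adjoin _ ?v")
proof (intro equalityI subsetI)
  let ?n = "degree (mp x)"
  have n: "?n > 0" by (rule degree_mp_pos)
  fix y assume "y \<in> Lam x k (Suc J)"
  then obtain g where g: "y = (\<Sum>i<rdeg x. \<gamma> ^ i * poly (of_int_poly (g i)) x)"
    "\<And>i. i < rdeg x \<Longrightarrow> degree (g i) \<le> ?n - 1 + k + (if i < Suc J then 1 else 0)" by (elim LamE) blast
  define c where "c = Polynomial.coeff (g J) (?n + k)"
  define h where "h = g(J := g J - Polynomial.monom c (?n + k))"
  have "y = (\<Sum>i<rdeg x. \<gamma> ^ i * poly (of_int_poly (h i)) x) + of_int c * ?v"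
    unfolding g(1) using J
    by (simp add: sum.remove[of "{..<rdeg x}" J] h_def poly_of_int_poly_diff poly_of_int_poly_monom poly_monom algebra_simps)
  moreover have "(\<Sum>i<rdeg x. \<gamma> ^ i * poly (of_int_poly (h i)) x) \<in> Lam x k J"
  proof (rule LamI[OF refl])
    fix i assume i: "i < rdeg x"
    have "degree (g J - Polynomial.monom c (?n + k)) \<le> ?n - 1 + k"
    proof (rule degree_le, intro allI impI)
      fix l assume "l > ?n - 1 + k"
      then have "l = ?n + k \<or> l > ?n + k" using n by linarith
      then show "Polynomial.coeff (g J - Polynomial.monom c (?n + k)) l = 0"
        using g(2)[OF J] n by (auto simp: c_def coeff_eq_0)
    qed
    then show "degree (h i) \<le> ?n - 1 + k + (if i < J then 1 else 0)"
      using g(2)[OF i] i by (auto simp: h_def less_Suc_eq)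
  qed
  ultimately show "y \<in> adjoin (Lam x k J) ?v" unfolding adjoin_def by blast
next
  let ?n = "degree (mp x)"
  have n: "?n > 0" by (rule degree_mp_pos)
  fix y assume "y \<in> adjoin (Lam x k J) ?v"
  then obtain g c where gc: "y = g + of_int c * ?v" "g \<in> Lam x k J" by (auto simp: adjoin_def)
  have "g \<in> Lam x k (Suc J)"
    using gc(2) Lam_mono[of k k J "Suc J"] by auto
  moreover have "?v \<in> Lam x k (Suc J)"
    using single_in_Lam[OF J, of "Polynomial.monom 1 (?n + k)" k "Suc J"] n degree_monom_le[of "1::int" "?n + k"]
    by (simp add: poly_monom)
  ultimately show "y \<in> Lam x k (Suc J)"
    unfolding gc(1) by (intro subgrp_add[OF subgrp_Lam] subgrp_of_int_mult[OF subgrp_Lam])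
qed

text \<open>This is where the leading coefficient enters. By directness only the component at
  \<open>\<gamma>^J\<close> matters. If \<open>c x^(n + k)\<close> is an integer combination of
  lower powers, Gauss's lemma makes the relation a multiple of \<open>ipol x\<close>, so its leading
  coefficient divides \<open>c\<close>. Conversely, subtracting a multiple of \<open>x^k\<close>
  times \<open>ipol x\<close> lowers the degree.\<close>

lemma Lam_adjoin_iff:
  assumes J: "J < rdeg x"
  shows "of_int c * (\<gamma> ^ J * x ^ (degree (mp x) + k)) \<in> Lam x k J \<longleftrightarrow> lead_coeff (ipol x) dvd c"
proof
  let ?n = "degree (mp x)"
  have n: "?n > 0" by (rule degree_mp_pos)
  assume "of_int c * (\<gamma> ^ J * x ^ (?n + k)) \<in> Lam x k J"
  then obtain g where g: "of_int c * (\<gamma> ^ J * x ^ (?n + k)) = (\<Sum>i<rdeg x. \<gamma> ^ i * poly (of_int_poly (g i)) x)"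
    "\<And>i. i < rdeg x \<Longrightarrow> degree (g i) \<le> ?n - 1 + k + (if i < J then 1 else 0)" by (elim LamE) blast
  define h where "h = g(J := g J - Polynomial.monom c (?n + k))"
  have "(\<Sum>i<rdeg x. \<gamma> ^ i * poly (of_int_poly (h i)) x) =
      (\<Sum>i<rdeg x. \<gamma> ^ i * poly (of_int_poly (g i)) x) - of_int c * (\<gamma> ^ J * x ^ (?n + k))"
    using J by (simp add: sum.remove[of "{..<rdeg x}" J] h_def poly_of_int_poly_diff poly_of_int_poly_monom poly_monom algebra_simps)
  then have "(\<Sum>i<rdeg x. \<gamma> ^ i * poly (of_int_poly (h i)) x) = 0" using g(1) by simp
  from rdeg_direct[where y = "\<lambda>i. poly (of_int_poly (h i)) x", OF poly_of_int_poly_in_qf this J]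
  have "poly (of_int_poly (h J)) x = 0" .
  then have "ipol x dvd h J" by (rule ipol_dvd)
  then obtain q where q: "h J = ipol x * q" by (elim dvdE)
  have "Polynomial.coeff (h J) (?n + k) = - c"
    using g(2)[OF J] n by (simp add: h_def coeff_eq_0)
  moreover have "degree (h J) \<le> ?n + k"
    using g(2)[OF J] n degree_monom_le[of c "?n + k"] by (auto simp: h_def intro!: degree_diff_le)
  ultimately have "c = 0 \<or> lead_coeff (h J) = - c"
    by (metis coeff_eq_0 le_neq_implies_less neg_0_equal_iff_equal)
  then show "lead_coeff (ipol x) dvd c"
    unfolding q lead_coeff_mult by (metis dvd_0_right dvd_minus_iff dvd_triv_left)
next
  let ?n = "degree (mp x)" and ?a = "lead_coeff (ipol x)"
  have n: "?n > 0" by (rule degree_mp_pos)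
  assume "?a dvd c"
  then obtain c' where c': "c = ?a * c'" by (elim dvdE)
  define g where "g = Polynomial.monom c (?n + k) - smult c' (Polynomial.monom 1 k * ipol x)"
  have "poly (of_int_poly g) x = of_int c * x ^ (?n + k)"
    by (simp add: g_def poly_of_int_poly_diff poly_of_int_poly_smult poly_of_int_poly_mult poly_monom)
  moreover have "degree g \<le> ?n - 1 + k"
  proof (rule degree_le, intro allI impI)
    fix l assume "l > ?n - 1 + k"
    then have "l = ?n + k \<or> l > ?n + k" using n by linarith
    then show "Polynomial.coeff g l = 0"
      by (auto simp: g_def coeff_monom_mult c' degree_ipol[symmetric] coeff_eq_0)
  qed
  ultimately show "of_int c * (\<gamma> ^ J * x ^ (?n + k)) \<in> Lam x k J"
    using single_in_Lam[OF J, of g k J] by (simp add: mult_ac)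
qed

text \<open>Each of the \<open>rdeg x\<close> steps from \<open>k\<close> to \<open>k + 1\<close>
  multiplies the index by the leading coefficient.\<close>

lemma idx_Lam: "idx (Lam x k 0) (Lam x 0 0) = nat (lead_coeff (ipol x)) ^ (rdeg x * k)"
proof (induction k)
  case (Suc k)
  have "J \<le> rdeg x \<Longrightarrow> idx (Lam x k J) (Lam x k 0) = nat (lead_coeff (ipol x)) ^ J" for J
  proof (induction J)
    case (Suc J)
    have "idx (Lam x k (Suc J)) (Lam x k 0) = idx (Lam x k (Suc J)) (Lam x k J) * idx (Lam x k J) (Lam x k 0)"
      by (rule idx_tower) (auto simp: subgrp_Lam Lam_mono)
    also have "idx (Lam x k (Suc J)) (Lam x k J) = nat (lead_coeff (ipol x))"
      using Suc.prems Lam_Suc[of J x k] Lam_adjoin_iff[of J x _ k] by (simp add: idx_adjoin[OF subgrp_Lam ipol(2)])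
    finally show ?case using Suc by simp
  qed (simp add: idx_self subgrp_Lam)
  moreover have "Lam x k (rdeg x) = Lam x (Suc k) 0"
    unfolding Lam_def by (intro Collect_cong ex_cong1 conj_cong refl all_cong) auto
  ultimately have "idx (Lam x (Suc k) 0) (Lam x k 0) = nat (lead_coeff (ipol x)) ^ rdeg x" by fastforce
  moreover have "idx (Lam x (Suc k) 0) (Lam x 0 0) = idx (Lam x (Suc k) 0) (Lam x k 0) * idx (Lam x k 0) (Lam x 0 0)"
    by (intro idx_tower subgrp_Lam Lam_mono) auto
  ultimately show ?case using Suc by (simp add: power_add)
qed (simp add: idx_self subgrp_Lam)

end

section \<open>Comparison of the explicit lattices with the ring of integers\<close>

context nf
begin

lemma Lam_0_eq_zspan:
  "Lam x 0 0 = zspan (\<lambda>(i, j). \<gamma> ^ i * x ^ j) ({..<rdeg x} \<times> {..<degree (mp x)})" (is "_ = zspan ?e ?I")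
proof (intro equalityI subsetI)
  let ?n = "degree (mp x)"
  have n: "?n > 0" by (rule degree_mp_pos)
  fix y assume "y \<in> Lam x 0 0"
  then obtain g where g: "y = (\<Sum>i<rdeg x. \<gamma> ^ i * poly (of_int_poly (g i)) x)"
    "\<And>i. i < rdeg x \<Longrightarrow> degree (g i) \<le> ?n - 1" by (elim LamE) auto
  have p: "poly (of_int_poly (g i)) x = (\<Sum>j<?n. of_int (Polynomial.coeff (g i) j) * x ^ j)" if "i < rdeg x" for i
  proof -
    have "poly (of_int_poly (g i)) x = (\<Sum>j\<le>degree (g i). of_int (Polynomial.coeff (g i) j) * x ^ j)"
      by (simp add: poly_altdef)
    also have "\<dots> = (\<Sum>j<?n. of_int (Polynomial.coeff (g i) j) * x ^ j)"
      by (rule sum.mono_neutral_left) (use g(2)[OF that] n in \<open>auto simp: coeff_eq_0\<close>)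
    finally show ?thesis .
  qed
  have "y = (\<Sum>i<rdeg x. \<Sum>j<?n. of_int (Polynomial.coeff (g i) j) * (\<gamma> ^ i * x ^ j))"
    unfolding g(1) by (intro sum.cong refl) (simp add: p sum_distrib_left mult_ac)
  also have "\<dots> = (\<Sum>k\<in>?I. of_int (Polynomial.coeff (g (fst k)) (snd k)) * ?e k)"
    by (simp add: sum.cartesian_product case_prod_unfold)
  finally show "y \<in> zspan ?e ?I" by (rule zspanI)
next
  let ?n = "degree (mp x)"
  fix y assume "y \<in> zspan ?e ?I"
  then obtain c where c: "y = (\<Sum>k\<in>?I. of_int (c k) * ?e k)" by (rule zspanE)
  have "?e k \<in> Lam x 0 0" if "k \<in> ?I" for k
  proof -
    obtain i j where k: "k = (i, j)" "i < rdeg x" "j < ?n" using \<open>k \<in> ?I\<close> by auto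
    then show ?thesis
      using single_in_Lam[of i x "Polynomial.monom 1 j" 0 0] degree_monom_le[of "1::int" j]
      by (simp add: poly_monom)
  qed
  then show "y \<in> Lam x 0 0"
    unfolding c by (intro subgrp_sum[OF subgrp_Lam] subgrp_of_int_mult[OF subgrp_Lam])
qed

lemma idx_Lam_0_mult: "m > 0 \<Longrightarrow> idx (Lam x 0 0) ((*) (of_nat m) ` Lam x 0 0) = m ^ (rdeg x * degree (mp x))"
proof -
  let ?n = "degree (mp x)"
  let ?I = "{..<rdeg x} \<times> {..<?n}" and ?e = "\<lambda>(i, j). \<gamma> ^ i * x ^ j"
  assume m: "m > 0"
  have "\<forall>k\<in>?I. c k = 0" if "(\<Sum>k\<in>?I. of_int (c k) * ?e k) = 0" for c
  proof -
    define p where "p i = (\<Sum>j<?n. of_int (c (i, j)) * x ^ j)" for i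
    have "(\<Sum>i<rdeg x. \<gamma> ^ i * p i) = (\<Sum>i<rdeg x. \<Sum>j<?n. of_int (c (i, j)) * (\<gamma> ^ i * x ^ j))"
      by (simp add: p_def sum_distrib_left mult_ac)
    also have "\<dots> = (\<Sum>k\<in>?I. of_int (c k) * ?e k)"
      by (simp add: sum.cartesian_product case_prod_unfold)
    finally have "(\<Sum>i<rdeg x. \<gamma> ^ i * p i) = 0" using that by simp
    moreover have "p i \<in> qf x" for i unfolding p_def by (auto intro!: qf_sum qf_mult)
    ultimately have "p i = 0" if "i < rdeg x" for i using rdeg_direct[of x p i] that by blast
    then show ?thesis using power_basis_independent[of "\<lambda>j. c (i, j)" x for i] unfolding p_def by auto
  qed
  then show ?thesis
    unfolding Lam_0_eq_zspan using idx_zspan_mult[of ?I ?e m] m by simp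
qed

lemma K_multiple_in_Lam:
  assumes "z \<in> K"
  shows "\<exists>E>0. of_nat E * z \<in> Lam x 0 0"
proof -
  obtain y where y: "\<And>i. y i \<in> qf x" "z = (\<Sum>i<rdeg x. \<gamma> ^ i * y i)" using rdeg_span[OF assms, of x] by blast
  have "\<exists>E>0. of_nat E * (\<gamma> ^ i * y i) \<in> Lam x 0 0" if "i \<in> {..<rdeg x}" for i
  proof -
    obtain c where c: "y i = ev c x" using y(1)[of i] by (auto simp: qf_def)
    define c' where "c' = c mod mp x"
    obtain E g where E: "E > 0" "smult (of_int E) c' = of_int_poly g" by (rule clear_denominators)
    have "degree g = degree (smult (of_int E) c')" by (simp only: E(2) of_int_hom.degree_map_poly_hom)
    then have "degree g = degree c'" using E(1) by simp
    moreover have "degree c' < degree (mp x)"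
      using degree_mod_less'[of "mp x" c] degree_mp_pos[of x] unfolding c'_def by (cases "c mod mp x = 0") auto
    ultimately have "\<gamma> ^ i * poly (of_int_poly g) x \<in> Lam x 0 0"
      using that by (intro single_in_Lam) auto
    moreover have "poly (of_int_poly g) x = of_int E * y i"
      using ev_mod[of "mp x" x c] by (simp add: poly_of_int_poly_eq_ev E(2)[symmetric] ev_smult c c'_def)
    ultimately have "of_nat (nat E) * (\<gamma> ^ i * y i) \<in> Lam x 0 0"
      using E(1) by (simp add: mult_ac)
    then show ?thesis using E(1) by (intro exI[of _ "nat E"]) simp
  qed
  then obtain E :: nat where E: "E > 0" "\<And>i. i \<in> {..<rdeg x} \<Longrightarrow> of_nat E * (\<gamma> ^ i * y i) \<in> Lam x 0 0"
    using common_multiple[of "{..<rdeg x}" "Lam x 0 0" "\<lambda>i. \<gamma> ^ i * y i"] subgrp_Lam by auto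
  have "of_nat E * z \<in> Lam x 0 0"
    unfolding y(2) sum_distrib_left by (intro subgrp_sum[OF subgrp_Lam] E)
  then show ?thesis using E(1) by blast
qed

lemma OK_multiple_in_Lam:
  obtains E :: nat where "E > 0" "(*) (of_nat E) ` OK \<subseteq> Lam x 0 0"
proof -
  obtain E0 :: nat where E0: "E0 > 0" "(*) (of_nat E0) ` OK \<subseteq> zspan (\<lambda>i. \<gamma> ^ i) {..<d}"
    by (rule OK_conductor)
  have "\<exists>E>0. of_nat E * \<gamma> ^ i \<in> Lam x 0 0" for i by (intro K_multiple_in_Lam) auto
  then obtain E :: nat where E: "E > 0" "\<And>i. i \<in> {..<d} \<Longrightarrow> of_nat E * \<gamma> ^ i \<in> Lam x 0 0"
    using common_multiple[of "{..<d}" "Lam x 0 0" "\<lambda>i. \<gamma> ^ i"] subgrp_Lam by auto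
  show ?thesis
  proof (rule that[of "E * E0"])
    show "(*) (of_nat (E * E0)) ` OK \<subseteq> Lam x 0 0"
    proof safe
      fix y assume "y \<in> OK"
      then have "of_nat E0 * y \<in> zspan (\<lambda>i. \<gamma> ^ i) {..<d}" using E0(2) by blast
      then obtain c where "of_nat E0 * y = (\<Sum>i<d. of_int (c i) * \<gamma> ^ i)" by (rule zspanE)
      then have "of_nat (E * E0) * y = (\<Sum>i<d. of_int (c i) * (of_nat E * \<gamma> ^ i))"
        by (simp add: mult.assoc) (simp add: sum_distrib_left mult_ac)
      also have "\<dots> \<in> Lam x 0 0"
        by (intro subgrp_sum[OF subgrp_Lam] subgrp_of_int_mult[OF subgrp_Lam] E)
      finally show "of_nat (E * E0) * y \<in> Lam x 0 0" .
    qed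
  qed (use E E0 in simp)
qed

lemma K_multiple_in_OK:
  assumes "z \<in> K"
  obtains E :: nat where "E > 0" "of_nat E * z \<in> OK"
proof -
  obtain m :: int where m: "m > 0" "algebraic_int (of_int m * z)" by (rule multiple_algebraic_int)
  then have "of_nat (nat m) * z \<in> OK" using assms by (auto simp: OK_def ints_def)
  then show ?thesis using that[of "nat m"] m(1) by simp
qed

lemma Lam_multiple_in_OK:
  assumes "x \<in> K"
  obtains D :: nat where "D > 0" "(*) (of_nat D) ` Lam x 0 0 \<subseteq> OK"
proof -
  let ?I = "{..<rdeg x} \<times> {..<degree (mp x)}" and ?e = "\<lambda>(i, j). \<gamma> ^ i * x ^ j"
  have "\<exists>E>0. of_nat E * ?e k \<in> OK" for k
  proof -
    have "?e k \<in> K" using assms by (cases k) auto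
    then show ?thesis by (rule K_multiple_in_OK) blast
  qed
  then obtain D :: nat where D: "D > 0" "\<And>k. k \<in> ?I \<Longrightarrow> of_nat D * ?e k \<in> OK"
    using common_multiple[of ?I OK ?e] subgrp_OK by auto
  show ?thesis
  proof (rule that[OF D(1)], safe)
    fix y assume "y \<in> Lam x 0 0"
    then obtain c where "y = (\<Sum>k\<in>?I. of_int (c k) * ?e k)" unfolding Lam_0_eq_zspan by (rule zspanE)
    then have "of_nat D * y = (\<Sum>k\<in>?I. of_int (c k) * (of_nat D * ?e k))"
      by (simp add: sum_distrib_left mult_ac)
    also have "\<dots> \<in> OK" by (intro OK_sum OK_mult[OF OK_of_int] D(2))
    finally show "of_nat D * y \<in> OK" .
  qed
qed

text \<open>The tower law for degrees, obtained by counting: \<open>M / 2 M\<close> has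
  \<open>2^rank\<close> elements, and the ring of integers and \<open>Lam x 0 0\<close> are
  commensurable, so their ranks agree.\<close>

lemma rdeg_mult_degree:
  assumes "x \<in> K"
  shows "rdeg x * degree (mp x) = d"
proof -
  obtain E :: nat where E: "E > 0" "(*) (of_nat E) ` OK \<subseteq> Lam x 0 0" by (rule OK_multiple_in_Lam)
  obtain D :: nat where D: "D > 0" "(*) (of_nat D) ` Lam x 0 0 \<subseteq> OK" using Lam_multiple_in_OK[OF assms] by blast
  have "(2::nat) ^ (rdeg x * degree (mp x)) = 2 ^ d"
    using idx_commensurable(1)[OF subgrp_OK subgrp_Lam D E, of 2] idx_OK idx_OK[of 2] idx_Lam_0_mult[of 2 x] by simp
  then show ?thesis by simp
qed

text \<open>The fractional ideal \<open>(O + x O)^k\<close>. Unlike \<open>Lam\<close> it is a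
  module over the ring of integers, so its index can also be computed through prime ideals.\<close>

definition Ek :: "qbar \<Rightarrow> nat \<Rightarrow> qbar set" where
  "Ek x k = {\<Sum>j\<le>k. x ^ j * z j | z. \<forall>j. z j \<in> OK}"

lemma EkI: "(\<And>j. z j \<in> OK) \<Longrightarrow> (\<Sum>j\<le>k. x ^ j * z j) \<in> Ek x k"
  unfolding Ek_def by blast

lemma EkE:
  assumes "y \<in> Ek x k"
  obtains z where "\<And>j. z j \<in> OK" "y = (\<Sum>j\<le>k. x ^ j * z j)"
  using assms unfolding Ek_def by blast

lemma subgrp_Ek: "subgrp (Ek x k)"
  unfolding subgrp_def
proof (intro conjI ballI)
  show "0 \<in> Ek x k" using EkI[of "\<lambda>_. 0" x k] by (simp add: OK_0)
  fix a b assume "a \<in> Ek x k" "b \<in> Ek x k"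
  then obtain y z where "\<And>j. y j \<in> OK" "a = (\<Sum>j\<le>k. x ^ j * y j)" "\<And>j. z j \<in> OK" "b = (\<Sum>j\<le>k. x ^ j * z j)"
    by (elim EkE) blast
  then show "a - b \<in> Ek x k"
    using EkI[of "\<lambda>j. y j - z j" x k] by (simp add: OK_diff right_diff_distrib sum_subtractf)
qed

lemma power_mult_in_Ek: "j \<le> k \<Longrightarrow> z \<in> OK \<Longrightarrow> x ^ j * z \<in> Ek x k"
  using EkI[of "\<lambda>l. if l = j then z else 0" x k] by (simp add: OK_0 if_distrib cong: if_cong)

lemma OK_subset_Ek: "OK \<subseteq> Ek x k"
  using power_mult_in_Ek[of 0 k _ x] by auto

text \<open>A term of degree \<open>n + k\<close> in \<open>x\<close>, with
  \<open>n = degree (mp x)\<close>, is written as \<open>x^(k + 1) x^(n - 1)\<close>, so the surplus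
  degree moves into the outer power.\<close>

lemma Lam_decomposition:
  assumes "y \<in> Lam x k 0"
  obtains l where "\<And>j. l j \<in> Lam x 0 0" "y = (\<Sum>j\<le>k. x ^ j * l j)"
proof -
  have "\<exists>l. (\<forall>j. l j \<in> Lam x 0 0) \<and> y = (\<Sum>j\<le>k. x ^ j * l j)" using assms
  proof (induction k arbitrary: y)
    case 0
    then show ?case by (intro exI[of _ "\<lambda>_. y"]) auto
  next
    case (Suc k)
    let ?n = "degree (mp x)"
    have n: "?n > 0" by (rule degree_mp_pos)
    obtain g where g: "y = (\<Sum>i<rdeg x. \<gamma> ^ i * poly (of_int_poly (g i)) x)"
      "\<And>i. i < rdeg x \<Longrightarrow> degree (g i) \<le> ?n - 1 + Suc k" using Suc.prems by (elim LamE) auto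
    define c where "c i = Polynomial.coeff (g i) (?n + k)" for i
    define h where "h i = g i - Polynomial.monom (c i) (?n + k)" for i
    define y1 where "y1 = (\<Sum>i<rdeg x. \<gamma> ^ i * poly (of_int_poly (h i)) x)"
    define y2 where "y2 = (\<Sum>i<rdeg x. \<gamma> ^ i * poly (of_int_poly (Polynomial.monom (c i) (?n - 1))) x)"
    have "degree (h i) \<le> ?n - 1 + k" if "i < rdeg x" for i
    proof (rule degree_le, intro allI impI)
      fix l assume "l > ?n - 1 + k"
      then have "l = ?n + k \<or> l > ?n + k" using n by linarith
      then show "Polynomial.coeff (h i) l = 0"
        using g(2)[OF that] n by (auto simp: c_def h_def coeff_eq_0)
    qed
    then have "y1 \<in> Lam x k 0" unfolding y1_def by (intro LamI[OF refl]) auto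
    then obtain l where l: "\<forall>j. l j \<in> Lam x 0 0" "y1 = (\<Sum>j\<le>k. x ^ j * l j)" using Suc.IH by blast
    have "y2 \<in> Lam x 0 0" unfolding y2_def
      by (intro LamI[OF refl]) (auto intro: degree_monom_le)
    moreover have "y = y1 + x ^ Suc k * y2"
    proof -
      have "x ^ Suc k * x ^ (?n - 1) = x ^ (?n + k)"
        using n power_add[of x "Suc k" "?n - 1"] by (simp add: add.commute)
      then have "x ^ Suc k * y2 = (\<Sum>i<rdeg x. \<gamma> ^ i * (of_int (c i) * x ^ (?n + k)))"
        unfolding y2_def by (simp add: sum_distrib_left poly_monom mult_ac)
      then show ?thesis
        by (simp add: g(1) y1_def h_def poly_of_int_poly_diff poly_monom right_diff_distrib sum_subtractf)
    qed
    ultimately show ?case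
      using l by (intro exI[of _ "l(Suc k := y2)"]) auto
  qed
  then show ?thesis using that by blast
qed

lemma power_mult_Lam:
  assumes "y \<in> Lam x 0 0" "j \<le> k"
  shows "x ^ j * y \<in> Lam x k 0"
proof -
  obtain g where g: "y = (\<Sum>i<rdeg x. \<gamma> ^ i * poly (of_int_poly (g i)) x)"
    "\<And>i. i < rdeg x \<Longrightarrow> degree (g i) \<le> degree (mp x) - 1" using assms by (elim LamE) auto
  show ?thesis
  proof (rule LamI[where g = "\<lambda>i. Polynomial.monom 1 j * g i"])
    show "x ^ j * y = (\<Sum>i<rdeg x. \<gamma> ^ i * poly (of_int_poly (Polynomial.monom 1 j * g i)) x)"
      by (simp add: g(1) poly_of_int_poly_mult poly_monom sum_distrib_left mult_ac)
    fix i assume "i < rdeg x"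
    then show "degree (Polynomial.monom 1 j * g i) \<le> degree (mp x) - 1 + k + (if i < 0 then 1 else 0)"
      using degree_mult_le[of "Polynomial.monom 1 j" "g i"] degree_monom_le[of "1::int" j] g(2)[of i] assms(2) by simp
  qed
qed

text \<open>Up to bounded factors, \<open>OK + x OK + \<dots> + x^k OK\<close> contains \<open>OK\<close> with the same index as
  for the explicit lattice \<^const>\<open>Lam\<close>, for which the index is a pure power.\<close>

lemma Ek_growth:
  assumes x: "x \<in> K"
  obtains q B :: nat where "q > 0" "B > 0"
    "\<And>k. idx (Ek x k) OK * q \<le> B * nat (lead_coeff (ipol x)) ^ (rdeg x * k)"
    "\<And>k. nat (lead_coeff (ipol x)) ^ (rdeg x * k) \<le> idx (Ek x k) OK * q"
proof -
  obtain E :: nat where E: "E > 0" "(*) (of_nat E) ` OK \<subseteq> Lam x 0 0" by (rule OK_multiple_in_Lam)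
  obtain D :: nat where D: "D > 0" "(*) (of_nat D) ` Lam x 0 0 \<subseteq> OK" using Lam_multiple_in_OK[OF x] by blast
  define L where "L k = (*) (of_nat D) ` Lam x k 0" for k
  have L: "subgrp (L k)" for k unfolding L_def by (intro subgrp_image_mult subgrp_Lam)
  have L0: "L 0 \<subseteq> L k" for k unfolding L_def by (intro image_mono Lam_mono) auto
  have LO: "L 0 \<subseteq> OK" using D(2) by (simp add: L_def)
  have LE: "L k \<subseteq> Ek x k" for k
  proof
    fix y assume "y \<in> L k"
    then obtain y' where y': "y' \<in> Lam x k 0" "y = of_nat D * y'" by (auto simp: L_def)
    obtain l where l: "\<And>j. l j \<in> Lam x 0 0" "y' = (\<Sum>j\<le>k. x ^ j * l j)" using Lam_decomposition[OF y'(1)] by blast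
    have "y = (\<Sum>j\<le>k. x ^ j * (of_nat D * l j))" by (simp add: y' l sum_distrib_left mult_ac)
    then show "y \<in> Ek x k" using EkI[of "\<lambda>j. of_nat D * l j"] D(2) l(1) by blast
  qed
  have EL: "(*) (of_nat (D * E)) ` Ek x k \<subseteq> L k" for k
  proof safe
    fix y assume "y \<in> Ek x k"
    then obtain z where z: "\<And>j. z j \<in> OK" "y = (\<Sum>j\<le>k. x ^ j * z j)" using EkE[OF \<open>y \<in> Ek x k\<close>] by blast
    have "of_nat E * y = (\<Sum>j\<le>k. x ^ j * (of_nat E * z j))" by (simp add: z sum_distrib_left mult_ac)
    also have "\<dots> \<in> Lam x k 0"
      using E(2) z(1) by (intro subgrp_sum[OF subgrp_Lam] power_mult_Lam) auto
    finally show "of_nat (D * E) * y \<in> L k" by (auto simp: L_def mult.assoc)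
  qed
  have EkO: "\<exists>m>0. (*) (of_nat m) ` Ek x k \<subseteq> OK" for k
  proof -
    have "\<exists>m>0. of_nat m * x ^ j \<in> OK" for j using K_multiple_in_OK[of "x ^ j"] x by auto
    then obtain m :: nat where m: "m > 0" "\<And>j. j \<in> {..k} \<Longrightarrow> of_nat m * x ^ j \<in> OK"
      using common_multiple[of "{..k}" OK "\<lambda>j. x ^ j"] subgrp_OK by auto
    have "of_nat m * y \<in> OK" if "y \<in> Ek x k" for y
    proof -
      obtain z where z: "\<And>j. z j \<in> OK" "y = (\<Sum>j\<le>k. x ^ j * z j)" using EkE[OF \<open>y \<in> Ek x k\<close>] by blast
      have "of_nat m * y = (\<Sum>j\<le>k. (of_nat m * x ^ j) * z j)" by (simp add: z sum_distrib_left mult_ac)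
      also have "\<dots> \<in> OK" by (intro OK_sum OK_mult[OF m(2) z(1)])
      finally show ?thesis .
    qed
    then show ?thesis using m(1) by blast
  qed
  have idxE: "idx (Ek x k) ((*) (of_nat m) ` Ek x k) = m ^ d" if m: "m > 0" for k m
  proof -
    obtain m' :: nat where "m' > 0" "(*) (of_nat m') ` Ek x k \<subseteq> OK" using EkO by blast
    then show ?thesis
      using idx_commensurable(1)[OF subgrp_OK subgrp_Ek, of m' x k 1 m] OK_subset_Ek[of x k] idx_OK m by auto
  qed
  \<comment> \<open>\<open>q\<close> and \<open>s k\<close> measure two discrepancies: between the
    ring of integers and \<open>L 0\<close>, and between \<open>Ek x k\<close> and
    \<open>L k\<close>. The second divides \<open>(D E)^d\<close> for every \<open>k\<close>, which
    is the uniformity needed.\<close>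
  define q where "q = idx OK (L 0)"
  have q: "q > 0"
    unfolding q_def L_def using idx_commensurable(2)[OF subgrp_OK subgrp_Lam D E, of 1] idx_OK by simp
  define s where "s k = idx (Ek x k) (L k)" for k
  have s: "0 < s k" "s k \<le> (D * E) ^ d" for k
  proof -
    have "(D * E) ^ d = s k * idx (L k) ((*) (of_nat (D * E)) ` Ek x k)"
      unfolding s_def using idxE[of "D * E" k] D(1) E(1)
        idx_tower[OF subgrp_Ek L subgrp_image_mult[OF subgrp_Ek] LE EL, of k] by simp
    then have "s k dvd (D * E) ^ d" by simp
    moreover have "(D * E) ^ d > 0" using D(1) E(1) by simp
    ultimately show "0 < s k" "s k \<le> (D * E) ^ d" by (auto intro: dvd_imp_le Nat.gr0I)
  qed
  have eq: "idx (Ek x k) OK * q = s k * nat (lead_coeff (ipol x)) ^ (rdeg x * k)" for k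
  proof -
    have "idx (Ek x k) OK * q = idx (Ek x k) (L 0)"
      unfolding q_def by (rule idx_tower[symmetric, OF subgrp_Ek subgrp_OK L OK_subset_Ek LO])
    also have "\<dots> = s k * idx (L k) (L 0)"
      unfolding s_def by (rule idx_tower[OF subgrp_Ek L L LE L0])
    also have "idx (L k) (L 0) = idx (Lam x k 0) (Lam x 0 0)"
      unfolding L_def by (rule idx_mult) (use D(1) subgrp_Lam in auto)
    finally show ?thesis by (simp add: idx_Lam)
  qed
  show ?thesis
  proof (rule that[OF q, of "(D * E) ^ d"])
    show "(D * E) ^ d > 0" using D(1) E(1) by simp
    show "idx (Ek x k) OK * q \<le> (D * E) ^ d * nat (lead_coeff (ipol x)) ^ (rdeg x * k)" for k
      unfolding eq by (intro mult_right_mono s) simp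
    show "nat (lead_coeff (ipol x)) ^ (rdeg x * k) \<le> idx (Ek x k) OK * q" for k
      unfolding eq using s(1)[of k] by simp
  qed
qed

text \<open>All lattices \<open>u Lam_k\<close> lie inside the ring of integers, so the index of
  \<open>u Lam_0\<close> in them, a power of the leading coefficient with exponent
  \<open>rdeg x * k\<close>, divides one fixed number. Hence the leading coefficient is 1. This is
  the form of integral closedness used for prime ideals.\<close>

lemma almost_integral:
  assumes x: "x \<in> K" and u: "u \<in> OK" "u \<noteq> 0" and pw: "\<And>k. u * x ^ k \<in> OK"
  shows "x \<in> OK"
proof -
  obtain E :: nat where E: "E > 0" "(*) (of_nat E) ` OK \<subseteq> Lam x 0 0" by (rule OK_multiple_in_Lam)
  obtain N :: nat and u' where N: "N > 0" "u' \<in> OK" "of_nat N = u * u'" using integer_multiple_OK[OF u] by blast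
  define M where "M k = (*) u ` Lam x k 0" for k
  have M: "subgrp (M k)" for k unfolding M_def by (intro subgrp_image_mult subgrp_Lam)
  have MO: "M k \<subseteq> OK" for k
  proof
    fix y assume "y \<in> M k"
    then obtain g where g: "y = u * (\<Sum>i<rdeg x. \<gamma> ^ i * poly (of_int_poly (g i)) x)"
      by (auto simp: M_def elim!: LamE)
    have "u * poly (of_int_poly g) x \<in> OK" for g
    proof -
      have "u * poly (of_int_poly g) x = (\<Sum>i\<le>degree g. of_int (Polynomial.coeff g i) * (u * x ^ i))"
        by (simp add: poly_altdef sum_distrib_left mult_ac)
      also have "\<dots> \<in> OK" by (intro OK_sum OK_mult OK_of_int pw)
      finally show ?thesis .
    qed
    then have "(\<Sum>i<rdeg x. \<gamma> ^ i * (u * poly (of_int_poly (g i)) x)) \<in> OK"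
      by (intro OK_sum OK_mult[OF OK_power[OF OK_gen]])
    then show "y \<in> OK" by (simp add: g sum_distrib_left mult_ac)
  qed
  have sub: "(*) (of_nat (N * E)) ` OK \<subseteq> M 0"
  proof safe
    fix y assume y: "y \<in> OK"
    have "of_nat (N * E) * y = u * (of_nat E * (u' * y))" by (simp add: N(3) mult_ac)
    moreover have "of_nat E * (u' * y) \<in> Lam x 0 0" using E(2) N(2) y by blast
    ultimately show "of_nat (N * E) * y \<in> M 0" unfolding M_def by blast
  qed
  have pos: "idx OK (M 0) > 0"
    by (rule idx_pos_mono(1)[OF subgrp_OK M subgrp_image_mult[OF subgrp_OK] MO sub])
       (use idx_OK[of "N * E"] N(1) E(1) in simp)
  let ?a = "nat (lead_coeff (ipol x))"
  have "?a ^ (rdeg x * k) \<le> idx OK (M 0)" for k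
  proof -
    have "idx OK (M 0) = idx OK (M k) * idx (M k) (M 0)"
      by (rule idx_tower[OF subgrp_OK M M MO]) (simp add: M_def image_mono Lam_mono)
    also have "idx (M k) (M 0) = ?a ^ (rdeg x * k)"
      unfolding M_def using u(2) by (simp add: idx_mult subgrp_Lam idx_Lam)
    finally have "?a ^ (rdeg x * k) dvd idx OK (M 0)" by simp
    then show ?thesis using pos by (rule dvd_imp_le)
  qed
  then have "\<not> idx OK (M 0) < (?a ^ rdeg x) ^ idx OK (M 0)" by (simp add: power_mult linorder_not_less)
  then have "\<not> 1 < ?a ^ rdeg x" using power_gt_expt[of "?a ^ rdeg x" "idx OK (M 0)"] by auto
  then have "\<not> 1 < ?a" using one_less_power[of ?a "rdeg x"] rdeg_pos[of x] by blast
  then have "lead_coeff (ipol x) = 1" using ipol(2)[of x] by linarith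
  then show ?thesis using x by (simp add: OK_def ints_def algebraic_int_iff_ipol)
qed

end

section \<open>Prime ideals and their valuations\<close>

context nf
begin

definition idl :: "qbar set \<Rightarrow> bool" where
  "idl I \<longleftrightarrow> I \<subseteq> OK \<and> subgrp I \<and> (\<forall>a\<in>OK. \<forall>b\<in>I. a * b \<in> I)"

text \<open>The zero ideal is excluded, so that these are exactly the finite places;
  \<open>nf_primes_eq\<close> makes the identification.\<close>

definition prime_id :: "qbar set \<Rightarrow> bool" where
  "prime_id P \<longleftrightarrow> idl P \<and> P \<noteq> OK \<and> P \<noteq> {0} \<and> (\<forall>a\<in>OK. \<forall>b\<in>OK. a * b \<in> P \<longrightarrow> a \<in> P \<or> b \<in> P)"

lemma idlD: "idl I \<Longrightarrow> subgrp I" "idl I \<Longrightarrow> a \<in> I \<Longrightarrow> a \<in> OK" "idl I \<Longrightarrow> a \<in> OK \<Longrightarrow> b \<in> I \<Longrightarrow> a * b \<in> I"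
  by (auto simp: idl_def)

lemma idl_eq_OK: "idl I \<Longrightarrow> 1 \<in> I \<Longrightarrow> I = OK"
  by (auto simp: idl_def) (metis mult_1_right)

lemma idx_idl_pos:
  assumes "idl I" "a \<in> I" "a \<noteq> 0"
  shows "idx OK I > 0"
proof -
  obtain N :: nat and u' where N: "N > 0" "u' \<in> OK" "of_nat N = a * u'"
    using integer_multiple_OK[OF idlD(2)[OF assms(1,2)] assms(3)] by blast
  have "(*) (of_nat N) ` OK \<subseteq> I"
  proof safe
    fix z assume "z \<in> OK"
    then have "(u' * z) * a \<in> I" using N(2) assms(1,2) by (intro idlD(3)[OF assms(1)]) auto
    then show "of_nat N * z \<in> I" by (simp add: N(3) mult_ac)
  qed
  moreover have "I \<subseteq> OK" using idlD(2)[OF assms(1)] by blast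
  ultimately show ?thesis
    using idx_pos_mono(1)[OF subgrp_OK idlD(1)[OF assms(1)] subgrp_image_mult[OF subgrp_OK]] idx_OK[OF N(1)] N(1)
    by simp
qed

text \<open>The index in the ring of integers is the measure for inductions over ideals, in place of
  a chain condition.\<close>

lemma idx_idl_less:
  assumes "idl I" "idl J" "I \<subset> J" "a \<in> I" "a \<noteq> 0"
  shows "idx OK J < idx OK I"
proof -
  have I: "subgrp I" "subgrp J" "J \<subseteq> OK" using assms by (auto simp: idl_def)
  have t: "idx OK I = idx OK J * idx J I"
    by (rule idx_tower) (use I subgrp_OK assms in auto)
  have p: "idx OK I > 0" using assms idx_idl_pos by blast
  have "idx J I \<noteq> 1" using idx_eq_1_iff[of J I] I assms by auto
  then have "idx J I \<ge> 2" "idx OK J > 0" using p t by (cases "idx J I = 0"; force)+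
  then have "idx OK J * 2 \<le> idx OK J * idx J I" by (intro mult_left_mono) auto
  then show ?thesis using t \<open>idx OK J > 0\<close> by linarith
qed

definition extend_idl :: "qbar set \<Rightarrow> qbar \<Rightarrow> qbar set" where
  "extend_idl I b = {i + b * r | i r. i \<in> I \<and> r \<in> OK}"

lemma idl_extend:
  assumes "idl I" "b \<in> OK"
  shows "idl (extend_idl I b)"
  unfolding idl_def
proof (intro conjI ballI subsetI)
  note I = idlD[OF assms(1)]
  show "y \<in> OK" if "y \<in> extend_idl I b" for y using that I assms(2) by (auto simp: extend_idl_def)
  show "subgrp (extend_idl I b)"
    unfolding subgrp_def
  proof (intro conjI ballI)
    show "0 \<in> extend_idl I b" unfolding extend_idl_def
      by (intro CollectI exI[of _ 0]) (auto simp: subgrp_0[OF I(1)])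
    fix y z assume "y \<in> extend_idl I b" "z \<in> extend_idl I b"
    then obtain i r i' r' where "y = i + b * r" "z = i' + b * r'" "i \<in> I" "r \<in> OK" "i' \<in> I" "r' \<in> OK"
      by (auto simp: extend_idl_def)
    then show "y - z \<in> extend_idl I b" unfolding extend_idl_def
      by (intro CollectI exI[of _ "i - i'"] exI[of _ "r - r'"]) (auto simp: algebra_simps subgrp_diff[OF I(1)])
  qed
  fix a y assume "a \<in> OK" "y \<in> extend_idl I b"
  then obtain i r where "y = i + b * r" "i \<in> I" "r \<in> OK" by (auto simp: extend_idl_def)
  then show "a * y \<in> extend_idl I b" unfolding extend_idl_def using \<open>a \<in> OK\<close>
    by (intro CollectI exI[of _ "a * i"] exI[of _ "a * r"]) (auto simp: algebra_simps I(3))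
qed

lemma extend_idl_supset:
  assumes "idl I"
  shows "I \<subseteq> extend_idl I b" "b \<in> extend_idl I b"
proof -
  show "I \<subseteq> extend_idl I b" unfolding extend_idl_def by (intro subsetI CollectI, rule_tac exI, rule exI[of _ 0]) auto
  show "b \<in> extend_idl I b" unfolding extend_idl_def
    by (intro CollectI exI[of _ 0] exI[of _ 1]) (auto simp: subgrp_0[OF idlD(1)[OF assms]])
qed

lemma prime_idD:
  assumes "prime_id P"
  shows "idl P" "1 \<notin> P" "\<exists>p\<in>P. p \<noteq> 0" "a \<in> OK \<Longrightarrow> b \<in> OK \<Longrightarrow> a * b \<in> P \<Longrightarrow> a \<in> P \<or> b \<in> P"
proof -
  show I: "idl P" using assms by (simp add: prime_id_def)
  show "1 \<notin> P" using idl_eq_OK[OF I] assms by (auto simp: prime_id_def)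
  show "\<exists>p\<in>P. p \<noteq> 0" using assms subgrp_0[OF idlD(1)[OF I]] by (auto simp: prime_id_def)
  show "a \<in> OK \<Longrightarrow> b \<in> OK \<Longrightarrow> a * b \<in> P \<Longrightarrow> a \<in> P \<or> b \<in> P" using assms by (auto simp: prime_id_def)
qed

lemma prime_id_not_mult:
  "prime_id P \<Longrightarrow> a \<in> OK - P \<Longrightarrow> b \<in> OK - P \<Longrightarrow> a * b \<in> OK - P"
  using prime_idD(4)[of P a b] by auto

text \<open>Multiplication by \<open>a\<close> induces an isomorphism from \<open>OK / P\<close> onto \<open>(P + a OK) / P\<close>, and both are finite.\<close>

lemma prime_id_inverse:
  assumes P: "prime_id P" and a: "a \<in> OK" "a \<notin> P"
  obtains b where "b \<in> OK" "1 - a * b \<in> P"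
proof -
  note I = prime_idD(1)[OF P]
  define J where "J = extend_idl P a"
  have J: "idl J" "P \<subseteq> J" unfolding J_def using idl_extend[OF I a(1)] extend_idl_supset(1)[OF I] by blast+
  have "idx J P = idx OK P"
  proof (rule idx_iso[where \<phi> = "\<lambda>r. a * r"])
    show "a * r \<in> J" if "r \<in> OK" for r unfolding J_def extend_idl_def
      by (intro CollectI exI[of _ 0] exI[of _ r]) (auto simp: that subgrp_0[OF idlD(1)[OF I]])
    show "\<exists>r\<in>OK. c - a * r \<in> P" if c: "c \<in> J" for c
    proof -
      obtain i r where "c = i + a * r" "i \<in> P" "r \<in> OK" using c by (auto simp: J_def extend_idl_def)
      then show ?thesis by (intro bexI[of _ r]) auto
    qed
    show "a * r \<in> P \<longleftrightarrow> r \<in> P" if "r \<in> OK" for r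
      using prime_idD(4)[OF P a(1) that] a idlD(3)[OF I a(1)] by blast
  qed (use I subgrp_OK in \<open>auto simp: idl_def algebra_simps\<close>)
  moreover have "idx OK P = idx OK J * idx J P"
    by (rule idx_tower) (use I J subgrp_OK in \<open>auto simp: idl_def\<close>)
  moreover have "idx OK P > 0" using prime_idD(3)[OF P] idx_idl_pos[OF I] by blast
  ultimately have "idx OK J = 1" by simp
  then have "J = OK" using idx_eq_1_iff[of OK J] subgrp_OK J by (auto simp: idl_def)
  then have "1 \<in> J" by auto
  then obtain i r where "1 = i + a * r" "i \<in> P" "r \<in> OK" by (auto simp: J_def extend_idl_def)
  then have "1 - a * r = i" by (simp add: diff_eq_eq)
  then show ?thesis using that[of r] \<open>r \<in> OK\<close> \<open>i \<in> P\<close> by simp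
qed

text \<open>An element of \<open>I\<close> outside \<open>P\<close> is invertible modulo
  \<open>P\<close>, which would put 1 into \<open>I\<close>.\<close>

lemma prime_id_maximal:
  assumes "prime_id P" "idl I" "P \<subseteq> I" "1 \<notin> I"
  shows "I = P"
proof (rule ccontr)
  assume "I \<noteq> P"
  then obtain a where a: "a \<in> I" "a \<notin> P" using assms by blast
  then obtain b where b: "b \<in> OK" "1 - a * b \<in> P" using prime_id_inverse[OF assms(1)] idlD(2)[OF assms(2)] by blast
  have "b * a \<in> I" using idlD(3)[OF assms(2) b(1) a(1)] .
  then have "(1 - a * b) + b * a \<in> I"
    using subgrp_add[OF idlD(1)[OF assms(2)]] b(2) assms(3) by blast
  then show False using assms(4) by (simp add: mult.commute)
qed

text \<open>Localised at \<open>P\<close>, every nonzero ideal contains a power of \<open>P\<close>;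
  the element \<open>s\<close> outside \<open>P\<close> is the denominator that the localisation
  would allow. The power of \<open>P\<close> appears through products of \<open>n\<close> arbitrary
  elements of \<open>P\<close>, which avoids sums.\<close>

lemma power_in_ideal_away_from_prime:
  assumes P: "prime_id P"
  shows "idl I \<Longrightarrow> a \<in> I \<Longrightarrow> a \<noteq> 0 \<Longrightarrow>
    \<exists>s\<in>OK - P. \<exists>n::nat. \<forall>f. (\<forall>i. f i \<in> P) \<longrightarrow> s * (\<Prod>i<n. f i) \<in> I"
proof (induction "idx OK I" arbitrary: I a rule: less_induct)
  case less
  note I = idlD[OF less.prems(1)]
  consider "\<not> I \<subseteq> P" | "I = P" | "I \<subset> P" by blast
  then show ?case
  proof cases
    case 1
    then obtain s where s: "s \<in> I" "s \<notin> P" by blast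
    show ?thesis by (rule bexI[of _ s], rule exI[of _ "0::nat"]) (use s I(2) in auto)
  next
    case 2
    have "1 * (\<Prod>i<1. f i) \<in> I" if "\<forall>i. f i \<in> P" for f :: "nat \<Rightarrow> qbar"
      using that 2 by simp
    then show ?thesis using prime_idD(2)[OF P] by blast
  next
    \<comment> \<open>A nonzero ideal strictly inside \<open>P\<close> is not prime, since nonzero
      primes are maximal. For \<open>b c\<close> in \<open>I\<close> with \<open>b\<close> and
      \<open>c\<close> outside it, \<open>(I + b O) (I + c O)\<close> lies in \<open>I\<close>, and
      both factors have smaller index.\<close>
    case 3
    have "\<not> prime_id I"
    proof
      assume "prime_id I"
      then have "P = I" by (rule prime_id_maximal) (use prime_idD[OF P] 3 in auto)
      then show False using 3 by simp
    qed
    moreover have "I \<noteq> OK" "I \<noteq> {0}" using 3 prime_idD(2)[OF P] less.prems by auto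
    ultimately obtain b c where bc: "b \<in> OK" "c \<in> OK" "b * c \<in> I" "b \<notin> I" "c \<notin> I"
      using less.prems(1) unfolding prime_id_def by blast
    have ext: "\<exists>s\<in>OK - P. \<exists>n::nat. \<forall>f. (\<forall>i. f i \<in> P) \<longrightarrow> s * (\<Prod>i<n. f i) \<in> extend_idl I b'"
      if b': "b' \<in> OK" "b' \<notin> I" for b'
    proof (rule less.hyps)
      have "I \<subset> extend_idl I b'" using extend_idl_supset[OF less.prems(1), of b'] b'(2) by blast
      then show "idx OK (extend_idl I b') < idx OK I"
        by (rule idx_idl_less[OF less.prems(1) idl_extend[OF less.prems(1) b'(1)] _ less.prems(2,3)])
      show "idl (extend_idl I b')" by (rule idl_extend[OF less.prems(1) b'(1)])
      show "a \<in> extend_idl I b'" using extend_idl_supset(1)[OF less.prems(1)] less.prems(2) by blast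
    qed (rule less.prems(3))
    obtain s1 and n1 :: nat where 1: "s1 \<in> OK - P" "\<And>f. (\<forall>i. f i \<in> P) \<Longrightarrow> s1 * (\<Prod>i<n1. f i) \<in> extend_idl I b"
      using ext[OF bc(1,4)] by blast
    obtain s2 and n2 :: nat where 2: "s2 \<in> OK - P" "\<And>f. (\<forall>i. f i \<in> P) \<Longrightarrow> s2 * (\<Prod>i<n2. f i) \<in> extend_idl I c"
      using ext[OF bc(2,5)] by blast
    have "s1 * s2 * (\<Prod>i<n1 + n2. f i) \<in> I" if f: "\<forall>i. f i \<in> P" for f
    proof -
      have sp: "(\<Prod>i<n1 + n2. f i) = (\<Prod>i<n1. f i) * (\<Prod>i<n2. f (n1 + i))"
        by (induction n2) (simp_all add: mult_ac)
      obtain i1 r1 where e1: "s1 * (\<Prod>i<n1. f i) = i1 + b * r1" "i1 \<in> I" "r1 \<in> OK"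
        using 1(2)[OF f] by (auto simp: extend_idl_def)
      obtain i2 r2 where e2: "s2 * (\<Prod>i<n2. f (n1 + i)) = i2 + c * r2" "i2 \<in> I" "r2 \<in> OK"
        using 2(2)[of "\<lambda>i. f (n1 + i)"] f by (auto simp: extend_idl_def)
      have "s1 * s2 * (\<Prod>i<n1 + n2. f i) = (s1 * (\<Prod>i<n1. f i)) * (s2 * (\<Prod>i<n2. f (n1 + i)))"
        unfolding sp by (simp add: mult_ac)
      also have "\<dots> = (i1 + b * r1) * i2 + ((c * r2) * i1 + (r1 * r2) * (b * c))"
        unfolding e1 e2 by (simp add: algebra_simps)
      also have "\<dots> \<in> I"
      proof (intro subgrp_add[OF I(1)])
        show "(i1 + b * r1) * i2 \<in> I" by (rule I(3)) (use e1 e2 bc I(2)[OF e1(2)] in auto)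
        show "(c * r2) * i1 \<in> I" by (rule I(3)) (use e1 e2 bc in auto)
        show "(r1 * r2) * (b * c) \<in> I" by (rule I(3)) (use e1 e2 bc in auto)
      qed
      finally show ?thesis .
    qed
    then show ?thesis using prime_id_not_mult[OF P 1(1) 2(1)] by blast
  qed
qed

text \<open>The element \<open>t\<close> inverts \<open>P\<close> locally. It is a multiple of a
  quotient \<open>\<tau> = b / a\<close> with \<open>b P\<close> inside \<open>a O\<close> but
  \<open>b\<close> outside \<open>a O\<close>. If \<open>\<tau> P\<close> were contained in
  \<open>P\<close>, all \<open>a \<tau>^k\<close> would be integral, and \<tau> itself would be
  integral by \<open>almost_integral\<close>.\<close>

lemma prime_id_uniformizer:
  assumes P: "prime_id P"
  obtains t q where "t \<in> K" "q \<in> P" "\<And>p. p \<in> P \<Longrightarrow> t * p \<in> OK" "t * q \<in> OK" "t * q \<notin> P" "1 - t * q \<in> P"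
proof -
  note I = prime_idD(1)[OF P]
  obtain a where a: "a \<in> P" "a \<noteq> 0" using prime_idD(3)[OF P] by blast
  have aO: "a \<in> OK" using idlD(2)[OF I a(1)] .
  define A where "A = (*) a ` OK"
  have A: "idl A" unfolding A_def idl_def
  proof (intro conjI ballI)
    show "subgrp ((*) a ` OK)" by (rule subgrp_image_mult[OF subgrp_OK])
    show "x * y \<in> (*) a ` OK" if "x \<in> OK" "y \<in> (*) a ` OK" for x y
      using that by (auto simp: image_iff mult.left_commute intro!: bexI[of _ "x * z" for z])
  qed (use aO in auto)
  have aA: "a \<in> A" unfolding A_def using OK_1 by force
  define good where "good n \<longleftrightarrow> (\<exists>s\<in>OK - P. \<forall>f. (\<forall>i. f i \<in> P) \<longrightarrow> s * (\<Prod>i<n. f i) \<in> A)" for n :: nat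
  \<comment> \<open>Minimality of \<open>n\<close> supplies a product of \<open>n - 1\<close>
    elements of \<open>P\<close> that, multiplied by \<open>s\<close>, stays outside
    \<open>a O\<close>; one more factor from \<open>P\<close> brings it inside.\<close>
  define n where "n = (LEAST n. good n)"
  have "\<exists>n. good n"
    using power_in_ideal_away_from_prime[OF P A aA a(2)] unfolding good_def by blast
  then have n: "good n" "\<And>m. m < n \<Longrightarrow> \<not> good m" unfolding n_def by (auto intro: LeastI_ex dest: not_less_Least)
  then obtain s where s: "s \<in> OK - P" "\<And>f. (\<forall>i. f i \<in> P) \<Longrightarrow> s * (\<Prod>i<n. f i) \<in> A"
    unfolding good_def by blast
  have AP: "A \<subseteq> P" unfolding A_def using idlD(3)[OF I _ a(1)] by (auto simp: mult.commute)
  have "n \<noteq> 0" using s(2)[of "\<lambda>_. a"] a(1) s(1) AP by (cases "n = 0") auto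
  then have "\<not> good (n - 1)" using n(2)[of "n - 1"] by simp
  then obtain f where f: "\<forall>i. f i \<in> P" "s * (\<Prod>i<n - 1. f i) \<notin> A" unfolding good_def using s(1) by blast
  define b where "b = s * (\<Prod>i<n - 1. f i)"
  have bO: "b \<in> OK" unfolding b_def using s(1) f(1) idlD(2)[OF I] by (intro OK_mult OK_prod) auto
  have bp: "b * p \<in> A" if "p \<in> P" for p
  proof -
    have "(\<Prod>i<n. (f(n - 1 := p)) i) = (\<Prod>i<Suc (n - 1). (f(n - 1 := p)) i)" using \<open>n \<noteq> 0\<close> by simp
    also have "\<dots> = (\<Prod>i<n - 1. f i) * p" by simp
    finally have "s * (\<Prod>i<n. (f(n - 1 := p)) i) = b * p" by (simp add: b_def mult_ac)
    then show ?thesis using s(2)[of "f(n - 1 := p)"] f(1) that by auto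
  qed
  define \<tau> where "\<tau> = b / a"
  have \<tau>K: "\<tau> \<in> K" unfolding \<tau>_def using OK_K[OF aO] OK_K[OF bO] by auto
  have \<tau>P: "\<tau> * p \<in> OK" if "p \<in> P" for p
  proof -
    obtain r where "b * p = a * r" "r \<in> OK" using bp[OF \<open>p \<in> P\<close>] by (auto simp: A_def)
    then show ?thesis using a(2) by (simp add: \<tau>_def)
  qed
  have "\<tau> \<notin> OK"
  proof
    assume "\<tau> \<in> OK"
    then have "b \<in> A" unfolding A_def \<tau>_def using a(2) by (auto simp: image_iff intro!: bexI[of _ "b / a"])
    then show False using f(2) by (simp add: b_def)
  qed
  have "\<exists>q\<in>P. \<tau> * q \<notin> P"
  proof (rule ccontr)
    assume "\<not> ?thesis"
    then have "a * \<tau> ^ k \<in> P" for k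
      by (induction k) (use a(1) in \<open>auto simp: mult_ac\<close>)
    then have "\<tau> \<in> OK" using almost_integral[OF \<tau>K aO a(2)] idlD(2)[OF I] by blast
    then show False using \<open>\<tau> \<notin> OK\<close> by simp
  qed
  then obtain q where q: "q \<in> P" "\<tau> * q \<notin> P" by blast
  \<comment> \<open>Scaling by an inverse of \<open>\<tau> q\<close> modulo \<open>P\<close> makes
    \<open>t q\<close> congruent to 1.\<close>
  obtain u where u: "u \<in> OK" "1 - (\<tau> * q) * u \<in> P" using prime_id_inverse[OF P \<tau>P[OF q(1)] q(2)] by blast
  show ?thesis
  proof (rule that[of "u * \<tau>" q])
    show "u * \<tau> \<in> K" using \<tau>K OK_K[OF u(1)] by auto
    show "u * \<tau> * p \<in> OK" if "p \<in> P" for p using OK_mult[OF u(1) \<tau>P[OF that]] by (simp add: mult.assoc)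
    then show "u * \<tau> * q \<in> OK" using q(1) .
    show m: "1 - u * \<tau> * q \<in> P" using u(2) by (simp add: mult_ac)
    show "u * \<tau> * q \<notin> P"
      using subgrp_add[OF idlD(1)[OF I] m, of "u * \<tau> * q"] prime_idD(2)[OF P] by auto
  qed (rule q(1))
qed

end

text \<open>The pair is fixed once: \<open>q\<close> serves as a uniformizer at \<open>P\<close> and
  \<open>t\<close> as its inverse up to a unit. The congruence of \<open>t q\<close> to 1 modulo
  \<open>P\<close> is what later splits elements of powers of \<open>P\<close> into
  products.\<close>

locale nf_prime = nf +
  fixes P :: "qbar set" and t q :: qbar
  assumes P: "prime_id P" and tK: "t \<in> K" and qP: "q \<in> P" and tP: "p \<in> P \<Longrightarrow> t * p \<in> OK"
    and tq: "t * q \<in> OK" "t * q \<notin> P" "1 - t * q \<in> P"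
begin

lemmas PI = prime_idD(1)[OF P]
lemmas not_mult = prime_id_not_mult[OF P]

lemma q_OK: "q \<in> OK" using idlD(2)[OF PI qP] .

lemma qt_nonzero: "q \<noteq> 0" "t \<noteq> 0"
  using tq(2) subgrp_0[OF idlD(1)[OF PI]] by auto

lemma not_P_power: "a \<in> OK - P \<Longrightarrow> a ^ n \<in> OK - P"
  by (induction n) (use not_mult prime_idD(2)[OF P] in auto)

lemma not_P_nonzero: "a \<in> OK - P \<Longrightarrow> a \<noteq> 0"
  using subgrp_0[OF idlD(1)[OF PI]] by auto

text \<open>Order \<open>n\<close> at \<open>P\<close> means \<open>a = (u / s) q^n\<close> with
  \<open>u\<close> and \<open>s\<close> outside \<open>P\<close>. As a relation it can be handled
  before existence and uniqueness are known.\<close>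

definition V :: "qbar \<Rightarrow> int \<Rightarrow> bool" where
  "V a n \<longleftrightarrow> (\<exists>s\<in>OK - P. \<exists>u\<in>OK - P. s * a = u * q powi n)"

lemma V_nonzero: "V a n \<Longrightarrow> a \<noteq> 0"
  unfolding V_def using not_P_nonzero qt_nonzero by fastforce

lemma V_mult:
  assumes "V a n" "V b m"
  shows "V (a * b) (n + m)"
proof -
  obtain s u s' u' where *: "s \<in> OK - P" "u \<in> OK - P" "s' \<in> OK - P" "u' \<in> OK - P"
    and e: "s * a = u * q powi n" "s' * b = u' * q powi m" using assms unfolding V_def by blast
  have "(s * s') * (a * b) = (s * a) * (s' * b)" by (simp add: mult_ac)
  also have "\<dots> = (u * u') * q powi (n + m)" unfolding e using qt_nonzero by (simp add: power_int_add mult_ac)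
  finally show ?thesis unfolding V_def using not_mult * by blast
qed

lemma V_inverse:
  assumes "V a n"
  shows "V (inverse a) (- n)"
proof -
  obtain s u where *: "s \<in> OK - P" "u \<in> OK - P" "s * a = u * q powi n" using assms unfolding V_def by blast
  have "u * inverse a = s * q powi (- n)"
    using *(3) V_nonzero[OF assms] qt_nonzero(1) by (simp add: power_int_minus field_simps)
  then show ?thesis unfolding V_def using * by blast
qed

lemma V_unique_aux:
  assumes "V a n" "V a m"
  shows "\<not> n < m"
proof
  assume nm: "n < m"
  obtain s u s' u' where *: "s \<in> OK - P" "u \<in> OK - P" "s' \<in> OK - P" "u' \<in> OK - P"
    and e: "s * a = u * q powi n" "s' * a = u' * q powi m" using assms unfolding V_def by blast
  define k where "k = nat (m - n)"
  have k: "k > 0" "q powi m = q powi n * q ^ k"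
  proof -
    have "m = n + int k" using nm by (simp add: k_def)
    then show "q powi m = q powi n * q ^ k" using qt_nonzero by (simp add: power_int_add)
  qed (use nm in \<open>simp add: k_def\<close>)
  have "(s' * u) * q powi n = (s * u' * q ^ k) * q powi n"
    using e k(2) by (metis mult.assoc mult.commute)
  then have "s' * u = s * u' * q ^ k" using qt_nonzero by simp
  also have "s * u' * q ^ k = (s * u' * q ^ (k - 1)) * q"
    using k(1) by (cases k) (auto simp: mult_ac)
  also have "\<dots> \<in> P" by (rule idlD(3)[OF PI _ qP]) (use * q_OK in auto)
  finally show False using not_mult[OF *(3,2)] by blast
qed

lemma V_unique: "V a n \<Longrightarrow> V a m \<Longrightarrow> n = m"
  using V_unique_aux[of a n m] V_unique_aux[of a m n] by force

text \<open>A description of the \<open>n\<close>-th power of \<open>P\<close> by divisibility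
  instead of sums of products; \<open>ideal_power_eq_pw\<close> proves the equality.\<close>

definition pw :: "nat \<Rightarrow> qbar set" where
  "pw n = {a \<in> OK. \<forall>j\<le>n. t ^ j * a \<in> OK}"

text \<open>The order is the last \<open>n\<close> up to which the numbers \<open>t^j a\<close> stay
  integral. It exists, since otherwise \<open>t\<close> would be integral by
  \<open>almost_integral\<close> and \<open>t q\<close> would lie in \<open>P\<close>. The number
  \<open>t^n a\<close> is outside \<open>P\<close>, since \<open>t\<close> times it is not
  integral.\<close>

lemma V_ex:
  assumes a: "a \<in> OK" "a \<noteq> 0"
  obtains n where "V a (int n)" "\<And>m. a \<in> pw m \<longleftrightarrow> m \<le> n"
proof -
  have "\<exists>k. a * t ^ k \<notin> OK"
  proof (rule ccontr)
    assume "\<not> ?thesis"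
    then have "t \<in> OK" using almost_integral[OF tK a] by blast
    then show False using idlD(3)[OF PI _ qP] tq(2) by blast
  qed
  define N where "N = (LEAST k. a * t ^ k \<notin> OK)"
  have N: "a * t ^ N \<notin> OK" "\<And>j. j < N \<Longrightarrow> a * t ^ j \<in> OK"
    unfolding N_def using LeastI_ex[OF \<open>\<exists>k. a * t ^ k \<notin> OK\<close>] by (auto dest: not_less_Least)
  then have "N \<noteq> 0" using a(1) by (cases "N = 0") auto
  then obtain n where n: "N = Suc n" by (cases N) auto
  define u where "u = t ^ n * a"
  have u: "u \<in> OK" using N(2)[of n] n by (simp add: u_def mult.commute)
  have "u \<notin> P"
  proof
    assume "u \<in> P"
    then have "t * u \<in> OK" by (rule tP)
    then show False using N(1) by (simp add: n u_def mult_ac)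
  qed
  moreover have "(t * q) ^ n \<in> OK - P" using not_P_power[of "t * q"] tq by blast
  moreover have "(t * q) ^ n * a = u * q powi int n" by (simp add: u_def power_mult_distrib mult_ac)
  ultimately have "V a (int n)" unfolding V_def using u by blast
  moreover have "a \<in> pw m \<longleftrightarrow> m \<le> n" for m
  proof
    assume "a \<in> pw m"
    then have "j \<le> m \<Longrightarrow> a * t ^ j \<in> OK" for j unfolding pw_def by (simp add: mult.commute)
    then show "m \<le> n" using N(1) n by (metis not_less_eq_eq)
  next
    assume "m \<le> n"
    then show "a \<in> pw m" using N(2) n a(1) unfolding pw_def by (auto simp: mult.commute)
  qed
  ultimately show ?thesis using that by blast
qed

lemma V_nonneg: "a \<in> OK \<Longrightarrow> V a n \<Longrightarrow> n \<ge> 0"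
  using V_ex[of a] V_unique V_nonzero by (metis of_nat_0_le_iff)

lemma V_pos_iff:
  assumes "a \<in> OK" "V a n"
  shows "a \<in> P \<longleftrightarrow> n > 0"
proof -
  obtain s u where *: "s \<in> OK - P" "u \<in> OK - P" "s * a = u * q powi n" using assms unfolding V_def by blast
  have n: "n \<ge> 0" by (rule V_nonneg[OF assms])
  have sa: "s * a \<in> P \<longleftrightarrow> a \<in> P" using prime_idD(4)[OF P, of s a] idlD(3)[OF PI, of s a] * assms(1) by blast
  show ?thesis
  proof (cases "n = 0")
    case True
    then show ?thesis using * sa by simp
  next
    case False
    then obtain k where "n = int (Suc k)" using n by (metis gr0_conv_Suc nat_0_iff nonneg_int_cases of_nat_0_less_iff order_le_less)
    then have "s * a = (u * q ^ k) * q" using * by (simp add: mult_ac power_int_def nat_add_distrib)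
    also have "\<dots> \<in> P" by (rule idlD(3)[OF PI _ qP]) (use * q_OK in auto)
    finally show ?thesis using sa False n by auto
  qed
qed

lemma V_K_ex:
  assumes "a \<in> K" "a \<noteq> 0"
  obtains n where "V a n"
proof -
  obtain E :: nat where E: "E > 0" "of_nat E * a \<in> OK" using K_multiple_in_OK[OF assms(1)] by blast
  obtain n where n: "V (of_nat E * a) (int n)" using V_ex[OF E(2)] E(1) assms(2) by auto
  obtain m where "V (of_nat E) (int m)" using V_ex[OF OK_of_nat, of E] E(1) by auto
  from V_mult[OF n V_inverse[OF this]] have "V (of_nat E * a * inverse (of_nat E)) (int n - int m)" by simp
  moreover have "of_nat E * a * inverse (of_nat E) = a" using E(1) by simp
  ultimately show ?thesis using that by simp
qed

text \<open>After clearing denominators and taking out \<open>q^n\<close> with the smaller exponent,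
  the sum becomes \<open>w q^n\<close> with \<open>w\<close> integral, and integral elements have
  order at least 0.\<close>

lemma V_add:
  assumes ab: "V a n" "V b m" "V (a + b) k"
  shows "min n m \<le> k"
proof -
  have *: "n \<le> k" if ab: "V a n" "V b m" "V (a + b) k" and nm: "n \<le> m" for a b n m
  proof -
    obtain s u s' u' where *: "s \<in> OK - P" "u \<in> OK - P" "s' \<in> OK - P" "u' \<in> OK - P"
      and e: "s * a = u * q powi n" "s' * b = u' * q powi m" using ab unfolding V_def by blast
    define l where "l = nat (m - n)"
    have ql: "q powi m = q powi n * q ^ l"
    proof -
      have "m = n + int l" using nm by (simp add: l_def)
      then show ?thesis using qt_nonzero by (simp add: power_int_add)
    qed
    define w where "w = s' * u + s * u' * q ^ l"
    have w: "w \<in> OK" unfolding w_def using * q_OK by (intro OK_add OK_mult OK_power) auto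
    have eq: "(s * s') * (a + b) = w * q powi n"
    proof -
      have "(s * s') * (a + b) = s' * (s * a) + s * (s' * b)" by (simp add: algebra_simps)
      then show ?thesis unfolding e ql w_def by (simp add: algebra_simps)
    qed
    have V1: "V c 0" if "c \<in> OK - P" for c
      unfolding V_def by (intro bexI[of _ 1] bexI[of _ c]) (use that prime_idD(2)[OF P] in auto)
    have "V ((s * s') * (a + b)) (0 + k)" by (intro V_mult V1 ab(3) not_mult *)
    then have wk: "V (w * q powi n) k" unfolding eq by simp
    then have "w \<noteq> 0" using V_nonzero by fastforce
    then obtain j where j: "V w (int j)" using V_ex[OF w] by blast
    have "V (q powi n) n" unfolding V_def
      by (intro bexI[of _ 1]) (use prime_idD(2)[OF P] in auto)
    from V_unique[OF V_mult[OF j this] wk] show ?thesis by simp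
  qed
  show ?thesis
    using *[of a n b m] *[of b m a n] ab by (cases "n \<le> m") (auto simp: add.commute)
qed

lemma V_t: "V t (-1)"
proof -
  have "V (inverse q) (-1)"
    unfolding V_def by (intro bexI[of _ 1]) (use prime_idD(2)[OF P] in \<open>auto simp: power_int_minus\<close>)
  moreover have "V (t * q) 0"
    unfolding V_def by (intro bexI[of _ 1] bexI[of _ "t * q"]) (use prime_idD(2)[OF P] tq in auto)
  ultimately have "V (t * q * inverse q) (0 + -1)" by (intro V_mult)
  moreover have "t * q * inverse q = t" using qt_nonzero by simp
  ultimately show ?thesis by simp
qed

lemma V_fraction:
  assumes "V a n" "n \<ge> 0"
  obtains s where "s \<in> OK - P" "s * a \<in> OK"
proof -
  obtain s u where *: "s \<in> OK - P" "u \<in> OK - P" "s * a = u * q powi n" using assms unfolding V_def by blast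
  have "q powi n = q ^ nat n" using assms(2) by (simp add: power_int_def)
  then have "s * a \<in> OK" using * q_OK by auto
  then show ?thesis using that * by blast
qed

lemma ideal_power_eq_pw: "P [^]\<^bsub>ideals_set (nf_integers K)\<^esub> n = pw n"
proof (induction n)
  case 0
  have "carrier (nf_integers K) = OK" by (simp add: nf_integers_def OK_def ints_def)
  then show ?case by (simp add: nat_pow_def ideals_set_def pw_def)
next
  case (Suc n)
  let ?R = "nf_integers K"
  have m: "a \<otimes>\<^bsub>?R\<^esub> b = a * b" "a \<oplus>\<^bsub>?R\<^esub> b = a + b" for a b
    by (simp_all add: nf_integers_def ring_of_type_algebra_def)
  have "P [^]\<^bsub>ideals_set ?R\<^esub> Suc n = ideal_prod ?R (pw n) P"
    using Suc by (simp add: nat_pow_def ideals_set_def)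
  also have "\<dots> = pw (Suc n)"
  proof (intro equalityI subsetI)
    fix y assume "y \<in> ideal_prod ?R (pw n) P"
    then show "y \<in> pw (Suc n)"
    proof induction
      case (prod a p)
      have p: "p \<in> OK" "t * p \<in> OK" using idlD(2)[OF PI] tP prod by auto
      have "t ^ j * (a * p) \<in> OK" if "j \<le> Suc n" for j
      proof (cases "j \<le> n")
        case True
        then have "(t ^ j * a) * p \<in> OK" using prod(1) p(1) by (auto simp: pw_def)
        then show ?thesis by (simp add: mult_ac)
      next
        case False
        then have "j = Suc n" using that by simp
        moreover have "(t ^ n * a) * (t * p) \<in> OK" using prod(1) p(2) by (auto simp: pw_def)
        ultimately show ?thesis by (simp add: mult_ac)
      qed
      then show ?case using prod p by (auto simp: pw_def m)
    next
      case (sum a b)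
      then show ?case by (auto simp: pw_def m distrib_left)
    qed
  next
    fix a assume a: "a \<in> pw (Suc n)"
    \<comment> \<open>The splitting \<open>a = (t a) q + a (1 - t q)\<close> writes \<open>a\<close>
      as a sum of two products, each of an element of \<open>pw n\<close> and an element of
      \<open>P\<close>.\<close>
    have "t * a \<in> pw n"
      using a by (auto simp: pw_def dest: spec[of _ "Suc _"] simp flip: power_Suc2 mult.assoc)
    then have "(t * a) * q \<in> ideal_prod ?R (pw n) P" using ideal_prod.prod[of "t * a" "pw n" q P ?R] qP by (simp add: m)
    moreover have "a * (1 - t * q) \<in> ideal_prod ?R (pw n) P"
      using ideal_prod.prod[of a "pw n" "1 - t * q" P ?R] tq(3) a by (simp add: m pw_def)
    ultimately have "(t * a) * q + a * (1 - t * q) \<in> ideal_prod ?R (pw n) P"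
      using ideal_prod.sum[of _ ?R "pw n" P] by (metis m(2))
    then show "a \<in> ideal_prod ?R (pw n) P" by (simp add: algebra_simps)
  qed
  finally show ?case .
qed

lemma V_prime_ord_int:
  assumes "a \<in> OK" "a \<noteq> 0"
  shows "V a (int (prime_ord_int K P a))"
proof -
  obtain n where n: "V a (int n)" "\<And>m. a \<in> pw m \<longleftrightarrow> m \<le> n" using V_ex[OF assms] by blast
  have "prime_ord_int K P a = n"
    unfolding prime_ord_int_def ideal_power_eq_pw by (rule Greatest_equality) (simp_all add: n)
  then show ?thesis using n by simp
qed

text \<open>Multiplicativity and uniqueness of \<open>V\<close> give independence of the fraction
  \<open>a / b\<close>, so that the definite description in \<open>prime_ord\<close>
  denotes.\<close>

lemma V_prime_ord:
  assumes "a \<in> K" "a \<noteq> 0"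
  shows "V a (prime_ord K P a)"
proof -
  obtain n where n: "V a n" using V_K_ex[OF assms] by blast
  have c: "carrier (nf_integers K) = OK" by (simp add: nf_integers_def OK_def ints_def)
  have "prime_ord K P a = n"
    unfolding prime_ord_def c
  proof (rule the_equality)
    obtain E :: nat where E: "E > 0" "of_nat E * a \<in> OK" using K_multiple_in_OK[OF assms(1)] by blast
    have e: "of_nat E * a \<noteq> 0" "of_nat E \<noteq> (0 :: qbar)" using E(1) assms(2) by auto
    have "V ((of_nat E * a) * inverse (of_nat E))
        (int (prime_ord_int K P (of_nat E * a)) + - int (prime_ord_int K P (of_nat E)))"
      by (intro V_mult V_inverse V_prime_ord_int E(2) e OK_of_nat)
    moreover have "of_nat E * a * inverse (of_nat E) = a" using E(1) by simp
    ultimately have "n = int (prime_ord_int K P (of_nat E * a)) - int (prime_ord_int K P (of_nat E))"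
      using V_unique[OF n] by simp
    then show "\<exists>a'\<in>OK - {0}. \<exists>b\<in>OK - {0}. a = a' / b \<and> n = int (prime_ord_int K P a') - int (prime_ord_int K P b)"
      using E e by (intro bexI[of _ "of_nat E * a"] bexI[of _ "of_nat E"]) auto
  next
    fix k assume "\<exists>a'\<in>OK - {0}. \<exists>b\<in>OK - {0}. a = a' / b \<and> k = int (prime_ord_int K P a') - int (prime_ord_int K P b)"
    then obtain a' b where ab: "a' \<in> OK" "a' \<noteq> 0" "b \<in> OK" "b \<noteq> 0" "a = a' / b"
      "k = int (prime_ord_int K P a') - int (prime_ord_int K P b)" by blast
    have "V (a' * inverse b) (int (prime_ord_int K P a') + - int (prime_ord_int K P b))"
      by (intro V_mult V_inverse V_prime_ord_int ab)
    then show "k = n" using V_unique[OF n] ab by (simp add: divide_inverse)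
  qed
  then show ?thesis using n by simp
qed

end

section \<open>Orders at all primes of one number field\<close>

context nf
begin

lemma nf_prime_ex:
  assumes "prime_id P"
  obtains t q where "nf_prime \<gamma> P t q"
  using prime_id_uniformizer[OF assms] assms int_gen by (metis nf_axioms nf_prime.intro nf_prime_axioms.intro)

abbreviation "val P \<equiv> prime_ord K P"

lemma val_mult:
  assumes "prime_id P" "a \<in> K" "b \<in> K" "a \<noteq> 0" "b \<noteq> 0"
  shows "val P (a * b) = val P a + val P b"
proof -
  obtain t q where "nf_prime \<gamma> P t q" using nf_prime_ex[OF assms(1)] .
  then interpret nf_prime \<gamma> P t q .
  show ?thesis
    using V_mult[OF V_prime_ord V_prime_ord] V_prime_ord[of "a * b"] assms V_unique by (metis mult_eq_0_iff qf_mult)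
qed

lemma val_1:
  assumes "prime_id P"
  shows "val P 1 = 0"
  using val_mult[OF assms, of 1 1] qf_1 by auto

lemma val_inverse:
  assumes "prime_id P" "a \<in> K" "a \<noteq> 0"
  shows "val P (inverse a) = - val P a"
  using val_mult[OF assms(1,2), of "inverse a"] assms val_1[OF assms(1)] by (simp add: qf_inverse)

lemma val_power:
  assumes "prime_id P" "a \<in> K" "a \<noteq> 0"
  shows "val P (a ^ k) = int k * val P a"
  by (induction k) (use assms in \<open>auto simp: val_1 val_mult[OF assms(1,2) qf_power[OF assms(2)] assms(3)] algebra_simps\<close>)

lemma val_add:
  assumes "prime_id P" "a \<in> K" "b \<in> K" "a \<noteq> 0" "b \<noteq> 0" "a + b \<noteq> 0"
  shows "min (val P a) (val P b) \<le> val P (a + b)"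
proof -
  obtain t q where "nf_prime \<gamma> P t q" using nf_prime_ex[OF assms(1)] .
  then interpret nf_prime \<gamma> P t q .
  show ?thesis
    by (rule V_add[OF V_prime_ord V_prime_ord V_prime_ord]) (use assms in auto)
qed

lemma val_nonneg:
  assumes "prime_id P" "a \<in> OK" "a \<noteq> 0"
  shows "0 \<le> val P a"
proof -
  obtain t q where "nf_prime \<gamma> P t q" using nf_prime_ex[OF assms(1)] .
  then interpret nf_prime \<gamma> P t q .
  show ?thesis by (rule V_nonneg[OF assms(2) V_prime_ord]) (use assms OK_K in auto)
qed

lemma val_pos_iff:
  assumes "prime_id P" "a \<in> OK" "a \<noteq> 0"
  shows "a \<in> P \<longleftrightarrow> 0 < val P a"
proof -
  obtain t q where "nf_prime \<gamma> P t q" using nf_prime_ex[OF assms(1)] .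
  then interpret nf_prime \<gamma> P t q .
  show ?thesis by (rule V_pos_iff[OF assms(2) V_prime_ord]) (use assms OK_K in auto)
qed

lemma val_fraction:
  assumes "prime_id P" "a \<in> K" "a \<noteq> 0" "0 \<le> val P a"
  obtains s where "s \<in> OK" "s \<notin> P" "s * a \<in> OK"
proof -
  obtain t q where "nf_prime \<gamma> P t q" using nf_prime_ex[OF assms(1)] .
  then interpret nf_prime \<gamma> P t q .
  show ?thesis using V_fraction[OF V_prime_ord[OF assms(2,3)] assms(4)] that by blast
qed

lemma val_ge_add:
  assumes P: "prime_id P" and "a \<in> K" "b \<in> K" "a + b \<noteq> 0"
    and "a \<noteq> 0 \<Longrightarrow> n \<le> val P a" "b \<noteq> 0 \<Longrightarrow> n \<le> val P b"
  shows "n \<le> val P (a + b)"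
  using assms val_add[OF P, of a b] by (cases "a = 0"; cases "b = 0") auto

lemma val_ge_sum:
  assumes P: "prime_id P" and "\<And>i. i \<in> I \<Longrightarrow> f i \<in> K" "\<And>i. i \<in> I \<Longrightarrow> f i \<noteq> 0 \<Longrightarrow> n \<le> val P (f i)"
    "sum f I \<noteq> 0"
  shows "n \<le> val P (sum f I)"
  using assms(2-)
proof (induction I rule: infinite_finite_induct)
  case (insert i I)
  show ?case unfolding sum.insert[OF insert.hyps]
    by (rule val_ge_add[OF P]) (use insert in \<open>auto intro!: qf_sum\<close>)
qed auto

lemma prime_id_subset_eq:
  assumes "prime_id P" "prime_id Q" "P \<subseteq> Q"
  shows "P = Q"
  using prime_id_maximal[of P Q] prime_idD[of Q] assms by blast

text \<open>At another prime \<open>Q\<close> some \<open>p\<close> in \<open>P\<close> has order 0,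
  and \<open>t p\<close> is integral, so \<open>t\<close> has no pole at \<open>Q\<close>.\<close>

lemma inverse_uniformizer:
  assumes P: "prime_id P"
  obtains t where "t \<in> K" "t \<noteq> 0" "val P t = -1" "\<And>p. p \<in> P \<Longrightarrow> t * p \<in> OK"
    "\<And>Q. prime_id Q \<Longrightarrow> Q \<noteq> P \<Longrightarrow> 0 \<le> val Q t"
proof -
  obtain t q where "nf_prime \<gamma> P t q" using nf_prime_ex[OF P] .
  then interpret nf_prime \<gamma> P t q .
  have "val Q t \<ge> 0" if Q: "prime_id Q" "Q \<noteq> P" for Q
  proof -
    obtain p where p: "p \<in> P" "p \<notin> Q" using prime_id_subset_eq[OF P Q(1)] Q(2) by blast
    have p0: "p \<noteq> 0" "p \<in> OK" using p idlD(2)[OF PI] subgrp_0[OF idlD(1)[OF prime_idD(1)[OF Q(1)]]] by auto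
    have "val Q p = 0" using val_pos_iff[OF Q(1) p0(2,1)] val_nonneg[OF Q(1) p0(2,1)] p by simp
    moreover have "val Q (t * p) \<ge> 0" by (rule val_nonneg[OF Q(1) tP[OF p(1)]]) (use p0 qt_nonzero in auto)
    ultimately show ?thesis using val_mult[OF Q(1) tK OK_K[OF p0(2)] qt_nonzero(2) p0(1)] by simp
  qed
  moreover have "val P t = -1" using V_unique[OF V_prime_ord[OF tK qt_nonzero(2)] V_t] .
  ultimately show ?thesis using that tK qt_nonzero tP by blast
qed

section \<open>Norms of ideals\<close>

text \<open>The order of an ideal as an attained minimum over its nonzero elements. It is a
  relation, since the zero ideal has no such minimum.\<close>

definition isv :: "qbar set \<Rightarrow> qbar set \<Rightarrow> nat \<Rightarrow> bool" where
  "isv P I n \<longleftrightarrow> (\<exists>a\<in>I. a \<noteq> 0 \<and> val P a = int n) \<and> (\<forall>a\<in>I. a \<noteq> 0 \<longrightarrow> int n \<le> val P a)"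

lemma isv_unique: "isv P I n \<Longrightarrow> isv P I m \<Longrightarrow> n = m"
  unfolding isv_def by (metis of_nat_le_iff order_antisym)

lemma isv_ex:
  assumes "prime_id P" "idl I" "a \<in> I" "a \<noteq> 0"
  shows "\<exists>n. isv P I n"
proof -
  define n where "n = (LEAST n. \<exists>b\<in>I. b \<noteq> 0 \<and> val P b = int n)"
  have nat: "\<exists>n. val P b = int n" if "b \<in> I" "b \<noteq> 0" for b
    using val_nonneg[OF assms(1) idlD(2)[OF assms(2) that(1)] that(2)] by (metis nonneg_int_cases)
  have "\<exists>n. \<exists>b\<in>I. b \<noteq> 0 \<and> val P b = int n" using nat[OF assms(3,4)] assms(3,4) by blast
  then have "\<exists>b\<in>I. b \<noteq> 0 \<and> val P b = int n" unfolding n_def by (rule LeastI_ex)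
  moreover have "int n \<le> val P b" if "b \<in> I" "b \<noteq> 0" for b
    using nat[OF that] that unfolding n_def by (metis (mono_tags, lifting) Least_le of_nat_le_iff)
  ultimately show ?thesis unfolding isv_def by blast
qed

definition vI :: "qbar set \<Rightarrow> qbar set \<Rightarrow> nat" where
  "vI P I = (THE n. isv P I n)"

lemma vI_eq: "isv P I n \<Longrightarrow> vI P I = n"
  unfolding vI_def by (rule the_equality) (auto intro: isv_unique)

lemma isv_pos_iff:
  assumes "prime_id P" "idl I" "isv P I n"
  shows "I \<subseteq> P \<longleftrightarrow> n > 0"
proof
  assume "I \<subseteq> P"
  obtain a where "a \<in> I" "a \<noteq> 0" "val P a = int n" using assms(3) by (auto simp: isv_def)
  then show "n > 0" using val_pos_iff[OF assms(1), of a] idlD(2)[OF assms(2)] \<open>I \<subseteq> P\<close> by auto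
next
  assume n: "n > 0"
  show "I \<subseteq> P"
  proof
    fix a assume a: "a \<in> I"
    show "a \<in> P"
    proof (cases "a = 0")
      case True
      then show ?thesis using subgrp_0[OF idlD(1)[OF prime_idD(1)[OF assms(1)]]] by simp
    next
      case False
      then have "int n \<le> val P a" using assms(3) a by (auto simp: isv_def)
      then show ?thesis using val_pos_iff[OF assms(1) idlD(2)[OF assms(2) a] False] n by simp
    qed
  qed
qed

lemma ex_prime_above:
  assumes I: "idl I" "a \<in> I" "a \<noteq> 0" "1 \<notin> I"
  obtains P where "prime_id P" "I \<subseteq> P"
proof -
  \<comment> \<open>A proper ideal above \<open>I\<close> of least index is prime: adjoining a
    further element lowers the index, so the enlarged ideal must contain 1.\<close>
  obtain J where J: "idl J \<and> I \<subseteq> J \<and> 1 \<notin> J" "\<And>J'. idl J' \<and> I \<subseteq> J' \<and> 1 \<notin> J' \<Longrightarrow> idx OK J \<le> idx OK J'"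
    using ex_has_least_nat[of "\<lambda>J. idl J \<and> I \<subseteq> J \<and> 1 \<notin> J" I "idx OK"] I by blast
  have "prime_id J"
    unfolding prime_id_def
  proof (intro conjI ballI impI)
    show "J \<noteq> OK" "J \<noteq> {0}" using J I by auto
    fix u v assume uv: "u \<in> OK" "v \<in> OK" "u * v \<in> J"
    show "u \<in> J \<or> v \<in> J"
    proof (rule ccontr)
      assume *: "\<not> ?thesis"
      let ?J' = "extend_idl J u"
      have J': "idl ?J'" "J \<subset> ?J'" using idl_extend[of J u] extend_idl_supset[of J u] J uv * by auto
      have "idx OK ?J' < idx OK J" using idx_idl_less[of J ?J' a] J J' I by blast
      then have "1 \<in> ?J'" using J(2)[of ?J'] J(1) J' by fastforce
      then obtain j r where jr: "1 = j + u * r" "j \<in> J" "r \<in> OK" by (auto simp: extend_idl_def)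
      have "v = v * j + r * (u * v)" using arg_cong[OF jr(1), of "\<lambda>z. v * z"] by (simp add: algebra_simps)
      also have "\<dots> \<in> J" using J(1) uv jr by (intro subgrp_add[of J] idlD(1) idlD(3)[of J v] idlD(3)[of J r]) auto
      finally show False using * by simp
    qed
  qed (use J in auto)
  then show ?thesis using that J by blast
qed

text \<open>Induction on the index. With \<open>t\<close> the inverse uniformizer at a prime
  \<open>P\<close> above \<open>I\<close>, the ideal \<open>J = I + t I\<close> stands for
  \<open>P^(-1) I\<close>: its order drops by one at \<open>P\<close> and is unchanged elsewhere,
  and \<open>J / I\<close> has as many elements as \<open>O / P\<close>.\<close>

lemma idx_eq_prod_norms:
  assumes "idl I" "a \<in> I" "a \<noteq> 0"
  shows "finite {P. prime_id P \<and> I \<subseteq> P} \<and> idx OK I = (\<Prod>P | prime_id P \<and> I \<subseteq> P. idx OK P ^ vI P I)"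
  using assms
proof (induction "idx OK I" arbitrary: I a rule: less_induct)
  case less
  note I = less.prems
  show ?case
  proof (cases "1 \<in> I")
    case True
    then have "I = OK" by (rule idl_eq_OK[OF I(1)])
    then have "{P. prime_id P \<and> I \<subseteq> P} = {}" using prime_idD(2) by blast
    then show ?thesis using \<open>I = OK\<close> idx_self[OF subgrp_OK] by (simp only:) simp
  next
    case False
    then obtain P where P: "prime_id P" "I \<subseteq> P" using ex_prime_above[OF I] by blast
    obtain t where t: "t \<in> K" "t \<noteq> 0" "val P t = -1" "\<And>p. p \<in> P \<Longrightarrow> t * p \<in> OK"
      "\<And>Q. prime_id Q \<Longrightarrow> Q \<noteq> P \<Longrightarrow> 0 \<le> val Q t" using inverse_uniformizer[OF P(1)] by blast
    note sI = idlD(1)[OF I(1)]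
    define J where "J = {i + t * j | i j. i \<in> I \<and> j \<in> I}"
    have J: "idl J" unfolding idl_def
    proof (intro conjI ballI subsetI)
      show "y \<in> OK" if "y \<in> J" for y using that t(4) P(2) idlD(2)[OF I(1)] unfolding J_def by blast
      show "subgrp J" unfolding subgrp_def
      proof (intro conjI ballI)
        show "0 \<in> J" unfolding J_def by (intro CollectI exI[of _ 0]) (auto simp: subgrp_0[OF sI])
        fix y z assume "y \<in> J" "z \<in> J"
        then obtain i j i' j' where "y = i + t * j" "z = i' + t * j'" "i \<in> I" "j \<in> I" "i' \<in> I" "j' \<in> I"
          by (auto simp: J_def)
        then show "y - z \<in> J" unfolding J_def
          by (intro CollectI exI[of _ "i - i'"] exI[of _ "j - j'"]) (auto simp: algebra_simps subgrp_diff[OF sI])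
      qed
      fix u y assume "u \<in> OK" "y \<in> J"
      then obtain i j where "y = i + t * j" "i \<in> I" "j \<in> I" by (auto simp: J_def)
      then show "u * y \<in> J" unfolding J_def using \<open>u \<in> OK\<close>
        by (intro CollectI exI[of _ "u * i"] exI[of _ "u * j"]) (auto simp: distrib_left mult.left_commute[of u] idlD(3)[OF I(1)])
    qed
    have tJ: "t * j \<in> J" if "j \<in> I" for j
      unfolding J_def by (intro CollectI exI[of _ 0] exI[of _ j]) (auto simp: subgrp_0[OF sI] that)
    have IJ: "I \<subseteq> J"
      unfolding J_def by (intro subsetI CollectI, rule_tac x = x in exI, rule exI[of _ 0]) (auto simp: subgrp_0[OF sI])
    have IK: "i \<in> K" if "i \<in> I" for i using OK_K[OF idlD(2)[OF I(1) that]] .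
    obtain n where n: "isv P I n" using isv_ex[OF P(1) I] by blast
    obtain b where b: "b \<in> I" "b \<noteq> 0" "val P b = int n" using n by (auto simp: isv_def)
    have npos: "n > 0" using isv_pos_iff[OF P(1) I(1) n] P(2) by simp
    have valtb: "val P (t * b) = int n - 1" using val_mult[OF P(1) t(1) IK[OF b(1)] t(2) b(2)] b(3) t(3) by simp
    have isvP: "isv P J (n - 1)" unfolding isv_def
    proof (intro conjI ballI impI)
      show "\<exists>a\<in>J. a \<noteq> 0 \<and> val P a = int (n - 1)"
        by (rule bexI[OF _ tJ[OF b(1)]]) (use valtb npos t(2) b(2) in auto)
      fix y assume y: "y \<in> J" "y \<noteq> 0"
      then obtain i j where ij: "y = i + t * j" "i \<in> I" "j \<in> I" by (auto simp: J_def)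
      show "int (n - 1) \<le> val P y" unfolding ij(1)
      proof (rule val_ge_add[OF P(1)])
        show "i \<noteq> 0 \<Longrightarrow> int (n - 1) \<le> val P i" using n ij(2) unfolding isv_def by fastforce
        show "t * j \<noteq> 0 \<Longrightarrow> int (n - 1) \<le> val P (t * j)"
          using val_mult[OF P(1) t(1) IK[OF ij(3)] t(2)] n ij(3) npos t(3) unfolding isv_def by fastforce
      qed (use IK ij t(1) y in auto)
    qed
    have isvQ: "isv Q J m" if Q: "prime_id Q" "Q \<noteq> P" and m: "isv Q I m" for Q m
      unfolding isv_def
    proof (intro conjI ballI impI)
      show "\<exists>a\<in>J. a \<noteq> 0 \<and> val Q a = int m" using m IJ unfolding isv_def by blast
      fix y assume y: "y \<in> J" "y \<noteq> 0"
      then obtain i j where ij: "y = i + t * j" "i \<in> I" "j \<in> I" by (auto simp: J_def)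
      show "int m \<le> val Q y" unfolding ij(1)
      proof (rule val_ge_add[OF Q(1)])
        show "i \<noteq> 0 \<Longrightarrow> int m \<le> val Q i" using m ij(2) unfolding isv_def by blast
        show "t * j \<noteq> 0 \<Longrightarrow> int m \<le> val Q (t * j)"
          using val_mult[OF Q(1) t(1) IK[OF ij(3)] t(2)] m ij(3) t(5)[OF Q] unfolding isv_def by fastforce
      qed (use IK ij t(1) y in auto)
    qed
    \<comment> \<open>Multiplication by \<open>t b\<close>, where \<open>b\<close> has least order
      at \<open>P\<close> in \<open>I\<close>, maps \<open>O\<close> onto \<open>J\<close> modulo
      \<open>I\<close>. Exactly \<open>P\<close> is sent into \<open>I\<close>, because outside
      \<open>P\<close> the image has order \<open>n - 1\<close>.\<close>
    have norm: "idx J I = idx OK P"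
    proof (rule idx_iso[where \<phi> = "\<lambda>r. r * (t * b)"])
      show "r * (t * b) \<in> J" if "r \<in> OK" for r using idlD(3)[OF J that tJ[OF b(1)]] .
      show "r * (t * b) \<in> I \<longleftrightarrow> r \<in> P" if r: "r \<in> OK" for r
      proof
        assume "r \<in> P"
        then have "(t * r) * b \<in> I" by (intro idlD(3)[OF I(1) t(4) b(1)])
        then show "r * (t * b) \<in> I" by (simp add: mult_ac)
      next
        assume *: "r * (t * b) \<in> I"
        show "r \<in> P"
        proof (rule ccontr)
          assume "r \<notin> P"
          then have "r \<noteq> 0" using subgrp_0[OF idlD(1)[OF prime_idD(1)[OF P(1)]]] by auto
          then have "val P r = 0" using val_pos_iff[OF P(1) r] val_nonneg[OF P(1) r] \<open>r \<notin> P\<close> by simp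
          then have "val P (r * (t * b)) = int n - 1"
            using val_mult[OF P(1) OK_K[OF r], of "t * b"] t(1,2) IK[OF b(1)] b(2) valtb \<open>r \<noteq> 0\<close> by auto
          then show False using n * t(2) b(2) \<open>r \<noteq> 0\<close> unfolding isv_def by force
        qed
      qed
      show "\<exists>r\<in>OK. c - r * (t * b) \<in> I" if c: "c \<in> J" for c
      proof -
        obtain i j where ij: "c = i + t * j" "i \<in> I" "j \<in> I" using c by (auto simp: J_def)
        show ?thesis
        proof (cases "j = 0")
          case True
          then show ?thesis using ij by (intro bexI[of _ 0]) auto
        next
          case False
          \<comment> \<open>The quotient \<open>j / b\<close> is integral at \<open>P\<close> by the
            choice of \<open>b\<close>. Its denominator \<open>s\<close>, outside \<open>P\<close>,
            is inverted modulo \<open>P\<close> to obtain a multiplier \<open>r\<close> in the ring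
            of integers.\<close>
          have "0 \<le> val P (j * inverse b)"
            using val_mult[OF P(1) IK[OF ij(3)] _ False, of "inverse b"] val_inverse[OF P(1) IK[OF b(1)] b(2)]
              n ij(3) False b IK[OF b(1)] unfolding isv_def by fastforce
          then obtain s where s: "s \<in> OK" "s \<notin> P" "s * (j * inverse b) \<in> OK"
            using val_fraction[OF P(1), of "j * inverse b"] IK[OF ij(3)] IK[OF b(1)] False b(2) by auto
          obtain s' where s': "s' \<in> OK" "1 - s * s' \<in> P" using prime_id_inverse[OF P(1) s(1,2)] by blast
          define r where "r = s' * (s * (j * inverse b))"
          have "c - r * (t * b) = i + (t * (1 - s * s')) * j"
            unfolding r_def ij(1) using b(2) by (simp add: algebra_simps)
          also have "\<dots> \<in> I" by (intro subgrp_add[OF sI ij(2)] idlD(3)[OF I(1) t(4)[OF s'(2)] ij(3)])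
          finally show ?thesis using s' s unfolding r_def by blast
        qed
      qed
    qed (use P subgrp_OK sI in \<open>auto simp: algebra_simps intro: idlD(1)[OF prime_idD(1)]\<close>)
    have "idx OK P \<noteq> 1"
      using idx_eq_1_iff[OF subgrp_OK, of P] prime_idD(1,2)[OF P(1)] by (auto simp: idl_def)
    then have "I \<noteq> J" using norm idx_self[OF sI] by auto
    then have "idx OK J < idx OK I" using idx_idl_less[OF I(1) J _ I(2,3)] IJ by blast
    then have IH: "finite {Q. prime_id Q \<and> J \<subseteq> Q}" "idx OK J = (\<Prod>Q | prime_id Q \<and> J \<subseteq> Q. idx OK Q ^ vI Q J)"
      using less.hyps[OF _ J _ I(3)] IJ I(2) by auto
    let ?S = "{Q. prime_id Q \<and> I \<subseteq> Q}"
    have sub: "?S \<subseteq> insert P {Q. prime_id Q \<and> J \<subseteq> Q}"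
    proof
      fix Q assume Q: "Q \<in> ?S"
      show "Q \<in> insert P {Q. prime_id Q \<and> J \<subseteq> Q}"
      proof (cases "Q = P")
        case False
        obtain m where m: "isv Q I m" using isv_ex[of Q, OF _ I] Q by blast
        then have "m > 0" using isv_pos_iff[of Q I m] Q I(1) by blast
        then show ?thesis using isv_pos_iff[OF _ J isvQ[OF _ False m]] Q by auto
      qed auto
    qed
    have fin: "finite ?S" by (rule finite_subset[OF sub]) (use IH(1) in auto)
    have "idx OK J = (\<Prod>Q\<in>?S. idx OK Q ^ vI Q J)"
      unfolding IH(2)
    proof (rule prod.mono_neutral_left[OF fin])
      show "\<forall>Q\<in>?S - {Q. prime_id Q \<and> J \<subseteq> Q}. idx OK Q ^ vI Q J = 1"
      proof
        fix Q assume Q: "Q \<in> ?S - {Q. prime_id Q \<and> J \<subseteq> Q}"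
        then obtain m where m: "isv Q J m" using isv_ex[OF _ J _ I(3)] IJ I(2) by blast
        then have "m = 0" using isv_pos_iff[OF _ J m] Q by auto
        then show "idx OK Q ^ vI Q J = 1" using vI_eq[OF m] by simp
      qed
    qed (use IJ in auto)
    also have "\<dots> * idx OK P = (\<Prod>Q\<in>?S. idx OK Q ^ vI Q I)"
    proof -
      have PS: "P \<in> ?S" using P by blast
      have "(\<Prod>Q\<in>?S - {P}. idx OK Q ^ vI Q J) = (\<Prod>Q\<in>?S - {P}. idx OK Q ^ vI Q I)"
      proof (rule prod.cong[OF refl])
        fix Q assume Q: "Q \<in> ?S - {P}"
        obtain m where m: "isv Q I m" using isv_ex[of Q, OF _ I] Q by blast
        then show "idx OK Q ^ vI Q J = idx OK Q ^ vI Q I"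
          using vI_eq[OF m] vI_eq[OF isvQ[OF _ _ m]] Q by simp
      qed
      moreover have "idx OK P ^ vI P I = idx OK P ^ vI P J * idx OK P"
        using npos by (cases n) (simp_all add: vI_eq[OF n] vI_eq[OF isvP] mult.commute)
      ultimately show ?thesis by (simp add: prod.remove[OF fin PS] mult_ac)
    qed
    finally have "idx OK J * idx OK P = (\<Prod>Q\<in>?S. idx OK Q ^ vI Q I)" .
    moreover have "idx OK I = idx OK J * idx J I"
      by (rule idx_tower) (use subgrp_OK J sI IJ in \<open>auto simp: idl_def\<close>)
    ultimately show ?thesis using fin norm by simp
  qed
qed

lemma idx_eq_prod_isv:
  assumes "idl I" "a \<in> I" "a \<noteq> 0" and S: "finite S" "{P. prime_id P \<and> I \<subseteq> P} \<subseteq> S"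
    and v: "\<And>P. P \<in> S \<Longrightarrow> prime_id P \<and> isv P I (n P)"
  shows "idx OK I = (\<Prod>P\<in>S. idx OK P ^ n P)"
proof -
  have "idx OK I = (\<Prod>P | prime_id P \<and> I \<subseteq> P. idx OK P ^ vI P I)"
    using idx_eq_prod_norms[OF assms(1-3)] by blast
  also have "\<dots> = (\<Prod>P\<in>S. idx OK P ^ n P)"
  proof (rule prod.mono_neutral_cong_left[OF S])
    show "\<forall>P\<in>S - {P. prime_id P \<and> I \<subseteq> P}. idx OK P ^ n P = 1"
      using v isv_pos_iff[OF _ assms(1)] by fastforce
    show "idx OK P ^ vI P I = idx OK P ^ n P" if "P \<in> {P. prime_id P \<and> I \<subseteq> P}" for P
      using v[of P] vI_eq that S(2) by auto
  qed
  finally show ?thesis .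
qed

end

section \<open>The index of the fractional ideals \<open>Ek x k\<close> through prime ideals\<close>

context nf
begin

lemma idl_multiples:
  assumes "a \<in> OK"
  shows "idl ((*) a ` OK)"
  unfolding idl_def
proof (intro conjI ballI)
  show "subgrp ((*) a ` OK)" by (rule subgrp_image_mult[OF subgrp_OK])
  show "b * c \<in> (*) a ` OK" if "b \<in> OK" "c \<in> (*) a ` OK" for b c
    using that by (auto simp: mult.left_commute[of b a])
qed (use assms in auto)

lemma isv_multiples:
  assumes P: "prime_id P" and a: "a \<in> OK" "a \<noteq> 0"
  shows "isv P ((*) a ` OK) (nat (val P a))"
  unfolding isv_def
proof (intro conjI ballI impI)
  have p: "int (nat (val P a)) = val P a" using val_nonneg[OF P a] by simp
  show "\<exists>b\<in>(*) a ` OK. b \<noteq> 0 \<and> val P b = int (nat (val P a))"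
    by (rule bexI[of _ "a * 1"]) (use a p OK_1 in auto)
  fix b assume "b \<in> (*) a ` OK" "b \<noteq> 0"
  then obtain c where c: "b = a * c" "c \<in> OK" "c \<noteq> 0" by auto
  then show "int (nat (val P a)) \<le> val P b"
    using val_mult[OF P OK_K[OF a(1)] OK_K[OF c(2)] a(2) c(3)] val_nonneg[OF P c(2,3)] p by simp
qed

lemma finite_primes_containing:
  assumes "a \<in> OK" "a \<noteq> 0"
  shows "finite {P. prime_id P \<and> a \<in> P}"
proof -
  have "finite {P. prime_id P \<and> (*) a ` OK \<subseteq> P}"
    using idx_eq_prod_norms[OF idl_multiples[OF assms(1)], of a] assms(2) OK_1 by force
  moreover have "(*) a ` OK \<subseteq> P" if "prime_id P" "a \<in> P" for P
    using idlD(3)[OF prime_idD(1)[OF that(1)] _ that(2)] by (auto simp: mult.commute[of a])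
  ultimately show ?thesis by (intro finite_subset[of "{P. prime_id P \<and> a \<in> P}"]) auto
qed

text \<open>A negative order can occur only at primes containing a denominator of \<open>x\<close>;
  positive orders are negative orders of the inverse.\<close>

lemma finite_val_nonzero:
  assumes "x \<in> K" "x \<noteq> 0"
  shows "finite {P. prime_id P \<and> val P x \<noteq> 0}"
proof -
  have neg: "finite {P. prime_id P \<and> val P x < 0}" if x: "x \<in> K" "x \<noteq> 0" for x
  proof -
    obtain m :: nat where m: "m > 0" "of_nat m * x \<in> OK" using K_multiple_in_OK[OF x(1)] by blast
    have "of_nat m \<in> P" if P: "prime_id P" "val P x < 0" for P
    proof -
      have "val P (of_nat m * x) = val P (of_nat m) + val P x"
        by (rule val_mult[OF P(1)]) (use x m(1) in auto)
      moreover have "val P (of_nat m * x) \<ge> 0" using val_nonneg[OF P(1) m(2)] x m(1) by auto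
      ultimately show ?thesis using val_pos_iff[OF P(1), of "of_nat m"] P(2) m(1) OK_of_nat by simp
    qed
    then show ?thesis
      using finite_primes_containing[of "of_nat m"] m(1) OK_of_nat by (auto elim!: finite_subset[rotated])
  qed
  have "{P. prime_id P \<and> val P x \<noteq> 0} \<subseteq> {P. prime_id P \<and> val P x < 0} \<union> {P. prime_id P \<and> val P (inverse x) < 0}"
    using val_inverse assms by auto
  then show ?thesis
    by (rule finite_subset) (use neg[OF assms] neg[of "inverse x"] assms in auto)
qed

text \<open>Scaling by \<open>a = m^k\<close> turns \<open>Ek x k\<close> into an integral ideal
  \<open>I\<close> whose order at \<open>P\<close> is that of \<open>a\<close> minus
  \<open>k max(0, - val P x)\<close>. Dividing the norm of \<open>a O\<close> by that of
  \<open>I\<close> leaves the product over the poles of \<open>x\<close>.\<close>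

lemma idx_Ek:
  assumes x: "x \<in> K" "x \<noteq> 0" and S: "finite S" "\<And>P. P \<in> S \<Longrightarrow> prime_id P"
    "\<And>P. prime_id P \<Longrightarrow> val P x < 0 \<Longrightarrow> P \<in> S"
  shows "idx (Ek x k) OK = (\<Prod>P\<in>S. idx OK P ^ nat (- val P x)) ^ k"
proof -
  obtain m :: nat where m: "m > 0" "of_nat m * x \<in> OK" using K_multiple_in_OK[OF x(1)] by blast
  define a :: qbar where "a = of_nat m ^ k"
  have a: "a \<in> OK" "a \<noteq> 0" using m(1) by (auto simp: a_def)
  define I where "I = (*) a ` Ek x k"
  have Ie: "\<exists>z. (\<forall>j. z j \<in> OK) \<and> y = a * (\<Sum>j\<le>k. x ^ j * z j)" if "y \<in> I" for y
    using that unfolding I_def Ek_def by blast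
  have xj: "a * x ^ j \<in> OK" if "j \<le> k" for j
  proof -
    have "a = of_nat m ^ (k - j) * of_nat m ^ j" unfolding a_def using that by (simp add: power_add[symmetric])
    then have "a * x ^ j = of_nat m ^ (k - j) * (of_nat m * x) ^ j" by (simp add: power_mult_distrib mult_ac)
    then show ?thesis using m(2) by auto
  qed
  have I: "idl I" unfolding idl_def
  proof (intro conjI ballI subsetI)
    show "subgrp I" unfolding I_def by (rule subgrp_image_mult[OF subgrp_Ek])
    show "y \<in> OK" if "y \<in> I" for y
    proof -
      obtain z where z: "\<And>j. z j \<in> OK" "y = a * (\<Sum>j\<le>k. x ^ j * z j)" using Ie[OF \<open>y \<in> I\<close>] by blast
      have "y = (\<Sum>j\<le>k. (a * x ^ j) * z j)" by (simp add: z sum_distrib_left mult_ac)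
      also have "\<dots> \<in> OK" by (intro OK_sum OK_mult[OF xj z(1)]) auto
      finally show ?thesis .
    qed
    fix b y assume "b \<in> OK" "y \<in> I"
    then obtain z where z: "\<And>j. z j \<in> OK" "y = a * (\<Sum>j\<le>k. x ^ j * z j)" using Ie[of y] by blast
    have "b * y = a * (\<Sum>j\<le>k. x ^ j * (b * z j))" by (simp add: z sum_distrib_left mult_ac)
    then show "b * y \<in> I" unfolding I_def using EkI[of "\<lambda>j. b * z j" x k] \<open>b \<in> OK\<close> z(1) by auto
  qed
  have aI: "(*) a ` OK \<subseteq> I" unfolding I_def using OK_subset_Ek by blast
  have aI': "a \<in> I" using aI OK_1 by force
  have isvI: "isv P I (nat (val P a) - k * nat (- val P x))" "k * nat (- val P x) \<le> nat (val P a)"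
    if P: "prime_id P" for P
  proof -
    have va: "val P a = int k * val P (of_nat m)"
      unfolding a_def by (rule val_power[OF P]) (use m(1) in auto)
    have vk: "val P (x ^ j) = int j * val P x" for j by (rule val_power[OF P x])
    have "val P (of_nat m * x) = val P (of_nat m) + val P x"
      by (rule val_mult[OF P]) (use x m(1) in auto)
    moreover have "val P (of_nat m * x) \<ge> 0" using val_nonneg[OF P m(2)] x m(1) by auto
    moreover have "val P (of_nat m) \<ge> 0" using val_nonneg[OF P OK_of_nat] m(1) by simp
    ultimately have n: "int (nat (- val P x)) \<le> val P (of_nat m)" by simp
    then have "int (k * nat (- val P x)) \<le> val P a"
      unfolding va by (simp only: of_nat_mult) (intro mult_left_mono, auto)
    then show le: "k * nat (- val P x) \<le> nat (val P a)" by linarith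
    then have eq: "int (nat (val P a) - k * nat (- val P x)) = val P a - int k * int (nat (- val P x))"
      using val_nonneg[OF P a] by (simp add: of_nat_diff)
    show "isv P I (nat (val P a) - k * nat (- val P x))"
      unfolding isv_def eq
    proof (intro conjI ballI impI)
      \<comment> \<open>The minimum is attained at \<open>a x^k\<close> when \<open>x\<close> has a
        pole at \<open>P\<close>, and at \<open>a\<close> otherwise.\<close>
      show "\<exists>y\<in>I. y \<noteq> 0 \<and> val P y = val P a - int k * int (nat (- val P x))"
      proof (cases "val P x < 0")
        case True
        have "val P (a * x ^ k) = val P a + int k * val P x"
          using val_mult[OF P OK_K[OF a(1)] qf_power[OF x(1)] a(2)] x(2) vk by auto
        moreover have "a * x ^ k \<in> I" unfolding I_def using power_mult_in_Ek[of k k 1 x] OK_1 by auto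
        ultimately show ?thesis using True a(2) x(2) by (intro bexI[of _ "a * x ^ k"]) auto
      next
        case False
        then show ?thesis using aI' a(2) by (intro bexI[of _ a]) auto
      qed
      fix y assume y: "y \<in> I" "y \<noteq> 0"
      then obtain z where z: "\<And>j. z j \<in> OK" "y = a * (\<Sum>j\<le>k. x ^ j * z j)" using Ie[of y] by blast
      have y': "y = (\<Sum>j\<le>k. a * x ^ j * z j)" by (simp add: z sum_distrib_left mult_ac)
      show "val P a - int k * int (nat (- val P x)) \<le> val P y"
        unfolding y'
      proof (rule val_ge_sum[OF P])
        show "a * x ^ j * z j \<in> K" for j using OK_K[OF a(1)] OK_K[OF z(1)] x by auto
        show "sum (\<lambda>j. a * x ^ j * z j) {..k} \<noteq> 0" using y y' by simp
        fix j assume j: "j \<in> {..k}" "a * x ^ j * z j \<noteq> 0"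
        have "val P (a * x ^ j * z j) = val P (a * x ^ j) + val P (z j)"
          by (rule val_mult[OF P]) (use j OK_K[OF a(1)] OK_K[OF z(1)] x in auto)
        also have "val P (a * x ^ j) = val P a + int j * val P x"
          using val_mult[OF P OK_K[OF a(1)] qf_power[OF x(1)] a(2)] x(2) vk by auto
        finally have "val P (a * x ^ j * z j) = val P a + int j * val P x + val P (z j)" .
        moreover have "val P (z j) \<ge> 0" using val_nonneg[OF P z(1)] j by auto
        moreover have "- (int k * int (nat (- val P x))) \<le> int j * val P x"
        proof (cases "val P x < 0")
          case True
          then have "int k * val P x \<le> int j * val P x" using j by (intro mult_right_mono_neg) auto
          then show ?thesis using True by simp
        qed simp
        ultimately show "val P a - int k * int (nat (- val P x)) \<le> val P (a * x ^ j * z j)" by linarith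
      qed
    qed
  qed
  \<comment> \<open>The primes containing \<open>a\<close> are added so that one finite set
    describes both norms; in the quotient the primes outside \<open>S\<close> contribute 1.\<close>
  define T where "T = S \<union> {P. prime_id P \<and> a \<in> P}"
  have T: "finite T" "\<And>P. P \<in> T \<Longrightarrow> prime_id P"
    unfolding T_def using S finite_primes_containing[OF a] by auto
  have sub: "{P. prime_id P \<and> J \<subseteq> P} \<subseteq> T" if "a \<in> J" for J
    using that unfolding T_def by auto
  have sIa: "a \<in> (*) a ` OK" using OK_1 by force
  have "idx OK ((*) a ` OK) = (\<Prod>P\<in>T. idx OK P ^ nat (val P a))"
    by (rule idx_eq_prod_isv[OF idl_multiples[OF a(1)] sIa a(2) T(1) sub[OF sIa]])
       (use T(2) isv_multiples[OF _ a] in blast)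
  moreover have I': "idx OK I = (\<Prod>P\<in>T. idx OK P ^ (nat (val P a) - k * nat (- val P x)))"
    by (rule idx_eq_prod_isv[OF I aI' a(2) T(1) sub[OF aI']]) (use T(2) isvI(1) in blast)
  moreover have "idx OK ((*) a ` OK) = idx OK I * idx I ((*) a ` OK)"
    by (rule idx_tower) (use I aI subgrp_OK subgrp_image_mult[OF subgrp_OK] in \<open>auto simp: idl_def\<close>)
  moreover have "idx I ((*) a ` OK) = idx (Ek x k) OK"
    unfolding I_def by (rule idx_mult[OF subgrp_Ek subgrp_OK a(2)])
  moreover have "(\<Prod>P\<in>T. idx OK P ^ nat (val P a)) =
      idx OK I * (\<Prod>P\<in>T. idx OK P ^ (k * nat (- val P x)))"
    unfolding I' prod.distrib[symmetric]
    by (intro prod.cong refl) (use isvI(2) T(2) in \<open>simp add: power_add[symmetric]\<close>)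
  moreover have "idx OK I > 0" by (rule idx_idl_pos[OF I aI' a(2)])
  ultimately have "idx (Ek x k) OK = (\<Prod>P\<in>T. idx OK P ^ (k * nat (- val P x)))" by simp
  also have "\<dots> = (\<Prod>P\<in>S. idx OK P ^ (k * nat (- val P x)))"
  proof (rule prod.mono_neutral_right[OF T(1)])
    show "\<forall>P\<in>T - S. idx OK P ^ (k * nat (- val P x)) = 1"
    proof
      fix P assume "P \<in> T - S"
      then have "\<not> val P x < 0" using T(2) S(3) by blast
      then show "idx OK P ^ (k * nat (- val P x)) = 1" by simp
    qed
  qed (simp add: T_def)
  also have "\<dots> = (\<Prod>P\<in>S. idx OK P ^ nat (- val P x)) ^ k"
    by (simp add: prod_power_distrib power_mult mult.commute[of k])
  finally show ?thesis .
qed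

end

text \<open>Bernoulli's inequality \<open>(C + 1)^k (C + 1) >= C^k (C + 1 + k)\<close> makes the
  ratio of the powers unbounded as soon as \<open>A > C > 0\<close>.\<close>

lemma power_bounded_ratio_le:
  fixes A C q B :: nat
  assumes "\<And>k. A ^ k * q \<le> B * C ^ k" "q > 0"
  shows "A \<le> C"
proof (rule ccontr)
  assume "\<not> A \<le> C"
  then have AC: "A \<ge> Suc C" by simp
  have bern: "Suc C ^ k * Suc C \<ge> C ^ k * (Suc C + k)" for k
  proof (induction k)
    case (Suc k)
    have "C ^ Suc k * (Suc C + Suc k) \<le> C ^ k * (Suc C + k) * Suc C"
      by (simp add: algebra_simps)
    also have "\<dots> \<le> Suc C ^ k * Suc C * Suc C" using Suc by (intro mult_right_mono) auto
    finally show ?case by (simp add: algebra_simps)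
  qed simp
  \<comment> \<open>Chosen so that cancelling \<open>C^k\<close> leaves
    \<open>C + 1 + k <= k\<close>. The cancellation requires \<open>C\<close> nonzero, hence the
    case distinction.\<close>
  define k where "k = B * Suc C"
  show False
  proof (cases "C = 0")
    case True
    have "A ^ 1 * q \<le> B * C ^ 1" by (rule assms)
    then show False using True AC assms(2) by simp
  next
    case False
    have "C ^ k * (Suc C + k) \<le> Suc C ^ k * Suc C" by (rule bern)
    also have "\<dots> \<le> A ^ k * q * Suc C"
      using power_mono[OF AC, of k] assms(2) by (intro mult_right_mono order_trans[OF power_mono[OF AC]]) (auto intro: order_trans[of _ "A ^ k * 1"])
    also have "\<dots> \<le> B * C ^ k * Suc C" using assms(1) by (intro mult_right_mono) auto
    also have "\<dots> = C ^ k * k" unfolding k_def by (simp only: mult_ac)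
    finally have "Suc C + k \<le> k" using False unfolding mult_le_cancel1 by auto
    then show False by simp
  qed
qed

context nf
begin

text \<open>The index of the ring of integers in \<open>Ek x k\<close> is exactly the
  \<open>k\<close>-th power of the left side and, up to factors bounded in \<open>k\<close>, the
  \<open>k\<close>-th power of the right side.\<close>

theorem prod_prime_denominators:
  assumes x: "x \<in> K" "x \<noteq> 0" and S: "finite S" "\<And>P. P \<in> S \<Longrightarrow> prime_id P"
    "\<And>P. prime_id P \<Longrightarrow> val P x < 0 \<Longrightarrow> P \<in> S"
  shows "(\<Prod>P\<in>S. idx OK P ^ nat (- val P x)) = nat (lead_coeff (ipol x)) ^ rdeg x"
proof -
  obtain q B where g: "q > 0" "B > 0"
    "\<And>k. idx (Ek x k) OK * q \<le> B * nat (lead_coeff (ipol x)) ^ (rdeg x * k)"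
    "\<And>k. nat (lead_coeff (ipol x)) ^ (rdeg x * k) \<le> idx (Ek x k) OK * q"
    using Ek_growth[OF x(1)] by metis
  define A where "A = (\<Prod>P\<in>S. idx OK P ^ nat (- val P x))"
  define C where "C = nat (lead_coeff (ipol x)) ^ rdeg x"
  have E: "idx (Ek x k) OK = A ^ k" for k
    unfolding A_def by (rule idx_Ek[OF x S])
  have "A \<le> C"
    by (rule power_bounded_ratio_le[of A q B C]) (use g E in \<open>auto simp: C_def power_mult[symmetric]\<close>)
  moreover have "C \<le> A"
    by (rule power_bounded_ratio_le[of C 1 q A]) (use g E in \<open>auto simp: C_def power_mult[symmetric] mult.commute\<close>)
  ultimately show ?thesis by (simp add: A_def C_def)
qed

end

section \<open>Complex embeddings\<close>

text \<open>By the Bezout identity over the rationals, a root of \<open>mp x\<close> in any field of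
  characteristic 0 is a root of no nonzero rational polynomial of smaller degree.\<close>

lemma mp_dvd_if_root:
  fixes z :: "'a::field_char_0"
  assumes "ev (mp x) z = 0" "ev c z = 0"
  shows "mp x dvd c"
proof (rule ccontr)
  assume *: "\<not> mp x dvd c"
  define c' where "c' = c mod mp x"
  have "c' \<noteq> 0" using * by (auto simp: c'_def mod_eq_0_iff_dvd)
  moreover have "degree c' < degree (mp x)"
    using \<open>c' \<noteq> 0\<close> degree_mod_less[OF mp_nonzero] unfolding c'_def by blast
  ultimately obtain u v where "u * mp x + v * c' = 1" by (rule mp_bezout)
  then have "ev (u * mp x + v * c') z = 1" by (simp add: ev_1)
  moreover have "ev c' z = 0" using ev_mod[OF assms(1)] assms(2) by (simp add: c'_def)
  ultimately show False using assms by (simp add: ev_add ev_mult)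
qed

definition cofactor :: "qbar \<Rightarrow> complex \<Rightarrow> complex poly" where
  "cofactor x w = (\<Prod>v\<in>conjugates x - {w}. [:- v, 1:])"

lemma cofactor:
  assumes "w \<in> conjugates x"
  shows "map_poly of_rat (mp x) = [:- w, 1:] * cofactor x w"
    "degree (cofactor x w) = degree (mp x) - 1" "monic (cofactor x w)"
    "poly (cofactor x w) w = ev (pderiv (mp x)) w"
    "v \<in> conjugates x \<Longrightarrow> v \<noteq> w \<Longrightarrow> poly (cofactor x w) v = 0"
proof -
  show eq: "map_poly of_rat (mp x) = [:- w, 1:] * cofactor x w"
    using mp_complex_factorization[of x] assms finite_conjugates[of x] unfolding cofactor_def
    by (simp add: prod.remove[of "conjugates x" w] del: mult_pCons_left)
  have "degree (cofactor x w) = (\<Sum>v\<in>conjugates x - {w}. degree [:- v, 1:])"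
    unfolding cofactor_def by (rule degree_prod_eq_sum_degree) auto
  then show "degree (cofactor x w) = degree (mp x) - 1"
    using assms finite_conjugates[of x] by (simp add: card_conjugates)
  show "monic (cofactor x w)"
    unfolding cofactor_def by (rule monic_prod) auto
  show "poly (cofactor x w) w = ev (pderiv (mp x)) w"
    using eq by (simp add: of_rat_hom.map_poly_pderiv pderiv_mult pderiv_pCons del: mult_pCons_left)
  show "v \<in> conjugates x \<Longrightarrow> v \<noteq> w \<Longrightarrow> poly (cofactor x w) v = 0"
    using finite_conjugates[of x] by (auto simp: cofactor_def poly_prod)
qed

lemma cofactor_coeff:
  assumes "w \<in> conjugates x"
  shows "w * Polynomial.coeff (cofactor x w) j =
    (if j = 0 then 0 else Polynomial.coeff (cofactor x w) (j - 1)) - of_rat (Polynomial.coeff (mp x) j)"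
proof -
  have "of_rat (Polynomial.coeff (mp x) j) = Polynomial.coeff ([:- w, 1:] * cofactor x w) j"
    by (simp only: cofactor(1)[OF assms, symmetric] of_rat_hom.coeff_map_poly_hom)
  then show ?thesis by (cases j) simp_all
qed

text \<open>Coefficient \<open>j\<close> of the sum of \<open>N(w) w^l m(T) / (T - w)\<close> over
  the conjugates, with \<open>m\<close> the minimal polynomial. These polynomials link weighted
  power sums to rational coefficients and take the place of the theory of symmetric
  functions.\<close>

definition wsum :: "qbar \<Rightarrow> (complex \<Rightarrow> nat) \<Rightarrow> nat \<Rightarrow> nat \<Rightarrow> complex" where
  "wsum x N j l = (\<Sum>w\<in>conjugates x. of_nat (N w) * w ^ l * Polynomial.coeff (cofactor x w) j)"

lemma wsum_Suc: "wsum x N j (Suc l) = (if j = 0 then 0 else wsum x N (j - 1) l)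
    - of_rat (Polynomial.coeff (mp x) j) * (\<Sum>w\<in>conjugates x. of_nat (N w) * w ^ l)"
proof -
  have "wsum x N j (Suc l) = (\<Sum>w\<in>conjugates x. of_nat (N w) * w ^ l * (w * Polynomial.coeff (cofactor x w) j))"
    by (simp add: wsum_def mult_ac)
  also have "\<dots> = (\<Sum>w\<in>conjugates x. of_nat (N w) * w ^ l * 
     ((if j = 0 then 0 else Polynomial.coeff (cofactor x w) (j - 1)) - of_rat (Polynomial.coeff (mp x) j)))"
    by (intro sum.cong refl) (simp only: cofactor_coeff)
  also have "\<dots> = (if j = 0 then 0 else wsum x N (j - 1) l)
    - of_rat (Polynomial.coeff (mp x) j) * (\<Sum>w\<in>conjugates x. of_nat (N w) * w ^ l)"
    by (cases "j = 0") (simp_all add: wsum_def right_diff_distrib sum_subtractf sum_distrib_left sum_negf mult_ac)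
  finally show ?thesis .
qed

lemma wsum_top: "wsum x N (degree (mp x) - 1) l = (\<Sum>w\<in>conjugates x. of_nat (N w) * w ^ l)"
  unfolding wsum_def
proof (rule sum.cong[OF refl])
  fix w assume "w \<in> conjugates x"
  then show "of_nat (N w) * w ^ l * Polynomial.coeff (cofactor x w) (degree (mp x) - 1) = of_nat (N w) * w ^ l"
    using cofactor(2,3)[of w x] by simp
qed

lemma power_sum_rational: "(\<Sum>w\<in>conjugates x. w ^ l) \<in> \<rat>"
proof -
  have "wsum x (\<lambda>_. 1) j l \<in> \<rat>" for j
  proof (induction l arbitrary: j)
    case 0
    \<comment> \<open>With all weights 1 and \<open>l = 0\<close> the polynomial is the derivative
      of the minimal polynomial; the recursion \<open>wsum_Suc\<close> raises
      \<open>l\<close>.\<close>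
    have "pderiv (map_poly of_rat (mp x)) = (\<Sum>w\<in>conjugates x. cofactor x w)"
      unfolding mp_complex_factorization pderiv_prod cofactor_def by (simp add: pderiv_pCons)
    then have "wsum x (\<lambda>_. 1) j 0 = Polynomial.coeff (pderiv (map_poly of_rat (mp x))) j"
      by (simp add: wsum_def coeff_sum)
    then show ?case by (simp add: of_rat_hom.map_poly_pderiv[symmetric])
  next
    case (Suc l)
    have "(\<Sum>w\<in>conjugates x. of_nat 1 * w ^ l) \<in> \<rat>" using Suc[of "degree (mp x) - 1"] unfolding wsum_top .
    then show ?case unfolding wsum_Suc using Suc[of "j - 1"] by auto
  qed
  from this[of "degree (mp x) - 1"] show ?thesis unfolding wsum_top by simp
qed

lemma ev_sum_rational: "(\<Sum>w\<in>conjugates x. ev c w) \<in> \<rat>"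
proof -
  have "(\<Sum>w\<in>conjugates x. ev c w) = (\<Sum>i\<le>degree c. of_rat (Polynomial.coeff c i) * (\<Sum>w\<in>conjugates x. w ^ i))"
    unfolding ev_altdef sum_distrib_left by (rule sum.swap)
  then show ?thesis by (simp only:) (rule Rats_sum, rule Rats_mult[OF Rats_of_rat power_sum_rational])
qed

lemma wsum_rational:
  assumes "\<And>l. (\<Sum>w\<in>conjugates x. of_nat (N w) * w ^ l) \<in> \<rat>"
  shows "k < degree (mp x) \<Longrightarrow> wsum x N (degree (mp x) - 1 - k) l \<in> \<rat>"
proof (induction k arbitrary: l)
  case 0
  show ?case unfolding diff_zero wsum_top by (rule assms)
next
  case (Suc k)
  let ?j = "degree (mp x) - 1 - k"
  have j: "?j \<noteq> 0" "?j - 1 = degree (mp x) - 1 - Suc k" using Suc.prems by auto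
  have "wsum x N (?j - 1) l = wsum x N ?j (Suc l)
    + of_rat (Polynomial.coeff (mp x) ?j) * (\<Sum>w\<in>conjugates x. of_nat (N w) * w ^ l)"
    unfolding wsum_Suc using j(1) by simp
  then show ?case unfolding j(2) using Suc assms by auto
qed

text \<open>A substitute for transitivity of a Galois group. The polynomial \<open>R\<close>, the
  sum of \<open>N(w) m(T) / (T - w)\<close>, has rational coefficients and satisfies
  \<open>R(w) = N(w) m'(w)\<close>. So \<open>R - N(w1) m'\<close> vanishes at \<open>w1\<close>,
  hence at every conjugate, and \<open>m'(w2)\<close> is nonzero.\<close>

lemma rational_weights_constant:
  assumes rat: "\<And>l. (\<Sum>w\<in>conjugates x. of_nat (N w) * w ^ l) \<in> \<rat>"
    and w: "w1 \<in> conjugates x" "w2 \<in> conjugates x"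
  shows "N w1 = N w2"
proof -
  define n where "n = degree (mp x)"
  define R where "R = (\<Sum>w\<in>conjugates x. smult (of_nat (N w)) (cofactor x w))"
  have "Polynomial.coeff R j \<in> \<rat>" for j
  proof (cases "j < n")
    case True
    then have "wsum x N j 0 \<in> \<rat>" using wsum_rational[OF rat, of "n - 1 - j" 0] by (simp add: n_def)
    then show ?thesis by (simp add: R_def coeff_sum wsum_def)
  next
    case False
    then have "Polynomial.coeff (cofactor x w) j = 0" if "w \<in> conjugates x" for w
      using cofactor(2)[OF that] degree_mp_pos[of x] by (intro coeff_eq_0) (simp add: n_def)
    then show ?thesis by (simp add: R_def coeff_sum)
  qed
  then have "\<exists>r. Polynomial.coeff R j = of_rat r" for j by (metis Rats_cases)
  then obtain r where r: "\<And>j. Polynomial.coeff R j = of_rat (r j)" by metis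
  define ir :: "complex \<Rightarrow> rat" where "ir = inv_into UNIV of_rat"
  define R0 where "R0 = map_poly ir R"
  have inv: "ir (of_rat a) = a" for a
    unfolding ir_def by (rule inv_into_f_f) (simp_all add: inj_def)
  have "ir 0 = 0" using inv[of 0] by simp
  then have "map_poly of_rat R0 = R"
    by (intro poly_eqI) (simp add: R0_def r inv coeff_map_poly)
  moreover have "poly R w = of_nat (N w) * ev (pderiv (mp x)) w" if "w \<in> conjugates x" for w
  proof -
    have "poly R w = (\<Sum>v\<in>conjugates x. if v = w then of_nat (N w) * poly (cofactor x w) w else 0)"
      unfolding R_def poly_sum by (intro sum.cong) (use that cofactor(5) in auto)
    then show ?thesis using that finite_conjugates[of x] cofactor(4)[OF that] by simp
  qed
  ultimately have R: "ev R0 w = of_nat (N w) * ev (pderiv (mp x)) w" if "w \<in> conjugates x" for w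
    using that by simp
  have "mp x dvd R0 - smult (of_nat (N w1)) (pderiv (mp x))"
    by (rule mp_dvd_if_root[of x w1]) (use w(1) R in \<open>auto simp: ev_diff ev_smult conjugates_def\<close>)
  then have "ev (R0 - smult (of_nat (N w1)) (pderiv (mp x))) w2 = 0"
    using w(2) by (auto simp: conjugates_def ev_mult elim!: dvdE)
  then have "of_nat (N w2) * ev (pderiv (mp x)) w2 = of_nat (N w1) * ev (pderiv (mp x)) w2"
    using R[OF w(2)] by (simp add: ev_diff ev_smult)
  moreover have "ev (pderiv (mp x)) w2 \<noteq> 0" using simple_roots_mp w(2) by (auto simp: conjugates_def)
  ultimately show ?thesis by simp
qed

section \<open>Fibres of the conjugates and the embeddings of the field\<close>

context nf
begin

text \<open>Every conjugate of \<open>x\<close> is a value \<open>ev c z\<close> for equally many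
  \<open>z\<close>. The multiplicities \<open>N\<close> have rational weighted power sums, because
  these are the sums of \<open>ev (c ^ l)\<close> over the conjugates of \<gamma>. So
  \<open>N\<close> is constant, and counting gives \<open>d = degree (mp x) * N\<close>.\<close>

lemma sum_over_conjugates:
  fixes \<phi> :: "complex \<Rightarrow> real"
  assumes x: "x = ev c \<gamma>"
  shows "(\<Sum>z\<in>conjugates \<gamma>. \<phi> (ev c z)) = real (rdeg x) * (\<Sum>w\<in>conjugates x. \<phi> w)"
proof -
  define N where "N w = card {z \<in> conjugates \<gamma>. ev c z = w}" for w :: complex
  have fin: "finite (conjugates x)" "finite (conjugates \<gamma>)" by (rule finite_conjugates)+
  have im: "ev c z \<in> conjugates x" if "z \<in> conjugates \<gamma>" for z
  proof -
    have "ev (pcompose (mp x) c) \<gamma> = 0" by (simp add: ev_pcompose x)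
    then have "ev (pcompose (mp x) c) z = 0" using ev_conjugate[of \<gamma> z] that by (auto simp: conjugates_def)
    then show ?thesis by (simp add: ev_pcompose conjugates_def)
  qed
  have sum: "(\<Sum>z\<in>conjugates \<gamma>. h (ev c z)) = (\<Sum>w\<in>conjugates x. of_nat (N w) * h w)"
    for h :: "complex \<Rightarrow> 'b::comm_ring_1"
  proof -
    have "(\<Sum>w\<in>conjugates x. \<Sum>z\<in>{z \<in> conjugates \<gamma>. ev c z = w}. h (ev c z)) = (\<Sum>z\<in>conjugates \<gamma>. h (ev c z))"
      by (rule sum.group) (use fin im in auto)
    moreover have "(\<Sum>z\<in>{z \<in> conjugates \<gamma>. ev c z = w}. h (ev c z)) = of_nat (N w) * h w" for w
      by (simp add: N_def)
    ultimately show ?thesis by simp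
  qed
  have "(\<Sum>w\<in>conjugates x. of_nat (N w) * w ^ l) \<in> \<rat>" for l
  proof -
    have "(\<Sum>w\<in>conjugates x. of_nat (N w) * w ^ l) = (\<Sum>z\<in>conjugates \<gamma>. ev (c ^ l) z)"
      using sum[of "\<lambda>w. w ^ l"] by (simp add: ev_power)
    then show ?thesis using ev_sum_rational by metis
  qed
  note const = rational_weights_constant[OF this]
  obtain w0 where w0: "w0 \<in> conjugates x"
    using card_conjugates[of x] degree_mp_pos[of x] by (metis card.empty ex_in_conv less_irrefl)
  have "d = (\<Sum>w\<in>conjugates x. N w)"
    using sum[of "\<lambda>_. 1 :: int"] by (simp add: card_conjugates of_nat_sum[symmetric] del: of_nat_sum)
  also have "\<dots> = (\<Sum>w\<in>conjugates x. N w0)" by (intro sum.cong refl const w0)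
  also have "\<dots> = degree (mp x) * N w0" by (simp add: card_conjugates)
  finally have "N w0 = rdeg x"
    using rdeg_mult_degree[of x] degree_mp_pos[of x] x by (auto simp: mult.commute qf_def)
  then have "N w = rdeg x" if "w \<in> conjugates x" for w using const[OF that w0] by simp
  then show ?thesis using sum[of \<phi>] by (simp add: sum_distrib_left)
qed

text \<open>The choice of \<open>c\<close> does not affect the value when \<open>z\<close> is a
  conjugate: polynomials that agree at \<gamma> agree there. The restriction matches the extensional
  functions in \<open>nf_embeddings\<close>.\<close>

definition emb :: "complex \<Rightarrow> qbar \<Rightarrow> complex" where
  "emb z = restrict (\<lambda>x. ev (SOME c. x = ev c \<gamma>) z) K"

lemma emb_ev: "z \<in> conjugates \<gamma> \<Longrightarrow> emb z (ev c \<gamma>) = ev c z"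
proof -
  assume z: "z \<in> conjugates \<gamma>"
  define c' where "c' = (SOME c'. ev c \<gamma> = ev c' \<gamma>)"
  have "ev c \<gamma> = ev c' \<gamma>" unfolding c'_def by (rule someI[of _ c]) simp
  then have "ev (c - c') \<gamma> = 0" by (simp add: ev_diff)
  then have "ev (c - c') z = 0" using ev_conjugate z by (auto simp: conjugates_def)
  then show ?thesis using qf_ev[of c \<gamma>] by (simp add: emb_def c'_def ev_diff)
qed

lemma emb_hom:
  assumes "z \<in> conjugates \<gamma>" "a \<in> K" "b \<in> K"
  shows "emb z (a + b) = emb z a + emb z b" "emb z (a * b) = emb z a * emb z b"
    "emb z (of_rat r) = of_rat r"
proof -
  obtain p q where "a = ev p \<gamma>" "b = ev q \<gamma>" using assms by (auto simp: qf_def)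
  then show "emb z (a + b) = emb z a + emb z b" "emb z (a * b) = emb z a * emb z b"
    using emb_ev[OF assms(1), of "p + q"] emb_ev[OF assms(1), of "p * q"] emb_ev[OF assms(1)]
    by (simp_all add: ev_add ev_mult)
  show "emb z (of_rat r) = of_rat r" using emb_ev[OF assms(1), of "[:r:]"] by (simp add: ev_const)
qed

lemma bij_betw_emb: "bij_betw emb (conjugates \<gamma>) (nf_embeddings K)"
  unfolding bij_betw_def
proof (intro conjI equalityI subsetI)
  show "inj_on emb (conjugates \<gamma>)"
  proof (rule inj_onI)
    fix z z' assume z: "z \<in> conjugates \<gamma>" "z' \<in> conjugates \<gamma>" "emb z = emb z'"
    then have "emb z (ev [:0, 1:] \<gamma>) = emb z' (ev [:0, 1:] \<gamma>)" by simp
    then show "z = z'" unfolding emb_ev[OF z(1)] emb_ev[OF z(2)] by (simp add: ev_pCons ev_const)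
  qed
  fix h assume "h \<in> emb ` conjugates \<gamma>"
  then obtain z where z: "z \<in> conjugates \<gamma>" "h = emb z" by blast
  have "emb z 1 = 1" using emb_hom(3)[OF z(1) qf_0 qf_0, of 1] by simp
  then show "h \<in> nf_embeddings K"
    unfolding nf_embeddings_def z(2)
  proof (intro IntI)
    show "emb z \<in> extensional K" by (simp add: emb_def)
  qed (use emb_hom(1,2)[OF z(1)] \<open>emb z 1 = 1\<close> in \<open>auto simp: Ring.ring_hom_def ring_of_type_algebra_def\<close>)
next
  fix h assume "h \<in> nf_embeddings K"
  then have h: "\<And>a b. a \<in> K \<Longrightarrow> b \<in> K \<Longrightarrow> h (a + b) = h a + h b" "h 1 = 1"
    "\<And>a b. a \<in> K \<Longrightarrow> b \<in> K \<Longrightarrow> h (a * b) = h a * h b" "h \<in> extensional K"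
    by (auto simp: nf_embeddings_def Ring.ring_hom_def ring_of_type_algebra_def)
  have h0: "h 0 = 0" using h(1)[OF qf_0 qf_0] by simp
  have hm: "h (- a) = - h a" if "a \<in> K" for a
    using h(1)[OF that qf_uminus[OF that]] h0 by (simp add: eq_neg_iff_add_eq_0 add.commute)
  have hn: "h (of_nat n) = of_nat n" for n
    by (induction n) (use h0 h(1)[OF qf_1 qf_of_nat] h(2) in auto)
  have hi: "h (of_int n) = of_int n" for n
    using hn[of "nat n"] hm[OF qf_of_nat[of "nat (- n)"]] hn[of "nat (- n)"] by (cases "n \<ge> 0") auto
  have hr: "h (of_rat r) = of_rat r" for r
  proof -
    obtain n e where r: "r = of_int n / of_int e" "e > 0"
      by (metis quotient_of_div quotient_of_denom_pos surj_pair)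
    have "of_rat r * of_int e = (of_int n :: qbar)" using r by (simp add: of_rat_divide)
    then have "h (of_rat r) * of_int e = of_int n" using h(3)[OF qf_of_rat qf_of_int, of r e] hi by metis
    then have "h (of_rat r) = of_int n / of_int e" using r(2) by (subst eq_divide_eq) auto
    also have "\<dots> = of_rat r" by (simp add: r(1) of_rat_divide)
    finally show ?thesis .
  qed
  have he: "h (ev c \<gamma>) = ev c (h \<gamma>)" for c
  proof (induction c)
    case (pCons a p)
    then show ?case
      using h(1)[OF qf_of_rat qf_mult[OF qf_self qf_ev]] h(3)[OF qf_self qf_ev] hr by (simp add: ev_pCons)
  qed (simp add: h0)
  have z: "h \<gamma> \<in> conjugates \<gamma>" using he[of "mp \<gamma>"] h0 by (simp add: conjugates_def)
  have "h = emb (h \<gamma>)"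
  proof (rule extensionalityI[OF h(4)])
    show "emb (h \<gamma>) \<in> extensional K" by (simp add: emb_def)
    fix a assume "a \<in> K"
    then obtain c where "a = ev c \<gamma>" by (auto simp: qf_def)
    then show "h a = emb (h \<gamma>) a" using he emb_ev[OF z] by simp
  qed
  then show "h \<in> emb ` conjugates \<gamma>" using z by blast
qed

end

section \<open>The height of the definition\<close>

lemma ln_power_int:
  fixes y :: real
  assumes "0 < y"
  shows "ln (y powi n) = of_int n * ln y"
  using assms by (cases "n \<ge> 0") (auto simp: power_int_def ln_realpow ln_inverse)

section \<open>The ingredients of the defined height in terms of the generator\<close>

context nf
begin

lemma nf_integers_simps:
  "carrier (nf_integers K) = OK" "a \<otimes>\<^bsub>nf_integers K\<^esub> b = a * b" "a \<oplus>\<^bsub>nf_integers K\<^esub> b = a + b"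
  "\<one>\<^bsub>nf_integers K\<^esub> = 1" "\<zero>\<^bsub>nf_integers K\<^esub> = 0"
  by (simp_all add: nf_integers_def ring_of_type_algebra_def OK_def ints_def)

lemma cring_nf_integers: "cring (nf_integers K)"
proof (rule cringI)
  show "abelian_group (nf_integers K)"
  proof (rule abelian_groupI)
    fix a assume "a \<in> carrier (nf_integers K)"
    then show "\<exists>b\<in>carrier (nf_integers K). b \<oplus>\<^bsub>nf_integers K\<^esub> a = \<zero>\<^bsub>nf_integers K\<^esub>"
      by (intro bexI[of _ "- a"]) (auto simp: nf_integers_simps)
  qed (auto simp: nf_integers_simps)
  show "comm_monoid (nf_integers K)"
    by (rule comm_monoidI) (auto simp: nf_integers_simps mult_ac)
qed (auto simp: nf_integers_simps algebra_simps)

lemma ideal_iff_idl: "ideal I (nf_integers K) \<longleftrightarrow> idl I"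
proof
  interpret R: cring "nf_integers K" by (rule cring_nf_integers)
  have minus: "\<ominus>\<^bsub>nf_integers K\<^esub> a = - a" if "a \<in> OK" for a
    using that by (intro R.minus_equality) (auto simp: nf_integers_simps)
  {
    assume "ideal I (nf_integers K)"
    then interpret I: ideal I "nf_integers K" .
    have sub: "I \<subseteq> OK" using I.a_subset by (simp add: nf_integers_simps)
    have "a - b \<in> I" if "a \<in> I" "b \<in> I" for a b
    proof -
      have "b \<in> OK" using sub that(2) by blast
      then have "- b \<in> I" using I.a_inv_closed[OF that(2)] minus[of b] by (simp only:)
      from I.a_closed[OF that(1) this] show ?thesis by (simp add: nf_integers_simps(3))
    qed
    then show "idl I"
      unfolding idl_def subgrp_def using sub I.zero_closed I.I_l_closed by (auto simp: nf_integers_simps)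
  }
  assume I: "idl I"
  show "ideal I (nf_integers K)"
  proof (rule idealI[OF R.ring_axioms])
    show "subgroup I (add_monoid (nf_integers K))"
    proof (rule R.add.subgroupI)
      show "I \<subseteq> carrier (nf_integers K)" using I by (simp add: idl_def nf_integers_simps)
      show "I \<noteq> {}" using subgrp_0[OF idlD(1)[OF I]] by auto
      show "\<ominus>\<^bsub>nf_integers K\<^esub> a \<in> I" if "a \<in> I" for a
        using minus[OF idlD(2)[OF I that]] subgrp_uminus[OF idlD(1)[OF I] that] by (simp only:)
      show "a \<oplus>\<^bsub>nf_integers K\<^esub> b \<in> I" if "a \<in> I" "b \<in> I" for a b
        using subgrp_add[OF idlD(1)[OF I] that] nf_integers_simps(3)[of a b] by simp
    qed
    show "x \<otimes>\<^bsub>nf_integers K\<^esub> a \<in> I" "a \<otimes>\<^bsub>nf_integers K\<^esub> x \<in> I"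
      if "a \<in> I" "x \<in> carrier (nf_integers K)" for a x
      using idlD(3)[OF I _ that(1), of x] that(2) by (simp_all add: nf_integers_simps mult.commute)
  qed
qed

lemma nf_primes_eq: "nf_primes K = {P. prime_id P}"
proof -
  have "primeideal P (nf_integers K) \<and> P \<noteq> {0} \<longleftrightarrow> prime_id P" for P
  proof
    assume *: "primeideal P (nf_integers K) \<and> P \<noteq> {0}"
    then interpret primeideal P "nf_integers K" by simp
    show "prime_id P"
      unfolding prime_id_def
      using * I_notcarr I_prime is_ideal ideal_iff_idl by (auto simp: nf_integers_simps)
  next
    assume "prime_id P"
    then show "primeideal P (nf_integers K) \<and> P \<noteq> {0}"
      using cring_nf_integers ideal_iff_idl[of P]
      by (intro conjI primeidealI) (auto simp only: prime_id_def nf_integers_simps)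
  qed
  then show ?thesis by (auto simp: nf_primes_def)
qed

lemma ideal_norm_eq: "ideal_norm K P = idx OK P"
proof -
  have "carrier (nf_integers K Quot P) = coset P ` OK"
    by (auto simp: FactRing_def A_RCOSETS_def RCOSETS_def a_r_coset_def r_coset_def coset_def
        nf_integers_simps image_iff)
  then show ?thesis by (simp add: ideal_norm_def idx_def)
qed

text \<open>The dimension is built up along the flag of spans of
  \<open>1, \<gamma>, ..., \<gamma>^(i - 1)\<close>; as long as \<open>i < d\<close>, the next power
  is outside the span.\<close>

lemma nf_degree_eq: "nf_degree K = d"
proof -
  interpret Q: field Qbar by (rule field_from_type_algebra)
  have sf: "subfield \<rat> Qbar"
  proof (rule Q.subfieldI')
    show "subring \<rat> Qbar"
    proof (rule Q.subringI)
      show "\<ominus>\<^bsub>Qbar\<^esub> h \<in> \<rat>" if "h \<in> \<rat>" for h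
      proof -
        have "\<ominus>\<^bsub>Qbar\<^esub> h = - h"
          by (rule Q.minus_equality) (auto simp: ring_of_type_algebra_def)
        then show ?thesis using that by simp
      qed
    qed (auto simp: ring_of_type_algebra_def)
    show "inv\<^bsub>Qbar\<^esub> k \<in> \<rat>" if "k \<in> \<rat> - {\<zero>\<^bsub>Qbar\<^esub>}" for k
    proof -
      have "inv\<^bsub>Qbar\<^esub> k = inverse k"
        using that by (intro Q.comm_inv_char) (auto simp: ring_of_type_algebra_def)
      then show ?thesis using that by simp
    qed
  qed
  define E where "E i = {\<Sum>j<i. of_rat (c j) * \<gamma> ^ j | c. True}" for i :: nat
  have "i \<le> d \<Longrightarrow> Q.dimension i \<rat> (E i)" for i
  proof (induction i)
    case 0
    have "E 0 = {\<zero>\<^bsub>Qbar\<^esub>}" by (auto simp: E_def ring_of_type_algebra_def)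
    then show ?case using Q.zero_dim by simp
  next
    case (Suc i)
    have "\<gamma> ^ i \<notin> E i"
    proof
      assume "\<gamma> ^ i \<in> E i"
      then obtain c where c: "\<gamma> ^ i = (\<Sum>j<i. of_rat (c j) * \<gamma> ^ j)" by (auto simp: E_def)
      define p where "p = Polynomial.monom 1 i - (\<Sum>j<i. Polynomial.monom (c j) j)"
      have "ev p \<gamma> = 0" by (simp add: p_def ev_diff ev_sum poly_monom c)
      then have "mp \<gamma> dvd p" by (simp add: mp)
      moreover have "Polynomial.coeff p i = 1" by (simp add: p_def coeff_sum)
      then have "p \<noteq> 0" by auto
      moreover have "degree p \<le> i"
        by (rule degree_le) (auto simp: p_def coeff_sum)
      ultimately show False using dvd_imp_degree_le[of "mp \<gamma>" p] Suc.prems by simp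
    qed
    moreover have "Q.line_extension \<rat> (\<gamma> ^ i) (E i) = E (Suc i)"
    proof -
      have "Q.line_extension \<rat> (\<gamma> ^ i) (E i) = {k * \<gamma> ^ i + e | k e. k \<in> \<rat> \<and> e \<in> E i}"
        unfolding Q.line_extension_def by (auto simp: set_add_def set_mult_def r_coset_def ring_of_type_algebra_def)
      also have "\<dots> = E (Suc i)"
      proof (intro equalityI subsetI)
        fix y assume "y \<in> {k * \<gamma> ^ i + e | k e. k \<in> \<rat> \<and> e \<in> E i}"
        then obtain k c where y: "y = of_rat k * \<gamma> ^ i + (\<Sum>j<i. of_rat (c j) * \<gamma> ^ j)"
          by (auto simp: E_def elim!: Rats_cases)
        have "y = (\<Sum>j<Suc i. of_rat ((c(i := k)) j) * \<gamma> ^ j)" by (simp add: y add.commute)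
        then show "y \<in> E (Suc i)" unfolding E_def by blast
      next
        fix y assume "y \<in> E (Suc i)"
        then obtain c where "y = of_rat (c i) * \<gamma> ^ i + (\<Sum>j<i. of_rat (c j) * \<gamma> ^ j)"
          by (auto simp: E_def add.commute)
        then show "y \<in> {k * \<gamma> ^ i + e | k e. k \<in> \<rat> \<and> e \<in> E i}"
          unfolding E_def by (intro CollectI exI conjI) (assumption, auto)
      qed
      finally show ?thesis .
    qed
    ultimately show ?case
      using Q.Suc_dim[of "\<gamma> ^ i" "E i" i \<rat>] Suc by (simp add: ring_of_type_algebra_def)
  qed
  moreover have "E d = K"
  proof (intro equalityI subsetI)
    fix y assume "y \<in> E d"
    then show "y \<in> K" by (auto simp: E_def intro!: qf_sum qf_mult)
  next
    fix y assume "y \<in> K"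
    then obtain c where c: "y = ev c \<gamma>" by (auto simp: qf_def)
    define c' where "c' = c mod mp \<gamma>"
    have "degree c' < d"
      using degree_mod_less'[of "mp \<gamma>" c] degree_mp_pos[of \<gamma>] unfolding c'_def by (cases "c mod mp \<gamma> = 0") auto
    then have "ev c' \<gamma> = (\<Sum>j<d. of_rat (Polynomial.coeff c' j) * \<gamma> ^ j)"
      unfolding ev_altdef by (intro sum.mono_neutral_left) (auto simp: coeff_eq_0)
    then have "y = (\<Sum>j<d. of_rat (Polynomial.coeff c' j) * \<gamma> ^ j)"
      using ev_mod[of "mp \<gamma>" \<gamma> c] by (simp add: c c'_def)
    then show "y \<in> E d" unfolding E_def by blast
  qed
  ultimately have "Q.dimension d \<rat> K" by fastforce
  from Q.dimI[OF sf this] show ?thesis by (simp add: nf_degree_def over_def)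
qed

lemma idx_prime_pos: "prime_id P \<Longrightarrow> 0 < idx OK P"
  using idx_idl_pos[OF prime_idD(1)] prime_idD(3) by blast

lemma prime_abs_eq: "prime_id P \<Longrightarrow> x \<noteq> 0 \<Longrightarrow> prime_abs K P x = real (idx OK P) powi (- val P x)"
  by (simp add: prime_abs_def ideal_norm_eq)

lemma ln_prime_abs:
  assumes "prime_id P" "x \<noteq> 0"
  shows "ln (prime_abs K P x) = - of_int (val P x) * ln (real (idx OK P))"
    "ln (max 1 (prime_abs K P x)) = real (nat (- val P x)) * ln (real (idx OK P))"
proof -
  have N: "real (idx OK P) \<ge> 1" using idx_prime_pos[OF assms(1)] by simp
  show 1: "ln (prime_abs K P x) = - of_int (val P x) * ln (real (idx OK P))"
    unfolding prime_abs_eq[OF assms] using N by (simp add: ln_power_int)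
  have pos: "0 < prime_abs K P x" unfolding prime_abs_eq[OF assms] using N by simp
  show "ln (max 1 (prime_abs K P x)) = real (nat (- val P x)) * ln (real (idx OK P))"
  proof (cases "val P x \<ge> 0")
    case True
    have "ln (prime_abs K P x) \<le> 0" unfolding 1 using True N by simp
    then have "prime_abs K P x \<le> 1" using pos by simp
    then show ?thesis using True by (simp add: max_def)
  next
    case False
    have "ln (prime_abs K P x) \<ge> 0" unfolding 1 using False N by (simp add: mult_nonpos_nonneg)
    then have "prime_abs K P x \<ge> 1" using pos by simp
    then show ?thesis using False 1 by (simp add: max_absorb2)
  qed
qed

lemma sum_ln_max_prime_abs:
  assumes x: "x \<in> K" "x \<noteq> 0" and S: "finite S" "\<And>P. P \<in> S \<Longrightarrow> prime_id P"
    "\<And>P. prime_id P \<Longrightarrow> val P x < 0 \<Longrightarrow> P \<in> S"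
  shows "(\<Sum>P\<in>S. ln (max 1 (prime_abs K P x))) = real (rdeg x) * ln (of_int (lead_coeff (ipol x)))"
proof -
  have "(\<Sum>P\<in>S. ln (max 1 (prime_abs K P x))) = (\<Sum>P\<in>S. ln (real (idx OK P ^ nat (- val P x))))"
    by (intro sum.cong refl) (use S(2) x idx_prime_pos in \<open>simp add: ln_prime_abs ln_realpow\<close>)
  also have "\<dots> = ln (\<Prod>P\<in>S. real (idx OK P ^ nat (- val P x)))"
    by (rule ln_prod[symmetric]) (use S idx_prime_pos in auto)
  also have "(\<Prod>P\<in>S. real (idx OK P ^ nat (- val P x))) = real (nat (lead_coeff (ipol x)) ^ rdeg x)"
    by (simp only: prod_prime_denominators[OF x S, symmetric] of_nat_prod)
  also have "\<dots> = of_int (lead_coeff (ipol x)) ^ rdeg x"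
    using ipol(2)[of x] by simp
  finally show ?thesis using ipol(2)[of x] by (simp add: ln_realpow)
qed

lemma infsum_prime_abs:
  assumes x: "x \<in> K" "x \<noteq> 0" and S: "finite S" "\<And>P. P \<in> S \<Longrightarrow> prime_id P"
    "\<And>P. prime_id P \<Longrightarrow> val P x < 0 \<Longrightarrow> P \<in> S"
  shows "(\<Sum>\<^sub>\<infinity>P\<in>nf_primes K. ln (max 1 (prime_abs K P x))) = (\<Sum>P\<in>S. ln (max 1 (prime_abs K P x)))"
proof -
  have "(\<Sum>\<^sub>\<infinity>P\<in>nf_primes K. ln (max 1 (prime_abs K P x))) = (\<Sum>\<^sub>\<infinity>P\<in>S. ln (max 1 (prime_abs K P x)))"
  proof (rule infsum_cong_neutral)
    fix P assume "P \<in> nf_primes K - S"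
    then have "prime_id P" "\<not> val P x < 0" using S(3) by (auto simp: nf_primes_eq)
    then show "ln (max 1 (prime_abs K P x)) = 0" using ln_prime_abs(2) x by simp
  qed (use S(2) in \<open>auto simp: nf_primes_eq\<close>)
  then show ?thesis using infsum_finite[OF S(1)] by simp
qed

text \<open>The logarithmic Mahler measure of \<open>ipol x\<close>, declared outside the locale
  because it involves \<open>x\<close> only and no number field.\<close>

definition (in -) log_mahler :: "qbar \<Rightarrow> real" where
  "log_mahler x = ln (of_int (lead_coeff (ipol x))) + (\<Sum>w\<in>conjugates x. ln (max 1 (cmod w)))"

text \<open>Both local sums are \<open>rdeg x\<close> times a quantity attached to \<open>x\<close>,
  and \<open>d\<close> is \<open>rdeg x\<close> times the degree of \<open>x\<close>, so the
  dependence on the field cancels.\<close>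

lemma weil_height_on_eq:
  assumes "x \<in> K" "x \<noteq> 0"
  shows "weil_height_on K x = log_mahler x / degree (mp x)"
proof -
  define S where "S = {P. prime_id P \<and> val P x \<noteq> 0}"
  have S: "finite S" "\<And>P. P \<in> S \<Longrightarrow> prime_id P" "\<And>P. prime_id P \<Longrightarrow> val P x < 0 \<Longrightarrow> P \<in> S"
    using finite_val_nonzero[OF assms] by (auto simp: S_def)
  obtain c where c: "x = ev c \<gamma>" using assms(1) by (auto simp: qf_def)
  have "(\<Sum>\<sigma>\<in>nf_embeddings K. ln (max 1 (cmod (\<sigma> x)))) = (\<Sum>z\<in>conjugates \<gamma>. ln (max 1 (cmod (ev c z))))"
    by (subst sum.reindex_bij_betw[OF bij_betw_emb, symmetric]) (simp add: c emb_ev)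
  also have "\<dots> = real (rdeg x) * (\<Sum>w\<in>conjugates x. ln (max 1 (cmod w)))"
    by (rule sum_over_conjugates[OF c])
  finally have a: "(\<Sum>\<sigma>\<in>nf_embeddings K. ln (max 1 (cmod (\<sigma> x)))) = real (rdeg x) * (\<Sum>w\<in>conjugates x. ln (max 1 (cmod w)))" .
  have b: "(\<Sum>\<^sub>\<infinity>P\<in>nf_primes K. ln (max 1 (prime_abs K P x))) = real (rdeg x) * ln (of_int (lead_coeff (ipol x)))"
    using infsum_prime_abs[OF assms S] sum_ln_max_prime_abs[OF assms S] by (rule trans)
  have "weil_height_on K x = real (rdeg x) * log_mahler x / real d"
    unfolding weil_height_on_def nf_degree_eq a b log_mahler_def by (simp add: distrib_left add.commute)
  also have "real d = real (rdeg x) * real (degree (mp x))"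
    using rdeg_mult_degree[OF assms(1)] by (metis of_nat_mult)
  finally show ?thesis using rdeg_pos[of x] by simp
qed

end

lemma qf_multiple:
  assumes "m \<noteq> 0"
  shows "qf (of_int m * x) = qf x"
proof
  show "qf (of_int m * x) \<subseteq> qf x" by (rule qf_subset) auto
  have "of_int m * x / of_int m \<in> qf (of_int m * x)" by (intro qf_divide qf_self qf_of_int)
  then have "x \<in> qf (of_int m * x)" using assms by simp
  then show "qf x \<subseteq> qf (of_int m * x)" by (rule qf_subset)
qed

lemma nf_ex:
  obtains \<gamma> where "nf \<gamma>" "qf \<gamma> = qf x"
proof -
  obtain m :: int where "m > 0" "algebraic_int (of_int m * x)" by (rule multiple_algebraic_int)
  then show ?thesis using that[of "of_int m * x"] qf_multiple[of m x] by (simp add: nf_def)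
qed

lemma weil_height_eq:
  assumes "x \<noteq> 0"
  shows "weil_height x = log_mahler x / degree (mp x)"
proof -
  obtain \<gamma> where g: "nf \<gamma>" "qf \<gamma> = qf x" by (rule nf_ex)
  then interpret nf \<gamma> by simp
  show ?thesis
    unfolding weil_height_def generate_field_eq_qf g(2)[symmetric]
    by (rule weil_height_on_eq) (use g(2) assms in auto)
qed

section \<open>The product formula and height inequalities\<close>

lemma coeff_0_ipol:
  assumes "x \<noteq> 0"
  shows "Polynomial.coeff (ipol x) 0 \<noteq> 0"
proof
  obtain c q where cq: "ipol x = pCons c q" by (cases "ipol x") auto
  assume "Polynomial.coeff (ipol x) 0 = 0"
  then have c: "c = 0" by (simp add: cq)
  have "x * poly (of_int_poly q) x = 0"
    using poly_ipol_self[of x] by (simp add: cq c of_int_hom.map_poly_pCons_hom)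
  then have "ipol x dvd q" using assms by (intro ipol_dvd) simp
  moreover have "q \<noteq> 0" using cq c ipol_nonzero[of x] by auto
  ultimately have "degree (ipol x) \<le> degree q" by (rule dvd_imp_degree_le)
  then show False using cq \<open>q \<noteq> 0\<close> by simp
qed

lemma reflect_ipol_root:
  assumes "x \<noteq> 0"
  shows "poly (of_int_poly (reflect_poly (ipol x))) (inverse x) = 0"
proof -
  have "(of_int_poly (reflect_poly (ipol x)) :: qbar poly) = reflect_poly (of_int_poly (ipol x))"
    by (intro poly_eqI) (simp add: coeff_reflect_poly)
  then show ?thesis using assms by (simp add: poly_reflect_poly_nz)
qed

text \<open>The reversed polynomial vanishes at the inverse. Divisibility in both directions forces
  equal degrees, and the leading coefficient on one side and the constant coefficient on the other
  divide each other.\<close>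

lemma ipol_inverse:
  assumes x: "x \<noteq> 0"
  shows "degree (mp (inverse x)) = degree (mp x)"
    "lead_coeff (ipol (inverse x)) = \<bar>Polynomial.coeff (ipol x) 0\<bar>"
proof -
  let ?f = "ipol x" and ?g = "ipol (inverse x)"
  have deg: "degree (reflect_poly (ipol y)) = degree (ipol y)" if "y \<noteq> 0" for y
    using coeff_0_ipol[OF that] by simp
  obtain c where c: "reflect_poly ?f = ?g * c" using ipol_dvd[OF reflect_ipol_root[OF x]] by (elim dvdE)
  obtain c' where c': "reflect_poly ?g = ?f * c'"
    using ipol_dvd[of "reflect_poly ?g" x] reflect_ipol_root[of "inverse x"] x by (auto elim!: dvdE)
  have nz: "reflect_poly ?f \<noteq> 0" "reflect_poly ?g \<noteq> 0" by auto
  have "degree ?g + degree c = degree ?f"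
    using deg[OF x] c nz(1) degree_mult_eq[of ?g c] by (metis mult_zero_right ipol_nonzero)
  moreover have "degree ?f + degree c' = degree ?g"
    using deg[of "inverse x"] x c' nz(2) degree_mult_eq[of ?f c'] by (metis mult_zero_right ipol_nonzero inverse_nonzero_iff_nonzero)
  ultimately show "degree (mp (inverse x)) = degree (mp x)" by (simp add: degree_ipol)
  have "lead_coeff (reflect_poly ?f) = Polynomial.coeff ?f 0"
    using coeff_0_ipol[OF x] by (simp add: coeff_reflect_poly)
  then have 1: "lead_coeff ?g dvd Polynomial.coeff ?f 0" unfolding c lead_coeff_mult by (metis dvd_triv_left)
  have "Polynomial.coeff (reflect_poly ?g) 0 = lead_coeff ?g" by simp
  then have 2: "Polynomial.coeff ?f 0 dvd lead_coeff ?g" unfolding c' by (metis coeff_mult_0 dvd_triv_left)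
  show "lead_coeff ?g = \<bar>Polynomial.coeff ?f 0\<bar>"
    using 1 2 ipol(2)[of "inverse x"] by (metis abs_of_pos zdvd_antisym_abs)
qed

lemma sum_ln_conjugates:
  assumes x: "x \<noteq> 0"
  shows "(\<Sum>w\<in>conjugates x. ln (cmod w)) =
    ln (of_int \<bar>Polynomial.coeff (ipol x) 0\<bar>) - ln (of_int (lead_coeff (ipol x)))"
proof -
  let ?a = "lead_coeff (ipol x)"
  have a: "?a > 0" by (rule ipol(2))
  have e: "of_int (Polynomial.coeff (ipol x) 0) = of_int ?a * ev (mp x) (0 :: complex)"
    using poly_ipol[of x "0 :: complex"] by (simp add: poly_0_coeff_0)
  have p: "ev (mp x) (0 :: complex) = (\<Prod>w\<in>conjugates x. - w)"
    unfolding mp_complex_factorization by (simp add: poly_prod)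
  have nz: "w \<noteq> 0" if "w \<in> conjugates x" for w
    using that coeff_0_ipol[OF x] e by (auto simp: conjugates_def)
  have "of_int \<bar>Polynomial.coeff (ipol x) 0\<bar> = cmod (of_int (Polynomial.coeff (ipol x) 0))" by simp
  also have "\<dots> = of_int ?a * (\<Prod>w\<in>conjugates x. cmod w)"
    unfolding e p using a by (simp add: norm_mult prod_norm[symmetric])
  finally have "ln (of_int \<bar>Polynomial.coeff (ipol x) 0\<bar>) = ln (of_int ?a * (\<Prod>w\<in>conjugates x. cmod w))" by simp
  also have "\<dots> = ln (of_int ?a) + (\<Sum>w\<in>conjugates x. ln (cmod w))"
    using a nz finite_conjugates[of x] by (subst ln_mult) (auto intro!: prod_pos simp: ln_prod)
  finally show ?thesis by simp
qed

section \<open>The product formula and its consequence for quotients\<close>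

context nf
begin

definition gplaces :: "qbar \<Rightarrow> qbar set set" where
  "gplaces x = {P. prime_id P \<and> val P x \<noteq> 0}"

text \<open>The product formula. Since \<open>ln |x| = ln max(1, |x|) - ln max(1, |1/x|)\<close>,
  the finite part is \<open>rdeg x\<close> times the difference of the logarithms of the leading
  coefficients for \<open>x\<close> and \<open>1/x\<close>. Up to sign these are the two end
  coefficients of \<open>ipol x\<close>, whose quotient is the product of the conjugates.\<close>

lemma sum_ln_prime_abs:
  assumes x: "x \<in> K" "x \<noteq> 0" and S: "finite S" "\<And>P. P \<in> S \<Longrightarrow> prime_id P" "gplaces x \<subseteq> S"
  shows "(\<Sum>P\<in>S. ln (prime_abs K P x)) = - (\<Sum>z\<in>conjugates \<gamma>. ln (cmod (emb z x)))"
proof -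
  have ix: "inverse x \<in> K" "inverse x \<noteq> 0" using x by auto
  have vi: "val P (inverse x) = - val P x" if "prime_id P" for P by (rule val_inverse[OF that x])
  have "(\<Sum>P\<in>S. ln (prime_abs K P x)) =
      (\<Sum>P\<in>S. ln (max 1 (prime_abs K P x))) - (\<Sum>P\<in>S. ln (max 1 (prime_abs K P (inverse x))))"
    unfolding sum_subtractf[symmetric]
  proof (intro sum.cong refl)
    fix P assume "P \<in> S"
    then have P: "prime_id P" by (rule S)
    have "- of_int (val P x) = real (nat (- val P x)) - real (nat (val P x))" by linarith
    then show "ln (prime_abs K P x) = ln (max 1 (prime_abs K P x)) - ln (max 1 (prime_abs K P (inverse x)))"
      unfolding ln_prime_abs[OF P x(2)] ln_prime_abs[OF P ix(2)] vi[OF P] by (simp add: left_diff_distrib)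
  qed
  also have "(\<Sum>P\<in>S. ln (max 1 (prime_abs K P x))) = real (rdeg x) * ln (of_int (lead_coeff (ipol x)))"
    by (rule sum_ln_max_prime_abs[OF x S(1,2)]) (use S(3) in \<open>auto simp: gplaces_def\<close>)
  also have "(\<Sum>P\<in>S. ln (max 1 (prime_abs K P (inverse x)))) = real (rdeg (inverse x)) * ln (of_int (lead_coeff (ipol (inverse x))))"
    by (rule sum_ln_max_prime_abs[OF ix S(1,2)]) (use S(3) vi in \<open>auto simp: gplaces_def\<close>)
  also have "rdeg (inverse x) = rdeg x"
    using rdeg_mult_degree[OF x(1)] rdeg_mult_degree[OF ix(1)] degree_mp_pos[of x] unfolding ipol_inverse(1)[OF x(2)]
    by (metis mult_right_cancel less_irrefl)
  also have "real (rdeg x) * ln (of_int (lead_coeff (ipol x))) - real (rdeg x) * ln (of_int (lead_coeff (ipol (inverse x)))) =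
      - (real (rdeg x) * (\<Sum>w\<in>conjugates x. ln (cmod w)))"
    unfolding sum_ln_conjugates[OF x(2)] ipol_inverse(2)[OF x(2)] by (simp add: right_diff_distrib)
  also have "real (rdeg x) * (\<Sum>w\<in>conjugates x. ln (cmod w)) = (\<Sum>z\<in>conjugates \<gamma>. ln (cmod (emb z x)))"
  proof -
    obtain c where c: "x = ev c \<gamma>" using x(1) by (auto simp: qf_def)
    show ?thesis using sum_over_conjugates[OF c, of "\<lambda>w. ln (cmod w)"] by (simp add: c emb_ev)
  qed
  finally show ?thesis .
qed

text \<open>The set \<open>S\<close> may be any finite set of primes containing those that matter,
  so that several numbers can share it.\<close>

lemma d_weil_height:
  assumes x: "x \<in> K" "x \<noteq> 0" and S: "finite S" "\<And>P. P \<in> S \<Longrightarrow> prime_id P" "gplaces x \<subseteq> S"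
  shows "real d * weil_height x =
    (\<Sum>z\<in>conjugates \<gamma>. ln (max 1 (cmod (emb z x)))) + (\<Sum>P\<in>S. ln (max 1 (prime_abs K P x)))"
proof -
  obtain c where c: "x = ev c \<gamma>" using x(1) by (auto simp: qf_def)
  have "(\<Sum>z\<in>conjugates \<gamma>. ln (max 1 (cmod (emb z x)))) = real (rdeg x) * (\<Sum>w\<in>conjugates x. ln (max 1 (cmod w)))"
    using sum_over_conjugates[OF c, of "\<lambda>w. ln (max 1 (cmod w))"] by (simp add: c emb_ev)
  moreover have "(\<Sum>P\<in>S. ln (max 1 (prime_abs K P x))) = real (rdeg x) * ln (of_int (lead_coeff (ipol x)))"
    by (rule sum_ln_max_prime_abs[OF x S(1,2)]) (use S(3) in \<open>auto simp: gplaces_def\<close>)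
  moreover have "real d = real (rdeg x) * real (degree (mp x))"
    using rdeg_mult_degree[OF x(1)] by (metis of_nat_mult)
  ultimately show ?thesis
    using degree_mp_pos[of x] by (simp add: weil_height_eq[OF x(2)] log_mahler_def distrib_left)
qed

lemma emb_nonzero:
  assumes "z \<in> conjugates \<gamma>" "x \<in> K" "x \<noteq> 0"
  shows "emb z x \<noteq> 0"
proof -
  have "emb z x * emb z (inverse x) = emb z 1"
    using emb_hom(2)[OF assms(1,2) qf_inverse[OF assms(2)]] assms(3) by simp
  then show ?thesis using emb_hom(3)[OF assms(1) qf_0 qf_0, of 1] by auto
qed

lemma prime_abs_pos: "prime_id P \<Longrightarrow> x \<noteq> 0 \<Longrightarrow> 0 < prime_abs K P x"
  using prime_abs_eq idx_prime_pos by simp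

lemma prime_abs_mult:
  assumes P: "prime_id P" and "a \<in> K" "b \<in> K"
  shows "prime_abs K P (a * b) = prime_abs K P a * prime_abs K P b"
proof (cases "a = 0 \<or> b = 0")
  case False
  then have nz: "a \<noteq> 0" "b \<noteq> 0" "a * b \<noteq> 0" by auto
  have v: "- val P (a * b) = - val P a + - val P b" using val_mult[OF P assms(2,3) nz(1,2)] by simp
  have "real (idx OK P) powi (- val P a + - val P b) =
      real (idx OK P) powi (- val P a) * real (idx OK P) powi (- val P b)"
    by (rule power_int_add) (use idx_prime_pos[OF P] in simp)
  then show ?thesis
    unfolding prime_abs_eq[OF P nz(1)] prime_abs_eq[OF P nz(2)] prime_abs_eq[OF P nz(3)] v .
qed (auto simp: prime_abs_def)

text \<open>Locally \<open>max(1, |u/D|) = max(|u|, |D|) / |D|\<close>, and the denominators vanish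
  in the sum over all places by the product formula. The constant \<open>c\<close> is paid at the
  \<open>d\<close> embeddings only, so after normalisation it costs \<open>ln c\<close>. The list
  \<open>ys\<close> allows repeated factors.\<close>

lemma weil_height_quotient_le:
  assumes u: "u \<in> K" "u \<noteq> 0" and D: "D \<in> K" "D \<noteq> 0" and c: "c > 0"
    and ys: "\<And>y. y \<in> set ys \<Longrightarrow> y \<in> K \<and> y \<noteq> 0"
    and arch: "\<And>z. z \<in> conjugates \<gamma> \<Longrightarrow>
      max (cmod (emb z u)) (cmod (emb z D)) \<le> c * (\<Prod>y\<leftarrow>ys. max 1 (cmod (emb z y)))"
    and fin: "\<And>P. prime_id P \<Longrightarrow>
      max (prime_abs K P u) (prime_abs K P D) \<le> (\<Prod>y\<leftarrow>ys. max 1 (prime_abs K P y))"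
  shows "weil_height (u / D) \<le> ln c + (\<Sum>y\<leftarrow>ys. weil_height y)"
proof -
  have uD: "u / D \<in> K" "u / D \<noteq> 0" using u D by auto
  define S where "S = gplaces (u / D) \<union> gplaces D \<union> (\<Union>y\<in>set ys. gplaces y)"
  have S: "finite S" "\<And>P. P \<in> S \<Longrightarrow> prime_id P"
    unfolding S_def using finite_val_nonzero uD D ys by (auto simp: gplaces_def)
  have pos: "0 < (\<Prod>y\<leftarrow>ys. max 1 (f y))" for f :: "qbar \<Rightarrow> real"
    by (induction ys) auto
  have lnp: "ln (\<Prod>y\<leftarrow>ys. max 1 (f y)) = (\<Sum>y\<leftarrow>ys. ln (max 1 (f y)))" for f :: "qbar \<Rightarrow> real"
  proof (induction ys)
    case (Cons y ys)
    have "0 < (\<Prod>y\<leftarrow>ys. max 1 (f y))" by (induction ys) auto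
    then have "ln (max 1 (f y) * (\<Prod>y\<leftarrow>ys. max 1 (f y))) = ln (max 1 (f y)) + ln (\<Prod>y\<leftarrow>ys. max 1 (f y))"
      by (subst ln_mult) auto
    then show ?case unfolding list.map prod_list.Cons sum_list.Cons Cons.IH .
  qed simp
  have div: "ln (max 1 (a / b)) \<le> ln B - ln b" if "max a b \<le> B" "0 < b" for a b B :: real
  proof -
    have "max 1 (a / b) \<le> B / b" using that by (simp add: field_simps)
    then have "ln (max 1 (a / b)) \<le> ln (B / b)" by simp
    also have "\<dots> = ln B - ln b" by (subst ln_div) (use that in auto)
    finally show ?thesis .
  qed
  have emb_div: "emb z (u / D) = emb z u / emb z D" if z: "z \<in> conjugates \<gamma>" for z
    using emb_hom(2)[OF z uD(1) D(1)] D(2) emb_nonzero[OF z D] by (simp add: field_simps)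
  have pa_div: "prime_abs K P (u / D) = prime_abs K P u / prime_abs K P D" if P: "prime_id P" for P
  proof -
    have "prime_abs K P u = prime_abs K P (u / D) * prime_abs K P D"
      using prime_abs_mult[OF P uD(1) D(1)] D(2) by simp
    then show ?thesis using prime_abs_pos[OF P D(2)] by (simp add: field_simps)
  qed
  have "real d * weil_height (u / D) =
    (\<Sum>z\<in>conjugates \<gamma>. ln (max 1 (cmod (emb z (u / D))))) + (\<Sum>P\<in>S. ln (max 1 (prime_abs K P (u / D))))"
    by (rule d_weil_height[OF uD S]) (auto simp: S_def)
  also have "\<dots> \<le> (\<Sum>z\<in>conjugates \<gamma>. ln c + (\<Sum>y\<leftarrow>ys. ln (max 1 (cmod (emb z y)))) - ln (cmod (emb z D))) +
      (\<Sum>P\<in>S. (\<Sum>y\<leftarrow>ys. ln (max 1 (prime_abs K P y))) - ln (prime_abs K P D))"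
  proof (intro add_mono sum_mono)
    fix z assume z: "z \<in> conjugates \<gamma>"
    have "ln (max 1 (cmod (emb z u) / cmod (emb z D))) \<le> ln (c * (\<Prod>y\<leftarrow>ys. max 1 (cmod (emb z y)))) - ln (cmod (emb z D))"
      by (rule div[OF arch[OF z]]) (use emb_nonzero[OF z D] in simp)
    also have "ln (c * (\<Prod>y\<leftarrow>ys. max 1 (cmod (emb z y)))) = ln c + (\<Sum>y\<leftarrow>ys. ln (max 1 (cmod (emb z y))))"
      unfolding lnp[symmetric] by (rule ln_mult_pos[OF c pos])
    finally show "ln (max 1 (cmod (emb z (u / D)))) \<le> ln c + (\<Sum>y\<leftarrow>ys. ln (max 1 (cmod (emb z y)))) - ln (cmod (emb z D))"
      by (simp add: emb_div[OF z] norm_divide)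
  next
    fix P assume "P \<in> S"
    then have P: "prime_id P" by (rule S)
    show "ln (max 1 (prime_abs K P (u / D))) \<le> (\<Sum>y\<leftarrow>ys. ln (max 1 (prime_abs K P y))) - ln (prime_abs K P D)"
      using div[OF fin[OF P] prime_abs_pos[OF P D(2)]] unfolding pa_div[OF P] lnp .
  qed
  also have "\<dots> = real d * ln c + ((\<Sum>y\<leftarrow>ys. \<Sum>z\<in>conjugates \<gamma>. ln (max 1 (cmod (emb z y)))) +
      (\<Sum>y\<leftarrow>ys. \<Sum>P\<in>S. ln (max 1 (prime_abs K P y)))) -
      ((\<Sum>z\<in>conjugates \<gamma>. ln (cmod (emb z D))) + (\<Sum>P\<in>S. ln (prime_abs K P D)))"
  proof -
    have "(\<Sum>i\<in>A. \<Sum>y\<leftarrow>ys. f i y) = (\<Sum>y\<leftarrow>ys. \<Sum>i\<in>A. f i y)" for A and f :: "'b \<Rightarrow> qbar \<Rightarrow> real"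
      by (induction ys) (simp_all add: sum.distrib)
    note sw = this
    show ?thesis
      unfolding sum_subtractf sum.distrib sw[symmetric] by (simp add: card_conjugates)
  qed
  also have "(\<Sum>z\<in>conjugates \<gamma>. ln (cmod (emb z D))) + (\<Sum>P\<in>S. ln (prime_abs K P D)) = 0"
  proof -
    have "gplaces D \<subseteq> S" unfolding S_def by blast
    then show ?thesis using sum_ln_prime_abs[OF D S] by simp
  qed
  also have "(\<Sum>y\<leftarrow>ys. \<Sum>z\<in>conjugates \<gamma>. ln (max 1 (cmod (emb z y)))) +
      (\<Sum>y\<leftarrow>ys. \<Sum>P\<in>S. ln (max 1 (prime_abs K P y))) = (\<Sum>y\<leftarrow>ys. real d * weil_height y)"
  proof -
    have "(\<Sum>y\<leftarrow>ys. real d * weil_height y) = (\<Sum>y\<leftarrow>ys. (\<Sum>z\<in>conjugates \<gamma>. ln (max 1 (cmod (emb z y)))) +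
      (\<Sum>P\<in>S. ln (max 1 (prime_abs K P y))))"
      by (intro arg_cong[where f = sum_list] map_cong refl d_weil_height S) (use ys in \<open>auto simp: S_def\<close>)
    then show ?thesis by (simp add: sum_list_addf)
  qed
  also have "(\<Sum>y\<leftarrow>ys. real d * weil_height y) = real d * (\<Sum>y\<leftarrow>ys. weil_height y)"
    by (simp add: sum_list_const_mult)
  finally have "real d * weil_height (u / D) \<le> real d * (ln c + (\<Sum>y\<leftarrow>ys. weil_height y))"
    by (simp add: distrib_left)
  then show ?thesis using degree_mp_pos[of \<gamma>] by simp
qed

lemma prime_abs_add:
  assumes P: "prime_id P" and ab: "a \<in> K" "b \<in> K"
  shows "prime_abs K P (a + b) \<le> max (prime_abs K P a) (prime_abs K P b)"
proof (cases "a = 0 \<or> b = 0 \<or> a + b = 0")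
  case True
  have "prime_abs K P y \<ge> 0" for y using prime_abs_pos[OF P, of y] by (cases "y = 0") (auto simp: prime_abs_def)
  then show ?thesis using True by (auto simp: prime_abs_def le_max_iff_disj)
next
  case False
  then have "min (val P a) (val P b) \<le> val P (a + b)" using val_add[OF P] ab by blast
  then have "- val P (a + b) \<le> - val P a \<or> - val P (a + b) \<le> - val P b" by linarith
  moreover have "real (idx OK P) \<ge> 1" using idx_prime_pos[OF P] by simp
  ultimately show ?thesis
    unfolding le_max_iff_disj using False by (auto simp: prime_abs_eq[OF P] intro: power_int_increasing)
qed

lemma prime_abs_OK:
  assumes P: "prime_id P" and a: "a \<in> OK"
  shows "prime_abs K P a \<le> 1"
proof (cases "a = 0")
  case False
  have N: "real (idx OK P) \<ge> 1" using idx_prime_pos[OF P] by simp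
  have "- val P a \<le> 0" using val_nonneg[OF P a False] by simp
  from power_int_increasing[OF this N] False N show ?thesis by (simp add: prime_abs_eq[OF P])
qed (simp add: prime_abs_def)

end

section \<open>Primitive elements\<close>

text \<open>Euclidean division by a monic polynomial never leaves the field of the coefficients.
  This gives access to minimal polynomials over \<open>qf \<gamma>\<close> while all polynomials
  have type \<open>qbar poly\<close>.\<close>

lemma division_over_subfield:
  fixes m :: "qbar poly"
  assumes m: "monic m" "\<And>i. Polynomial.coeff m i \<in> qf \<gamma>"
  shows "(\<And>i. Polynomial.coeff p i \<in> qf \<gamma>) \<Longrightarrow>
    \<exists>r. (\<forall>i. Polynomial.coeff r i \<in> qf \<gamma>) \<and> m dvd p - r \<and> (r = 0 \<or> degree r < degree m)"
proof (induction "degree p" arbitrary: p rule: less_induct)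
  case less
  show ?case
  proof (cases "p = 0 \<or> degree p < degree m")
    case True
    then show ?thesis using less.prems by (intro exI[of _ p]) auto
  next
    case False
    define s where "s = Polynomial.monom (lead_coeff p) (degree p - degree m) * m"
    define p' where "p' = p - s"
    have cs: "Polynomial.coeff s i \<in> qf \<gamma>" for i
      unfolding s_def coeff_monom_mult using m(2) less.prems by auto
    have ps: "Polynomial.coeff p' i \<in> qf \<gamma>" for i
      unfolding p'_def coeff_diff using less.prems cs by auto
    have ls: "Polynomial.coeff s (degree p) = lead_coeff p" using False m(1) by (simp add: s_def coeff_monom_mult)
    have ds: "degree s \<le> degree p"
      using degree_mult_le[of "Polynomial.monom (lead_coeff p) (degree p - degree m)" m]
        degree_monom_le[of "lead_coeff p" "degree p - degree m"] False unfolding s_def by linarith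
    show ?thesis
    proof (cases "p' = 0")
      case True
      then have "p = s" by (simp add: p'_def)
      moreover have "m dvd s" by (simp add: s_def)
      ultimately show ?thesis by (intro exI[of _ 0]) auto
    next
      case False
      have "degree p' \<le> degree p" unfolding p'_def using ds by (intro degree_diff_le) auto
      moreover have "Polynomial.coeff p' (degree p) = 0" by (simp add: p'_def ls)
      ultimately have "degree p' < degree p"
        using False by (metis le_neq_implies_less leading_coeff_0_iff)
      from less.hyps[OF this ps] obtain r where r: "\<forall>i. Polynomial.coeff r i \<in> qf \<gamma>" "m dvd p' - r" "r = 0 \<or> degree r < degree m"
        by blast
      have "p - r = (p' - r) + s" by (simp add: p'_def)
      also have "m dvd \<dots>" using r(2) by (intro dvd_add) (auto simp: s_def)
      finally show ?thesis using r by blast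
    qed
  qed
qed

text \<open>For \<open>\<gamma> = x + c y\<close>, let \<open>F\<close> be the minimal polynomial of
  \<open>x\<close> evaluated at \<open>\<gamma> - c T\<close>, and \<open>G\<close> that of
  \<open>y\<close>. Both have coefficients in \<open>qf \<gamma>\<close>, and once finitely many
  \<open>c\<close> are avoided their only common root is \<open>y\<close>. The minimal polynomial of
  \<open>y\<close> over \<open>qf \<gamma>\<close> divides both and is squarefree, hence
  linear.\<close>

lemma primitive_element:
  fixes x y :: qbar
  obtains \<gamma> where "x \<in> qf \<gamma>" "y \<in> qf \<gamma>"
proof -
  define Rx where "Rx = {u :: qbar. ev (mp x) u = 0}"
  define Ry where "Ry = {v :: qbar. ev (mp y) v = 0}"
  have fin: "finite Rx" "finite Ry" unfolding Rx_def Ry_def by (auto intro!: poly_roots_finite)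
  \<comment> \<open>For \<open>v = y\<close> the quotient is 0 by convention, which only adds
    \<open>c = 0\<close> to the excluded values.\<close>
  define bad where "bad = (\<lambda>(u, v). (u - x) / (y - v)) ` (Rx \<times> Ry)"
  have "finite bad" using fin by (simp add: bad_def)
  moreover have "infinite (range (of_nat :: nat \<Rightarrow> qbar))" by (rule range_inj_infinite) (simp add: inj_def)
  ultimately obtain c :: nat where c: "(of_nat c :: qbar) \<notin> bad" by (metis finite_subset rangeE subsetI)
  define \<gamma> where "\<gamma> = x + of_nat c * y"
  define F where "F = pcompose (map_poly of_rat (mp x)) [:\<gamma>, - of_nat c:]"
  define G where "G = (map_poly of_rat (mp y) :: qbar poly)"
  define S where "S p \<longleftrightarrow> (\<forall>i. Polynomial.coeff p i \<in> qf \<gamma>)" for p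
  have SF: "S F" unfolding S_def F_def
    by (intro allI coeff_pcompose_semiring_closed) (auto simp: coeff_pCons split: nat.splits)
  have SG: "S G" by (auto simp: S_def G_def)
  have Fy: "poly F y = 0" by (simp add: F_def poly_pcompose \<gamma>_def algebra_simps)
  have Gy: "poly G y = 0" by (simp add: G_def)
  have "G \<noteq> 0" by (simp add: G_def)
  then obtain m0 where m0: "m0 \<noteq> 0 \<and> S m0 \<and> poly m0 y = 0"
    "\<And>p. p \<noteq> 0 \<and> S p \<and> poly p y = 0 \<Longrightarrow> degree m0 \<le> degree p"
    using ex_has_least_nat[of "\<lambda>p. p \<noteq> 0 \<and> S p \<and> poly p y = 0" G degree] SG Gy by blast
  define m where "m = smult (inverse (lead_coeff m0)) m0"
  have m: "monic m" "S m" "poly m y = 0" "degree m = degree m0"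
    using m0(1) by (auto simp: m_def S_def intro!: qf_mult qf_inverse)
  have dvd: "m dvd p" if p: "S p" "poly p y = 0" for p
  proof -
    obtain r where r: "S r" "m dvd p - r" "r = 0 \<or> degree r < degree m"
      using division_over_subfield[OF m(1), of \<gamma> p] m(2) p(1) unfolding S_def by blast
    obtain q where "p - r = m * q" using r(2) by (elim dvdE)
    then have "poly p y - poly r y = poly m y * poly q y" by (metis poly_diff poly_mult)
    then have "poly r y = 0" using p(2) m(3) by simp
    then have "r = 0" using m0(2)[of r] r(1,3) m(4) by fastforce
    then show ?thesis using r(2) by simp
  qed
  have only: "v = y" if v: "poly m v = 0" for v
  proof (rule ccontr)
    assume vy: "v \<noteq> y"
    have "poly F v = 0" "poly G v = 0" using dvd[OF SF Fy] dvd[OF SG Gy] v by (auto elim!: dvdE)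
    then have "\<gamma> - of_nat c * v \<in> Rx" "v \<in> Ry" by (auto simp: F_def G_def Rx_def Ry_def poly_pcompose algebra_simps)
    moreover have "of_nat c = (\<gamma> - of_nat c * v - x) / (y - v)"
      using vy by (simp add: \<gamma>_def field_simps)
    ultimately have "of_nat c \<in> bad" unfolding bad_def by (intro image_eqI[of _ _ "(\<gamma> - of_nat c * v, v)"]) auto
    then show False using c by simp
  qed
  have "m \<noteq> 0" using m(1) by auto
  have dm: "degree m = 1"
  proof -
    have "card {v. poly m v = 0} = degree m"
    proof -
      have "rsquarefree m"
        unfolding rsquarefree_def
      proof (intro conjI allI)
        fix v
        have "order v m \<le> order v G"
          by (rule dvd_imp_order_le) (use dvd[OF SG Gy] \<open>G \<noteq> 0\<close> in auto)
        moreover have "order v G = 0 \<or> order v G = 1"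
          using rsquarefree_mp[of y, where 'a = qbar] unfolding rsquarefree_def G_def by blast
        ultimately show "order v m = 0 \<or> order v m = 1" by auto
      qed (rule \<open>m \<noteq> 0\<close>)
      obtain A where A: "size A = degree m" "m = smult (lead_coeff m) (\<Prod>x\<in>#A. [:- x, 1:])"
        using alg_closed_imp_factorization[OF \<open>m \<noteq> 0\<close>] by blast
      have roots: "poly m v = 0 \<longleftrightarrow> v \<in># A" for v
        by (subst A(2)) (use \<open>m \<noteq> 0\<close> in \<open>auto simp: poly_prod_mset image_iff prod_mset_zero_iff\<close>)
      have "count A v \<le> 1" for v
      proof (rule ccontr)
        assume "\<not> count A v \<le> 1"
        then have "{#v, v#} \<subseteq># A" by (auto simp: subseteq_mset_def)
        then have "(\<Prod>x\<in>#{#v, v#}. [:- x, 1:]) dvd (\<Prod>x\<in>#A. [:- x, 1:])"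
          by (intro prod_mset_subset_imp_dvd image_mset_subseteq_mono)
        then have "[:- v, 1:] ^ 2 dvd m" by (subst A(2)) (simp add: power2_eq_square dvd_smult)
        then have "2 \<le> order v m" using \<open>m \<noteq> 0\<close> by (metis order_divides)
        then show False using \<open>rsquarefree m\<close> by (auto simp: rsquarefree_def dest!: spec[of _ v])
      qed
      then have "A = mset_set (set_mset A)"
        by (intro multiset_eqI) (metis count_eq_zero_iff count_mset_set(1,3) finite_set_mset le_SucE One_nat_def le_zero_eq not_in_iff)
      then have "card (set_mset A) = degree m" using A(1) by (metis size_mset_set)
      then show ?thesis using roots by simp
    qed
    moreover have "{v. poly m v = 0} = {y}" using only m(3) by blast
    ultimately show ?thesis by simp
  qed
  obtain a q where aq: "m = pCons a q" by (cases m) auto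
  then have "q \<noteq> 0" "degree q = 0" using dm by (auto split: if_splits)
  then obtain b where b: "q = [:b:]" by (elim degree_eq_zeroE)
  then have "b = 1" using m(1) aq \<open>q \<noteq> 0\<close> by simp
  then have "a + y = 0" using m(3) aq b by simp
  then have "y = - a" by (simp add: eq_neg_iff_add_eq_0 add.commute)
  moreover have "a \<in> qf \<gamma>" using m(2) aq unfolding S_def by (metis coeff_pCons_0)
  ultimately have "y \<in> qf \<gamma>" by auto
  then have yS: "y \<in> qf \<gamma>" using m(2) by (auto simp: S_def)
  have "x = \<gamma> - of_nat c * y" by (simp add: \<gamma>_def)
  also have "\<dots> \<in> qf \<gamma>" using yS by auto
  finally show ?thesis using that yS by blast
qed

lemma common_number_field:
  assumes "finite F"
  obtains \<gamma> where "nf \<gamma>" "F \<subseteq> qf \<gamma>"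
proof -
  have "\<exists>\<gamma>. F \<subseteq> qf \<gamma>" using assms
  proof (induction F rule: finite_induct)
    case (insert y F)
    then obtain x where "F \<subseteq> qf x" by blast
    moreover obtain \<gamma> where "x \<in> qf \<gamma>" "y \<in> qf \<gamma>" by (rule primitive_element)
    ultimately show ?case using qf_subset[of x \<gamma>] by (intro exI[of _ \<gamma>]) auto
  qed auto
  then obtain x where "F \<subseteq> qf x" by blast
  moreover obtain \<gamma> where "nf \<gamma>" "qf \<gamma> = qf x" by (rule nf_ex)
  ultimately show ?thesis using that by blast
qed

section \<open>Basic properties of the height\<close>

lemma log_mahler_nonneg: "0 \<le> log_mahler x"
  unfolding log_mahler_def using ipol(2)[of x] by (intro add_nonneg_nonneg sum_nonneg) auto

lemma weil_height_nonneg: "x \<noteq> 0 \<Longrightarrow> 0 \<le> weil_height x"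
  by (simp add: weil_height_eq log_mahler_nonneg)

lemma weil_height_mult_le:
  assumes "x \<noteq> 0" "y \<noteq> 0"
  shows "weil_height (x * y) \<le> weil_height x + weil_height y"
proof -
  obtain \<gamma> where g: "nf \<gamma>" "{x, y} \<subseteq> qf \<gamma>" by (rule common_number_field[of "{x, y}"]) auto
  then interpret nf \<gamma> by simp
  have K: "x \<in> K" "y \<in> K" using g by auto
  have b: "max (a * b) 1 \<le> max 1 a * max 1 b" if "0 \<le> a" "0 \<le> b" for a b :: real
  proof -
    have "a * b \<le> max 1 a * max 1 b" using that by (intro mult_mono) auto
    moreover have "1 * 1 \<le> max 1 a * max 1 b" by (intro mult_mono) auto
    ultimately show ?thesis by simp
  qed
  have "weil_height (x * y / 1) \<le> ln 1 + (\<Sum>y\<leftarrow>[x, y]. weil_height y)"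
  proof (rule weil_height_quotient_le)
    show "max (cmod (emb z (x * y))) (cmod (emb z 1)) \<le> 1 * (\<Prod>y\<leftarrow>[x, y]. max 1 (cmod (emb z y)))"
      if z: "z \<in> conjugates \<gamma>" for z
      using emb_hom(2)[OF z K] emb_hom(3)[OF z K, of 1] b[of "cmod (emb z x)" "cmod (emb z y)"]
      by (simp add: norm_mult)
    show "max (prime_abs K P (x * y)) (prime_abs K P 1) \<le> (\<Prod>y\<leftarrow>[x, y]. max 1 (prime_abs K P y))"
      if P: "prime_id P" for P
      using prime_abs_mult[OF P K] prime_abs_OK[OF P OK_1] prime_abs_pos[OF P] assms
        b[of "prime_abs K P x" "prime_abs K P y"] by (simp add: less_imp_le)
  qed (use assms K in auto)
  then show ?thesis by simp
qed

lemma weil_height_inverse: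
  assumes "x \<noteq> 0"
  shows "weil_height (inverse x) = weil_height x"
proof -
  have le: "weil_height (inverse x) \<le> weil_height x" if "x \<noteq> 0" for x
  proof -
    obtain \<gamma> where g: "nf \<gamma>" "{x} \<subseteq> qf \<gamma>" by (rule common_number_field[of "{x}"]) auto
    then interpret nf \<gamma> by simp
    have "weil_height (1 / x) \<le> ln 1 + (\<Sum>y\<leftarrow>[x]. weil_height y)"
    proof (rule weil_height_quotient_le)
      show "max (cmod (emb z 1)) (cmod (emb z x)) \<le> 1 * (\<Prod>y\<leftarrow>[x]. max 1 (cmod (emb z y)))"
        if z: "z \<in> conjugates \<gamma>" for z
        using emb_hom(3)[OF z qf_0 qf_0, of 1] by simp
      show "max (prime_abs K P 1) (prime_abs K P x) \<le> (\<Prod>y\<leftarrow>[x]. max 1 (prime_abs K P y))"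
        if P: "prime_id P" for P
        using prime_abs_OK[OF P OK_1] by simp
    qed (use that g in auto)
    then show ?thesis by (simp add: divide_inverse)
  qed
  show ?thesis using le[OF assms] le[of "inverse x"] assms by simp
qed

lemma weil_height_power:
  assumes "x \<noteq> 0"
  shows "weil_height (x ^ n) = real n * weil_height x"
proof -
  obtain \<gamma> where g: "nf \<gamma>" "{x} \<subseteq> qf \<gamma>" by (rule common_number_field[of "{x}"]) auto
  then interpret nf \<gamma> by simp
  have K: "x \<in> K" "x ^ n \<in> K" using g by auto
  have nz: "x ^ n \<noteq> 0" using assms by simp
  define S where "S = gplaces x \<union> gplaces (x ^ n)"
  have S: "finite S" "\<And>P. P \<in> S \<Longrightarrow> prime_id P"
    using finite_val_nonzero[OF K(1) assms] finite_val_nonzero[OF K(2) nz] by (auto simp: S_def gplaces_def)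
  have ln_max: "ln (max 1 (a ^ n)) = real n * ln (max 1 a)" if "0 \<le> a" for a :: real
  proof -
    have "max 1 (a ^ n) = max 1 a ^ n"
      using that by (cases "a \<le> 1") (auto simp: max_def power_le_one one_le_power not_le dest: antisym)
    then show ?thesis by (simp add: ln_realpow)
  qed
  have ep: "emb z (x ^ n) = emb z x ^ n" if z: "z \<in> conjugates \<gamma>" for z
  proof (induction n)
    case (Suc n)
    then show ?case using emb_hom(2)[OF z K(1) qf_power[OF K(1)]] by simp
  qed (use emb_hom(3)[OF z K, of 1] in simp)
  have pp: "prime_abs K P (x ^ n) = prime_abs K P x ^ n" if P: "prime_id P" for P
  proof (induction n)
    case (Suc n)
    then show ?case using prime_abs_mult[OF P K(1) qf_power[OF K(1)]] by simp
  qed (use val_1[OF P] in \<open>simp add: prime_abs_def\<close>)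
  have "real d * weil_height (x ^ n) = (\<Sum>z\<in>conjugates \<gamma>. ln (max 1 (cmod (emb z (x ^ n))))) +
      (\<Sum>P\<in>S. ln (max 1 (prime_abs K P (x ^ n))))"
    by (rule d_weil_height[OF K(2) nz S]) (auto simp: S_def)
  also have "\<dots> = real n * ((\<Sum>z\<in>conjugates \<gamma>. ln (max 1 (cmod (emb z x)))) +
      (\<Sum>P\<in>S. ln (max 1 (prime_abs K P x))))"
    unfolding distrib_left sum_distrib_left
    by (intro arg_cong2[where f = "(+)"] sum.cong refl)
       (simp_all add: ep pp S(2) norm_power ln_max prime_abs_pos[OF S(2) assms] less_imp_le)
  also have "\<dots> = real n * (real d * weil_height x)"
    by (subst d_weil_height[OF K(1) assms S]) (auto simp: S_def)
  finally show ?thesis using degree_mp_pos[of \<gamma>] by simp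
qed

section \<open>Numbers of height zero\<close>

lemma degree_mp_le:
  assumes "y \<in> qf x"
  shows "degree (mp y) \<le> degree (mp x)"
proof -
  obtain m :: int where m: "m > 0" "algebraic_int (of_int m * x)" by (rule multiple_algebraic_int)
  interpret nf "of_int m * x" using m(2) by (rule nf.intro)
  have "ev (pcompose (mp x) [:0, inverse (of_int m):]) (of_int m * x) = 0"
  proof -
    have "of_int m * x * of_rat (inverse (of_int m)) = x" using m(1) by (simp add: of_rat_inverse)
    moreover have "ev [:0, r:] y = y * of_rat r" for r and y :: qbar by (simp add: ev_pCons)
    ultimately show ?thesis by (simp only: ev_pcompose ev_mp)
  qed
  then have "mp (of_int m * x) dvd pcompose (mp x) [:0, inverse (of_int m):]" by (simp add: mp)
  moreover have "pcompose (mp x) [:0, inverse (of_int m):] \<noteq> 0"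
    using m(1) by (simp add: pcompose_eq_0_iff)
  ultimately have "d \<le> degree (pcompose (mp x) [:0, inverse (of_int m):])" by (rule dvd_imp_degree_le)
  then have "d \<le> degree (mp x)" using m(1) by simp
  moreover have "rdeg y * degree (mp y) = d" using rdeg_mult_degree assms qf_multiple[of m x] m(1) by auto
  then have "degree (mp y) \<le> d" using rdeg_pos[of y] by (cases "rdeg y") auto
  ultimately show ?thesis by simp
qed

lemma coeff_prod_linear_bound:
  fixes S :: "complex set"
  assumes "finite S" "\<And>w. w \<in> S \<Longrightarrow> cmod w \<le> 1"
  shows "cmod (Polynomial.coeff (\<Prod>w\<in>S. [:- w, 1:]) i) \<le> 2 ^ card S"
  using assms
proof (induction S arbitrary: i rule: finite_induct)
  case (insert w S)
  let ?p = "\<Prod>w\<in>S. [:- w, 1:]"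
  have IH: "cmod (Polynomial.coeff ?p i) \<le> 2 ^ card S" for i using insert by blast
  have e: "(\<Prod>w\<in>insert w S. [:- w, 1:]) = smult (- w) ?p + pCons 0 ?p"
    using insert.hyps by simp
  have 1: "cmod (w * Polynomial.coeff ?p i) \<le> 1 * 2 ^ card S"
    unfolding norm_mult using insert.prems IH by (intro mult_mono) auto
  have 2: "cmod (Polynomial.coeff (pCons 0 ?p) i) \<le> 2 ^ card S"
    using IH by (cases i) auto
  have "cmod (Polynomial.coeff (smult (- w) ?p + pCons 0 ?p) i)
      \<le> cmod (w * Polynomial.coeff ?p i) + cmod (Polynomial.coeff (pCons 0 ?p) i)"
    using norm_triangle_ineq[of "Polynomial.coeff (smult (- w) ?p) i" "Polynomial.coeff (pCons 0 ?p) i"] by simp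
  then show ?case unfolding e using 1 2 insert.hyps by simp
qed (auto simp: coeff_1)

lemma finite_bounded_int_polys: "finite {p :: int poly. degree p \<le> n \<and> (\<forall>i. \<bar>Polynomial.coeff p i\<bar> \<le> B)}"
proof (rule finite_imageD)
  let ?A = "{p :: int poly. degree p \<le> n \<and> (\<forall>i. \<bar>Polynomial.coeff p i\<bar> \<le> B)}"
  let ?f = "\<lambda>p :: int poly. map (Polynomial.coeff p) [0..<Suc n]"
  show "finite (?f ` ?A)"
    by (rule finite_subset[OF _ finite_lists_length_eq[of "{-B..B}" "Suc n"]]) (auto simp: abs_le_iff minus_le_iff)
  show "inj_on ?f ?A"
  proof (rule inj_onI, rule poly_eqI)
    fix p q i assume pq: "p \<in> ?A" "q \<in> ?A" "?f p = ?f q"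
    show "Polynomial.coeff p i = Polynomial.coeff q i"
    proof (cases "i \<le> n")
      case True
      have "Polynomial.coeff r i = ?f r ! i" for r :: "int poly"
        using True by (simp del: upt_Suc)
      then show ?thesis using pq(3) by presburger
    next
      case False
      then show ?thesis using pq(1,2) by (simp add: coeff_eq_0)
    qed
  qed
qed

text \<open>Kronecker: the powers of \<open>x\<close> are algebraic integers of bounded degree whose conjugates
  lie in the unit disc, so there are only finitely many of them.\<close>

lemma kronecker:
  assumes x: "x \<noteq> 0" "weil_height x = 0"
  obtains n :: nat where "n > 0" "x ^ n = 1"
proof -
  define D where "D = degree (mp x)"
  define B :: int where "B = 2 ^ D"
  define A where "A = {p :: int poly. degree p \<le> D \<and> (\<forall>i. \<bar>Polynomial.coeff p i\<bar> \<le> B)}"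
  have mem: "ipol (x ^ k) \<in> A" for k
  proof -
    let ?y = "x ^ k"
    have y: "?y \<noteq> 0" using x by simp
    have "weil_height ?y = 0" using weil_height_power[OF x(1), of k] x(2) by simp
    then have lm: "log_mahler ?y = 0" using degree_mp_pos[of ?y] by (simp add: weil_height_eq[OF y])
    have a: "0 \<le> ln (real_of_int (lead_coeff (ipol ?y)))" using ipol(2)[of ?y] by simp
    have s: "0 \<le> (\<Sum>w\<in>conjugates ?y. ln (max 1 (cmod w)))" by (intro sum_nonneg) auto
    \<comment> \<open>A sum of nonnegative terms is 0, so each term is: the leading coefficient is 1
      and no conjugate leaves the unit disc.\<close>
    have "ln (real_of_int (lead_coeff (ipol ?y))) = 0" "(\<Sum>w\<in>conjugates ?y. ln (max 1 (cmod w))) = 0"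
      using lm a s unfolding log_mahler_def by linarith+
    then have lc: "lead_coeff (ipol ?y) = 1" and w: "\<And>w. w \<in> conjugates ?y \<Longrightarrow> ln (max 1 (cmod w)) = 0"
      using ipol(2)[of ?y] finite_conjugates[of ?y] by (auto simp: sum_nonneg_eq_0_iff)
    have w1: "cmod w \<le> 1" if "w \<in> conjugates ?y" for w
      using w[OF that] by (smt (verit) ln_gt_zero)
    have "degree (mp ?y) \<le> D" unfolding D_def by (intro degree_mp_le) auto
    moreover have "\<bar>Polynomial.coeff (ipol ?y) i\<bar> \<le> B" for i
    proof -
      have "(of_int (Polynomial.coeff (ipol ?y) i) :: rat) = Polynomial.coeff (of_int_poly (ipol ?y)) i" by simp
      also have "\<dots> = Polynomial.coeff (mp ?y) i" unfolding ipol(3) lc by simp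
      finally have "(of_int (Polynomial.coeff (ipol ?y) i) :: complex) = of_rat (Polynomial.coeff (mp ?y) i)"
        by (metis of_rat_of_int_eq)
      also have "\<dots> = Polynomial.coeff (\<Prod>w\<in>conjugates ?y. [:- w, 1:]) i"
        by (simp only: mp_complex_factorization[symmetric] of_rat_hom.coeff_map_poly_hom)
      finally have "cmod (of_int (Polynomial.coeff (ipol ?y) i)) \<le> 2 ^ card (conjugates ?y)"
        using coeff_prod_linear_bound[OF finite_conjugates w1] by metis
      also have "\<dots> \<le> 2 ^ D" using \<open>degree (mp ?y) \<le> D\<close> by (simp add: card_conjugates)
      finally have "real_of_int \<bar>Polynomial.coeff (ipol ?y) i\<bar> \<le> real_of_int B" by (simp add: B_def)
      then show ?thesis by linarith
    qed
    ultimately show ?thesis by (simp add: A_def degree_ipol)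
  qed
  have "finite A" unfolding A_def by (rule finite_bounded_int_polys)
  then have "finite (\<Union>p\<in>A - {0}. {y :: qbar. poly (of_int_poly p) y = 0})"
    by (intro finite_UN_I finite_Diff poly_roots_finite) auto
  moreover have "range (\<lambda>k. x ^ k) \<subseteq> (\<Union>p\<in>A - {0}. {y :: qbar. poly (of_int_poly p) y = 0})"
  proof (intro image_subsetI)
    fix k
    show "x ^ k \<in> (\<Union>p\<in>A - {0}. {y :: qbar. poly (of_int_poly p) y = 0})"
      by (rule UN_I[of "ipol (x ^ k)"]) (use mem[of k] in auto)
  qed
  ultimately have "finite (range (\<lambda>k. x ^ k))" by (rule finite_subset[rotated])
  then have "\<not> inj (\<lambda>k :: nat. x ^ k)" using finite_imageD infinite_UNIV_nat by blast
  then obtain i j :: nat where ij: "i \<noteq> j" "x ^ i = x ^ j" by (auto simp: inj_def)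
  have "\<exists>n>0. x ^ n = 1" if "i < j" "x ^ i = x ^ j" for i j :: nat
  proof -
    have "x ^ j = x ^ i * x ^ (j - i)" using that(1) by (simp add: power_add[symmetric])
    then have "x ^ (j - i) = 1" using that(2) x(1) by simp
    then show ?thesis using that(1) by (intro exI[of _ "j - i"]) auto
  qed
  then have "\<exists>n>0. x ^ n = 1" using ij by (metis linorder_neqE_nat)
  then show ?thesis using that by blast
qed

section \<open>Elimination between two linear forms\<close>

text \<open>One statement for all places: \<open>T = 2\<close> for the ordinary absolute value,
  \<open>T = 1\<close> for an ultrametric one. Numerator and determinant in Cramer's rule are
  differences of two monomials, each of which is bounded by \<open>Y\<close> times one common
  product of factors \<open>max 1 (...)\<close>.\<close>

lemma elimination_local_bound:
  fixes \<phi> :: "qbar \<Rightarrow> real" and K :: "qbar set"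
  assumes mult: "\<And>y z. y \<in> K \<Longrightarrow> z \<in> K \<Longrightarrow> \<phi> (y * z) = \<phi> y * \<phi> z"
    and diff: "\<And>y z. y \<in> K \<Longrightarrow> z \<in> K \<Longrightarrow> \<phi> (y - z) \<le> T * max (\<phi> y) (\<phi> z)"
    and nonneg: "\<And>y. 0 \<le> \<phi> y" and one: "\<phi> 1 = 1" and T: "0 \<le> T"
    and K: "\<And>y z. y \<in> K \<Longrightarrow> z \<in> K \<Longrightarrow> y * z \<in> K" "1 \<in> K"
    and mem: "A \<in> K" "B \<in> K" "C \<in> K" "a1 \<in> K" "a2 \<in> K" "b1 \<in> K" "b2 \<in> K" "w1 \<in> K" "w2 \<in> K"
    and bound: "\<phi> A \<le> Y" "\<phi> B \<le> Y" "\<phi> C \<le> Y"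
  shows "max (\<phi> (C * (b2 * w2) - a2 ^ M * B)) (\<phi> (a1 ^ M * A * (b2 * w2) - a2 ^ M * B * (b1 * w1)))
    \<le> T * (Y * (max 1 (\<phi> a1) ^ M * max 1 (\<phi> a2) ^ M * max 1 (\<phi> b1) * max 1 (\<phi> b2) * max 1 (\<phi> w1) * max 1 (\<phi> w2)))"
    (is "_ \<le> T * (Y * ?\<Pi>)")
proof -
  have pw: "y ^ n \<in> K" "\<phi> (y ^ n) = \<phi> y ^ n" if "y \<in> K" for y n
  proof -
    have "y ^ n \<in> K \<and> \<phi> (y ^ n) = \<phi> y ^ n" by (induction n) (use that K one mult in auto)
    then show "y ^ n \<in> K" "\<phi> (y ^ n) = \<phi> y ^ n" by auto
  qed
  have Y: "0 \<le> Y" using nonneg[of A] bound(1) by linarith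
  have le: "0 \<le> max 1 (\<phi> y) ^ n" "1 \<le> max 1 (\<phi> y) ^ n" "\<phi> y ^ n \<le> max 1 (\<phi> y) ^ n" for y n
    using nonneg[of y] by (auto intro: power_mono)
  note fin = mult_mono bound le nonneg Y zero_le_power mult_nonneg_nonneg max.cobounded1 max.cobounded2
    order_trans[OF zero_le_one max.cobounded1] zero_le_one
  have "\<phi> C * (1 * 1 * 1 * \<phi> b2 * 1 * \<phi> w2) \<le> Y * ?\<Pi>" by (intro fin)
  then have 1: "\<phi> (C * (b2 * w2)) \<le> Y * ?\<Pi>" using mem K by (simp add: mult mult_ac)
  have "\<phi> B * (1 * \<phi> a2 ^ M * 1 * 1 * 1 * 1) \<le> Y * ?\<Pi>" by (intro fin)
  then have 2: "\<phi> (a2 ^ M * B) \<le> Y * ?\<Pi>" using mem K by (simp add: mult pw mult_ac)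
  have "\<phi> A * (\<phi> a1 ^ M * 1 * 1 * \<phi> b2 * 1 * \<phi> w2) \<le> Y * ?\<Pi>" by (intro fin)
  then have 3: "\<phi> (a1 ^ M * A * (b2 * w2)) \<le> Y * ?\<Pi>" using mem K by (simp add: mult pw mult_ac)
  have "\<phi> B * (1 * \<phi> a2 ^ M * \<phi> b1 * 1 * \<phi> w1 * 1) \<le> Y * ?\<Pi>" by (intro fin)
  then have 4: "\<phi> (a2 ^ M * B * (b1 * w1)) \<le> Y * ?\<Pi>" using mem K by (simp add: mult pw mult_ac)
  have "\<phi> (C * (b2 * w2) - a2 ^ M * B) \<le> T * max (\<phi> (C * (b2 * w2))) (\<phi> (a2 ^ M * B))"
    by (rule diff) (use mem K pw in auto)
  also have "\<dots> \<le> T * (Y * ?\<Pi>)" using 1 2 T by (intro mult_left_mono) auto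
  finally have u: "\<phi> (C * (b2 * w2) - a2 ^ M * B) \<le> T * (Y * ?\<Pi>)" .
  have "\<phi> (a1 ^ M * A * (b2 * w2) - a2 ^ M * B * (b1 * w1))
      \<le> T * max (\<phi> (a1 ^ M * A * (b2 * w2))) (\<phi> (a2 ^ M * B * (b1 * w1)))"
    by (rule diff) (use mem K pw in auto)
  also have "\<dots> \<le> T * (Y * ?\<Pi>)" using 3 4 T by (intro mult_left_mono) auto
  finally show ?thesis using u by simp
qed

context nf
begin

lemma emb_poly:
  assumes z: "z \<in> conjugates \<gamma>" and x: "x \<in> K"
  shows "emb z (poly (of_int_poly p) x) = poly (of_int_poly p) (emb z x)"
proof -
  obtain c where c: "x = ev c \<gamma>" using x by (auto simp: qf_def)
  show ?thesis
    using emb_ev[OF z, of "pcompose (of_int_poly p) c"] emb_ev[OF z, of c]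
    by (simp add: c poly_of_int_poly_eq_ev ev_pcompose)
qed

lemma prime_abs_poly_le:
  assumes P: "prime_id P" and x: "x \<in> K" and p: "degree p \<le> N"
  shows "prime_abs K P (poly (of_int_poly p) x) \<le> max 1 (prime_abs K P x) ^ N"
proof -
  have nn: "0 \<le> prime_abs K P y" for y
    using prime_abs_pos[OF P, of y] by (cases "y = 0") (auto simp: prime_abs_def)
  show ?thesis using p
  proof (induction p arbitrary: N)
    case 0
    then show ?case using nn by (simp add: prime_abs_def)
  next
    case (pCons a p)
    have q: "poly (of_int_poly p) x \<in> K" using poly_of_int_poly_in_qf[of p x] qf_subset[OF x] by blast
    have a: "prime_abs K P (of_int a) \<le> max 1 (prime_abs K P x) ^ N"
    proof -
      have "1 \<le> max 1 (prime_abs K P x) ^ N" by (rule one_le_power) simp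
      then show ?thesis using prime_abs_OK[OF P OK_of_int, of a] by linarith
    qed
    have "prime_abs K P (x * poly (of_int_poly p) x) \<le> max 1 (prime_abs K P x) ^ N"
    proof (cases "p = 0")
      case True
      then show ?thesis by (simp add: prime_abs_def)
    next
      case False
      then obtain N' where N': "N = Suc N'" "degree p \<le> N'" using pCons.prems by (cases N) auto
      have "prime_abs K P x * prime_abs K P (poly (of_int_poly p) x) \<le> max 1 (prime_abs K P x) * max 1 (prime_abs K P x) ^ N'"
        by (intro mult_mono pCons.IH N'(2)) (auto simp: nn)
      then show ?thesis using prime_abs_mult[OF P x q] N'(1) by simp
    qed
    then show ?case
      using prime_abs_add[OF P qf_of_int qf_mult[OF x q], of a] a
      by (simp add: of_int_hom.map_poly_pCons_hom)
  qed
qed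

end

text \<open>Cramer's rule for \<open>\<xi>1\<close>. The coefficients of the second equation are
  given as products, so that an application can put a number of small height into \<open>b1\<close>,
  \<open>b2\<close> and a power of a coordinate of \<beta> into \<open>w1\<close>,
  \<open>w2\<close>.\<close>

lemma height_elimination:
  fixes \<xi>1 \<xi>2 a1 a2 b1 b2 w1 w2 x :: qbar and A B C :: "int poly"
  assumes nz: "\<xi>1 \<noteq> 0" "a1 \<noteq> 0" "a2 \<noteq> 0" "b1 \<noteq> 0" "b2 \<noteq> 0" "w1 \<noteq> 0" "w2 \<noteq> 0" "x \<noteq> 0"
    and deg: "degree A \<le> N" "degree B \<le> N" "degree C \<le> N"
    and arch: "\<And>z :: complex. cmod (poly (of_int_poly A) z) \<le> \<kappa> * max 1 (cmod z) ^ N"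
      "\<And>z :: complex. cmod (poly (of_int_poly B) z) \<le> \<kappa> * max 1 (cmod z) ^ N"
      "\<And>z :: complex. cmod (poly (of_int_poly C) z) \<le> \<kappa> * max 1 (cmod z) ^ N"
    and \<kappa>: "0 < \<kappa>"
    and eq1: "\<xi>1 * (a1 ^ M * poly (of_int_poly A) x) + \<xi>2 * (a2 ^ M * poly (of_int_poly B) x) = poly (of_int_poly C) x"
    and eq2: "\<xi>1 * (b1 * w1) + \<xi>2 * (b2 * w2) = 1"
    and D: "a1 ^ M * poly (of_int_poly A) x * (b2 * w2) - a2 ^ M * poly (of_int_poly B) x * (b1 * w1) \<noteq> 0"
  shows "weil_height \<xi>1 \<le> ln (2 * \<kappa>) + real N * weil_height x + real M * (weil_height a1 + weil_height a2)
    + weil_height b1 + weil_height b2 + weil_height w1 + weil_height w2"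
proof -
  obtain \<gamma> where g: "nf \<gamma>" "{a1, a2, b1, b2, w1, w2, x} \<subseteq> qf \<gamma>"
    by (rule common_number_field[of "{a1, a2, b1, b2, w1, w2, x}"]) auto
  then interpret nf \<gamma> by simp
  have K: "a1 \<in> K" "a2 \<in> K" "b1 \<in> K" "b2 \<in> K" "w1 \<in> K" "w2 \<in> K" "x \<in> K" using g by auto
  have pK: "poly (of_int_poly p) x \<in> K" for p using poly_of_int_poly_in_qf[of p x] qf_subset[OF K(7)] by blast
  let ?A = "poly (of_int_poly A) x" and ?B = "poly (of_int_poly B) x" and ?C = "poly (of_int_poly C) x"
  define u where "u = ?C * (b2 * w2) - a2 ^ M * ?B"
  define D' where "D' = a1 ^ M * ?A * (b2 * w2) - a2 ^ M * ?B * (b1 * w1)"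
  have "\<xi>1 * D' = \<xi>1 * (a1 ^ M * ?A) * (b2 * w2) - a2 ^ M * ?B * (\<xi>1 * (b1 * w1))"
    by (simp add: D'_def algebra_simps)
  also have "\<xi>1 * (b1 * w1) = 1 - \<xi>2 * (b2 * w2)" using eq2 by (simp add: eq_diff_eq)
  also have "\<xi>1 * (a1 ^ M * ?A) = ?C - \<xi>2 * (a2 ^ M * ?B)" using eq1 by (simp add: eq_diff_eq)
  finally have "\<xi>1 * D' = u" by (simp add: u_def algebra_simps)
  then have \<xi>: "\<xi>1 = u / D'" "u \<noteq> 0" using D nz(1) by (auto simp: D'_def field_simps)
  have uK: "u \<in> K" "D' \<in> K" unfolding u_def D'_def using K pK by auto
  \<comment> \<open>Multiplicities encode exponents: \<open>N\<close> copies of \<open>x\<close> for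
    the polynomials and \<open>M\<close> copies of each of \<open>a1\<close> and
    \<open>a2\<close>.\<close>
  define ys where "ys = replicate N x @ replicate M a1 @ replicate M a2 @ [b1, b2, w1, w2]"
  have prod: "(\<Prod>y\<leftarrow>ys. f y) = f x ^ N * (f a1 ^ M * f a2 ^ M * f b1 * f b2 * f w1 * f w2)" for f :: "qbar \<Rightarrow> real"
    by (simp add: ys_def prod_list_replicate mult_ac)
  have sum: "(\<Sum>y\<leftarrow>ys. weil_height y) = real N * weil_height x + real M * (weil_height a1 + weil_height a2)
    + weil_height b1 + weil_height b2 + weil_height w1 + weil_height w2"
    by (simp add: ys_def sum_list_replicate algebra_simps)
  have "weil_height (u / D') \<le> ln (2 * \<kappa>) + (\<Sum>y\<leftarrow>ys. weil_height y)"
  proof (rule weil_height_quotient_le[OF uK(1) \<xi>(2) uK(2)])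
    show "D' \<noteq> 0" using D by (simp add: D'_def)
    show "y \<in> K \<and> y \<noteq> 0" if "y \<in> set ys" for y using that K nz by (auto simp: ys_def split: if_splits)
    fix z assume z: "z \<in> conjugates \<gamma>"
    have m: "emb z (- y) = - emb z y" if "y \<in> K" for y
      using emb_hom(1)[OF z that qf_uminus[OF that]] emb_hom(3)[OF z that that, of 0] by (simp add: eq_neg_iff_add_eq_0 add.commute)
    have "max (cmod (emb z u)) (cmod (emb z D')) \<le> 2 * (\<kappa> * max 1 (cmod (emb z x)) ^ N * (max 1 (cmod (emb z a1)) ^ M *
      max 1 (cmod (emb z a2)) ^ M * max 1 (cmod (emb z b1)) * max 1 (cmod (emb z b2)) * max 1 (cmod (emb z w1)) * max 1 (cmod (emb z w2))))"
      unfolding u_def D'_def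
    proof (rule elimination_local_bound[where K = K and \<phi> = "\<lambda>y. cmod (emb z y)"])
      show "cmod (emb z (y * y')) = cmod (emb z y) * cmod (emb z y')" if "y \<in> K" "y' \<in> K" for y y'
        using emb_hom(2)[OF z that] by (simp add: norm_mult)
      show "cmod (emb z (y - y')) \<le> 2 * max (cmod (emb z y)) (cmod (emb z y'))" if "y \<in> K" "y' \<in> K" for y y'
        using emb_hom(1)[OF z that(1) qf_uminus[OF that(2)]] m[OF that(2)] norm_triangle_ineq4[of "emb z y" "emb z y'"] by simp
      show "cmod (emb z 1) = 1" using emb_hom(3)[OF z K(1,1), of 1] by simp
    qed (use K pK arch in \<open>auto simp: emb_poly[OF z]\<close>)
    then show "max (cmod (emb z u)) (cmod (emb z D')) \<le> 2 * \<kappa> * (\<Prod>y\<leftarrow>ys. max 1 (cmod (emb z y)))"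
      unfolding prod by (simp only: mult.assoc)
  next
    fix P assume P: "prime_id P"
    have "max (prime_abs K P u) (prime_abs K P D') \<le> 1 * (max 1 (prime_abs K P x) ^ N * (max 1 (prime_abs K P a1) ^ M *
      max 1 (prime_abs K P a2) ^ M * max 1 (prime_abs K P b1) * max 1 (prime_abs K P b2) * max 1 (prime_abs K P w1) * max 1 (prime_abs K P w2)))"
      unfolding u_def D'_def
    proof (rule elimination_local_bound[where K = K and \<phi> = "prime_abs K P"])
      show "prime_abs K P (y * y') = prime_abs K P y * prime_abs K P y'" if "y \<in> K" "y' \<in> K" for y y'
        by (rule prime_abs_mult[OF P that])
      show "prime_abs K P (y - y') \<le> 1 * max (prime_abs K P y) (prime_abs K P y')" if "y \<in> K" "y' \<in> K" for y y'
      proof -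
        have "prime_abs K P (- y') = prime_abs K P (- 1) * prime_abs K P y'"
          using prime_abs_mult[OF P qf_uminus[OF qf_1] that(2)] by simp
        also have "\<dots> \<le> 1 * prime_abs K P y'"
          using prime_abs_OK[OF P OK_uminus[OF OK_1]] prime_abs_pos[OF P, of y']
          by (intro mult_right_mono) (cases "y' = 0"; simp add: prime_abs_def)+
        finally show ?thesis using prime_abs_add[OF P that(1) qf_uminus[OF that(2)]] by auto
      qed
      show "0 \<le> prime_abs K P y" for y
        using prime_abs_pos[OF P, of y] by (cases "y = 0") (auto simp: prime_abs_def)
      show "prime_abs K P 1 = 1" using val_1[OF P] by (simp add: prime_abs_def)
    qed (use K pK deg prime_abs_poly_le[OF P K(7)] in auto)
    then show "max (prime_abs K P u) (prime_abs K P D') \<le> (\<Prod>y\<leftarrow>ys. max 1 (prime_abs K P y))"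
      unfolding prod by simp
  qed (use \<kappa> in simp)
  then show ?thesis unfolding \<xi>(1)[symmetric] sum by simp
qed

section \<open>Pade approximants of the unit equation\<close>

text \<open>The expansion of \<open>(X + u)^(-n)\<close> for nonzero \<open>u\<close>. For
  \<open>n = 0\<close> the truncated subtraction in \<open>n + i - 1\<close> still gives the series
  1.\<close>

definition binom_fps :: "'a::field \<Rightarrow> nat \<Rightarrow> 'a fps" where
  "binom_fps u n = Abs_fps (\<lambda>i. (-1) ^ i * of_nat ((n + i - 1) choose i) * inverse u ^ (n + i))"

lemma binom_fps_0 [simp]: "binom_fps u 0 = 1"
proof (rule fps_ext)
  fix i show "fps_nth (binom_fps u 0) i = fps_nth 1 i"
    by (cases i) (simp_all add: binom_fps_def binomial_eq_0)
qed

lemma binom_fps_Suc: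
  assumes "u \<noteq> 0"
  shows "binom_fps u n = (fps_X + fps_const u) * binom_fps u (Suc n)"
proof (rule fps_ext)
  fix i show "fps_nth (binom_fps u n) i = fps_nth ((fps_X + fps_const u) * binom_fps u (Suc n)) i"
    using assms by (cases i) (simp_all add: binom_fps_def distrib_right field_simps)
qed

text \<open>The residues of \<open>w^(-m-1)\<close>-type products at two poles: those of
  \<open>w^(-n-1) (w - u)^(-m-1)\<close> at \<open>0\<close> and \<open>u\<close> cancel. These are
  the base cases of the formula for three poles.\<close>

lemma binom_fps_reflect:
  "fps_nth (binom_fps (- u) (Suc m)) n + fps_nth (binom_fps u (Suc n)) m = 0"
proof -
  have "(m + n) choose n = (n + m) choose m" by (subst binomial_symmetric) (simp_all add: add.commute)
  then show ?thesis
    by (simp add: binom_fps_def power_minus[of "inverse u"] power_add mult_ac)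
qed

text \<open>The residue at 0 of \<open>X^(-n) f\<close>, that is, the coefficient of
  \<open>X^(n - 1)\<close> in \<open>f\<close>; for \<open>n = 0\<close> there is no pole.\<close>

fun residue_coeff :: "nat \<Rightarrow> 'a::field fps \<Rightarrow> 'a" where
  "residue_coeff 0 f = 0"
| "residue_coeff (Suc n) f = fps_nth f n"

lemma residue_coeff_binom_fps:
  assumes "u \<noteq> 0"
  shows "residue_coeff (Suc n) (binom_fps u m * f) =
    residue_coeff n (binom_fps u (Suc m) * f) + u * residue_coeff (Suc n) (binom_fps u (Suc m) * f)"
  unfolding binom_fps_Suc[OF assms, of m] by (cases n) (simp_all add: distrib_right mult.assoc)

text \<open>The residues of \<open>w\<^sup>-\<^sup>a (w - 1)\<^sup>-\<^sup>b (w - z)\<^sup>-\<^sup>c\<close> at \<open>0\<close>, \<open>1\<close> and \<open>z\<close> add up to zero.\<close>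

lemma residue_sum:
  assumes z: "z \<noteq> 0" "z \<noteq> 1" and "a + b > 0"
  shows "residue_coeff a (binom_fps (-1) b * binom_fps (- z) (Suc c)) +
    residue_coeff b (binom_fps 1 a * binom_fps (1 - z) (Suc c)) +
    residue_coeff (Suc c) (binom_fps z a * binom_fps (z - 1) b) = 0"
  using assms(3)
proof (induction a arbitrary: b)
  case 0
  then obtain b' where "b = Suc b'" by (cases b) auto
  then show ?case using binom_fps_reflect[of "z - 1" c b'] by simp
next
  case (Suc a)
  note IH = Suc.IH
  show ?case
  proof (induction b)
    case 0
    then show ?case using binom_fps_reflect[of z c a] by simp
  next
    case (Suc b)
    \<comment> \<open>The identity \<open>1 / (w (w - 1)) = 1 / (w - 1) - 1 / w\<close> expresses
      the exponents \<open>(a + 1, b + 1)\<close> through \<open>(a, b + 1)\<close> and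
      \<open>(a + 1, b)\<close>, at each of the three poles separately.\<close>
    let ?T = "residue_coeff" and ?G = binom_fps
    note step = residue_coeff_binom_fps
    have 1: "?T (Suc a) (?G (-1) b * ?G (- z) (Suc c)) =
        ?T a (?G (-1) (Suc b) * ?G (- z) (Suc c)) - ?T (Suc a) (?G (-1) (Suc b) * ?G (- z) (Suc c))"
      using step[of "-1" a b "?G (- z) (Suc c)"] by simp
    have 2: "?T (Suc b) (?G 1 a * ?G (1 - z) (Suc c)) =
        ?T b (?G 1 (Suc a) * ?G (1 - z) (Suc c)) + ?T (Suc b) (?G 1 (Suc a) * ?G (1 - z) (Suc c))"
      using step[of 1 b a "?G (1 - z) (Suc c)"] by simp
    note 3 = step[OF z(1), of c a "?G (z - 1) (Suc b)"]
    have 4: "?T (Suc c) (?G z (Suc a) * ?G (z - 1) b) =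
        ?T c (?G z (Suc a) * ?G (z - 1) (Suc b)) + (z - 1) * ?T (Suc c) (?G z (Suc a) * ?G (z - 1) (Suc b))"
      using step[of "z - 1" c b "?G z (Suc a)"] z by (simp only: mult.commute[of "?G z (Suc a)"]) simp
    have 5: "?T (Suc c) (?G z (Suc a) * ?G (z - 1) (Suc b)) =
        ?T (Suc c) (?G z a * ?G (z - 1) (Suc b)) - ?T (Suc c) (?G z (Suc a) * ?G (z - 1) b)"
      unfolding 3 4 by (simp add: algebra_simps del: residue_coeff.simps)
    have 6: "?T a (?G (-1) (Suc b) * ?G (- z) (Suc c)) + ?T (Suc b) (?G 1 a * ?G (1 - z) (Suc c)) +
        ?T (Suc c) (?G z a * ?G (z - 1) (Suc b)) = 0" by (rule IH) simp
    have 7: "?T (Suc a) (?G (-1) b * ?G (- z) (Suc c)) + ?T b (?G 1 (Suc a) * ?G (1 - z) (Suc c)) +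
        ?T (Suc c) (?G z (Suc a) * ?G (z - 1) b) = 0" by (rule Suc)
    have "g0 + g1 + g2 = 0"
      if "t = p - g0" "s = q + g1" "g2 = h - l" "p + s + h = 0" "t + q + l = 0" for g0 g1 g2 t p s q h l :: 'a
    proof -
      have g: "g0 + g1 + g2 = (p + s + h) - (t + q + l)" unfolding that(1-3) by (simp add: algebra_simps)
      show ?thesis unfolding g that(4,5) by simp
    qed
    from this[OF 1 2 5 6 7] show ?case .
  qed
qed

definition pade_coeff :: "nat \<Rightarrow> nat \<Rightarrow> nat \<Rightarrow> nat \<Rightarrow> nat" where
  "pade_coeff a b n i = ((a + i) choose i) * ((b + (n - i)) choose (n - i))"

text \<open>The three residues for the exponents \<open>p + 1\<close>, \<open>p + 1\<close>,
  \<open>r + 1\<close> at \<open>0\<close>, \<open>1\<close>, \<open>z\<close>, multiplied up to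
  sign by the common denominator \<open>z^M (1 - z)^M\<close> with \<open>M = p + r + 1\<close>. The
  numbers \<open>pade_coeff\<close> come from the products of two binomial series.\<close>

lemma pade_identity:
  fixes z :: "'a::field"
  assumes z: "z \<noteq> 0" "z \<noteq> 1"
  shows "(1 - z) ^ (p + r + 1) * (\<Sum>i=0..p. of_nat (pade_coeff p r p i) * z ^ i) +
    (-1) ^ r * z ^ (p + r + 1) * (\<Sum>i=0..p. of_nat (pade_coeff p r p i) * (1 - z) ^ i) =
    (\<Sum>j=0..r. of_nat (pade_coeff p p r j) * ((1 - z) ^ j * (- z) ^ (r - j)))"
proof -
  let ?M = "p + r + 1" and ?e = "(-1) ^ (p + r) :: 'a"
  have z1: "1 - z \<noteq> 0" using z by simp
  have e0: "?e * z ^ ?M * residue_coeff (Suc p) (binom_fps (-1) (Suc p) * binom_fps (- z) (Suc r)) =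
      (\<Sum>i=0..p. of_nat (pade_coeff p r p i) * z ^ i)"
    unfolding residue_coeff.simps fps_mult_nth sum_distrib_left
  proof (rule sum.cong[OF refl], goal_cases)
    case (1 i)
    then obtain k where k: "p = i + k" using le_Suc_ex by auto
    show ?case using z
      by (simp add: binom_fps_def pade_coeff_def k power_minus[of "inverse z"] power_add field_simps minus_one_power_iff)
  qed
  have e1: "(-1) ^ p * (1 - z) ^ ?M * residue_coeff (Suc p) (binom_fps 1 (Suc p) * binom_fps (1 - z) (Suc r)) =
      (\<Sum>i=0..p. of_nat (pade_coeff p r p i) * (1 - z) ^ i)"
    unfolding residue_coeff.simps fps_mult_nth sum_distrib_left
  proof (rule sum.cong[OF refl], goal_cases)
    case (1 i)
    then obtain k where k: "p = i + k" using le_Suc_ex by auto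
    define y where "y = 1 - z"
    have y: "y \<noteq> 0" using z1 by (simp add: y_def)
    show ?case unfolding y_def[symmetric] using y
      by (simp add: binom_fps_def pade_coeff_def k power_add field_simps minus_one_power_iff)
  qed
  have e2: "- (?e * z ^ ?M * (1 - z) ^ ?M * residue_coeff (Suc r) (binom_fps z (Suc p) * binom_fps (z - 1) (Suc p))) =
      (\<Sum>j=0..r. of_nat (pade_coeff p p r j) * ((1 - z) ^ j * (- z) ^ (r - j)))"
    unfolding residue_coeff.simps fps_mult_nth sum_distrib_left sum_negf[symmetric]
  proof (rule sum.cong[OF refl], goal_cases)
    case (1 j)
    then obtain k where k: "r = j + k" using le_Suc_ex by auto
    define y where "y = 1 - z"
    have y: "y \<noteq> 0" "z - 1 = - y" using z1 by (simp_all add: y_def)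
    show ?case unfolding y_def[symmetric] y(2) using y(1) z(1)
      by (simp add: binom_fps_def pade_coeff_def k power_minus[of "inverse y"] power_minus[of z]
        power_add field_simps minus_one_power_iff)
  qed
  have e: "residue_coeff (Suc p) (binom_fps (-1) (Suc p) * binom_fps (- z) (Suc r)) +
    residue_coeff (Suc p) (binom_fps 1 (Suc p) * binom_fps (1 - z) (Suc r)) +
    residue_coeff (Suc r) (binom_fps z (Suc p) * binom_fps (z - 1) (Suc p)) = 0"
    by (rule residue_sum[OF z]) simp
  have comb: "(1 - z) ^ ?M * (?e * z ^ ?M * s0) + (-1) ^ r * z ^ ?M * ((-1) ^ p * (1 - z) ^ ?M * s1)
      = - (?e * z ^ ?M * (1 - z) ^ ?M * s2)" if "s0 + s1 + s2 = 0" for s0 s1 s2 :: 'a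
  proof -
    have s2: "s2 = - s0 - s1" using that by (metis add.commute add_eq_0_iff diff_conv_add_uminus minus_add_distrib)
    show ?thesis unfolding s2 by (simp add: power_add algebra_simps)
  qed
  show ?thesis by (rule comb[OF e, unfolded e0 e1 e2])
qed

definition pade_B :: "nat \<Rightarrow> nat \<Rightarrow> int poly" where
  "pade_B p r = (\<Sum>i=0..p. Polynomial.monom (of_nat (pade_coeff p r p i)) i)"

text \<open>Up to sign this is \<open>B(1 - x)\<close>: exchanging the two coordinates of a point of
  the line exchanges the roles of the two polynomials.\<close>

definition pade_A :: "nat \<Rightarrow> nat \<Rightarrow> int poly" where
  "pade_A p r = smult ((-1) ^ r) (pcompose (pade_B p r) [:1, -1:])"

definition pade_C :: "nat \<Rightarrow> nat \<Rightarrow> int poly" where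
  "pade_C p r = (\<Sum>j=0..r. smult (of_nat (pade_coeff p p r j)) ([:1, -1:] ^ j * [:0, -1:] ^ (r - j)))"

lemma poly_pade:
  fixes x :: "'a::field_char_0"
  shows "poly (of_int_poly (pade_B p r)) x = (\<Sum>i=0..p. of_nat (pade_coeff p r p i) * x ^ i)"
    and "poly (of_int_poly (pade_A p r)) x = (-1) ^ r * (\<Sum>i=0..p. of_nat (pade_coeff p r p i) * (1 - x) ^ i)"
    and "poly (of_int_poly (pade_C p r)) x = (\<Sum>j=0..r. of_nat (pade_coeff p p r j) * ((1 - x) ^ j * (- x) ^ (r - j)))"
proof -
  show B: "poly (of_int_poly (pade_B p r)) x = (\<Sum>i=0..p. of_nat (pade_coeff p r p i) * x ^ i)" for x :: 'a
    by (simp add: pade_B_def of_int_poly_hom.hom_sum poly_sum poly_monom)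
  show "poly (of_int_poly (pade_A p r)) x = (-1) ^ r * (\<Sum>i=0..p. of_nat (pade_coeff p r p i) * (1 - x) ^ i)"
    by (simp add: pade_A_def of_int_hom.map_poly_pcompose hom_distribs poly_pcompose B)
  show "poly (of_int_poly (pade_C p r)) x = (\<Sum>j=0..r. of_nat (pade_coeff p p r j) * ((1 - x) ^ j * (- x) ^ (r - j)))"
    by (simp add: pade_C_def poly_sum hom_distribs)
qed

lemma degree_pade: "degree (pade_B p r) \<le> p" "degree (pade_A p r) \<le> p" "degree (pade_C p r) \<le> r"
proof -
  show B: "degree (pade_B p r) \<le> p"
    unfolding pade_B_def by (intro degree_sum_le) (auto intro: order_trans[OF degree_monom_le])
  then show "degree (pade_A p r) \<le> p" by (simp add: pade_A_def)
  show "degree (pade_C p r) \<le> r" unfolding pade_C_def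
  proof (intro degree_sum_le)
    fix j assume j: "j \<in> {0..r}"
    have "degree (([:1, -1:] :: int poly) ^ j * [:0, -1:] ^ (r - j)) \<le> j + (r - j)"
      by (rule order_trans[OF degree_mult_le add_mono]) (simp_all add: degree_power_eq)
    then show "degree (smult (of_nat (pade_coeff p p r j)) (([:1, -1:] :: int poly) ^ j * [:0, -1:] ^ (r - j))) \<le> r"
      using j by (intro order_trans[OF degree_smult_le]) simp
  qed simp
qed

lemma pade_coeff_pos: "0 < pade_coeff a b n i"
  by (simp add: pade_coeff_def)

text \<open>In \<open>pade_C\<close> every summand contributes to the top degree with the same sign,
  so nothing cancels. The nondegeneracy argument rests on these exact degrees.\<close>

lemma coeff_pade:
  "Polynomial.coeff (pade_B p r) p \<noteq> 0" "Polynomial.coeff (pade_C p r) r \<noteq> 0"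
proof -
  show "Polynomial.coeff (pade_B p r) p \<noteq> 0"
    using pade_coeff_pos[of p r p p] by (simp add: pade_B_def Polynomial.coeff_sum)
  have "Polynomial.coeff (([:1, -1:] :: int poly) ^ j * [:0, -1:] ^ (r - j)) r = (-1) ^ r" if "j \<le> r" for j
  proof -
    let ?q = "([:1, -1:] :: int poly) ^ j * [:0, -1:] ^ (r - j)"
    have "degree ?q = r" using that by (simp add: degree_mult_eq degree_power_eq)
    moreover have "lead_coeff ?q = (-1) ^ r" using that by (simp add: lead_coeff_mult lead_coeff_power flip: power_add)
    ultimately show ?thesis by simp
  qed
  then have "Polynomial.coeff (pade_C p r) r = (\<Sum>j=0..r. of_nat (pade_coeff p p r j)) * (-1) ^ r"
    by (simp add: pade_C_def Polynomial.coeff_sum sum_distrib_right)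
  moreover have "(\<Sum>j=0..r. int (pade_coeff p p r j)) > 0"
    by (rule sum_pos) (use pade_coeff_pos in auto)
  ultimately show "Polynomial.coeff (pade_C p r) r \<noteq> 0" by simp
qed

lemma pade_poly_identity:
  "[:0, 1:] ^ (p + r + 1) * of_int_poly (pade_A p r) + [:1, -1:] ^ (p + r + 1) * of_int_poly (pade_B p r)
    = (of_int_poly (pade_C p r) :: 'a::field_char_0 poly)" (is "?L = ?R")
proof (rule ccontr)
  assume "?L \<noteq> ?R"
  then have "finite {x. poly (?L - ?R) x = 0}" by (intro poly_roots_finite) simp
  moreover have "UNIV - {0, 1} \<subseteq> {x. poly (?L - ?R) x = 0}"
  proof
    fix z :: 'a assume "z \<in> UNIV - {0, 1}"
    then show "z \<in> {x. poly (?L - ?R) x = 0}"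
      using pade_identity[of z p r] by (simp add: poly_pade mult.assoc add.commute mult.left_commute[of "(-1) ^ r"] del: power_Suc)
  qed
  ultimately show False using infinite_UNIV_char_0[where 'a = 'a] by (meson finite.emptyI finite_Diff2 finite_insert finite_subset)
qed

text \<open>Eliminating between the two Pade relations gives
  \<open>T^(2 N) \<Delta> = C1 B2 - C2 B1\<close> for the determinant \<Delta>. The right side has
  degree exactly \<open>2 N\<close>, since \<open>C2 B1\<close> does and \<open>C1 B2\<close> has
  degree at most \<open>2 N - 2\<close>. Hence \<Delta> is a nonzero constant and vanishes at no
  \<open>x\<close>.\<close>

lemma pade_nondegenerate:
  fixes x :: "'a::field_char_0"
  assumes N: "N \<ge> 1"
  shows "poly (of_int_poly (pade_A N (N - 1))) x * poly (of_int_poly (pade_B (N - 1) N)) x \<noteq>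
    poly (of_int_poly (pade_A (N - 1) N)) x * poly (of_int_poly (pade_B N (N - 1))) x"
proof -
  define A1 B1 C1 A2 B2 C2 :: "'a poly" where
    "A1 = of_int_poly (pade_A N (N - 1))" and "B1 = of_int_poly (pade_B N (N - 1))" and "C1 = of_int_poly (pade_C N (N - 1))" and
    "A2 = of_int_poly (pade_A (N - 1) N)" and "B2 = of_int_poly (pade_B (N - 1) N)" and "C2 = of_int_poly (pade_C (N - 1) N)"
  note defs = A1_def B1_def C1_def A2_def B2_def C2_def
  define \<Delta> where "\<Delta> = A1 * B2 - A2 * B1"
  have "[:0, 1:] ^ (2 * N) * A1 + [:1, -1:] ^ (2 * N) * B1 = C1"
    using pade_poly_identity[of N "N - 1", where 'a = 'a] N by (simp add: defs mult_2)
  moreover have "[:0, 1:] ^ (2 * N) * A2 + [:1, -1:] ^ (2 * N) * B2 = C2"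
    using pade_poly_identity[of "N - 1" N, where 'a = 'a] N by (simp add: defs mult_2)
  ultimately have id: "[:0, 1:] ^ (2 * N) * \<Delta> = C1 * B2 - C2 * B1"
    by (simp add: \<Delta>_def flip: \<open>_ = C1\<close> \<open>_ = C2\<close>) (simp add: algebra_simps)
  have deg: "degree C1 \<le> N - 1" "degree B2 \<le> N - 1" "degree C2 \<le> N" "degree B1 \<le> N"
    unfolding defs by (intro order_trans[OF degree_map_poly_le] degree_pade)+
  have lc: "Polynomial.coeff C2 N \<noteq> 0" "Polynomial.coeff B1 N \<noteq> 0"
    unfolding defs using coeff_pade by (auto simp: coeff_map_poly)
  then have deg': "degree C2 = N" "degree B1 = N" using deg le_degree le_antisym by blast+
  have d1: "degree (C1 * B2) < 2 * N" using degree_mult_le[of C1 B2] deg N by linarith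
  have d2: "degree (C2 * B1) = 2 * N" using deg' lc by (subst degree_mult_eq) auto
  have d: "degree (C1 * B2 - C2 * B1) \<le> 2 * N" using d1 d2 by (intro degree_diff_le) auto
  have "Polynomial.coeff (C2 * B1) (degree C2 + degree B1) \<noteq> 0"
    unfolding coeff_mult_degree_sum using lc deg' by simp
  then have "Polynomial.coeff (C1 * B2 - C2 * B1) (2 * N) \<noteq> 0"
    using d1 deg' by (simp add: coeff_eq_0 mult_2)
  then have c: "Polynomial.coeff \<Delta> 0 \<noteq> 0"
    unfolding id[symmetric] by (simp add: monom_altdef[of 1, symmetric, simplified] coeff_monom_mult)
  then have "degree ([:0, 1:] ^ (2 * N) * \<Delta>) = 2 * N + degree \<Delta>"
    by (subst degree_mult_eq) (auto simp: degree_power_eq)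
  then have "degree \<Delta> = 0" using d id by simp
  then obtain a where "\<Delta> = [:a:]" using degree_eq_zeroE by blast
  then have "poly \<Delta> x \<noteq> 0" using c by simp
  then show ?thesis by (simp add: \<Delta>_def defs)
qed

text \<open>Partial sums of the series of \<open>(1 - y)^(-m-1)\<close>. Multiplying by
  \<open>1 - y\<close> lowers \<open>m\<close> by one, up to a boundary term that is
  subtracted.\<close>

lemma sum_binomial_geometric_le:
  fixes y :: real
  assumes y: "0 \<le> y" "y < 1"
  shows "(\<Sum>i=0..n. real ((m + i) choose i) * y ^ i) \<le> (1 / (1 - y)) ^ (m + 1)"
proof (induction m arbitrary: n)
  case 0
  have "(\<Sum>i=0..n. y ^ i) = (1 - y ^ Suc n) / (1 - y)"
    using y sum_gp0[of y n] by (simp add: atLeast0AtMost)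
  also have "\<dots> \<le> 1 / (1 - y)" using y by (intro divide_right_mono) auto
  finally show ?case by simp
next
  case (Suc m)
  have le: "(1 - y) * (\<Sum>i=0..n. real ((Suc m + i) choose i) * y ^ i) \<le> (\<Sum>i=0..n. real ((m + i) choose i) * y ^ i)" for n
  proof -
    have "(1 - y) * (\<Sum>i=0..n. real ((Suc m + i) choose i) * y ^ i) =
      (\<Sum>i=0..n. real ((m + i) choose i) * y ^ i) - real ((Suc m + n) choose n) * y ^ Suc n"
    proof (induction n)
      case (Suc n)
      have "(1 - y) * (\<Sum>i=0..Suc n. real ((Suc m + i) choose i) * y ^ i) =
          (1 - y) * (\<Sum>i=0..n. real ((Suc m + i) choose i) * y ^ i) + (1 - y) * (real ((Suc m + Suc n) choose Suc n) * y ^ Suc n)"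
        by (simp add: distrib_left)
      also have "\<dots> = (\<Sum>i=0..Suc n. real ((m + i) choose i) * y ^ i) - real ((Suc m + Suc n) choose Suc n) * y ^ Suc (Suc n)"
        unfolding Suc by (simp add: algebra_simps)
      finally show ?case .
    qed simp
    then show ?thesis using y by simp
  qed
  have "(1 - y) * (\<Sum>i=0..n. real ((Suc m + i) choose i) * y ^ i) \<le> (1 / (1 - y)) ^ (m + 1)"
    using le[of n] Suc.IH[of n] by linarith
  then have "(\<Sum>i=0..n. real ((Suc m + i) choose i) * y ^ i) * (1 - y) \<le> (1 / (1 - y)) ^ (m + 1)"
    by (simp only: mult.commute)
  then have "(\<Sum>i=0..n. real ((Suc m + i) choose i) * y ^ i) \<le> (1 / (1 - y)) ^ (m + 1) / (1 - y)"
    using y by (intro mult_imp_le_div_pos) simp_all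
  then show ?case by simp
qed

text \<open>The sum is the coefficient of \<open>X^n\<close> in
  \<open>(1 - 2 X)^(-a-1) (1 - X)^(-b-1)\<close>; as all coefficients are nonnegative, it is at most
  \<open>s^(-n)\<close> times the value at \<open>X = s\<close>. The weights \<open>2^i\<close> come
  from \<open>|1 - z| <= 2 max(1, |z|)\<close>.\<close>

lemma sum_pade_coeff_le:
  fixes s :: real
  assumes s: "0 < s" "s < 1 / 2"
  shows "(\<Sum>i=0..n. real (pade_coeff a b n i) * 2 ^ i) \<le> (1 / s) ^ n * (1 / (1 - 2 * s)) ^ (a + 1) * (1 / (1 - s)) ^ (b + 1)"
proof -
  define f g where "f = (\<lambda>i. real ((a + i) choose i) * (2 * s) ^ i)" and "g = (\<lambda>k. real ((b + k) choose k) * s ^ k)"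
  have nn: "0 \<le> f i" "0 \<le> g i" for i using s by (simp_all add: f_def g_def)
  have F: "(\<Sum>i=0..n. f i) \<le> (1 / (1 - 2 * s)) ^ (a + 1)" unfolding f_def using s by (intro sum_binomial_geometric_le) auto
  have G: "(\<Sum>i=0..n. g i) \<le> (1 / (1 - s)) ^ (b + 1)" unfolding g_def using s by (intro sum_binomial_geometric_le) auto
  have "(\<Sum>i=0..n. real (pade_coeff a b n i) * 2 ^ i) = (\<Sum>i=0..n. (1 / s) ^ n * (f i * g (n - i)))"
  proof (rule sum.cong[OF refl])
    fix i assume "i \<in> {0..n}"
    then obtain k where k: "n = i + k" using le_Suc_ex by auto
    show "real (pade_coeff a b n i) * 2 ^ i = (1 / s) ^ n * (f i * g (n - i))"
      using s by (simp add: pade_coeff_def f_def g_def k power_add power_mult_distrib power_divide)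
  qed
  also have "\<dots> \<le> (\<Sum>i=0..n. (1 / s) ^ n * (f i * (\<Sum>k=0..n. g k)))"
    using nn s by (intro sum_mono mult_left_mono member_le_sum) auto
  also have "\<dots> = (1 / s) ^ n * ((\<Sum>i=0..n. f i) * (\<Sum>k=0..n. g k))"
    by (simp only: sum_product) (simp only: sum_distrib_left)
  also have "\<dots> \<le> (1 / s) ^ n * ((1 / (1 - 2 * s)) ^ (a + 1) * (1 / (1 - s)) ^ (b + 1))"
    using F G nn s by (intro mult_left_mono mult_mono) (auto intro: sum_nonneg)
  finally show ?thesis by (simp only: mult.assoc)
qed

text \<open>The value \<open>s = (3 - \<surd>3) / 6\<close> maximises \<open>s (1 - s) (1 - 2 s)\<close>, with maximum \<open>1 / (6 \<surd>3)\<close>.\<close>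

lemma sum_pade_coeff_le_sqrt:
  assumes "N \<ge> 1" and pr: "(p, r) = (N, N - 1) \<or> (p, r) = (N - 1, N)"
  shows "(\<Sum>i=0..p. real (pade_coeff p r p i) * 2 ^ i) \<le> sqrt 3 * (6 * sqrt 3) ^ N"
    "(\<Sum>i=0..r. real (pade_coeff p p r i) * 2 ^ i) \<le> sqrt 3 * (6 * sqrt 3) ^ N"
proof -
  obtain n where N: "N = Suc n" using assms(1) by (cases N) auto
  define s where "s = (3 - sqrt 3) / 6"
  have q: "1 < sqrt 3" "sqrt 3 < 2" "sqrt 3 * sqrt 3 = 3"
    by (simp_all add: real_less_rsqrt real_less_lsqrt)
  have s: "0 < s" "s < 1 / 2" using q by (simp_all add: s_def)
  define u v w where "u = 1 / s" and "v = 1 / (1 - 2 * s)" and "w = 1 / (1 - s)"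
  have v': "1 - 2 * s = sqrt 3 / 3" by (simp add: s_def field_simps)
  have v: "v = sqrt 3" unfolding v_def v' using q by (simp add: field_simps)
  have "u * w = 6" using s unfolding u_def w_def by (simp add: field_simps) (simp add: s_def field_simps q(3))
  then have uvw: "6 * sqrt 3 = u * v * w" using v by simp
  have pos: "0 < u" "0 < w" "0 < v" "w \<le> u" using s q by (simp_all add: u_def w_def v frac_le)
  have w2: "1 \<le> w" "w \<le> 2" using s by (simp_all add: w_def field_simps)
  note b = sum_pade_coeff_le[OF s, folded u_def v_def w_def]
  define Z where "Z = u ^ n * v ^ n * w ^ n"
  have Z: "0 \<le> Z" using pos by (simp add: Z_def)
  \<comment> \<open>The exponents leave a few factors beyond \<open>(u v w)^n\<close>, depending on
    which of \<open>p\<close> and \<open>r\<close> equals \<open>N\<close>. All of them are at most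
    \<open>v (u v w)\<close>, because \<open>w <= u\<close> and \<open>1 <= v\<close>; this is the
    origin of the additional factor \<open>sqrt 3\<close>.\<close>
  have wv: "w * w * v \<le> v * (u * v * w)" "w * w * v * v \<le> v * (u * v * w)" "u * v * w \<le> v * (u * v * w)"
  proof -
    have "w * (w * v) \<le> u * (w * v)" using pos by (intro mult_right_mono) auto
    moreover have "1 * (u * v * w) \<le> v * (u * v * w)" using pos v q by (intro mult_right_mono) auto
    ultimately show "w * w * v \<le> v * (u * v * w)" "u * v * w \<le> v * (u * v * w)" by (simp_all add: mult_ac)
    have "w * (w * v * v) \<le> u * (w * v * v)" using pos by (intro mult_right_mono) auto
    then show "w * w * v * v \<le> v * (u * v * w)" by (simp add: mult_ac)
  qed
  have T: "sqrt 3 * (6 * sqrt 3) ^ N = v * (u * v * w) * Z"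
  proof -
    have "(6 * sqrt 3) ^ N = (u * v * w) ^ N" by (simp only: uvw)
    then show ?thesis by (simp only: N power_Suc Z_def power_mult_distrib v[symmetric] mult_ac)
  qed
  note le = mult_right_mono[OF wv(1) Z] mult_right_mono[OF wv(2) Z] mult_right_mono[OF wv(3) Z]
  show "(\<Sum>i=0..p. real (pade_coeff p r p i) * 2 ^ i) \<le> sqrt 3 * (6 * sqrt 3) ^ N"
    using pr b[where n = p and a = p and b = r] le unfolding T
    by (auto simp: N Z_def mult_ac)
  show "(\<Sum>i=0..r. real (pade_coeff p p r i) * 2 ^ i) \<le> sqrt 3 * (6 * sqrt 3) ^ N"
    using pr b[where n = r and a = p and b = p] le unfolding T
    by (auto simp: N Z_def mult_ac)
qed

lemma cmod_pade_le:
  fixes z :: complex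
  shows "cmod (poly (of_int_poly (pade_B p r)) z) \<le> (\<Sum>i=0..p. real (pade_coeff p r p i) * 2 ^ i) * max 1 (cmod z) ^ p"
    and "cmod (poly (of_int_poly (pade_A p r)) z) \<le> (\<Sum>i=0..p. real (pade_coeff p r p i) * 2 ^ i) * max 1 (cmod z) ^ p"
    and "cmod (poly (of_int_poly (pade_C p r)) z) \<le> (\<Sum>i=0..r. real (pade_coeff p p r i) * 2 ^ i) * max 1 (cmod z) ^ r"
proof -
  define \<mu> where "\<mu> = max 1 (cmod z)"
  have \<mu>: "1 \<le> \<mu>" "cmod z \<le> \<mu>" by (simp_all add: \<mu>_def)
  have m: "cmod (1 - z) \<le> 2 * \<mu>" using norm_triangle_ineq4[of 1 z] \<mu> by simp
  have 1: "cmod (1 - z) ^ i * cmod z ^ k \<le> 2 ^ i * \<mu> ^ (i + k)" for i k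
  proof -
    have "cmod (1 - z) ^ i * cmod z ^ k \<le> (2 * \<mu>) ^ i * \<mu> ^ k"
      using m \<mu> by (intro mult_mono power_mono) auto
    then show ?thesis by (simp add: power_mult_distrib power_add)
  qed
  have 2: "cmod (1 - z) ^ i \<le> 2 ^ i * \<mu> ^ n" "cmod z ^ i \<le> 2 ^ i * \<mu> ^ n" if "i \<le> n" for i n
  proof -
    have "\<mu> ^ i \<le> \<mu> ^ n" by (rule power_increasing[OF that \<mu>(1)])
    moreover have "cmod (1 - z) ^ i \<le> 2 ^ i * \<mu> ^ i" using 1[of i 0] by simp
    moreover have "cmod z ^ i \<le> \<mu> ^ i" using \<mu> by (intro power_mono) auto
    moreover have "1 * \<mu> ^ n \<le> 2 ^ i * \<mu> ^ n" using \<mu> by (intro mult_right_mono) auto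
    moreover have "2 ^ i * \<mu> ^ i \<le> 2 ^ i * \<mu> ^ n" using calculation(1) by (intro mult_left_mono) auto
    ultimately show "cmod (1 - z) ^ i \<le> 2 ^ i * \<mu> ^ n" "cmod z ^ i \<le> 2 ^ i * \<mu> ^ n" by linarith+
  qed
  have 3: "cmod (1 - z) ^ i * cmod z ^ (r - i) \<le> 2 ^ i * \<mu> ^ r" if "i \<le> r" for i
    using 1[of i "r - i"] that by simp
  show "cmod (poly (of_int_poly (pade_B p r)) z) \<le> (\<Sum>i=0..p. real (pade_coeff p r p i) * 2 ^ i) * \<mu> ^ p"
    unfolding poly_pade sum_distrib_right mult.assoc
    by (intro order_trans[OF norm_sum] sum_mono) (auto simp: norm_mult norm_power intro!: mult_left_mono 2)
  show "cmod (poly (of_int_poly (pade_A p r)) z) \<le> (\<Sum>i=0..p. real (pade_coeff p r p i) * 2 ^ i) * \<mu> ^ p"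
    unfolding poly_pade sum_distrib_right mult.assoc norm_mult norm_power
    by (simp, intro order_trans[OF norm_sum] sum_mono) (auto simp: norm_mult norm_power intro!: mult_left_mono 2)
  show "cmod (poly (of_int_poly (pade_C p r)) z) \<le> (\<Sum>i=0..r. real (pade_coeff p p r i) * 2 ^ i) * \<mu> ^ r"
    unfolding poly_pade sum_distrib_right mult.assoc
    by (intro order_trans[OF norm_sum] sum_mono)
      (auto simp: norm_mult norm_power intro!: mult_left_mono 3)
qed

lemma pade_system:
  assumes "N \<ge> 1" and pr: "(p, r) = (N, N - 1) \<or> (p, r) = (N - 1, N)"
    and Q: "Q \<in> {pade_A p r, pade_B p r, pade_C p r}"
  shows "degree Q \<le> N" "cmod (poly (of_int_poly Q) z) \<le> sqrt 3 * (6 * sqrt 3) ^ N * max 1 (cmod z) ^ N"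
proof -
  have le: "p \<le> N" "r \<le> N" using pr by auto
  then show "degree Q \<le> N" using Q degree_pade[of p r] by auto
  have *: "S * max 1 (cmod z) ^ k \<le> sqrt 3 * (6 * sqrt 3) ^ N * max 1 (cmod z) ^ N"
    if "k \<le> N" "S \<le> sqrt 3 * (6 * sqrt 3) ^ N" for S k
    using that by (intro mult_mono power_increasing) auto
  note sums = sum_pade_coeff_le_sqrt[OF assms(1) pr]
  show "cmod (poly (of_int_poly Q) z) \<le> sqrt 3 * (6 * sqrt 3) ^ N * max 1 (cmod z) ^ N"
    using Q order_trans[OF cmod_pade_le(1)[of p r z] *[OF le(1) sums(1)]]
      order_trans[OF cmod_pade_le(2)[of p r z] *[OF le(1) sums(1)]]
      order_trans[OF cmod_pade_le(3)[of p r z] *[OF le(2) sums(2)]] by blast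
qed

section \<open>Points on the line close to powers\<close>

lemma weil_height_powi:
  assumes "x \<noteq> 0"
  shows "weil_height (x powi k) = \<bar>real_of_int k\<bar> * weil_height x"
proof (cases "k \<ge> 0")
  case True
  then show ?thesis using weil_height_power[OF assms, of "nat k"] by (simp add: power_int_def)
next
  case False
  then show ?thesis
    using weil_height_power[of "inverse x" "nat (- k)"] weil_height_inverse[OF assms] assms by (simp add: power_int_def)
qed

text \<open>Elimination with unknowns \<open>\<beta>1^(M n)\<close> and
  \<open>\<beta>2^(M n)\<close>. The coefficients involve \<open>(x1 / \<beta>1^n)^M\<close> and the
  product of \<open>y1 / \<beta>1^m\<close> with \<open>\<beta>1^(m - M n)\<close>, and likewise for
  the second coordinate. The argument \<open>x\<close> of the polynomials is kept apart from
  \<open>x1\<close>, so that the coordinates can be swapped.\<close>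

lemma coordinate_gap:
  fixes \<beta>1 \<beta>2 x1 x2 y1 y2 x :: qbar and A B C :: "int poly"
  assumes nz: "\<beta>1 \<noteq> 0" "\<beta>2 \<noteq> 0" "x1 \<noteq> 0" "x2 \<noteq> 0" "y1 \<noteq> 0" "y2 \<noteq> 0" "x \<noteq> 0"
    and h: "weil_height \<beta>1 = h" "weil_height \<beta>2 \<le> h"
    and \<alpha>: "weil_height (x1 / \<beta>1 ^ n) \<le> \<alpha>" "weil_height (x2 / \<beta>2 ^ n) \<le> \<alpha>"
    and \<alpha>': "weil_height (y1 / \<beta>1 ^ m) \<le> \<alpha>'" "weil_height (y2 / \<beta>2 ^ m) \<le> \<alpha>'"
    and hx: "weil_height x \<le> \<alpha> + real n * h"
    and deg: "degree A \<le> N" "degree B \<le> N" "degree C \<le> N"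
    and arch: "\<And>z :: complex. cmod (poly (of_int_poly A) z) \<le> \<kappa> * max 1 (cmod z) ^ N"
      "\<And>z :: complex. cmod (poly (of_int_poly B) z) \<le> \<kappa> * max 1 (cmod z) ^ N"
      "\<And>z :: complex. cmod (poly (of_int_poly C) z) \<le> \<kappa> * max 1 (cmod z) ^ N"
    and \<kappa>: "0 < \<kappa>"
    and eq: "x1 ^ M * poly (of_int_poly A) x + x2 ^ M * poly (of_int_poly B) x = poly (of_int_poly C) x" "y1 + y2 = 1"
    and ne: "x1 ^ M * poly (of_int_poly A) x * y2 \<noteq> x2 ^ M * poly (of_int_poly B) x * y1"
  shows "real M * (real n * h) \<le> ln (2 * \<kappa>) + real N * (\<alpha> + real n * h) + 2 * real M * \<alpha> + 2 * \<alpha>' + 2 * \<bar>real m - real M * real n\<bar> * h"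
proof -
  \<comment> \<open>An integer exponent, since \<open>M n\<close> may lie on either side of
    \<open>m\<close>; only its absolute value enters the height.\<close>
  let ?k = "int m - int (M * n)"
  define w where "w = (\<lambda>z :: qbar. z powi ?k)"
  have w: "y / z ^ m * w z = y / z ^ (M * n)" if "z \<noteq> 0" for y z :: qbar
  proof -
    have "w z = z powi int m / z powi int (M * n)" unfolding w_def by (rule power_int_diff) (use that in simp)
    then have "w z = z ^ m / z ^ (M * n)" by (simp only: power_int_of_nat)
    then show ?thesis using that by simp
  qed
  have wc: "z ^ (M * n) * (y / z ^ m * w z) = y" if "z \<noteq> 0" for y z :: qbar
    unfolding w[OF that] using that by simp
  have c: "z ^ (M * n) * ((y / z ^ n) ^ M * e) = y ^ M * e" if "z \<noteq> 0" for y z e :: qbar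
    using that by (simp add: power_divide power_mult[symmetric] mult.commute[of n])
  have wh: "weil_height (w z) \<le> \<bar>real m - real M * real n\<bar> * h" if "z \<noteq> 0" "weil_height z \<le> h" for z
    unfolding w_def weil_height_powi[OF that(1)] using mult_left_mono[OF that(2), of "\<bar>real m - real M * real n\<bar>"] by simp
  have "weil_height (\<beta>1 ^ (M * n)) \<le> ln (2 * \<kappa>) + real N * weil_height x
      + real M * (weil_height (x1 / \<beta>1 ^ n) + weil_height (x2 / \<beta>2 ^ n))
      + weil_height (y1 / \<beta>1 ^ m) + weil_height (y2 / \<beta>2 ^ m) + weil_height (w \<beta>1) + weil_height (w \<beta>2)"
  proof (rule height_elimination[OF _ _ _ _ _ _ _ nz(7) deg arch \<kappa>, where ?\<xi>2.0 = "\<beta>2 ^ (M * n)"])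
    show "\<beta>1 ^ (M * n) * ((x1 / \<beta>1 ^ n) ^ M * poly (of_int_poly A) x)
      + \<beta>2 ^ (M * n) * ((x2 / \<beta>2 ^ n) ^ M * poly (of_int_poly B) x) = poly (of_int_poly C) x"
      unfolding c[OF nz(1)] c[OF nz(2)] by (rule eq(1))
    show "\<beta>1 ^ (M * n) * (y1 / \<beta>1 ^ m * w \<beta>1) + \<beta>2 ^ (M * n) * (y2 / \<beta>2 ^ m * w \<beta>2) = 1"
      unfolding wc[OF nz(1)] wc[OF nz(2)] by (rule eq(2))
    let ?D = "(x1 / \<beta>1 ^ n) ^ M * poly (of_int_poly A) x * (y2 / \<beta>2 ^ m * w \<beta>2)
      - (x2 / \<beta>2 ^ n) ^ M * poly (of_int_poly B) x * (y1 / \<beta>1 ^ m * w \<beta>1)"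
    have "(\<beta>1 ^ (M * n) * \<beta>2 ^ (M * n)) * ?D = \<beta>1 ^ (M * n) * ((x1 / \<beta>1 ^ n) ^ M * poly (of_int_poly A) x) * (\<beta>2 ^ (M * n) * (y2 / \<beta>2 ^ m * w \<beta>2))
      - \<beta>2 ^ (M * n) * ((x2 / \<beta>2 ^ n) ^ M * poly (of_int_poly B) x) * (\<beta>1 ^ (M * n) * (y1 / \<beta>1 ^ m * w \<beta>1))"
      by (simp only: right_diff_distrib mult_ac)
    also have "\<dots> = x1 ^ M * poly (of_int_poly A) x * y2 - x2 ^ M * poly (of_int_poly B) x * y1"
      by (simp only: c[OF nz(1)] c[OF nz(2)] wc[OF nz(1)] wc[OF nz(2)])
    finally show "?D \<noteq> 0" using ne by (metis mult_zero_right eq_iff_diff_eq_0)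
  qed (use nz in \<open>simp_all add: w_def\<close>)
  moreover have "weil_height (\<beta>1 ^ (M * n)) = real M * (real n * h)"
    using weil_height_power[OF nz(1), of "M * n"] h(1) by simp
  moreover have "real N * weil_height x \<le> real N * (\<alpha> + real n * h)" using hx by (intro mult_left_mono) auto
  moreover have "real M * (weil_height (x1 / \<beta>1 ^ n) + weil_height (x2 / \<beta>2 ^ n)) \<le> real M * (\<alpha> + \<alpha>)"
    using \<alpha> by (intro mult_left_mono add_mono) auto
  moreover have "real M * (\<alpha> + \<alpha>) = 2 * real M * \<alpha>" by simp
  moreover have "weil_height \<beta>1 \<le> h" using h by simp
  ultimately show ?thesis using \<alpha>' wh[OF nz(1)] wh[OF nz(2) h(2)] by linarith
qed

text \<open>The bound is taken for a coordinate of \<beta> that attains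
  \<open>height2 \<beta>\<close>. If this is the second, the coordinates are exchanged while the
  polynomials are still evaluated at \<open>fst U\<close>.\<close>

lemma point_gap:
  fixes \<beta> U V :: "qbar \<times> qbar" and A B C :: "int poly"
  assumes \<beta>: "\<beta> \<in> carrier Gm2" and U: "U \<in> unit_line" and V: "V \<in> unit_line"
    and \<alpha>: "dist2 U (\<beta> [^]\<^bsub>Gm2\<^esub> n) \<le> \<alpha>" "dist2 V (\<beta> [^]\<^bsub>Gm2\<^esub> m) \<le> \<alpha>'"
    and polys: "\<And>Q. Q \<in> {A, B, C} \<Longrightarrow> degree Q \<le> N"
      "\<And>Q z. Q \<in> {A, B, C} \<Longrightarrow> cmod (poly (of_int_poly Q) z) \<le> \<kappa> * max 1 (cmod z) ^ N"
    and \<kappa>: "0 < \<kappa>"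
    and eq: "fst U ^ M * poly (of_int_poly A) (fst U) + snd U ^ M * poly (of_int_poly B) (fst U) = poly (of_int_poly C) (fst U)"
    and ne: "fst U ^ M * poly (of_int_poly A) (fst U) * snd V \<noteq> snd U ^ M * poly (of_int_poly B) (fst U) * fst V"
  defines "h \<equiv> height2 \<beta>"
  shows "real M * (real n * h) \<le> ln (2 * \<kappa>) + real N * (\<alpha> + real n * h) + 2 * real M * \<alpha> + 2 * \<alpha>' + 2 * \<bar>real m - real M * real n\<bar> * h"
proof -
  have nz: "fst \<beta> \<noteq> 0" "snd \<beta> \<noteq> 0" "fst U \<noteq> 0" "snd U \<noteq> 0" "fst V \<noteq> 0" "snd V \<noteq> 0"
    and sum: "fst V + snd V = 1"
    using \<beta> U V by (auto simp: carrier_Gm2 unit_line_def)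
  have \<beta>n: "\<beta> [^]\<^bsub>Gm2\<^esub> (k :: nat) \<in> carrier Gm2" for k
    using nz by (simp add: pow_Gm2 carrier_Gm2)
  have \<alpha>U: "weil_height (fst U / fst \<beta> ^ n) \<le> \<alpha>" "weil_height (snd U / snd \<beta> ^ n) \<le> \<alpha>"
    using \<alpha>(1) unfolding dist2_def inv_Gm2[OF \<beta>n] by (simp_all add: height2_def mult_Gm2 pow_Gm2 divide_inverse)
  have \<alpha>V: "weil_height (fst V / fst \<beta> ^ m) \<le> \<alpha>'" "weil_height (snd V / snd \<beta> ^ m) \<le> \<alpha>'"
    using \<alpha>(2) unfolding dist2_def inv_Gm2[OF \<beta>n] by (simp_all add: height2_def mult_Gm2 pow_Gm2 divide_inverse)
  have h: "weil_height (fst \<beta>) \<le> h" "weil_height (snd \<beta>) \<le> h" by (simp_all add: h_def height2_def)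
  have "weil_height (fst U / fst \<beta> ^ n * fst \<beta> ^ n) \<le> weil_height (fst U / fst \<beta> ^ n) + weil_height (fst \<beta> ^ n)"
    using nz by (intro weil_height_mult_le) auto
  moreover have "weil_height (fst \<beta> ^ n) \<le> real n * h"
    using weil_height_power[OF nz(1), of n] h(1) by (simp add: mult_left_mono)
  ultimately have hx: "weil_height (fst U) \<le> \<alpha> + real n * h" using \<alpha>U(1) nz by simp
  note P = polys(1)[of A] polys(1)[of B] polys(1)[of C] polys(2)[of A] polys(2)[of B] polys(2)[of C]
  note P = P[simplified]
  have "weil_height (fst \<beta>) = h \<or> weil_height (snd \<beta>) = h" by (simp add: h_def height2_def max_def)
  then show ?thesis
  proof
    assume 1: "weil_height (fst \<beta>) = h"
    show ?thesis
      by (rule coordinate_gap[OF nz nz(3) 1 h(2) \<alpha>U \<alpha>V hx P \<kappa> eq sum ne])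
  next
    assume 2: "weil_height (snd \<beta>) = h"
    show ?thesis
      by (rule coordinate_gap[OF nz(2,1,4,3,6,5) nz(3) 2 h(1) \<alpha>U(2,1) \<alpha>V(2,1) hx P(2,1,3) P(5,4,6) \<kappa>])
        (use eq sum ne in \<open>auto simp: add.commute\<close>)
  qed
qed

text \<open>The case \<open>M = 1\<close>, \<open>N = 0\<close> with constant polynomials. On the
  line the determinant \<open>fst U * snd V - snd U * fst V\<close> equals
  \<open>fst U - fst V\<close>, so distinct points give independent equations.\<close>

lemma linear_gap:
  fixes \<beta> U V :: "qbar \<times> qbar"
  assumes \<beta>: "\<beta> \<in> carrier Gm2" and U: "U \<in> unit_line" and V: "V \<in> unit_line" and ne: "U \<noteq> V"
    and \<alpha>: "dist2 U (\<beta> [^]\<^bsub>Gm2\<^esub> n) \<le> \<alpha>" "dist2 V (\<beta> [^]\<^bsub>Gm2\<^esub> m) \<le> \<alpha>'"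
  shows "real n * height2 \<beta> \<le> ln 2 + 2 * \<alpha> + 2 * \<alpha>' + 2 * \<bar>real m - real n\<bar> * height2 \<beta>"
proof -
  have sum: "fst U + snd U = 1" "fst V + snd V = 1" using U V by (auto simp: unit_line_def)
  have "fst U * snd V \<noteq> snd U * fst V"
  proof
    assume *: "fst U * snd V = snd U * fst V"
    have s: "snd U = 1 - fst U" "snd V = 1 - fst V" using sum by (simp_all add: algebra_simps)
    have "fst U = fst V" using * unfolding s by (simp add: algebra_simps)
    then show False using ne s by (simp add: prod_eq_iff)
  qed
  then show ?thesis
    using point_gap[OF \<beta> U V \<alpha>, of 1 1 1 0 1 1] sum by simp
qed

lemma pade_gap:
  fixes \<beta> U V :: "qbar \<times> qbar"
  assumes \<beta>: "\<beta> \<in> carrier Gm2" and U: "U \<in> unit_line" and V: "V \<in> unit_line" and N: "N \<ge> 1"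
    and \<alpha>: "dist2 U (\<beta> [^]\<^bsub>Gm2\<^esub> n) \<le> \<alpha>" "dist2 V (\<beta> [^]\<^bsub>Gm2\<^esub> m) \<le> \<alpha>'"
  defines "h \<equiv> height2 \<beta>"
  shows "real N * (real n * h) \<le> ln (2 * sqrt 3) + real N * ln (6 * sqrt 3) + 5 * real N * \<alpha> + 2 * \<alpha>'
    + 2 * \<bar>real m - 2 * real N * real n\<bar> * h"
proof -
  have nz: "fst U \<noteq> 0" "snd U \<noteq> 0" "fst V \<noteq> 0" "snd V \<noteq> 0" and s: "snd U = 1 - fst U"
    using U V by (auto simp: carrier_Gm2 unit_line_def algebra_simps)
  let ?A = "\<lambda>p r. poly (of_int_poly (pade_A p r)) (fst U)" and ?B = "\<lambda>p r. poly (of_int_poly (pade_B p r)) (fst U)"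
  define M where "M = 2 * N"
  \<comment> \<open>If both determinants vanished, multiplying crosswise and cancelling the nonzero
    coordinates would contradict \<open>pade_nondegenerate\<close>.\<close>
  have "\<exists>p r. ((p, r) = (N, N - 1) \<or> (p, r) = (N - 1, N)) \<and> fst U ^ M * ?A p r * snd V \<noteq> snd U ^ M * ?B p r * fst V"
  proof (rule ccontr)
    assume "\<not> ?thesis"
    then have e: "fst U ^ M * ?A N (N - 1) * snd V = snd U ^ M * ?B N (N - 1) * fst V"
      "fst U ^ M * ?A (N - 1) N * snd V = snd U ^ M * ?B (N - 1) N * fst V" by blast+
    have "(fst U ^ M * snd V * snd U ^ M * fst V) * (?A N (N - 1) * ?B (N - 1) N) =
        (fst U ^ M * ?A N (N - 1) * snd V) * (snd U ^ M * ?B (N - 1) N * fst V)"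
      by (simp only: mult_ac)
    also have "\<dots> = (snd U ^ M * ?B N (N - 1) * fst V) * (fst U ^ M * ?A (N - 1) N * snd V)"
      by (simp only: e)
    also have "\<dots> = (fst U ^ M * snd V * snd U ^ M * fst V) * (?A (N - 1) N * ?B N (N - 1))"
      by (simp only: mult_ac)
    finally have "?A N (N - 1) * ?B (N - 1) N = ?A (N - 1) N * ?B N (N - 1)"
      using nz by simp
    then show False using pade_nondegenerate[OF N, of "fst U"] by simp
  qed
  then obtain p r where pr: "(p, r) = (N, N - 1) \<or> (p, r) = (N - 1, N)"
    and ne: "fst U ^ M * ?A p r * snd V \<noteq> snd U ^ M * ?B p r * fst V" by blast
  have M: "M = p + r + 1" using pr N by (auto simp: M_def)
  have "fst U \<noteq> 1" using nz s by auto
  then have "fst U ^ M * ?A p r + snd U ^ M * ?B p r = poly (of_int_poly (pade_C p r)) (fst U)"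
    using pade_identity[OF nz(1), of p r, folded M] unfolding s poly_pade by (simp add: mult_ac add.commute)
  from point_gap[OF \<beta> U V \<alpha> pade_system[OF N pr] _ this ne]
  have "real M * (real n * h) \<le> ln (2 * (sqrt 3 * (6 * sqrt 3) ^ N)) + real N * (\<alpha> + real n * h)
    + 2 * real M * \<alpha> + 2 * \<alpha>' + 2 * \<bar>real m - real M * real n\<bar> * h" unfolding h_def by simp
  moreover have "ln (2 * (sqrt 3 * (6 * sqrt 3) ^ N)) = ln ((2 * sqrt 3) * (6 * sqrt 3) ^ N)" by (simp only: mult.assoc)
  moreover have "\<dots> = ln (2 * sqrt 3) + real N * ln (6 * sqrt 3)"
  proof -
    have "ln ((6 * sqrt 3) ^ N) = real N * ln (6 * sqrt 3)" by (rule ln_realpow)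
    moreover have "ln (2 * sqrt 3 * (6 * sqrt 3) ^ N) = ln (2 * sqrt 3) + ln ((6 * sqrt 3) ^ N)"
      by (rule ln_mult_pos) simp_all
    ultimately show ?thesis by simp
  qed
  moreover have "real M = 2 * real N" by (simp add: M_def)
  \<comment> \<open>The polynomials take back \<open>N n h\<close> of the \<open>2 N n h\<close> on
    the left, and \<open>N \<alpha> + 4 N \<alpha>\<close> gives the coefficient 5.\<close>
  ultimately show ?thesis by (simp add: algebra_simps)
qed

text \<open>By Kronecker's theorem a coordinate of height 0 is a root of unity, and two roots of
  unity have a common exponent.\<close>

lemma height2_pos:
  assumes \<beta>: "\<beta> \<in> carrier Gm2" and tors: "\<forall>n::nat. n > 0 \<longrightarrow> \<beta> [^]\<^bsub>Gm2\<^esub> n \<noteq> \<one>\<^bsub>Gm2\<^esub>"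
  shows "0 < height2 \<beta>"
proof (rule ccontr)
  assume *: "\<not> 0 < height2 \<beta>"
  have nz: "fst \<beta> \<noteq> 0" "snd \<beta> \<noteq> 0" using \<beta> by (auto simp: carrier_Gm2)
  have "weil_height (fst \<beta>) = 0" "weil_height (snd \<beta>) = 0"
    using * weil_height_nonneg[OF nz(1)] weil_height_nonneg[OF nz(2)] by (auto simp: height2_def)
  then obtain k l where kl: "k > 0" "fst \<beta> ^ k = 1" "l > 0" "snd \<beta> ^ l = 1"
    using kronecker nz by metis
  have "fst \<beta> ^ (k * l) = 1" "snd \<beta> ^ (k * l) = 1"
    using kl by (simp add: power_mult) (simp add: kl mult.commute[of k] power_mult)
  then have "\<beta> [^]\<^bsub>Gm2\<^esub> (k * l) = \<one>\<^bsub>Gm2\<^esub>" by (simp add: pow_Gm2 one_Gm2)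
  then show False using tors kl by simp
qed

section \<open>The auxiliary functions\<close>

text \<open>After taking logarithms, the lower bound on \<open>x\<close> is the non-emptiness of the
  interval.\<close>

lemma I_int_bounds:
  fixes \<delta> x :: real
  assumes \<delta>: "0 \<le> \<delta>" "\<delta> < 1 / 9"
    and x: "x > ln ((6 - 3 * \<delta>) / (1 - 9 * \<delta>) + 1 / 2) / ln ((3 - 2 * \<delta>) / (2 * (1 + \<delta>)))"
  shows "6 \<le> (6 - 3 * \<delta>) / (1 - 9 * \<delta>)" "1 < (3 - 2 * \<delta>) / (2 * (1 + \<delta>))" "0 < x"
    "(6 - 3 * \<delta>) / (1 - 9 * \<delta>) < ((3 - 2 * \<delta>) / (2 * (1 + \<delta>))) powr x - 1 / 2"
proof -
  let ?a = "(6 - 3 * \<delta>) / (1 - 9 * \<delta>)" and ?q = "(3 - 2 * \<delta>) / (2 * (1 + \<delta>))"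
  show a: "6 \<le> ?a" using \<delta> by (subst pos_le_divide_eq) auto
  show q: "1 < ?q" using \<delta> by (subst pos_less_divide_eq) auto
  have l: "0 < ln ?q" "0 < ln (?a + 1 / 2)" using q a by (auto intro: ln_gt_zero)
  then show "0 < x" using x divide_pos_pos[OF l(2,1)] by linarith
  have "ln (?a + 1 / 2) < x * ln ?q" using x l by (simp only: pos_divide_less_eq)
  then have "exp (ln (?a + 1 / 2)) < exp (x * ln ?q)" by simp
  also have "exp (ln (?a + 1 / 2)) = ?a + 1 / 2" using a by (intro exp_ln) linarith
  also have "exp (x * ln ?q) = ?q powr x" using q by (auto simp: powr_def)
  finally show "?a < ?q powr x - 1 / 2" by simp
qed

text \<open>The denominator of \<open>g_fun\<close> decreases in \<open>t\<close> and reaches 0 at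
  the right end of the interval.\<close>

lemma g_denominator_pos:
  fixes \<delta> x t :: real
  assumes \<delta>: "0 \<le> \<delta>" and q: "1 < (3 - 2 * \<delta>) / (2 * (1 + \<delta>))" and x: "0 < x"
    and t: "0 < t + 1 / 2" "t < ((3 - 2 * \<delta>) / (2 * (1 + \<delta>))) powr x - 1 / 2"
  shows "2 * (1 + \<delta>) * (t + 1 / 2) powr (1 / x) < 3 - 2 * \<delta>"
proof -
  let ?q = "(3 - 2 * \<delta>) / (2 * (1 + \<delta>))"
  have r: "(r powr x) powr (1 / x) = r" if "1 < r" for r
    using x that by (simp add: powr_powr)
  have "(t + 1 / 2) powr (1 / x) < (?q powr x) powr (1 / x)"
    using t x by (intro powr_less_mono2) auto
  also have "\<dots> = ?q" by (rule r[OF q])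
  finally have "(t + 1 / 2) powr (1 / x) < ?q" .
  moreover have "0 < 2 * (1 + \<delta>)" using \<delta> by simp
  ultimately have "(t + 1 / 2) powr (1 / x) * (2 * (1 + \<delta>)) < 3 - 2 * \<delta>" by (simp only: pos_less_divide_eq)
  then show ?thesis by (simp only: mult.commute)
qed

text \<open>\<open>f_fun\<close> tends to infinity at the left end and \<open>g_fun\<close> at the
  right end, so the infimum is that over a compact subinterval, where continuity provides a
  minimum.\<close>

lemma argmin_ex:
  fixes \<delta> \<theta> x :: real
  assumes \<delta>: "0 \<le> \<delta>" "\<delta> < 1 / 9" and \<theta>: "0 \<le> \<theta>"
    and x: "x > ln ((6 - 3 * \<delta>) / (1 - 9 * \<delta>) + 1 / 2) / ln ((3 - 2 * \<delta>) / (2 * (1 + \<delta>)))"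
  shows "\<exists>t0. is_arg_min (\<lambda>t. max (f_fun \<theta> \<delta> t) (g_fun \<theta> \<delta> x t)) (\<lambda>t. t \<in> I_int \<delta> x) t0"
proof -
  define a q where "a = (6 - 3 * \<delta>) / (1 - 9 * \<delta>)" and "q = (3 - 2 * \<delta>) / (2 * (1 + \<delta>))"
  define b where "b = q powr x - 1 / 2"
  note bounds = I_int_bounds[OF \<delta> x, folded a_def q_def, folded b_def]
  have I: "I_int \<delta> x = {a<..<b}" by (simp add: I_int_def a_def b_def q_def)
  let ?n = "\<lambda>t. (t - 5) * ln (6 * sqrt 3) + 6 * ln 6 + (5 * t - 1) * \<theta>" and ?d = "\<lambda>t. (1 - 9 * \<delta>) * t - (6 - 3 * \<delta>)"
  let ?e = "\<lambda>t. (3 - 2 * \<delta>) - 2 * (1 + \<delta>) * (t + 1 / 2) powr (1 / x)"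
  let ?m = "\<lambda>t. max (f_fun \<theta> \<delta> t) (g_fun \<theta> \<delta> x t)"
  have f: "f_fun \<theta> \<delta> = (\<lambda>t. ?n t / ?d t)" and g: "g_fun \<theta> \<delta> x = (\<lambda>t. (ln 2 + 4 * \<theta>) / ?e t)"
    by (auto simp: f_fun_def g_fun_def)
  have d0: "?d a = 0" using \<delta> by (simp add: a_def)
  have d: "0 < ?d t" if "a < t" for t
    using that d0 \<delta> mult_strict_left_mono[of a t "1 - 9 * \<delta>"] by simp
  have e: "0 < ?e t" if "a < t" "t < b" for t
    using g_denominator_pos[OF \<delta>(1) bounds(2,3)[unfolded q_def], of t] that bounds(1) unfolding b_def q_def by auto
  have "1 < sqrt 3" by (simp add: real_less_rsqrt)
  then have "1 < 6 * sqrt 3" by linarith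
  then have "0 < ln (6 * sqrt 3)" by (rule ln_gt_zero)
  then have n: "0 < ?n a" using bounds(1) \<theta> by (intro add_pos_nonneg add_pos_pos mult_pos_pos mult_nonneg_nonneg) auto
  have "filterlim (f_fun \<theta> \<delta>) at_top (at_right a)" unfolding f
  proof (rule LIM_at_top_divide[OF _ n])
    show "(?n \<longlongrightarrow> ?n a) (at_right a)" by (intro tendsto_intros)
    have "(?d \<longlongrightarrow> ?d a) (at_right a)" by (intro tendsto_intros)
    then show "(?d \<longlongrightarrow> 0) (at_right a)" unfolding d0 .
    show "eventually (\<lambda>t. 0 < ?d t) (at_right a)" using d by (auto simp: eventually_at_filter)
  qed
  then have F: "eventually (\<lambda>t. c < f_fun \<theta> \<delta> t) (at_right a)" for c by (simp add: filterlim_at_top_dense)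
  have "(?e \<longlongrightarrow> ?e b) (at_left b)"
    using bounds(1,4) by (intro tendsto_intros) auto
  moreover have e0: "?e b = 0"
  proof -
    have "(b + 1 / 2) powr (1 / x) = q" using bounds by (simp add: b_def powr_powr)
    then show ?thesis using \<delta> by (simp add: q_def)
  qed
  ultimately have E: "(?e \<longlongrightarrow> 0) (at_left b)" by simp
  have "filterlim (g_fun \<theta> \<delta> x) at_top (at_left b)" unfolding g
  proof (rule LIM_at_top_divide[OF tendsto_const _ E])
    show "0 < ln 2 + 4 * \<theta>" using \<theta> by (intro add_pos_nonneg) auto
    have "eventually (\<lambda>t. t \<in> {a<..<b}) (at_left b)" by (rule eventually_at_left_real) (rule bounds(4))
    then show "eventually (\<lambda>t. 0 < ?e t) (at_left b)" by (rule eventually_mono) (use e in auto)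
  qed
  then have G: "eventually (\<lambda>t. c < g_fun \<theta> \<delta> x t) (at_left b)" for c by (simp add: filterlim_at_top_dense)
  \<comment> \<open>An interior reference point. Near both ends the maximum exceeds its value at
    \<open>t1\<close>, so the search may be confined to a compact interval that contains
    \<open>t1\<close>.\<close>
  define t1 where "t1 = (a + b) / 2"
  have t1: "a < t1" "t1 < b" using bounds(4) by (simp_all add: t1_def)
  obtain a1 where a1: "a1 > a" "\<And>t. a < t \<Longrightarrow> t < a1 \<Longrightarrow> ?m t1 < f_fun \<theta> \<delta> t"
    using F[of "?m t1"] unfolding eventually_at_right_field by blast
  obtain b1 where b1: "b1 < b" "\<And>t. b1 < t \<Longrightarrow> t < b \<Longrightarrow> ?m t1 < g_fun \<theta> \<delta> x t"
    using G[of "?m t1"] unfolding eventually_at_left_field by blast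
  let ?K = "{min a1 t1..max b1 t1}"
  have K: "t \<in> ?K \<Longrightarrow> a < t \<and> t < b" for t using a1 b1 t1 by auto
  have "continuous_on ?K ?m" unfolding f g
  proof (intro continuous_intros)
    show "\<forall>t\<in>?K. ?d t \<noteq> 0" "\<forall>t\<in>?K. ?e t \<noteq> 0" using K d e by (metis less_irrefl)+
  qed (use K bounds(1) in fastforce)
  moreover have "compact ?K" "?K \<noteq> {}" by (auto simp: min_def max_def)
  ultimately obtain t0 where t0: "t0 \<in> ?K" "\<forall>t\<in>?K. ?m t0 \<le> ?m t"
    using continuous_attains_inf by blast
  have le: "?m t0 \<le> ?m t" if t: "a < t" "t < b" for t
  proof (cases "t \<in> ?K")
    case False
    then have "t < a1 \<or> b1 < t" using t by auto
    then have "?m t1 < ?m t" using a1(2)[of t] b1(2)[of t] t by (auto simp: less_max_iff_disj)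
    moreover have "?m t0 \<le> ?m t1" using t0 by auto
    ultimately show ?thesis by linarith
  qed (use t0 in blast)
  have "is_arg_min ?m (\<lambda>t. t \<in> I_int \<delta> x) t0"
    unfolding is_arg_min_def I
  proof (intro conjI notI)
    assume "\<exists>y. y \<in> {a<..<b} \<and> ?m y < ?m t0"
    then show False using le by (meson greaterThanLessThan_iff not_less)
  qed (use K[OF t0(1)] in simp)
  then show ?thesis ..
qed

text \<open>The reserve of \<open>6 ln 6\<close> in the numerator of \<open>f_fun\<close> over the
  constants left by the Pade bound: \<open>(6 sqrt 3)^3 (2 sqrt 3)^2 = 6^5 sqrt 3\<close>, which is
  below \<open>6^6\<close>.\<close>

lemma ln_bound_6_sqrt_3: "3 * ln (6 * sqrt 3) + 2 * ln (2 * sqrt 3) \<le> 6 * ln 6"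
proof -
  have "3 * ln (6 * sqrt 3) + 2 * ln (2 * sqrt 3) = ln ((6 * sqrt 3) ^ 3) + ln ((2 * sqrt 3) ^ 2)"
    by (simp only: ln_realpow of_nat_numeral)
  also have "\<dots> = ln ((6 * sqrt 3) ^ 3 * (2 * sqrt 3) ^ 2)" by (rule ln_mult_pos[symmetric]) simp_all
  also have "(6 * sqrt 3) ^ 3 * (2 * sqrt 3) ^ 2 = 7776 * sqrt 3"
    by (simp add: power_mult_distrib power3_eq_cube)
  also have "ln (7776 * sqrt 3) \<le> ln (6 ^ 6)"
  proof (subst ln_le_cancel_iff)
    have "sqrt 3 < 2" by (simp add: real_less_lsqrt)
    then show "7776 * sqrt 3 \<le> 6 ^ 6" by simp
  qed simp_all
  also have "ln (6 ^ 6) = 6 * ln (6 :: real)" by (simp only: ln_realpow of_nat_numeral)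
  finally show ?thesis .
qed

text \<open>Negates \<open>pade_gap\<close> for \<open>H = n h(\<beta>)\<close> and
  \<open>\<tau> = m / n\<close>. \<open>N\<close> is an integer nearest to
  \<open>\<tau> / 2\<close>, so \<open>\<rho> = \<tau> - 2 N\<close> is at most 1 in absolute value.
  Twice the right side splits into the bound on \<open>f_fun\<close>, moved from \<open>t\<close> to
  \<open>\<tau> - 1/2\<close>, and a remainder depending on \<rho>.\<close>

lemma pade_contradiction:
  fixes \<delta> \<theta> t \<tau> H :: real
  assumes \<delta>: "0 \<le> \<delta>" "\<delta> < 1 / 9" and \<theta>: "0 \<le> \<theta>" and t: "(6 - 3 * \<delta>) / (1 - 9 * \<delta>) < t"
    and \<tau>: "t + 1 / 2 \<le> \<tau>" and H: "f_fun \<theta> \<delta> t \<le> H" "0 < H"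
  obtains N :: nat where "N \<ge> 1"
    "\<theta> * (5 * real N + 2) + real N * ln (6 * sqrt 3) + ln (2 * sqrt 3)
      < H * (real N - 5 * real N * \<delta> - 2 * \<delta> * \<tau> - 2 * \<bar>\<tau> - 2 * real N\<bar>)"
proof -
  define L \<kappa> \<gamma> c where "L = ln (6 * sqrt 3)" and "\<kappa> = 6 - 3 * \<delta>" and "\<gamma> = 1 - 9 * \<delta>" and "c = 6 * ln 6 - 5 * L - \<theta>"
  define N where "N = nat \<lfloor>(\<tau> + 1) / 2\<rfloor>"
  define \<rho> where "\<rho> = \<tau> - 2 * real N"
  have \<gamma>: "0 < \<gamma>" "\<gamma> \<le> 1" using \<delta> by (simp_all add: \<gamma>_def)
  have t\<gamma>: "\<kappa> < \<gamma> * t" using t \<gamma> by (simp add: \<kappa>_def \<gamma>_def pos_divide_less_eq mult.commute)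
  have "6 \<le> \<kappa> / \<gamma>" using \<delta> unfolding \<kappa>_def \<gamma>_def by (subst pos_le_divide_eq) auto
  then have t6: "6 < t" using t by (simp add: \<kappa>_def \<gamma>_def)
  have N: "real N \<le> (\<tau> + 1) / 2" "(\<tau> + 1) / 2 < real N + 1" "N \<ge> 1"
  proof -
    have "1 \<le> \<lfloor>(\<tau> + 1) / 2\<rfloor>" using t6 \<tau> by (simp add: le_floor_iff)
    moreover from this have "real N = real_of_int \<lfloor>(\<tau> + 1) / 2\<rfloor>" by (simp add: N_def)
    ultimately show "real N \<le> (\<tau> + 1) / 2" "(\<tau> + 1) / 2 < real N + 1" "N \<ge> 1" by linarith+
  qed
  have \<rho>: "-1 \<le> \<rho>" "\<rho> \<le> 1" using N(1,2) by (simp_all add: \<rho>_def field_simps)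
  have \<tau>_eq: "\<tau> = 2 * real N + \<rho>" by (simp add: \<rho>_def)
  have "1 < sqrt 3" by (simp add: real_less_rsqrt)
  then have "1 < 6 * sqrt 3" by linarith
  then have L: "0 < L" unfolding L_def by (rule ln_gt_zero)
  have six: "3 * L + 2 * ln (2 * sqrt 3) \<le> 6 * ln 6" using ln_bound_6_sqrt_3 by (simp add: L_def)
  have f: "f_fun \<theta> \<delta> t = ((L + 5 * \<theta>) * t + c) / (\<gamma> * t - \<kappa>)"
    by (simp add: f_fun_def L_def \<kappa>_def \<gamma>_def c_def algebra_simps)
  have I: "(L + 5 * \<theta>) * t + c \<le> H * (\<gamma> * t - \<kappa>)"
    using H(1) t\<gamma> by (simp add: f pos_divide_le_eq)
  have "0 < ln (6 :: real)" by simp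
  \<comment> \<open>This sign says that the fractional linear function \<open>f_fun\<close> lies
    above its limit \<open>(L + 5 \<theta>) / \<gamma>\<close> at infinity. Hence \<open>H\<close>
    exceeds that limit, and the inequality persists when \<open>t\<close> grows to
    \<open>\<tau> - 1/2\<close>.\<close>
  have "0 < (L + 5 * \<theta>) * \<kappa> + \<gamma> * c"
  proof -
    have "5 * L + \<theta> \<le> (L + 5 * \<theta>) * \<kappa>"
    proof -
      have "L * 5 \<le> L * \<kappa>" "\<theta> * 5 \<le> \<theta> * \<kappa>" using L \<theta> \<delta> by (intro mult_left_mono; simp add: \<kappa>_def)+
      then show ?thesis using \<theta> by (simp add: algebra_simps)
    qed
    moreover have "\<gamma> * (5 * L + \<theta>) \<le> 1 * (5 * L + \<theta>)" using \<gamma> L \<theta> by (intro mult_right_mono) auto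
    moreover have "0 < \<gamma> * (6 * ln 6)" using \<gamma> by simp
    ultimately show ?thesis by (simp add: c_def algebra_simps)
  qed
  moreover have "\<gamma> * ((L + 5 * \<theta>) * t + c) \<le> \<gamma> * (H * (\<gamma> * t - \<kappa>))" using I \<gamma> by (intro mult_left_mono) auto
  ultimately have "(L + 5 * \<theta>) * (\<gamma> * t - \<kappa>) < H * \<gamma> * (\<gamma> * t - \<kappa>)" by (simp add: algebra_simps)
  then have H\<gamma>: "L + 5 * \<theta> < H * \<gamma>" using t\<gamma> by (simp add: mult_less_cancel_right)
  define s where "s = \<tau> - 1 / 2 - t"
  have "(L + 5 * \<theta>) * s \<le> H * \<gamma> * s" using H\<gamma> \<tau> by (intro mult_right_mono) (auto simp: s_def)
  with I have I': "(L + 5 * \<theta>) * (\<tau> - 1 / 2) + c \<le> H * (\<gamma> * (\<tau> - 1 / 2) - \<kappa>)"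
    by (simp add: s_def algebra_simps)
  \<comment> \<open>\<open>V\<close> is the value at \<open>\<delta> = 0\<close> of the right side
    of \<open>U\<close>. The quantity \<open>V - 1/2 + \<rho>\<close> is smallest at
    \<open>\<rho> = 1\<close> and \<open>\<rho> = -1\<close>, where it equals 2.\<close>
  define V where "V = (if 0 \<le> \<rho> then 13 / 2 - 5 * \<rho> else 13 / 2 + 3 * \<rho>)"
  have V: "0 < V" "2 \<le> V - 1 / 2 + \<rho>" using \<rho> by (auto simp: V_def)
  have \<delta>\<rho>: "\<delta> * \<rho> \<le> \<delta> * 1" "\<delta> * (-1) \<le> \<delta> * \<rho>" using \<delta> \<rho> by (intro mult_left_mono; simp)+
  have U: "\<gamma> * V \<le> \<kappa> + \<gamma> / 2 - \<rho> * (1 - 5 * \<delta>) - 4 * \<bar>\<rho>\<bar>"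
  proof (cases "0 \<le> \<rho>")
    case True
    have "\<kappa> + \<gamma> / 2 - \<rho> * (1 - 5 * \<delta>) - 4 * \<rho> - \<gamma> * (13 / 2 - 5 * \<rho>) = 51 * \<delta> - 40 * (\<delta> * \<rho>)"
      by (simp add: \<gamma>_def \<kappa>_def field_simps)
    then show ?thesis using True \<delta>\<rho> \<delta>(1) by (simp add: V_def)
  next
    case False
    have "\<kappa> + \<gamma> / 2 - \<rho> * (1 - 5 * \<delta>) + 4 * \<rho> - \<gamma> * (13 / 2 + 3 * \<rho>) = 51 * \<delta> + 32 * (\<delta> * \<rho>)"
      by (simp add: \<gamma>_def \<kappa>_def field_simps)
    then show ?thesis using False \<delta>\<rho> \<delta>(1) by (simp add: V_def)
  qed
  have "(L + 5 * \<theta>) * V < H * \<gamma> * V" using H\<gamma> V by (intro mult_strict_right_mono)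
  also have "\<dots> \<le> H * (\<kappa> + \<gamma> / 2 - \<rho> * (1 - 5 * \<delta>) - 4 * \<bar>\<rho>\<bar>)"
    using mult_left_mono[OF U, of H] H(2) by (simp add: mult.assoc)
  finally have 1: "(L + 5 * \<theta>) * V < H * (\<kappa> + \<gamma> / 2 - \<rho> * (1 - 5 * \<delta>) - 4 * \<bar>\<rho>\<bar>)" .
  have 2: "(L + 5 * \<theta>) * 2 \<le> (L + 5 * \<theta>) * (V - 1 / 2 + \<rho>)" using V L \<theta> by (intro mult_left_mono) auto
  have e: "2 * (H * (real N - 5 * real N * \<delta> - 2 * \<delta> * \<tau> - 2 * \<bar>\<rho>\<bar>)) =
      H * (\<gamma> * (\<tau> - 1 / 2) - \<kappa>) + H * (\<kappa> + \<gamma> / 2 - \<rho> * (1 - 5 * \<delta>) - 4 * \<bar>\<rho>\<bar>)"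
    unfolding \<tau>_eq \<gamma>_def by (simp add: field_simps)
  have e': "(L + 5 * \<theta>) * (\<tau> - 1 / 2) + (L + 5 * \<theta>) * V = (L + 5 * \<theta>) * (2 * real N) + (L + 5 * \<theta>) * (V - 1 / 2 + \<rho>)"
    unfolding \<tau>_eq by (simp add: algebra_simps)
  have "(L + 5 * \<theta>) * (2 * real N) = 2 * (\<theta> * (5 * real N) + real N * L)" by (simp add: algebra_simps)
  \<comment> \<open>The balance of constants: \<open>6 ln 6 - 5 L + 2 L\<close> must reach
    \<open>2 ln (2 sqrt 3)\<close>, which is \<open>ln_bound_6_sqrt_3\<close>, and
    \<open>10 \<theta> - \<theta>\<close> must reach \<open>4 \<theta>\<close>.\<close>
  moreover have "2 * (u + \<theta> * 2 + v + l) < R1 + R2"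
    if "p = 2 * (u + v)" "e1 + (6 * l6 - 5 * L - \<theta>) \<le> R1" "e2 < R2" "L * 2 + \<theta> * 10 \<le> e3"
      "e1 + e2 = p + e3" "3 * L + 2 * l \<le> 6 * l6" for u v l l6 p e1 e2 e3 R1 R2 :: real
    using that \<theta> by auto
  moreover have "L * 2 + \<theta> * 10 \<le> (L + 5 * \<theta>) * (V - 1 / 2 + \<rho>)" using 2 by simp
  ultimately have "2 * (\<theta> * (5 * real N + 2) + real N * L + ln (2 * sqrt 3))
      < 2 * (H * (real N - 5 * real N * \<delta> - 2 * \<delta> * \<tau> - 2 * \<bar>\<rho>\<bar>))"
    unfolding e distrib_left[of \<theta>] using I'[unfolded c_def] 1 e' six by blast
  then show ?thesis using that[OF N(3)] by (simp add: L_def \<rho>_def)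
qed

theorem theorem2p1:
  fixes \<beta> :: "qbar \<times> qbar" and F :: "nat \<Rightarrow> qbar \<times> qbar" and \<delta> \<theta> x :: real
  assumes "\<beta> \<in> carrier Gm2"
    and "\<forall>n::nat. n > 0 \<longrightarrow> \<beta> [^]\<^bsub>Gm2\<^esub> n \<noteq> \<one>\<^bsub>Gm2\<^esub>"
    and "\<forall>n. F n \<in> carrier Gm2"
    and "0 \<le> \<delta>" and "\<delta> < 1 / 9" and "0 \<le> \<theta>"
    and "\<forall>n. dist2 (F n) (\<beta> [^]\<^bsub>Gm2\<^esub> n) \<le> \<theta> + real n * \<delta> * height2 \<beta>"
    and "x > ln ((6 - 3 * \<delta>) / (1 - 9 * \<delta>) + 1 / 2) / ln ((3 - 2 * \<delta>) / (2 * (1 + \<delta>)))"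
  shows "\<exists>t\<^sub>0. is_arg_min (\<lambda>t. max (f_fun \<theta> \<delta> t) (g_fun \<theta> \<delta> x t)) (\<lambda>t. t \<in> I_int \<delta> x) t\<^sub>0 \<and>
    (let \<nu> = 1 / height2 \<beta> * max (f_fun \<theta> \<delta> t\<^sub>0) (g_fun \<theta> \<delta> x t\<^sub>0);
         S = F ` {n. real n \<ge> \<nu>} \<inter> unit_line
     in finite S \<and> int (card S) \<le> \<lceil>x\<rceil>)"
  proof -
  define h where "h = height2 \<beta>"
  have h: "0 < h" unfolding h_def by (rule height2_pos[OF assms(1,2)])
  note \<delta> = assms(4,5) and \<theta> = assms(6)
  define a q where "a = (6 - 3 * \<delta>) / (1 - 9 * \<delta>)" and "q = (3 - 2 * \<delta>) / (2 * (1 + \<delta>))"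
  note bounds = I_int_bounds[OF \<delta> assms(8), folded a_def q_def]
  obtain t0 where min: "is_arg_min (\<lambda>t. max (f_fun \<theta> \<delta> t) (g_fun \<theta> \<delta> x t)) (\<lambda>t. t \<in> I_int \<delta> x) t0"
    using argmin_ex[OF \<delta> \<theta> assms(8)] by blast
  then have "t0 \<in> I_int \<delta> x" by (simp add: is_arg_min_def)
  then have t0: "a < t0" "t0 < q powr x - 1 / 2" by (simp_all add: I_int_def a_def q_def)
  \<comment> \<open>The ratio to be forced between successive exponents: its \<open>x\<close>-th
    power is \<open>t0 + 1/2\<close>.\<close>
  define s where "s = (t0 + 1 / 2) powr (1 / x)"
  define E where "E = (3 - 2 * \<delta>) - 2 * (1 + \<delta>) * s"
  have E: "0 < E"
    using g_denominator_pos[OF \<delta>(1) bounds(2,3)[unfolded q_def], of t0] t0 bounds(1) unfolding E_def s_def q_def by auto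
  have g: "g_fun \<theta> \<delta> x t0 = (ln 2 + 4 * \<theta>) / E" by (simp add: g_fun_def E_def s_def)
  have s: "1 \<le> s" unfolding s_def using t0 bounds by (intro ge_one_powr_ge_zero) auto
  define \<nu> where "\<nu> = 1 / height2 \<beta> * max (f_fun \<theta> \<delta> t0) (g_fun \<theta> \<delta> x t0)"
  define S where "S = F ` {n. real n \<ge> \<nu>} \<inter> unit_line"
  have large: "f_fun \<theta> \<delta> t0 \<le> real n * h" "ln 2 + 4 * \<theta> \<le> (real n * h) * E" "0 < real n * h" if "real n \<ge> \<nu>" for n
  proof -
    have "max (f_fun \<theta> \<delta> t0) (g_fun \<theta> \<delta> x t0) \<le> real n * h"
      using that h by (simp add: \<nu>_def h_def[symmetric] pos_divide_le_eq)
    then show f: "f_fun \<theta> \<delta> t0 \<le> real n * h" and "ln 2 + 4 * \<theta> \<le> (real n * h) * E"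
      using E by (simp_all add: g pos_divide_le_eq)
    moreover have "0 < ln 2 + 4 * \<theta>" using \<theta> by (intro add_pos_nonneg) auto
    ultimately have "0 < (real n * h) * E" by linarith
    then show "0 < real n * h" using E by (simp add: zero_less_mult_iff)
  qed
  have dist: "dist2 (F n) (\<beta> [^]\<^bsub>Gm2\<^esub> n) \<le> \<theta> + real n * \<delta> * h" for n
    using assms(7) by (simp add: h_def)
  \<comment> \<open>Two distinct points give \<open>((3 - 2 \<delta>) n - 2 (1 + \<delta>) m) h <=
    ln 2 + 4 \<theta>\<close>, and the right side is at most \<open>n h E\<close>; by definition of
    \<open>E\<close> this means \<open>m >= s n\<close>.\<close>
  have ratio: "s * real n \<le> real m"
    if n: "real n \<ge> \<nu>" and nm: "n < m" and L: "F n \<in> unit_line" "F m \<in> unit_line" and ne: "F n \<noteq> F m" for n m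
  proof -
    have n0: "0 < real n" using large(3)[OF n] h by (simp add: zero_less_mult_iff)
    have "real n * h \<le> ln 2 + 2 * (\<theta> + real n * \<delta> * h) + 2 * (\<theta> + real m * \<delta> * h) + 2 * \<bar>real m - real n\<bar> * h"
      using linear_gap[OF assms(1) L ne dist dist] by (simp add: h_def)
    then have "h * ((3 - 2 * \<delta>) * real n - 2 * (1 + \<delta>) * real m) \<le> h * (real n * E)"
      using large(2)[OF n] nm by (simp add: algebra_simps)
    then have "(3 - 2 * \<delta>) * real n - 2 * (1 + \<delta>) * real m \<le> real n * E" using h by simp
    then have "2 * (1 + \<delta>) * (s * real n) \<le> 2 * (1 + \<delta>) * real m" by (simp add: E_def algebra_simps)
    then show ?thesis using \<delta> by simp
  qed
  define K where "K = nat \<lceil>x\<rceil>"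
  have K: "x \<le> real K" using bounds(3) unfolding K_def by linarith
  have "finite S \<and> int (card S) \<le> \<lceil>x\<rceil>"
  proof (rule ccontr)
    assume *: "\<not> ?thesis"
    \<comment> \<open>One point more than permitted. An infinite \<open>S\<close> is refuted through
      the same kind of finite subset.\<close>
    have "\<exists>T\<subseteq>S. finite T \<and> card T = Suc K"
    proof (cases "finite S")
      case True
      then have "\<not> int (card S) \<le> \<lceil>x\<rceil>" using * by simp
      then have "int K < int (card S)" using bounds(3) unfolding K_def by linarith
      then have "Suc K \<le> card S" by simp
      then show ?thesis using obtain_subset_with_card_n[of "Suc K" S] True by metis
    next
      case False
      then show ?thesis using infinite_arbitrarily_large by blast
    qed
    then obtain T where T: "T \<subseteq> S" "finite T" "card T = Suc K" by blast
    have "\<forall>v\<in>T. \<exists>n. real n \<ge> \<nu> \<and> F n = v" using T(1) unfolding S_def by blast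
    \<comment> \<open>One index for each point, so that distinct points have distinct indices and
      can be ordered by them.\<close>
    then obtain idx where idx: "\<And>v. v \<in> T \<Longrightarrow> real (idx v) \<ge> \<nu>" "\<And>v. v \<in> T \<Longrightarrow> F (idx v) = v" by metis
    have inj: "inj_on idx T" by (rule inj_on_inverseI[of _ F]) (rule idx(2))
    define xs where "xs = sorted_list_of_set (idx ` T)"
    have xs: "sorted_wrt (<) xs" "set xs = idx ` T" "length xs = Suc K"
      using T card_image[OF inj] by (simp_all add: xs_def)
    have mem: "real (xs ! i) \<ge> \<nu>" "F (xs ! i) \<in> unit_line" "xs ! i \<in> idx ` T" if "i \<le> K" for i
    proof -
      have "xs ! i \<in> set xs" using that xs(3) by (intro nth_mem) simp
      then show "xs ! i \<in> idx ` T" by (simp add: xs(2))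
      then show "real (xs ! i) \<ge> \<nu>" "F (xs ! i) \<in> unit_line" using idx T(1) by (auto simp: S_def)
    qed
    have growth: "s ^ i * real (xs ! 0) \<le> real (xs ! i)" if "i \<le> K" for i
      using that
    proof (induction i)
      case (Suc i)
      have lt: "xs ! i < xs ! Suc i" using sorted_wrt_nth_less[OF xs(1), of i "Suc i"] Suc.prems xs(3) by simp
      have "F (xs ! i) \<noteq> F (xs ! Suc i)"
        using lt mem(3)[of i] mem(3)[of "Suc i"] Suc.prems idx(2) by fastforce
      then have "s * real (xs ! i) \<le> real (xs ! Suc i)"
        using lt mem[of i] mem[of "Suc i"] Suc.prems by (intro ratio) auto
      moreover have "s * (s ^ i * real (xs ! 0)) \<le> s * real (xs ! i)"
        using Suc s by (intro mult_left_mono) auto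
      ultimately show ?case by (simp add: mult.assoc)
    qed simp
    define n m \<tau> where "n = xs ! 0" and "m = xs ! K" and "\<tau> = real m / real n"
    have n: "real n \<ge> \<nu>" "F n \<in> unit_line" and m: "F m \<in> unit_line" using mem[of 0] mem[of K] by (simp_all add: n_def m_def)
    have n0: "0 < real n" using large(3)[OF n(1)] h by (simp add: zero_less_mult_iff)
    \<comment> \<open>The chain has \<open>K\<close> steps, and \<open>K >= x\<close> and
      \<open>s >= 1\<close>, so the extreme indices have ratio at least \<open>s^K\<close>, hence at
      least \<open>t0 + 1/2\<close>.\<close>
    have "t0 + 1 / 2 = s powr x" using bounds t0 by (simp add: s_def powr_powr)
    also have "\<dots> \<le> s powr real K" using s K by (intro powr_mono) auto
    also have "\<dots> = s ^ K" using s by (simp add: powr_realpow)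
    also have "\<dots> \<le> \<tau>" using growth[of K] n0 by (simp add: \<tau>_def n_def m_def pos_le_divide_eq)
    finally have \<tau>: "t0 + 1 / 2 \<le> \<tau>" .
    have m\<tau>: "real m = \<tau> * real n" using n0 by (simp add: \<tau>_def)
    obtain N where N: "N \<ge> 1" "\<theta> * (5 * real N + 2) + real N * ln (6 * sqrt 3) + ln (2 * sqrt 3)
      < (real n * h) * (real N - 5 * real N * \<delta> - 2 * \<delta> * \<tau> - 2 * \<bar>\<tau> - 2 * real N\<bar>)"
      using pade_contradiction[OF \<delta> \<theta> t0(1)[unfolded a_def] \<tau> large(1,3)[OF n(1)]] by blast
    have "\<bar>real m - 2 * real N * real n\<bar> = \<bar>\<tau> - 2 * real N\<bar> * real n"
      using n0 by (simp add: m\<tau> abs_mult flip: left_diff_distrib)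
    then have "real N * (real n * h) \<le> ln (2 * sqrt 3) + real N * ln (6 * sqrt 3) + 5 * real N * (\<theta> + real n * \<delta> * h)
        + 2 * (\<theta> + \<tau> * real n * \<delta> * h) + 2 * (\<bar>\<tau> - 2 * real N\<bar> * real n) * h"
      using pade_gap[OF assms(1) n(2) m N(1) dist dist] by (simp add: h_def m\<tau>)
    then show False using N(2) by (simp add: algebra_simps)
  qed
  then show ?thesis using min by (auto simp: Let_def S_def \<nu>_def)
qed

end
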